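(* Let $\mathbb{F}$ be a field of characteristic $0$ and let $\mathcal{L}(\Gamma)$ be the generalized Virasoro-like algebra over $\mathbb{F}$. Choose $T=a_1\partial_1+a_2\partial_2\in\mathrm{span}\{\partial_1,\partial_2\}$ (with $a_1,a_2\in\mathbb{F}$) and $L_\alpha\in\mathcal{L}(\Gamma)$ with $\alpha=(\alpha_1,\alpha_2)\in\Gamma\setminus\{0\}$ such that $[T,L_\alpha]=L_\alpha$. Then there exists a noncommutative and noncocommutative Hopf algebra structure $(\mathcal{U}(\mathcal{L}(\Gamma))[[t]],\mu,\tau,\Delta,S,\epsilon)$ on $\mathcal{U}(\mathcal{L}(\Gamma))[[t]]$ over $\mathbb{F}[[t]]$ such that $\mathcal{U}(\mathcal{L}(\Gamma))[[t]]/t\,\mathcal{U}(\mathcal{L}(\Gamma))[[t]]=\mathcal{U}(\mathcal{L}(\Gamma))$, which preserves the product and the counit of $\mathcal{U}(\mathcal{L}(\Gamma))[[t]]$, and whose coproduct $\Delta$ and antipode $S$ are given, for all $\beta=(\beta_1,\beta_2)\in\Gamma\setminus\{0\}$ and $j=1,2$, by $$\Delta(L_\beta)=L_\beta\otimes(1-L_\alpha t)^{b}+\sum_{i=0}^{\infty}(-1)^i\,T^{\langle i\rangle}\otimes(1-L_\alpha t)^{-i}L_{\beta+i\alpha}\,c_i\,t^i,$$ $$\Delta(\partial_j)=\partial_j\otimes 1+1\otimes\partial_j+\alpha_j\,T^{\langle 1\rangle}\otimes(1-L_\alpha t)^{-1}L_\alpha t,$$ $$S(L_\beta)=-(1-L_\alpha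 t)^{-b}\sum_{i=0}^{\infty}L_{\beta+i\alpha}\,c_i\,T_1^{\langle i\rangle}\,t^i,$$ $$S(\partial_j)=\alpha_j\,T\,(1-L_\alpha t)^{-1}(L_\alpha t-L_\alpha^2t^2)-\partial_j,$$ where $b=a_1\beta_1+a_2\beta_2$, $c_i=\dfrac{(\alpha_1\beta_2-\alpha_2\beta_1)^i}{i!}$ and $c_0=1$.
   Context: Generalized Virasoro-like algebra: $\Gamma$ is a nondegenerate additive subgroup of $\mathbb{F}^2$ (i.e. $\Gamma$ contains an $\mathbb{F}$-basis of $\mathbb{F}^2$); $\mathcal{L}(\Gamma)$ is the Lie algebra over $\mathbb{F}$ with basis $\{L_\alpha,\partial_1,\partial_2 : \alpha\in\Gamma\setminus\{0\}\}$ and brackets $[L_\alpha,L_\beta]=(\alpha_1\beta_2-\alpha_2\beta_1)L_{\alpha+\beta}$, $[\partial_i,L_\alpha]=\alpha_iL_\alpha$, $[\partial_1,\partial_2]=0$, for $\alpha=(\alpha_1,\alpha_2),\beta=(\beta_1,\beta_2)\in\Gamma\setminus\{0\}$, $i=1,2$. Convention: $L_0=0$. $\mathcal{U}(\mathcal{L}(\Gamma))$ is the universal enveloping algebra with its standard Hopf algebra structure $(\mu,\tau,\Delta_0,\epsilon_0,S_0)$ ($\mu$ the product, $\tau$ the unit map): $\Delta_0(x)=x\otimes1+1\otimes x$, $S_0(x)=-x$, $\epsilon_0(x)=0$ for $x\in\mathcal{L}(\Gamma)$; it is extended $\mathbb{F}[[t]]$-linearly (and $t$-adically continuously) to $\mathcal{U}(\mathcal{L}(\Gamma))[[t]]$.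 "Preserves the product and the counit" means that $\mu,\tau$ and $\epsilon=\epsilon_0$ are those of this undeformed structure. Tensor products over $\mathbb{F}[[t]]$ are understood $t$-adically completed, so that $\Delta$ takes values in $(\mathcal{U}(\mathcal{L}(\Gamma))\otimes\mathcal{U}(\mathcal{L}(\Gamma)))[[t]]$. Notation: for an element $x$ of a unital $\mathbb{F}$-algebra, $a\in\mathbb{F}$ and an integer $n\ge0$, $x_a^{\langle n\rangle}=(x+a)(x+a+1)\cdots(x+a+n-1)$ (equal to $1$ for $n=0$), and $x^{\langle n\rangle}=x_0^{\langle n\rangle}$. For $c\in\mathbb{F}$, $(1-L_\alpha t)^c=\sum_{m\ge0}(-1)^m\binom{c}{m}L_\alpha^mt^m$ with $\binom{c}{m}=\frac{c(c-1)\cdots(c-m+1)}{m!}$. *)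

theory Defs
  imports
    "HOL-Analysis.Cartesian_Space"
    "HOL-Library.Poly_Mapping"
    "HOL-Computational_Algebra.Formal_Power_Series"
    "HOL-Algebra.QuotRing"
    "HOL-Algebra.Module"
begin

section \<open>Algebras with an explicit carrier over a type of scalars\<close>

text \<open>
  The ground ring is a type (\<open>'f::field_char_0\<close> or \<open>'f fps\<close>); algebras are
  records of type \<open>('k, 'a) module\<close> from HOL-Algebra, whose \<open>mult\<close> and \<open>one\<close> fields
  carry the (not necessarily commutative) product and its unit.
\<close>

definition scalar_algebra :: "('k::comm_ring_1, 'k) module" where
  "scalar_algebra =
    \<lparr>carrier = UNIV, mult = (*), one = 1, zero = 0, add = (+), smult = (*)\<rparr>"

definition assoc_algebra :: "('k::comm_ring_1, 'a) module \<Rightarrow> bool" where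
  "assoc_algebra A \<longleftrightarrow>
    ring A \<and> Module.module (scalar_algebra :: ('k, 'k) module) A \<and>
    (\<forall>c. \<forall>x\<in>carrier A. \<forall>y\<in>carrier A.
      (c \<odot>\<^bsub>A\<^esub> x) \<otimes>\<^bsub>A\<^esub> y = c \<odot>\<^bsub>A\<^esub> (x \<otimes>\<^bsub>A\<^esub> y) \<and>
      x \<otimes>\<^bsub>A\<^esub> (c \<odot>\<^bsub>A\<^esub> y) = c \<odot>\<^bsub>A\<^esub> (x \<otimes>\<^bsub>A\<^esub> y))"

definition linear_maps :: "('k, 'a) module \<Rightarrow> ('k, 'b) module \<Rightarrow> ('a \<Rightarrow> 'b) set" where
  "linear_maps M N =
    {h. h \<in> carrier M \<rightarrow> carrier N \<and>
        (\<forall>x\<in>carrier M. \<forall>y\<in>carrier M. h (x \<oplus>\<^bsub>M\<^esub> y) = h x \<oplus>\<^bsub>N\<^esub> h y) \<and>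
        (\<forall>c. \<forall>x\<in>carrier M. h (c \<odot>\<^bsub>M\<^esub> x) = c \<odot>\<^bsub>N\<^esub> h x)}"

definition algebra_homs :: "('k, 'a) module \<Rightarrow> ('k, 'b) module \<Rightarrow> ('a \<Rightarrow> 'b) set" where
  "algebra_homs A B = ring_hom A B \<inter> linear_maps A B"

definition opposite_algebra :: "('k, 'a) module \<Rightarrow> ('k, 'a) module" where
  "opposite_algebra A = A\<lparr>mult := (\<lambda>x y. y \<otimes>\<^bsub>A\<^esub> x)\<rparr>"

definition quotient_algebra :: "('k, 'a) module \<Rightarrow> 'a set \<Rightarrow> ('k, 'a set) module" where
  "quotient_algebra A I =
    ring.extend (A Quot I) (module.fields (\<lambda>c X. \<Union>x\<in>X. I +>\<^bsub>A\<^esub> (c \<odot>\<^bsub>A\<^esub> x)))"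

definition monoid_algebra :: "('x, 'm) monoid_scheme \<Rightarrow> ('f::field, 'x \<Rightarrow>\<^sub>0 'f) module" where
  "monoid_algebra M =
    \<lparr>carrier = {p. Poly_Mapping.keys p \<subseteq> carrier M},
     mult = (\<lambda>p q. \<Sum>x\<in>Poly_Mapping.keys p. \<Sum>y\<in>Poly_Mapping.keys q.
       Poly_Mapping.single (x \<otimes>\<^bsub>M\<^esub> y) (Poly_Mapping.lookup p x * Poly_Mapping.lookup q y)),
     one = Poly_Mapping.single \<one>\<^bsub>M\<^esub> 1, zero = 0, add = (+),
     smult = (\<lambda>c. Poly_Mapping.map ((*) c))\<rparr>"

section \<open>Tensor products\<close>

definition bilinear_relations ::
    "('f::field, 'a) module \<Rightarrow> ('f, 'b) module \<Rightarrow> ('a \<times> 'b \<Rightarrow>\<^sub>0 'f) set" where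
  "bilinear_relations A B =
    {Poly_Mapping.single (a \<oplus>\<^bsub>A\<^esub> a', b) 1 - Poly_Mapping.single (a, b) 1
       - Poly_Mapping.single (a', b) 1 | a a' b.
       a \<in> carrier A \<and> a' \<in> carrier A \<and> b \<in> carrier B} \<union>
    {Poly_Mapping.single (a, b \<oplus>\<^bsub>B\<^esub> b') 1 - Poly_Mapping.single (a, b) 1
       - Poly_Mapping.single (a, b') 1 | a b b'.
       a \<in> carrier A \<and> b \<in> carrier B \<and> b' \<in> carrier B} \<union>
    {Poly_Mapping.single (c \<odot>\<^bsub>A\<^esub> a, b) 1 - Poly_Mapping.single (a, b) c | c a b.
       a \<in> carrier A \<and> b \<in> carrier B} \<union>
    {Poly_Mapping.single (a, c \<odot>\<^bsub>B\<^esub> b) 1 - Poly_Mapping.single (a, b) c | c a b.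
       a \<in> carrier A \<and> b \<in> carrier B}"

text \<open>
  The free vector space on \<open>carrier A \<times> carrier B\<close> with the product
  \<open>(a, b) (c, d) = (a c, b d)\<close> is the monoid algebra of the product of the multiplicative
  monoids.  Multiplying a bilinearity relation by a basis vector gives such a relation again,
  so the ideal generated by the relations is just their linear span.
\<close>

definition tensor_ideal ::
    "('f::field, 'a) module \<Rightarrow> ('f, 'b) module \<Rightarrow> ('a \<times> 'b \<Rightarrow>\<^sub>0 'f) set" where
  "tensor_ideal A B =
    genideal (monoid_algebra (A \<times>\<times> B) :: ('f, 'a \<times> 'b \<Rightarrow>\<^sub>0 'f) module) (bilinear_relations A B)"

definition tensor_algebra ::
    "('f::field, 'a) module \<Rightarrow> ('f, 'b) module \<Rightarrow> ('f, ('a \<times> 'b \<Rightarrow>\<^sub>0 'f) set) module" where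
  "tensor_algebra A B = quotient_algebra (monoid_algebra (A \<times>\<times> B)) (tensor_ideal A B)"

definition pure_tensor ::
    "('f::field, 'a) module \<Rightarrow> ('f, 'b) module \<Rightarrow> 'a \<Rightarrow> 'b \<Rightarrow> ('a \<times> 'b \<Rightarrow>\<^sub>0 'f) set" where
  "pure_tensor A B a b =
    tensor_ideal A B +>\<^bsub>(monoid_algebra (A \<times>\<times> B) :: ('f, 'a \<times> 'b \<Rightarrow>\<^sub>0 'f) module)\<^esub>
      Poly_Mapping.single (a, b) 1"

text \<open>
  The linear map \<open>A \<otimes> B \<rightarrow> C\<close> with \<open>a \<otimes> b \<mapsto> h a b\<close>; for bilinear \<open>h\<close> the value does not
  depend on the chosen representative of the class \<open>X\<close>.
\<close>

definition tensor_lift ::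
    "('f::field, 'c) module \<Rightarrow> ('a \<Rightarrow> 'b \<Rightarrow> 'c) \<Rightarrow> ('a \<times> 'b \<Rightarrow>\<^sub>0 'f) set \<Rightarrow> 'c" where
  "tensor_lift C h X =
    (let p = (SOME p. p \<in> X) in
      finsum C (\<lambda>(a, b). Poly_Mapping.lookup p (a, b) \<odot>\<^bsub>C\<^esub> h a b) (Poly_Mapping.keys p))"

definition tensor_assoc ::
    "('f::field, 'a) module \<Rightarrow> ('a \<times> ('a \<times> 'a \<Rightarrow>\<^sub>0 'f) set \<Rightarrow>\<^sub>0 'f) set
      \<Rightarrow> (('a \<times> 'a \<Rightarrow>\<^sub>0 'f) set \<times> 'a \<Rightarrow>\<^sub>0 'f) set" where
  "tensor_assoc A =
    (let AA = tensor_algebra A A; AA_A = tensor_algebra AA A in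
      tensor_lift AA_A (\<lambda>a. tensor_lift AA_A
        (\<lambda>b c. pure_tensor AA A (pure_tensor A A a b) c)))"

definition tensor_flip ::
    "('f::field, 'a) module \<Rightarrow> ('a \<times> 'a \<Rightarrow>\<^sub>0 'f) set \<Rightarrow> ('a \<times> 'a \<Rightarrow>\<^sub>0 'f) set" where
  "tensor_flip A = tensor_lift (tensor_algebra A A) (\<lambda>a b. pure_tensor A A b a)"

section \<open>Formal power series with coefficients in an algebra\<close>

definition series_const :: "('f, 'a) module \<Rightarrow> 'a \<Rightarrow> nat \<Rightarrow> 'a" where
  "series_const A a = (\<lambda>n. if n = 0 then a else \<zero>\<^bsub>A\<^esub>)"

text \<open>\<open>A[[t]]\<close> as an algebra over \<open>'f[[t]]\<close>; a series is its coefficient sequence.\<close>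

definition series_algebra :: "('f::field, 'a) module \<Rightarrow> ('f fps, nat \<Rightarrow> 'a) module" where
  "series_algebra A =
    \<lparr>carrier = UNIV \<rightarrow> carrier A,
     mult = (\<lambda>x y n. \<Oplus>\<^bsub>A\<^esub>i\<in>{..n}. x i \<otimes>\<^bsub>A\<^esub> y (n - i)),
     one = series_const A \<one>\<^bsub>A\<^esub>,
     zero = (\<lambda>n. \<zero>\<^bsub>A\<^esub>),
     add = (\<lambda>x y n. x n \<oplus>\<^bsub>A\<^esub> y n),
     smult = (\<lambda>c x n. \<Oplus>\<^bsub>A\<^esub>i\<in>{..n}. fps_nth c i \<odot>\<^bsub>A\<^esub> x (n - i))\<rparr>"

text \<open>The \<open>t\<close>-adically convergent sum \<open>\<Sum>i. x i * t ^ i\<close> of series \<open>x i \<in> A[[t]]\<close>.\<close>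

definition series_tsum :: "('f, 'a) module \<Rightarrow> (nat \<Rightarrow> nat \<Rightarrow> 'a) \<Rightarrow> nat \<Rightarrow> 'a" where
  "series_tsum A x = (\<lambda>n. \<Oplus>\<^bsub>A\<^esub>i\<in>{..n}. x i (n - i))"

text \<open>
  The completed tensor product of \<open>A[[t]]\<close> and \<open>B[[t]]\<close> over \<open>'f[[t]]\<close> is
  \<open>(A \<otimes> B)[[t]]\<close>; \<open>series_tensor\<close> is the tensor product of two series in it.
\<close>

definition series_tensor ::
    "('f::field, 'a) module \<Rightarrow> ('f, 'b) module \<Rightarrow> (nat \<Rightarrow> 'a) \<Rightarrow> (nat \<Rightarrow> 'b)
      \<Rightarrow> nat \<Rightarrow> ('a \<times> 'b \<Rightarrow>\<^sub>0 'f) set" where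
  "series_tensor A B x y =
    (\<lambda>n. \<Oplus>\<^bsub>tensor_algebra A B\<^esub>i\<in>{..n}. pure_tensor A B (x i) (y (n - i)))"

text \<open>
  The \<open>'f[[t]]\<close>-linear map \<open>(A \<otimes> B)[[t]] \<rightarrow> C[[t]]\<close> with \<open>x \<otimes> y \<mapsto> h x y\<close>, for
  \<open>'f[[t]]\<close>-bilinear \<open>h\<close>.  It is determined by \<open>h\<close> on constant series: \<open>Z = \<Sum>k. Z k * t ^ k\<close>
  is sent to \<open>\<Sum>k. H (Z k) * t ^ k\<close> where \<open>H (a \<otimes> b) = h a b\<close>.
\<close>

definition series_lift ::
    "('f::field, 'a) module \<Rightarrow> ('f, 'b) module \<Rightarrow> ('f, 'c) module
      \<Rightarrow> ((nat \<Rightarrow> 'a) \<Rightarrow> (nat \<Rightarrow> 'b) \<Rightarrow> nat \<Rightarrow> 'c)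
      \<Rightarrow> (nat \<Rightarrow> ('a \<times> 'b \<Rightarrow>\<^sub>0 'f) set) \<Rightarrow> nat \<Rightarrow> 'c" where
  "series_lift A B C h Z =
    series_tsum C (\<lambda>k m.
      tensor_lift C (\<lambda>a b. h (series_const A a) (series_const B b) m) (Z k))"

section \<open>Topological Hopf algebras on \<open>A[[t]]\<close>\<close>

text \<open>
  Hopf algebra structures over \<open>'f[[t]]\<close> whose underlying algebra is \<open>A[[t]]\<close> with the product
  and unit coming from \<open>A\<close>.  Continuity of \<open>\<Delta>\<close>, \<open>S\<close>, \<open>\<epsilon>\<close> is automatic: an
  \<open>'f[[t]]\<close>-linear map sends \<open>t^n A[[t]]\<close> into \<open>t^n\<close> times its target.
\<close>

definition formal_hopf_algebra ::
    "('f::field, 'a) module \<Rightarrow> ((nat \<Rightarrow> 'a) \<Rightarrow> nat \<Rightarrow> ('a \<times> 'a \<Rightarrow>\<^sub>0 'f) set)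
      \<Rightarrow> ((nat \<Rightarrow> 'a) \<Rightarrow> nat \<Rightarrow> 'a) \<Rightarrow> ((nat \<Rightarrow> 'a) \<Rightarrow> 'f fps) \<Rightarrow> bool" where
  "formal_hopf_algebra A \<Delta> S \<epsilon> \<longleftrightarrow>
    (let H = series_algebra A; AA = tensor_algebra A A in
      assoc_algebra H \<and>
      \<Delta> \<in> algebra_homs H (series_algebra AA) \<and>
      \<epsilon> \<in> algebra_homs H scalar_algebra \<and>
      S \<in> linear_maps H H \<and>
      (\<forall>z\<in>carrier H.
        series_lift A A (tensor_algebra AA A) (\<lambda>x y. series_tensor AA A (\<Delta> x) y) (\<Delta> z)
          = tensor_assoc A \<circ>
            series_lift A A (tensor_algebra A AA) (\<lambda>x y. series_tensor A AA x (\<Delta> y)) (\<Delta> z)) \<and>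
      (\<forall>z\<in>carrier H.
        series_lift A A A (\<lambda>x y. \<epsilon> x \<odot>\<^bsub>H\<^esub> y) (\<Delta> z) = z \<and>
        series_lift A A A (\<lambda>x y. \<epsilon> y \<odot>\<^bsub>H\<^esub> x) (\<Delta> z) = z) \<and>
      (\<forall>z\<in>carrier H.
        series_lift A A A (\<lambda>x y. S x \<otimes>\<^bsub>H\<^esub> y) (\<Delta> z) = \<epsilon> z \<odot>\<^bsub>H\<^esub> \<one>\<^bsub>H\<^esub> \<and>
        series_lift A A A (\<lambda>x y. x \<otimes>\<^bsub>H\<^esub> S y) (\<Delta> z) = \<epsilon> z \<odot>\<^bsub>H\<^esub> \<one>\<^bsub>H\<^esub>))"

definition series_noncommutative :: "('f::field, 'a) module \<Rightarrow> bool" where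
  "series_noncommutative A \<longleftrightarrow>
    (\<exists>x\<in>carrier (series_algebra A). \<exists>y\<in>carrier (series_algebra A).
      x \<otimes>\<^bsub>series_algebra A\<^esub> y \<noteq> y \<otimes>\<^bsub>series_algebra A\<^esub> x)"

definition series_noncocommutative ::
    "('f::field, 'a) module \<Rightarrow> ((nat \<Rightarrow> 'a) \<Rightarrow> nat \<Rightarrow> ('a \<times> 'a \<Rightarrow>\<^sub>0 'f) set) \<Rightarrow> bool" where
  "series_noncocommutative A \<Delta> \<longleftrightarrow>
    (\<exists>x\<in>carrier (series_algebra A). tensor_flip A \<circ> \<Delta> x \<noteq> \<Delta> x)"

text \<open>
  \<open>A[[t]] / t A[[t]] = A\<close> as Hopf algebras: the constant coefficient induces an isomorphism
  \<open>\<theta>\<close> from the quotient onto \<open>A\<close>, and \<open>\<Delta>\<close>, \<open>S\<close>, \<open>\<epsilon>\<close> induce \<open>\<Delta>\<^sub>0\<close>, \<open>S\<^sub>0\<close>, \<open>\<epsilon>\<^sub>0\<close>.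
\<close>

definition reduces_mod_t ::
    "('f::field, 'a) module \<Rightarrow> ((nat \<Rightarrow> 'a) \<Rightarrow> nat \<Rightarrow> ('a \<times> 'a \<Rightarrow>\<^sub>0 'f) set)
      \<Rightarrow> ((nat \<Rightarrow> 'a) \<Rightarrow> nat \<Rightarrow> 'a) \<Rightarrow> ((nat \<Rightarrow> 'a) \<Rightarrow> 'f fps)
      \<Rightarrow> ('a \<Rightarrow> ('a \<times> 'a \<Rightarrow>\<^sub>0 'f) set) \<Rightarrow> ('a \<Rightarrow> 'a) \<Rightarrow> ('a \<Rightarrow> 'f) \<Rightarrow> bool" where
  "reduces_mod_t A \<Delta> S \<epsilon> \<Delta>\<^sub>0 S\<^sub>0 \<epsilon>\<^sub>0 \<longleftrightarrow>
    (let H = series_algebra A;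
         I = (\<lambda>x. fps_X \<odot>\<^bsub>H\<^esub> x) ` carrier H;
         \<theta> = (\<lambda>X. the_elem ((\<lambda>x. x 0) ` X)) in
      ideal I H \<and>
      \<theta> \<in> ring_iso (quotient_algebra H I) A \<and>
      (\<forall>c. \<forall>X\<in>carrier (quotient_algebra H I).
        \<theta> (c \<odot>\<^bsub>quotient_algebra H I\<^esub> X) = fps_nth c 0 \<odot>\<^bsub>A\<^esub> \<theta> X) \<and>
      (\<forall>x\<in>carrier H.
        \<Delta> x 0 = \<Delta>\<^sub>0 (\<theta> (I +>\<^bsub>H\<^esub> x)) \<and>
        \<theta> (I +>\<^bsub>H\<^esub> S x) = S\<^sub>0 (\<theta> (I +>\<^bsub>H\<^esub> x)) \<and>
        fps_nth (\<epsilon> x) 0 = \<epsilon>\<^sub>0 (\<theta> (I +>\<^bsub>H\<^esub> x))))"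

section \<open>Universal enveloping algebras\<close>

text \<open>For a Lie algebra the inherited fields \<open>mult\<close> and \<open>one\<close> are not used.\<close>

record ('f, 'x) lie_algebra = "('f, 'x) module" +
  lie_bracket :: "'x \<Rightarrow> 'x \<Rightarrow> 'x"

definition free_algebra :: "'x set \<Rightarrow> ('f::field, 'x list \<Rightarrow>\<^sub>0 'f) module" where
  "free_algebra X = monoid_algebra \<lparr>carrier = lists X, mult = (@), one = []\<rparr>"

text \<open>
  The first two families of relations turn the free algebra on the set \<open>carrier L\<close> into the
  tensor algebra of the vector space \<open>L\<close>.
\<close>

definition uea_relations :: "('f::field, 'x) lie_algebra \<Rightarrow> ('x list \<Rightarrow>\<^sub>0 'f) set" where
  "uea_relations L =
    {Poly_Mapping.single [x \<oplus>\<^bsub>L\<^esub> y] 1 - Poly_Mapping.single [x] 1 - Poly_Mapping.single [y] 1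
      | x y. x \<in> carrier L \<and> y \<in> carrier L} \<union>
    {Poly_Mapping.single [c \<odot>\<^bsub>L\<^esub> x] 1 - Poly_Mapping.single [x] c | c x. x \<in> carrier L} \<union>
    {Poly_Mapping.single [x, y] 1 - Poly_Mapping.single [y, x] 1
        - Poly_Mapping.single [lie_bracket L x y] 1
      | x y. x \<in> carrier L \<and> y \<in> carrier L}"

definition uea_ideal :: "('f::field, 'x) lie_algebra \<Rightarrow> ('x list \<Rightarrow>\<^sub>0 'f) set" where
  "uea_ideal L =
    genideal (free_algebra (carrier L) :: ('f, 'x list \<Rightarrow>\<^sub>0 'f) module) (uea_relations L)"

definition uea :: "('f::field, 'x) lie_algebra \<Rightarrow> ('f, ('x list \<Rightarrow>\<^sub>0 'f) set) module" where
  "uea L = quotient_algebra (free_algebra (carrier L)) (uea_ideal L)"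

definition uea_incl :: "('f::field, 'x) lie_algebra \<Rightarrow> 'x \<Rightarrow> ('x list \<Rightarrow>\<^sub>0 'f) set" where
  "uea_incl L x =
    uea_ideal L +>\<^bsub>(free_algebra (carrier L) :: ('f, 'x list \<Rightarrow>\<^sub>0 'f) module)\<^esub>
      Poly_Mapping.single [x] 1"

text \<open>
  The algebra homomorphism from the enveloping algebra to \<open>B\<close> extending a linear map \<open>\<phi>\<close> that
  sends brackets to commutators; for such \<open>\<phi>\<close> the chosen representative does not matter.
\<close>

definition uea_lift ::
    "('f::field, 'b) module \<Rightarrow> ('x \<Rightarrow> 'b) \<Rightarrow> ('x list \<Rightarrow>\<^sub>0 'f) set \<Rightarrow> 'b" where
  "uea_lift B \<phi> X =
    (let p = (SOME p. p \<in> X) in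
      finsum B (\<lambda>w. Poly_Mapping.lookup p w \<odot>\<^bsub>B\<^esub> foldr (\<lambda>x u. \<phi> x \<otimes>\<^bsub>B\<^esub> u) w \<one>\<^bsub>B\<^esub>)
        (Poly_Mapping.keys p))"

definition uea_comult ::
    "('f::field, 'x) lie_algebra \<Rightarrow> ('x list \<Rightarrow>\<^sub>0 'f) set
      \<Rightarrow> (('x list \<Rightarrow>\<^sub>0 'f) set \<times> ('x list \<Rightarrow>\<^sub>0 'f) set \<Rightarrow>\<^sub>0 'f) set" where
  "uea_comult L =
    (let U = uea L; UU = tensor_algebra U U in
      uea_lift UU (\<lambda>x. pure_tensor U U (uea_incl L x) \<one>\<^bsub>U\<^esub> \<oplus>\<^bsub>UU\<^esub> pure_tensor U U \<one>\<^bsub>U\<^esub> (uea_incl L x)))"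

definition uea_antipode ::
    "('f::field, 'x) lie_algebra \<Rightarrow> ('x list \<Rightarrow>\<^sub>0 'f) set \<Rightarrow> ('x list \<Rightarrow>\<^sub>0 'f) set" where
  "uea_antipode L = uea_lift (opposite_algebra (uea L)) (\<lambda>x. \<ominus>\<^bsub>uea L\<^esub> uea_incl L x)"

definition uea_counit :: "('f::field, 'x) lie_algebra \<Rightarrow> ('x list \<Rightarrow>\<^sub>0 'f) set \<Rightarrow> 'f" where
  "uea_counit L = uea_lift scalar_algebra (\<lambda>x. 0)"

text \<open>The \<open>'f[[t]]\<close>-linear, \<open>t\<close>-adically continuous extension of the counit.\<close>

definition uea_series_counit ::
    "('f::field, 'x) lie_algebra \<Rightarrow> (nat \<Rightarrow> ('x list \<Rightarrow>\<^sub>0 'f) set) \<Rightarrow> 'f fps" where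
  "uea_series_counit L x = Abs_fps (\<lambda>n. uea_counit L (x n))"

section \<open>The generalized Virasoro-like algebra\<close>

definition nondegenerate_subgroup :: "('f::field ^ 2) set \<Rightarrow> bool" where
  "nondegenerate_subgroup \<Gamma> \<longleftrightarrow>
    0 \<in> \<Gamma> \<and> (\<forall>\<alpha>\<in>\<Gamma>. \<forall>\<beta>\<in>\<Gamma>. \<alpha> + \<beta> \<in> \<Gamma>) \<and> (\<forall>\<alpha>\<in>\<Gamma>. - \<alpha> \<in> \<Gamma>) \<and>
    (\<exists>B\<subseteq>\<Gamma>. vec.independent B \<and> vec.span B = UNIV)"

datatype 'f vir_index = Root "'f ^ 2" | Deriv 2

definition L_vec :: "'f::field ^ 2 \<Rightarrow> 'f vir_index \<Rightarrow>\<^sub>0 'f" where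
  "L_vec \<alpha> = (if \<alpha> = 0 then 0 else Poly_Mapping.single (Root \<alpha>) 1)"

definition d_vec :: "2 \<Rightarrow> 'f::field vir_index \<Rightarrow>\<^sub>0 'f" where
  "d_vec i = Poly_Mapping.single (Deriv i) 1"

definition det2 :: "'f::field ^ 2 \<Rightarrow> 'f ^ 2 \<Rightarrow> 'f" where
  "det2 \<alpha> \<beta> = \<alpha> $ 1 * \<beta> $ 2 - \<alpha> $ 2 * \<beta> $ 1"

fun basis_bracket :: "'f::field vir_index \<Rightarrow> 'f vir_index \<Rightarrow> 'f vir_index \<Rightarrow>\<^sub>0 'f" where
  "basis_bracket (Root \<alpha>) (Root \<beta>) = Poly_Mapping.map ((*) (det2 \<alpha> \<beta>)) (L_vec (\<alpha> + \<beta>))"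
| "basis_bracket (Deriv i) (Root \<alpha>) = Poly_Mapping.map ((*) (\<alpha> $ i)) (L_vec \<alpha>)"
| "basis_bracket (Root \<alpha>) (Deriv i) = Poly_Mapping.map ((*) (- (\<alpha> $ i))) (L_vec \<alpha>)"
| "basis_bracket (Deriv i) (Deriv j) = 0"

definition virasoro_like :: "('f::field ^ 2) set \<Rightarrow> ('f, 'f vir_index \<Rightarrow>\<^sub>0 'f) lie_algebra" where
  "virasoro_like \<Gamma> =
    \<lparr>carrier = {p. Poly_Mapping.keys p \<subseteq> Root ` (\<Gamma> - {0}) \<union> range Deriv},
     mult = undefined, one = undefined, zero = 0, add = (+),
     smult = (\<lambda>c. Poly_Mapping.map ((*) c)),
     lie_bracket = (\<lambda>p q. \<Sum>x\<in>Poly_Mapping.keys p. \<Sum>y\<in>Poly_Mapping.keys q.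
       Poly_Mapping.map ((*) (Poly_Mapping.lookup p x * Poly_Mapping.lookup q y))
         (basis_bracket x y))\<rparr>"

lemma lookup_scale:
  fixes c :: "'f::field"
  shows "Poly_Mapping.lookup (Poly_Mapping.map ((*) c) p) k = c * Poly_Mapping.lookup p k"
  by (simp add: Poly_Mapping.map.rep_eq when_def)

lemma scale_one [simp]:
  fixes p :: "'x \<Rightarrow>\<^sub>0 'f::field"
  shows "Poly_Mapping.map ((*) 1) p = p"
  by (rule poly_mapping_eqI) (simp add: lookup_scale)

lemma lie_bracket_basis:
  fixes \<alpha> \<beta> :: "'f::field ^ 2"
  assumes "\<alpha> \<noteq> 0" "\<beta> \<noteq> 0"
  shows "lie_bracket (virasoro_like \<Gamma>) (L_vec \<alpha>) (L_vec \<beta>)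
      = det2 \<alpha> \<beta> \<odot>\<^bsub>virasoro_like \<Gamma>\<^esub> L_vec (\<alpha> + \<beta>)"
    and "lie_bracket (virasoro_like \<Gamma>) (d_vec i) (L_vec \<alpha>)
      = \<alpha> $ i \<odot>\<^bsub>virasoro_like \<Gamma>\<^esub> L_vec \<alpha>"
    and "lie_bracket (virasoro_like \<Gamma>) (d_vec i) (d_vec j) = (0 :: 'f vir_index \<Rightarrow>\<^sub>0 'f)"
  using assms by (simp_all add: virasoro_like_def L_vec_def d_vec_def)

section \<open>Rising factorials and binomial series\<close>

primrec rising :: "('f::field, 'a) module \<Rightarrow> 'f \<Rightarrow> 'a \<Rightarrow> nat \<Rightarrow> 'a" where
  "rising A a x 0 = \<one>\<^bsub>A\<^esub>"
| "rising A a x (Suc n) = rising A a x n \<otimes>\<^bsub>A\<^esub> (x \<oplus>\<^bsub>A\<^esub> (a + of_nat n) \<odot>\<^bsub>A\<^esub> \<one>\<^bsub>A\<^esub>)"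

text \<open>The series \<open>(1 - x t)^c\<close>.\<close>

definition binomial_series :: "('f::field_char_0, 'a) module \<Rightarrow> 'a \<Rightarrow> 'f \<Rightarrow> nat \<Rightarrow> 'a" where
  "binomial_series A x c = (\<lambda>m. ((-1) ^ m * (c gchoose m)) \<odot>\<^bsub>A\<^esub> (x [^]\<^bsub>A\<^esub> m))"

end

theory Submission
  imports Defs
begin

text \<open>
  The new coproduct is \<open>\<Delta>\<^sub>0\<close> conjugated by the Jordanian twist \<open>exp (T \<otimes> ln (1 - L t))\<close>, where
  \<open>L = L_\<alpha>\<close>.  The twist itself is avoided: for \<open>a\<close> in the enveloping algebra,
  \<open>\<Delta> a\<close> is the unique solution of the linear differential equation \<open>Y' = N Y - Y N\<close> in \<open>t\<close>
  with \<open>Y(0) = \<Delta>\<^sub>0 a\<close>, where \<open>N = - T \<otimes> L (1 - L t)^(-1)\<close> is the logarithmic derivative of the twist;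
  likewise the antipode solves \<open>Y' = M Y - Y M\<close> with \<open>M = T L\<close> and \<open>Y(0) = S\<^sub>0 a\<close>.  Uniqueness of
  solutions of such equations gives multiplicativity of \<open>\<Delta>\<close>, the Hopf algebra axioms, and the explicit
  formulas: in each case both sides solve the same equation with the same initial value.
\<close>

section \<open>Associative algebras\<close>

text \<open>Write F for the twist. In F the element T stays in the first leg and series in L in the
  second, so F commutes with its derivative and F' = N F; the conjugate of
  \<open>\<Delta>\<^sub>0 a\<close> by F therefore satisfies Y' = N Y - Y N. The gain is that N is
  minus a single pure tensor T \<otimes> G with G = L (1 - L t)^(-1), while F, its inverse and its
  cocycle identity would have to be handled as exponential series in completed tensor powers. The
  multiplicative cocycle identity becomes an additive one for N (\<open>twist_cocycle\<close>),
  which follows from the values of the coproduct on T and G alone. The choice M = T L is forced by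
  S(T) G = T S(G) = - T L. The antipode axioms lead to equations with different coefficients on the
  left and on the right of Y, so uniqueness is proved in that generality. Coefficient n + 1 of a
  solution is found by dividing by n + 1, which is where characteristic 0 enters. That L is nonzero
  and that T \<otimes> L differs from L \<otimes> T cannot be read off the presentation by
  generators and relations; a concrete representation separates them.\<close>

lemma cring_scalar_algebra: "cring (scalar_algebra :: ('k::comm_ring_1, 'k) module)"
proof -
  let ?K = "scalar_algebra :: ('k, 'k) module"
  have "\<exists>y\<in>carrier ?K. y \<oplus>\<^bsub>?K\<^esub> x = \<zero>\<^bsub>?K\<^esub>" for x
    by (rule bexI[of _ "- x"]) (simp_all add: scalar_algebra_def)
  then show ?thesis
    by (intro cringI abelian_groupI comm_monoidI) (simp_all add: scalar_algebra_def algebra_simps)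
qed

text \<open>Additive inverses are supplied by \<open>(-1) \<odot> x\<close>, so negation does not
  appear among the premises. The flat list of equations replaces the nested group, ring and module
  axioms in every later verification.\<close>

lemma assoc_algebraI:
  fixes A :: "('k::comm_ring_1, 'a) module" (structure)
  assumes "\<And>x y. x \<in> carrier A \<Longrightarrow> y \<in> carrier A \<Longrightarrow> x \<oplus> y \<in> carrier A"
    and "\<And>x y. x \<in> carrier A \<Longrightarrow> y \<in> carrier A \<Longrightarrow> x \<otimes> y \<in> carrier A"
    and "\<And>c x. x \<in> carrier A \<Longrightarrow> c \<odot> x \<in> carrier A"
    and "\<zero> \<in> carrier A" and "\<one> \<in> carrier A"
    and "\<And>x y z. x \<in> carrier A \<Longrightarrow> y \<in> carrier A \<Longrightarrow> z \<in> carrier A \<Longrightarrow>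
      (x \<oplus> y) \<oplus> z = x \<oplus> (y \<oplus> z)"
    and "\<And>x y. x \<in> carrier A \<Longrightarrow> y \<in> carrier A \<Longrightarrow> x \<oplus> y = y \<oplus> x"
    and "\<And>x. x \<in> carrier A \<Longrightarrow> \<zero> \<oplus> x = x"
    and "\<And>x y z. x \<in> carrier A \<Longrightarrow> y \<in> carrier A \<Longrightarrow> z \<in> carrier A \<Longrightarrow>
      (x \<otimes> y) \<otimes> z = x \<otimes> (y \<otimes> z)"
    and "\<And>x. x \<in> carrier A \<Longrightarrow> \<one> \<otimes> x = x" and "\<And>x. x \<in> carrier A \<Longrightarrow> x \<otimes> \<one> = x"
    and "\<And>x y z. x \<in> carrier A \<Longrightarrow> y \<in> carrier A \<Longrightarrow> z \<in> carrier A \<Longrightarrow>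
      (x \<oplus> y) \<otimes> z = x \<otimes> z \<oplus> y \<otimes> z"
    and "\<And>x y z. x \<in> carrier A \<Longrightarrow> y \<in> carrier A \<Longrightarrow> z \<in> carrier A \<Longrightarrow>
      z \<otimes> (x \<oplus> y) = z \<otimes> x \<oplus> z \<otimes> y"
    and "\<And>c d x. x \<in> carrier A \<Longrightarrow> (c + d) \<odot> x = c \<odot> x \<oplus> d \<odot> x"
    and "\<And>c x y. x \<in> carrier A \<Longrightarrow> y \<in> carrier A \<Longrightarrow> c \<odot> (x \<oplus> y) = c \<odot> x \<oplus> c \<odot> y"
    and "\<And>c d x. x \<in> carrier A \<Longrightarrow> (c * d) \<odot> x = c \<odot> (d \<odot> x)"
    and "\<And>x. x \<in> carrier A \<Longrightarrow> 1 \<odot> x = x" and "\<And>x. x \<in> carrier A \<Longrightarrow> 0 \<odot> x = \<zero>"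
    and "\<And>c x y. x \<in> carrier A \<Longrightarrow> y \<in> carrier A \<Longrightarrow> (c \<odot> x) \<otimes> y = c \<odot> (x \<otimes> y)"
    and "\<And>c x y. x \<in> carrier A \<Longrightarrow> y \<in> carrier A \<Longrightarrow> x \<otimes> (c \<odot> y) = c \<odot> (x \<otimes> y)"
  shows "assoc_algebra A"
proof -
  have inv: "\<exists>y\<in>carrier A. y \<oplus> x = \<zero>" if x: "x \<in> carrier A" for x
  proof (rule bexI[of _ "(-1) \<odot> x"])
    have "(-1) \<odot> x \<oplus> x = (-1) \<odot> x \<oplus> 1 \<odot> x"
      using x by (simp add: assms(17))
    also have "\<dots> = ((-1) + 1) \<odot> x"
      using x by (simp only: assms(14))
    finally show "(-1) \<odot> x \<oplus> x = \<zero>"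
      using x by (simp add: assms(18))
  qed (use x assms(3) in simp)
  have grp: "abelian_group A"
    by (rule abelian_groupI) (auto intro: assms(1-8) inv)
  have "ring A"
    by (rule ringI[OF grp]) (auto intro!: monoidI assms)
  moreover have "Module.module (scalar_algebra :: ('k, 'k) module) A"
    by (rule moduleI[OF cring_scalar_algebra grp])
      (simp_all add: scalar_algebra_def assms)
  ultimately show ?thesis
    unfolding assoc_algebra_def using assms(19,20) by blast
qed

locale algebra_over =
  fixes A :: "('k::comm_ring_1, 'a) module" (structure)
  assumes assoc_algebra: "assoc_algebra A"

sublocale algebra_over \<subseteq> ring A
  using assoc_algebra by (simp add: assoc_algebra_def)

context algebra_over
begin

lemma module_scalar: "Module.module (scalar_algebra :: ('k, 'k) module) A"
  using assoc_algebra by (simp add: assoc_algebra_def)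

lemma smult_closed [simp, intro]: "x \<in> carrier A \<Longrightarrow> c \<odot> x \<in> carrier A"
  using module.smult_closed[OF module_scalar, of c x] by (simp add: scalar_algebra_def)

lemma smult_l_distr: "x \<in> carrier A \<Longrightarrow> (c + d) \<odot> x = c \<odot> x \<oplus> d \<odot> x"
  using module.smult_l_distr[OF module_scalar, of c d x] by (simp add: scalar_algebra_def)

lemma smult_r_distr:
  "x \<in> carrier A \<Longrightarrow> y \<in> carrier A \<Longrightarrow> c \<odot> (x \<oplus> y) = c \<odot> x \<oplus> c \<odot> y"
  using module.smult_r_distr[OF module_scalar, of c x y] by (simp add: scalar_algebra_def)

lemma smult_smult: "x \<in> carrier A \<Longrightarrow> c \<odot> (d \<odot> x) = (c * d) \<odot> x"
  using module.smult_assoc1[OF module_scalar, of c d x] by (simp add: scalar_algebra_def)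

lemma smult_one [simp]: "x \<in> carrier A \<Longrightarrow> 1 \<odot> x = x"
  using module.smult_one[OF module_scalar, of x] by (simp add: scalar_algebra_def)

lemma smult_mult_left [simp]:
  "x \<in> carrier A \<Longrightarrow> y \<in> carrier A \<Longrightarrow> (c \<odot> x) \<otimes> y = c \<odot> (x \<otimes> y)"
  using assoc_algebra by (simp add: assoc_algebra_def)

lemma smult_mult_right [simp]:
  "x \<in> carrier A \<Longrightarrow> y \<in> carrier A \<Longrightarrow> x \<otimes> (c \<odot> y) = c \<odot> (x \<otimes> y)"
  using assoc_algebra by (simp add: assoc_algebra_def)

lemma smult_zero_left [simp]: "x \<in> carrier A \<Longrightarrow> 0 \<odot> x = \<zero>"
  using module.smult_l_null[OF module_scalar, of x] by (simp add: scalar_algebra_def)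

lemma smult_zero_right [simp]: "c \<odot> \<zero> = \<zero>"
  using module.smult_r_null[OF module_scalar, of c] by (simp add: scalar_algebra_def)

lemma smult_a_inv: "x \<in> carrier A \<Longrightarrow> c \<odot> (\<ominus> x) = \<ominus> (c \<odot> x)"
  using module.smult_r_minus[OF module_scalar, of c x] by (simp add: scalar_algebra_def)

lemma smult_uminus: "x \<in> carrier A \<Longrightarrow> (- c) \<odot> x = \<ominus> (c \<odot> x)"
  by (rule minus_equality[symmetric]) (simp_all flip: smult_l_distr)

lemma smult_minus:
  "x \<in> carrier A \<Longrightarrow> y \<in> carrier A \<Longrightarrow> c \<odot> (x \<ominus> y) = c \<odot> x \<ominus> c \<odot> y"
  by (simp add: a_minus_def smult_r_distr smult_a_inv)

lemma a_inv_eq_smult: "x \<in> carrier A \<Longrightarrow> \<ominus> x = (- 1) \<odot> x"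
  by (simp add: smult_uminus)

lemma finsum_smult_left:
  assumes "x \<in> carrier A"
  shows "(\<Oplus>i\<in>I. f i \<odot> x) = sum f I \<odot> x"
  using assms
proof (induction I rule: infinite_finite_induct)
  case (insert i I)
  then have "(\<lambda>i. f i \<odot> x) \<in> I \<rightarrow> carrier A"
    by auto
  with insert show ?case
    by (simp add: smult_l_distr)
qed (simp_all add: finsum_infinite)

lemma minus_eq_zero_iff:
  assumes "x \<in> carrier A" "y \<in> carrier A"
  shows "x \<ominus> y = \<zero> \<longleftrightarrow> x = y"
proof
  assume "x \<ominus> y = \<zero>"
  moreover have "(x \<ominus> y) \<oplus> y = x"
    using assms by (simp add: a_minus_def a_assoc l_neg)
  ultimately show "x = y"
    using assms by simp
qed (use assms in \<open>simp add: a_minus_def r_neg\<close>)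

lemma opposite_assoc_algebra: "assoc_algebra (opposite_algebra A)"
  by (rule assoc_algebraI)
    (simp_all add: opposite_algebra_def smult_l_distr smult_r_distr smult_smult l_distr r_distr
      m_assoc a_ac)

end

lemma scalar_assoc_algebra: "assoc_algebra (scalar_algebra :: ('k::comm_ring_1, 'k) module)"
  by (rule assoc_algebraI) (simp_all add: scalar_algebra_def algebra_simps)

lemma finsum_scalar_algebra:
  "finsum (scalar_algebra :: ('k::comm_ring_1, 'k) module) f I = sum f I"
proof -
  interpret cring "scalar_algebra :: ('k, 'k) module"
    by (rule cring_scalar_algebra)
  show ?thesis
  proof (induction I rule: infinite_finite_induct)
    case (insert i I)
    have "finsum scalar_algebra f (insert i I) = f i \<oplus>\<^bsub>scalar_algebra\<^esub> finsum scalar_algebra f I"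
      using insert.hyps by (intro finsum_insert) (simp_all add: scalar_algebra_def)
    with insert show ?case
      by (simp add: scalar_algebra_def)
  next
    case (infinite I)
    then show ?case
      using finsum_infinite[of I f] by (simp add: scalar_algebra_def)
  next
    case empty
    then show ?case
      using finsum_empty[of f] by (simp add: scalar_algebra_def)
  qed
qed

lemma linear_maps_closed: "h \<in> linear_maps M N \<Longrightarrow> x \<in> carrier M \<Longrightarrow> h x \<in> carrier N"
  by (auto simp: linear_maps_def)

lemma linear_maps_add:
  "h \<in> linear_maps M N \<Longrightarrow> x \<in> carrier M \<Longrightarrow> y \<in> carrier M \<Longrightarrow>
    h (x \<oplus>\<^bsub>M\<^esub> y) = h x \<oplus>\<^bsub>N\<^esub> h y"
  by (auto simp: linear_maps_def)

lemma linear_maps_smult: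
  "h \<in> linear_maps M N \<Longrightarrow> x \<in> carrier M \<Longrightarrow> h (c \<odot>\<^bsub>M\<^esub> x) = c \<odot>\<^bsub>N\<^esub> h x"
  by (auto simp: linear_maps_def)

lemma linear_mapsI:
  assumes "\<And>x. x \<in> carrier M \<Longrightarrow> h x \<in> carrier N"
    and "\<And>x y. x \<in> carrier M \<Longrightarrow> y \<in> carrier M \<Longrightarrow> h (x \<oplus>\<^bsub>M\<^esub> y) = h x \<oplus>\<^bsub>N\<^esub> h y"
    and "\<And>c x. x \<in> carrier M \<Longrightarrow> h (c \<odot>\<^bsub>M\<^esub> x) = c \<odot>\<^bsub>N\<^esub> h x"
  shows "h \<in> linear_maps M N"
  using assms by (auto simp: linear_maps_def)

lemma linear_maps_comp:
  "g \<in> linear_maps N P \<Longrightarrow> h \<in> linear_maps M N \<Longrightarrow> (\<lambda>x. g (h x)) \<in> linear_maps M P"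
  by (rule linear_mapsI)
    (simp_all add: linear_maps_closed linear_maps_add linear_maps_smult)

locale algebra_pair = A: algebra_over A + B: algebra_over B
  for A :: "('k::comm_ring_1, 'a) module" and B :: "('k, 'b) module"
begin

lemma linear_maps_zero: "h \<in> linear_maps A B \<Longrightarrow> h \<zero>\<^bsub>A\<^esub> = \<zero>\<^bsub>B\<^esub>"
  using linear_maps_smult[of h A B "\<zero>\<^bsub>A\<^esub>" 0] by (simp add: linear_maps_closed)

lemma linear_maps_a_inv:
  "h \<in> linear_maps A B \<Longrightarrow> x \<in> carrier A \<Longrightarrow> h (\<ominus>\<^bsub>A\<^esub> x) = \<ominus>\<^bsub>B\<^esub> h x"
  by (simp add: A.a_inv_eq_smult B.a_inv_eq_smult linear_maps_closed linear_maps_smult)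

lemma linear_maps_diff:
  "h \<in> linear_maps A B \<Longrightarrow> x \<in> carrier A \<Longrightarrow> y \<in> carrier A \<Longrightarrow>
    h (x \<ominus>\<^bsub>A\<^esub> y) = h x \<ominus>\<^bsub>B\<^esub> h y"
  by (simp add: a_minus_def linear_maps_a_inv linear_maps_add)

lemma linear_maps_finsum:
  assumes "h \<in> linear_maps A B" "f \<in> I \<rightarrow> carrier A"
  shows "h (finsum A f I) = (\<Oplus>\<^bsub>B\<^esub>i\<in>I. h (f i))"
  using assms(2)
proof (induction I rule: infinite_finite_induct)
  case (insert i I)
  then have f: "f i \<in> carrier A" "f \<in> I \<rightarrow> carrier A"
    by auto
  then have hf: "h (f i) \<in> carrier B" "(\<lambda>i. h (f i)) \<in> I \<rightarrow> carrier B"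
    using assms(1) by (auto intro: linear_maps_closed)
  have "h (finsum A f (insert i I)) = h (f i) \<oplus>\<^bsub>B\<^esub> h (finsum A f I)"
    using insert.hyps f linear_maps_add[OF assms(1)] by (simp add: A.finsum_insert)
  also have "\<dots> = h (f i) \<oplus>\<^bsub>B\<^esub> (\<Oplus>\<^bsub>B\<^esub>i\<in>I. h (f i))"
    using insert.IH f by simp
  also have "\<dots> = (\<Oplus>\<^bsub>B\<^esub>i\<in>insert i I. h (f i))"
    by (rule B.finsum_insert[OF insert.hyps hf(2) hf(1), symmetric])
  finally show ?case .
qed (simp_all add: A.finsum_infinite B.finsum_infinite linear_maps_zero[OF assms(1)])

lemma linear_maps_sum:
  assumes "g \<in> linear_maps A B" "h \<in> linear_maps A B"
  shows "(\<lambda>x. g x \<oplus>\<^bsub>B\<^esub> h x) \<in> linear_maps A B"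
  using assms
  by (intro linear_mapsI)
    (simp_all add: linear_maps_closed linear_maps_add linear_maps_smult B.smult_r_distr B.a_ac)

lemma linear_maps_uminus:
  assumes "h \<in> linear_maps A B"
  shows "(\<lambda>x. \<ominus>\<^bsub>B\<^esub> h x) \<in> linear_maps A B"
  using assms
  by (intro linear_mapsI)
    (simp_all add: linear_maps_closed linear_maps_add linear_maps_smult B.smult_a_inv B.minus_add)

lemma linear_maps_mult_left:
  assumes "h \<in> linear_maps A B" "b \<in> carrier B"
  shows "(\<lambda>x. b \<otimes>\<^bsub>B\<^esub> h x) \<in> linear_maps A B"
  using assms
  by (intro linear_mapsI)
    (simp_all add: linear_maps_closed linear_maps_add linear_maps_smult B.r_distr)

lemma linear_maps_mult_right:
  assumes "h \<in> linear_maps A B" "b \<in> carrier B"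
  shows "(\<lambda>x. h x \<otimes>\<^bsub>B\<^esub> b) \<in> linear_maps A B"
  using assms
  by (intro linear_mapsI)
    (simp_all add: linear_maps_closed linear_maps_add linear_maps_smult B.l_distr)

end

section \<open>Quotient algebras\<close>

lemma quotient_algebra_simps:
  "carrier (quotient_algebra A I) = a_rcosets\<^bsub>A\<^esub> I"
  "mult (quotient_algebra A I) = rcoset_mult A I"
  "one (quotient_algebra A I) = I +>\<^bsub>A\<^esub> \<one>\<^bsub>A\<^esub>"
  "zero (quotient_algebra A I) = I"
  "add (quotient_algebra A I) = set_add A"
  "smult (quotient_algebra A I) = (\<lambda>c X. \<Union>x\<in>X. I +>\<^bsub>A\<^esub> (c \<odot>\<^bsub>A\<^esub> x))"
  by (simp_all add: quotient_algebra_def ring.defs module.defs FactRing_def)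

locale algebra_ideal = algebra_over A + ideal I A
  for I and A :: "('k::comm_ring_1, 'a) module" (structure)
begin

abbreviation Q where "Q \<equiv> quotient_algebra A I"

lemma coset_closed: "x \<in> carrier A \<Longrightarrow> I +> x \<in> carrier Q"
  by (simp add: quotient_algebra_simps a_rcosetsI a_subset)

lemma coset_cases:
  assumes "X \<in> carrier Q"
  obtains x where "x \<in> carrier A" "X = I +> x"
  using assms by (auto simp: quotient_algebra_simps A_RCOSETS_def')

lemma coset_add:
  "x \<in> carrier A \<Longrightarrow> y \<in> carrier A \<Longrightarrow> (I +> x) \<oplus>\<^bsub>Q\<^esub> (I +> y) = I +> (x \<oplus> y)"
  by (simp add: quotient_algebra_simps a_rcos_sum)

lemma coset_mult:
  "x \<in> carrier A \<Longrightarrow> y \<in> carrier A \<Longrightarrow> (I +> x) \<otimes>\<^bsub>Q\<^esub> (I +> y) = I +> (x \<otimes> y)"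
  by (simp add: quotient_algebra_simps rcoset_mult_add)

lemma coset_one: "\<one>\<^bsub>Q\<^esub> = I +> \<one>"
  by (simp add: quotient_algebra_simps)

lemma coset_zero: "\<zero>\<^bsub>Q\<^esub> = I +> \<zero>"
  by (simp add: quotient_algebra_simps a_coset_add_zero a_subset)

lemma coset_eq_iff:
  "x \<in> carrier A \<Longrightarrow> y \<in> carrier A \<Longrightarrow> I +> x = I +> y \<longleftrightarrow> x \<ominus> y \<in> I"
  using quotient_eq_iff_same_a_r_cos[OF is_ideal] by blast

text \<open>A ring ideal is automatically a subspace: scaling by \<open>c\<close> is multiplication
  by \<open>c \<odot> \<one>\<close>.\<close>

lemma smult_ideal: "x \<in> I \<Longrightarrow> c \<odot> x \<in> I"
  using I_l_closed[of x "c \<odot> \<one>"] by (simp add: Icarr)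

lemma coset_memD:
  assumes "y \<in> I +> x" "x \<in> carrier A"
  shows "y \<in> carrier A" "I +> y = I +> x"
  using assms a_r_coset_subset_G[OF a_subset] a_repr_independence' a_subgroup by blast+

text \<open>The scalar multiple of a coset is defined as a union over its representatives. By
  \<open>smult_ideal\<close> they all yield the same coset, and a union of a constant family over a
  nonempty set is that constant.\<close>

lemma coset_smult:
  assumes "x \<in> carrier A"
  shows "c \<odot>\<^bsub>Q\<^esub> (I +> x) = I +> (c \<odot> x)"
proof -
  have "I +> (c \<odot> y) = I +> (c \<odot> x)" if "y \<in> I +> x" for y
  proof -
    have y: "y \<in> carrier A" "y \<ominus> x \<in> I"
      using coset_memD[OF that assms] coset_eq_iff[of y x] assms by simp_all
    with smult_ideal[of "y \<ominus> x" c] show ?thesis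
      using assms by (simp add: coset_eq_iff smult_minus)
  qed
  then have "(\<Union>y\<in>I +> x. I +> (c \<odot> y)) = (\<Union>y\<in>I +> x. I +> (c \<odot> x))"
    by (rule SUP_cong[OF refl])
  moreover have "I +> x \<noteq> {}"
    using a_rcos_self[OF assms] by blast
  ultimately show ?thesis
    by (simp add: quotient_algebra_simps)
qed

lemmas coset_ops = coset_add coset_mult coset_one coset_zero coset_smult

lemma quotient_assoc_algebra: "assoc_algebra Q"
  by (rule assoc_algebraI; (elim coset_cases)?)
    (simp_all add: coset_ops coset_closed smult_l_distr smult_r_distr smult_smult
      l_distr r_distr m_assoc a_ac)

text \<open>\<open>tensor_lift\<close> and \<open>uea_lift\<close> evaluate at a representative
  picked by \<open>SOME\<close>. A linear map that kills the ideal has the same value at the picked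
  representative as at \<open>x\<close>; this makes both definitions usable.\<close>

lemma quotient_lift:
  assumes C: "algebra_over C" and f: "f \<in> linear_maps A C"
    and vanish: "\<And>x. x \<in> I \<Longrightarrow> f x = \<zero>\<^bsub>C\<^esub>" and x: "x \<in> carrier A"
  shows "f (SOME p. p \<in> I +> x) = f x"
proof -
  interpret C: algebra_over C by (rule C)
  interpret algebra_pair A C ..
  define p where "p = (SOME p. p \<in> I +> x)"
  have "p \<in> I +> x"
    unfolding p_def by (rule someI[of _ x]) (rule a_rcos_self[OF x])
  note p = coset_memD[OF this x]
  then have "f (p \<ominus> x) = \<zero>\<^bsub>C\<^esub>"
    using x coset_eq_iff vanish by blast
  then have "f p \<ominus>\<^bsub>C\<^esub> f x = \<zero>\<^bsub>C\<^esub>"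
    using p x f by (simp add: linear_maps_diff)
  then show ?thesis
    using C.minus_eq_zero_iff[of "f p" "f x"] linear_maps_closed[OF f] p(1) x
    unfolding p_def[symmetric] by simp
qed

end

section \<open>Monoid algebras\<close>

text \<open>The induction never leaves the functions supported in \<open>X\<close>, so statements
  about a carrier given by a support condition reduce to single basis elements.\<close>

lemma poly_mapping_induct_keys [consumes 1, case_names zero single add]:
  fixes p :: "'x \<Rightarrow>\<^sub>0 'f::comm_monoid_add"
  assumes p: "Poly_Mapping.keys p \<subseteq> X" and zero: "P 0"
    and single: "\<And>x c. x \<in> X \<Longrightarrow> P (Poly_Mapping.single x c)"
    and add: "\<And>p q. Poly_Mapping.keys p \<subseteq> X \<Longrightarrow> Poly_Mapping.keys q \<subseteq> X \<Longrightarrow> P p \<Longrightarrow> P q \<Longrightarrow> P (p + q)"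
  shows "P p"
proof -
  let ?s = "\<lambda>F. \<Sum>x\<in>F. Poly_Mapping.single x (Poly_Mapping.lookup p x)"
  \<comment> \<open>The support bound is carried along because the case \<open>add\<close> demands
    it for both summands.\<close>
  have "P (?s F) \<and> Poly_Mapping.keys (?s F) \<subseteq> X" if "finite F" "F \<subseteq> X" for F
    using that
  proof (induction F)
    case (insert x F)
    let ?m = "Poly_Mapping.single x (Poly_Mapping.lookup p x)"
    have m: "Poly_Mapping.keys ?m \<subseteq> X"
      using insert.prems by (simp add: keys_single)
    have "P (?m + ?s F)"
      using insert m by (auto intro!: add single)
    moreover have "Poly_Mapping.keys (?m + ?s F) \<subseteq> X"
      using insert m Poly_Mapping.keys_add[of ?m "?s F"] by blast
    ultimately show ?case
      using insert.hyps by simp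
  qed (simp add: zero)
  moreover have "?s (Poly_Mapping.keys p) = p"
    by (rule poly_mapping_eqI) (simp add: lookup_sum lookup_single when_def in_keys_iff)
  ultimately show ?thesis
    using p by (metis finite_keys)
qed

lemma keys_scale_subset:
  "Poly_Mapping.keys (Poly_Mapping.map ((*) c) p) \<subseteq> Poly_Mapping.keys (p :: 'x \<Rightarrow>\<^sub>0 'f::field)"
  by (auto simp: in_keys_iff lookup_scale)

lemma scale_simps:
  fixes p q :: "'x \<Rightarrow>\<^sub>0 'f::field"
  shows "Poly_Mapping.map ((*) c) (p + q) = Poly_Mapping.map ((*) c) p + Poly_Mapping.map ((*) c) q"
    and "Poly_Mapping.map ((*) (c + d)) p = Poly_Mapping.map ((*) c) p + Poly_Mapping.map ((*) d) p"
    and "Poly_Mapping.map ((*) c) (Poly_Mapping.map ((*) d) p) = Poly_Mapping.map ((*) (c * d)) p"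
    and "Poly_Mapping.map ((*) 0) p = 0"
    and "Poly_Mapping.map ((*) c) (0 :: 'x \<Rightarrow>\<^sub>0 'f) = 0"
    and "Poly_Mapping.map ((*) c) (Poly_Mapping.single x d) = Poly_Mapping.single x (c * d)"
  by (rule poly_mapping_eqI;
      simp add: lookup_scale lookup_add lookup_single algebra_simps when_def)+

text \<open>The common core of \<open>tensor_lift\<close> and \<open>uea_lift\<close>: each is such
  an extension of a map on basis elements, evaluated at a representative of a coset.\<close>

definition linear_extension :: "('k::comm_ring_1, 'c) module \<Rightarrow> ('x \<Rightarrow> 'c) \<Rightarrow> ('x \<Rightarrow>\<^sub>0 'k) \<Rightarrow> 'c" where
  "linear_extension C h p =
    finsum C (\<lambda>x. Poly_Mapping.lookup p x \<odot>\<^bsub>C\<^esub> h x) (Poly_Mapping.keys p)"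

context algebra_over
begin

context
  fixes h :: "'x \<Rightarrow> 'a" and X
  assumes h: "h \<in> X \<rightarrow> carrier A"
begin

text \<open>The support of \<open>p + q\<close> may shrink by cancellation; over one common finite
  set the sums for \<open>p\<close>, \<open>q\<close> and \<open>p + q\<close> can be compared term
  by term.\<close>

lemma linear_extension_superset:
  assumes "finite F" "Poly_Mapping.keys p \<subseteq> F" "F \<subseteq> X"
  shows "linear_extension A h p = (\<Oplus>x\<in>F. Poly_Mapping.lookup p x \<odot> h x)"
  unfolding linear_extension_def
  by (rule add.finprod_mono_neutral_cong_left) (use assms h in \<open>auto simp: in_keys_iff Pi_iff\<close>)

lemma linear_extension_closed:
  "Poly_Mapping.keys p \<subseteq> X \<Longrightarrow> linear_extension A h p \<in> carrier A"
  unfolding linear_extension_def using h by (intro finsum_closed) auto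

lemma linear_extension_add:
  assumes "Poly_Mapping.keys p \<subseteq> X" "Poly_Mapping.keys q \<subseteq> X"
  shows "linear_extension A h (p + q) = linear_extension A h p \<oplus> linear_extension A h q"
proof -
  let ?F = "Poly_Mapping.keys p \<union> Poly_Mapping.keys q"
  have F: "finite ?F" "Poly_Mapping.keys p \<subseteq> ?F" "Poly_Mapping.keys q \<subseteq> ?F"
      "Poly_Mapping.keys (p + q) \<subseteq> ?F" "?F \<subseteq> X"
    using assms Poly_Mapping.keys_add[of p q] by auto
  then have h': "h x \<in> carrier A" if "x \<in> ?F" for x
    using h that by auto
  have "linear_extension A h (p + q) =
      (\<Oplus>x\<in>?F. Poly_Mapping.lookup p x \<odot> h x \<oplus> Poly_Mapping.lookup q x \<odot> h x)"
    unfolding linear_extension_superset[OF F(1,4,5)]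
    by (rule finsum_cong') (auto simp: h' lookup_add smult_l_distr)
  also have "\<dots> = linear_extension A h p \<oplus> linear_extension A h q"
    unfolding linear_extension_superset[OF F(1,2,5)] linear_extension_superset[OF F(1,3,5)]
    by (rule finsum_addf) (auto simp: h')
  finally show ?thesis .
qed

lemma linear_extension_single:
  assumes "x \<in> X"
  shows "linear_extension A h (Poly_Mapping.single x c) = c \<odot> h x"
proof -
  have "linear_extension A h (Poly_Mapping.single x c) =
      (\<Oplus>y\<in>{x}. Poly_Mapping.lookup (Poly_Mapping.single x c) y \<odot> h y)"
    by (rule linear_extension_superset) (use assms in auto)
  also have "\<dots> = c \<odot> h x"
    using h assms by (simp add: Pi_iff)
  finally show ?thesis .
qed

lemma linear_extension_zero: "linear_extension A h 0 = \<zero>"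
  by (simp add: linear_extension_def)

end
end

lemma linear_extension_scale:
  fixes C :: "('f::field, 'c) module"
  assumes "algebra_over C" and h: "h \<in> X \<rightarrow> carrier C" and "Poly_Mapping.keys p \<subseteq> X"
  shows "linear_extension C h (Poly_Mapping.map ((*) c) p) = c \<odot>\<^bsub>C\<^esub> linear_extension C h p"
proof -
  interpret algebra_over C by fact
  from assms(3) show ?thesis
  proof (induction p rule: poly_mapping_induct_keys)
    case (single x d)
    with h have "h x \<in> carrier C"
      by auto
    with single show ?case
      by (simp add: scale_simps linear_extension_single[OF h] smult_smult)
  next
    case (add p q)
    then have "Poly_Mapping.keys (Poly_Mapping.map ((*) c) p) \<subseteq> X"
        "Poly_Mapping.keys (Poly_Mapping.map ((*) c) q) \<subseteq> X"
      using keys_scale_subset[of c p] keys_scale_subset[of c q] by simp_all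
    with add show ?case
      by (simp add: scale_simps linear_extension_add[OF h] linear_extension_closed[OF h] smult_r_distr)
  qed (simp add: scale_simps linear_extension_zero[OF h])
qed

lemma monoid_algebra_simps:
  "carrier (monoid_algebra M) = {p. Poly_Mapping.keys p \<subseteq> carrier M}"
  "one (monoid_algebra M) = Poly_Mapping.single \<one>\<^bsub>M\<^esub> 1"
  "zero (monoid_algebra M) = 0"
  "add (monoid_algebra M) = (+)"
  "smult (monoid_algebra M) = (\<lambda>c. Poly_Mapping.map ((*) c))"
  by (simp_all add: monoid_algebra_def)

text \<open>The product is defined through exact supports. Enlarging the index sets makes
  distributivity a termwise computation, as with \<open>linear_extension_superset\<close>.\<close>

lemma monoid_algebra_mult_superset:
  fixes p q :: "'x \<Rightarrow>\<^sub>0 'f::field"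
  assumes "finite F" "finite G" "Poly_Mapping.keys p \<subseteq> F" "Poly_Mapping.keys q \<subseteq> G"
  shows "p \<otimes>\<^bsub>monoid_algebra M\<^esub> q = (\<Sum>x\<in>F. \<Sum>y\<in>G.
    Poly_Mapping.single (x \<otimes>\<^bsub>M\<^esub> y) (Poly_Mapping.lookup p x * Poly_Mapping.lookup q y))"
proof -
  have "(\<Sum>y\<in>Poly_Mapping.keys q.
        Poly_Mapping.single (x \<otimes>\<^bsub>M\<^esub> y) (Poly_Mapping.lookup p x * Poly_Mapping.lookup q y)) =
      (\<Sum>y\<in>G. Poly_Mapping.single (x \<otimes>\<^bsub>M\<^esub> y) (Poly_Mapping.lookup p x * Poly_Mapping.lookup q y))" for x
    by (rule sum.mono_neutral_left) (use assms in \<open>auto simp: in_keys_iff\<close>)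
  then have "p \<otimes>\<^bsub>monoid_algebra M\<^esub> q = (\<Sum>x\<in>Poly_Mapping.keys p. \<Sum>y\<in>G.
      Poly_Mapping.single (x \<otimes>\<^bsub>M\<^esub> y) (Poly_Mapping.lookup p x * Poly_Mapping.lookup q y))"
    by (simp add: monoid_algebra_def)
  also have "\<dots> = (\<Sum>x\<in>F. \<Sum>y\<in>G.
      Poly_Mapping.single (x \<otimes>\<^bsub>M\<^esub> y) (Poly_Mapping.lookup p x * Poly_Mapping.lookup q y))"
    by (rule sum.mono_neutral_left) (use assms in \<open>auto simp: in_keys_iff\<close>)
  finally show ?thesis .
qed

lemma monoid_algebra_mult_single:
  "Poly_Mapping.single x c \<otimes>\<^bsub>monoid_algebra M\<^esub> Poly_Mapping.single y d =
    Poly_Mapping.single (x \<otimes>\<^bsub>M\<^esub> y) (c * d)"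
  by (subst monoid_algebra_mult_superset[of "{x}" "{y}"]) auto

lemma monoid_algebra_distrib_right:
  "(p + q) \<otimes>\<^bsub>monoid_algebra M\<^esub> r = p \<otimes>\<^bsub>monoid_algebra M\<^esub> r + q \<otimes>\<^bsub>monoid_algebra M\<^esub> r"
proof -
  let ?F = "Poly_Mapping.keys p \<union> Poly_Mapping.keys q"
  have F: "finite ?F" "Poly_Mapping.keys p \<subseteq> ?F" "Poly_Mapping.keys q \<subseteq> ?F"
      "Poly_Mapping.keys (p + q) \<subseteq> ?F"
    using Poly_Mapping.keys_add[of p q] by auto
  show ?thesis
    unfolding monoid_algebra_mult_superset[OF F(1) finite_keys F(2) order.refl]
      monoid_algebra_mult_superset[OF F(1) finite_keys F(3) order.refl]
      monoid_algebra_mult_superset[OF F(1) finite_keys F(4) order.refl]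
    by (simp add: lookup_add distrib_right single_add sum.distrib)
qed

lemma monoid_algebra_distrib_left:
  "r \<otimes>\<^bsub>monoid_algebra M\<^esub> (p + q) = r \<otimes>\<^bsub>monoid_algebra M\<^esub> p + r \<otimes>\<^bsub>monoid_algebra M\<^esub> q"
proof -
  let ?F = "Poly_Mapping.keys p \<union> Poly_Mapping.keys q"
  have F: "finite ?F" "Poly_Mapping.keys p \<subseteq> ?F" "Poly_Mapping.keys q \<subseteq> ?F"
      "Poly_Mapping.keys (p + q) \<subseteq> ?F"
    using Poly_Mapping.keys_add[of p q] by auto
  show ?thesis
    unfolding monoid_algebra_mult_superset[OF finite_keys F(1) order.refl F(2)]
      monoid_algebra_mult_superset[OF finite_keys F(1) order.refl F(3)]
      monoid_algebra_mult_superset[OF finite_keys F(1) order.refl F(4)]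
    by (simp add: lookup_add distrib_left single_add sum.distrib)
qed

lemma monoid_algebra_mult_zero:
  "0 \<otimes>\<^bsub>monoid_algebra M\<^esub> p = 0" "p \<otimes>\<^bsub>monoid_algebra M\<^esub> 0 = 0"
  by (simp_all add: monoid_algebra_def)

lemmas monoid_algebra_mult_simps = monoid_algebra_mult_single monoid_algebra_distrib_right
  monoid_algebra_distrib_left monoid_algebra_mult_zero

lemma monoid_algebra_mult_keys:
  assumes "Group.monoid M"
  shows "Poly_Mapping.keys p \<subseteq> carrier M \<Longrightarrow> Poly_Mapping.keys q \<subseteq> carrier M \<Longrightarrow>
    Poly_Mapping.keys (p \<otimes>\<^bsub>monoid_algebra M\<^esub> q) \<subseteq> carrier M"
proof (induction p rule: poly_mapping_induct_keys)
  case (single x c)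
  from single(2) show ?case
  proof (induction q rule: poly_mapping_induct_keys)
    case (single y d)
    with \<open>x \<in> carrier M\<close> show ?case
      by (simp add: monoid_algebra_mult_simps monoid.m_closed[OF assms] keys_single)
  qed (simp_all add: monoid_algebra_mult_simps order.trans[OF Poly_Mapping.keys_add])
qed (simp_all add: monoid_algebra_mult_simps order.trans[OF Poly_Mapping.keys_add])

lemma monoid_algebra_mult_scale:
  shows "Poly_Mapping.map ((*) c) p \<otimes>\<^bsub>monoid_algebra M\<^esub> q =
      Poly_Mapping.map ((*) c) (p \<otimes>\<^bsub>monoid_algebra M\<^esub> q)"
    and "p \<otimes>\<^bsub>monoid_algebra M\<^esub> Poly_Mapping.map ((*) c) q =
      Poly_Mapping.map ((*) c) (p \<otimes>\<^bsub>monoid_algebra M\<^esub> q)"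
proof -
  have *: "Poly_Mapping.map ((*) c) p \<otimes>\<^bsub>monoid_algebra M\<^esub> q =
      Poly_Mapping.map ((*) c) (p \<otimes>\<^bsub>monoid_algebra M\<^esub> q) \<and>
    p \<otimes>\<^bsub>monoid_algebra M\<^esub> Poly_Mapping.map ((*) c) q =
      Poly_Mapping.map ((*) c) (p \<otimes>\<^bsub>monoid_algebra M\<^esub> q)"
  proof (induction p rule: poly_mapping_induct_keys[OF subset_UNIV])
    case (2 x d)
    show ?case
      by (induction q rule: poly_mapping_induct_keys[OF subset_UNIV])
        (simp_all add: monoid_algebra_mult_simps scale_simps mult.assoc mult.left_commute)
  qed (simp_all add: monoid_algebra_mult_simps scale_simps)
  then show "Poly_Mapping.map ((*) c) p \<otimes>\<^bsub>monoid_algebra M\<^esub> q =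
      Poly_Mapping.map ((*) c) (p \<otimes>\<^bsub>monoid_algebra M\<^esub> q)"
    and "p \<otimes>\<^bsub>monoid_algebra M\<^esub> Poly_Mapping.map ((*) c) q =
      Poly_Mapping.map ((*) c) (p \<otimes>\<^bsub>monoid_algebra M\<^esub> q)"
    by blast+
qed

lemma monoid_algebra_mult_assoc:
  assumes M: "Group.monoid M"
    and "Poly_Mapping.keys p \<subseteq> carrier M" "Poly_Mapping.keys q \<subseteq> carrier M"
      "Poly_Mapping.keys r \<subseteq> carrier M"
  shows "(p \<otimes>\<^bsub>monoid_algebra M\<^esub> q) \<otimes>\<^bsub>monoid_algebra M\<^esub> r =
    p \<otimes>\<^bsub>monoid_algebra M\<^esub> (q \<otimes>\<^bsub>monoid_algebra M\<^esub> r)"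
  using assms(2)
proof (induction p rule: poly_mapping_induct_keys)
  case (single x c)
  note x = single
  from assms(3) show ?case
  proof (induction q rule: poly_mapping_induct_keys)
    case (single y d)
    note y = single
    from assms(4) show ?case
      by (induction r rule: poly_mapping_induct_keys)
        (simp_all add: monoid_algebra_mult_simps monoid.m_assoc[OF M] x y mult.assoc)
  qed (simp_all add: monoid_algebra_mult_simps)
qed (simp_all add: monoid_algebra_mult_simps)

lemma monoid_algebra_mult_one:
  assumes "Group.monoid M" and "Poly_Mapping.keys p \<subseteq> carrier M"
  shows "Poly_Mapping.single \<one>\<^bsub>M\<^esub> 1 \<otimes>\<^bsub>monoid_algebra M\<^esub> p = p"
    and "p \<otimes>\<^bsub>monoid_algebra M\<^esub> Poly_Mapping.single \<one>\<^bsub>M\<^esub> 1 = p"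
  using assms(2)
  by (induction p rule: poly_mapping_induct_keys;
      simp add: monoid_algebra_mult_simps monoid.l_one[OF assms(1)] monoid.r_one[OF assms(1)])+

lemma monoid_assoc_algebra:
  assumes M: "Group.monoid M"
  shows "assoc_algebra (monoid_algebra M :: ('f::field, _) module)"
  by (rule assoc_algebraI)
    (auto simp: monoid_algebra_simps monoid_algebra_distrib_left monoid_algebra_distrib_right
      monoid_algebra_mult_scale monoid_algebra_mult_assoc[OF M] monoid_algebra_mult_one[OF M]
      scale_simps keys_single monoid.one_closed[OF M] add_ac
      dest!: subsetD[OF Poly_Mapping.keys_add] subsetD[OF keys_scale_subset]
        subsetD[OF monoid_algebra_mult_keys[OF M], rotated 2])

lemma linear_extension_linear_maps:
  assumes "algebra_over C" "h \<in> carrier M \<rightarrow> carrier C"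
  shows "linear_extension C h \<in> linear_maps (monoid_algebra M) C"
proof -
  interpret algebra_over C by fact
  show ?thesis
    by (rule linear_mapsI)
      (simp_all add: monoid_algebra_simps linear_extension_closed[OF assms(2)]
        linear_extension_add[OF assms(2)] linear_extension_scale[OF assms])
qed

lemma linear_extension_mult:
  assumes M: "Group.monoid M" and C: "algebra_over C" and h: "h \<in> carrier M \<rightarrow> carrier C"
    and mult: "\<And>x y. x \<in> carrier M \<Longrightarrow> y \<in> carrier M \<Longrightarrow> h (x \<otimes>\<^bsub>M\<^esub> y) = h x \<otimes>\<^bsub>C\<^esub> h y"
    and "Poly_Mapping.keys p \<subseteq> carrier M" "Poly_Mapping.keys q \<subseteq> carrier M"
  shows "linear_extension C h (p \<otimes>\<^bsub>monoid_algebra M\<^esub> q) =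
    linear_extension C h p \<otimes>\<^bsub>C\<^esub> linear_extension C h q"
proof -
  interpret C: algebra_over C by (rule C)
  note simps = monoid_algebra_mult_simps C.linear_extension_single[OF h] C.linear_extension_zero[OF h]
    C.linear_extension_add[OF h] monoid_algebra_mult_keys[OF M] C.linear_extension_closed[OF h]
    C.l_distr C.r_distr
  from assms(5) show ?thesis
  proof (induction p rule: poly_mapping_induct_keys)
    case (single x c)
    note x = single
    have hx: "h x \<in> carrier C"
      using h x by auto
    from assms(6) show ?case
    proof (induction q rule: poly_mapping_induct_keys)
      case (single y d)
      have "h y \<in> carrier C"
        using h single by auto
      with x single hx show ?case
        by (simp add: simps monoid.m_closed[OF M] mult C.smult_smult mult.commute)
    qed (use x hx in \<open>simp_all add: simps keys_single\<close>)
  qed (use assms(6) in \<open>simp_all add: simps\<close>)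
qed

text \<open>Translation invariance of \<open>H\<close> is what turns the common kernel into a two-sided ideal.\<close>

lemma linear_extension_kernel_ideal:
  fixes C :: "('f::field, 'c) module"
  assumes M: "Group.monoid M" and C: "algebra_over C" and H: "H \<subseteq> carrier M \<rightarrow> carrier C"
    and left: "\<And>h x. h \<in> H \<Longrightarrow> x \<in> carrier M \<Longrightarrow> (\<lambda>y. h (x \<otimes>\<^bsub>M\<^esub> y)) \<in> H"
    and right: "\<And>h x. h \<in> H \<Longrightarrow> x \<in> carrier M \<Longrightarrow> (\<lambda>y. h (y \<otimes>\<^bsub>M\<^esub> x)) \<in> H"
  shows "ideal {p \<in> carrier (monoid_algebra M). \<forall>h\<in>H. linear_extension C h p = \<zero>\<^bsub>C\<^esub>}
    (monoid_algebra M)" (is "ideal ?J ?A")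
proof -
  interpret C: algebra_over C by (rule C)
  interpret A: algebra_over ?A
    by unfold_locales (rule monoid_assoc_algebra[OF M])
  interpret algebra_pair ?A C ..
  have lin: "linear_extension C h \<in> linear_maps ?A C" if "h \<in> H" for h
    using linear_extension_linear_maps[OF C] H that by blast
  have closed: "h x \<in> carrier C" if "h \<in> H" "x \<in> carrier M" for h x
    using H that by auto
  have mult_left: "linear_extension C h (Poly_Mapping.single x c \<otimes>\<^bsub>?A\<^esub> p) =
      c \<odot>\<^bsub>C\<^esub> linear_extension C (\<lambda>y. h (x \<otimes>\<^bsub>M\<^esub> y)) p"
    if h: "h \<in> H" and x: "x \<in> carrier M" and p: "Poly_Mapping.keys p \<subseteq> carrier M" for h x c p
  proof -
    have *: "h \<in> carrier M \<rightarrow> carrier C" "(\<lambda>y. h (x \<otimes>\<^bsub>M\<^esub> y)) \<in> carrier M \<rightarrow> carrier C"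
      using H h left[OF h x] by auto
    note simps = monoid_algebra_mult_simps C.linear_extension_single[OF *(1)]
      C.linear_extension_single[OF *(2)] C.linear_extension_zero[OF *(1)]
      C.linear_extension_zero[OF *(2)] C.linear_extension_add[OF *(1)]
      C.linear_extension_add[OF *(2)] monoid_algebra_mult_keys[OF M]
      C.linear_extension_closed[OF *(1)] C.linear_extension_closed[OF *(2)] C.smult_r_distr
    from p show ?thesis
      by (induction p rule: poly_mapping_induct_keys)
        (use x h closed in \<open>simp_all add: simps keys_single monoid.m_closed[OF M] C.smult_smult\<close>)
  qed
  have mult_right: "linear_extension C h (p \<otimes>\<^bsub>?A\<^esub> Poly_Mapping.single x c) =
      c \<odot>\<^bsub>C\<^esub> linear_extension C (\<lambda>y. h (y \<otimes>\<^bsub>M\<^esub> x)) p"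
    if h: "h \<in> H" and x: "x \<in> carrier M" and p: "Poly_Mapping.keys p \<subseteq> carrier M" for h x c p
  proof -
    have *: "h \<in> carrier M \<rightarrow> carrier C" "(\<lambda>y. h (y \<otimes>\<^bsub>M\<^esub> x)) \<in> carrier M \<rightarrow> carrier C"
      using H h right[OF h x] by auto
    note simps = monoid_algebra_mult_simps C.linear_extension_single[OF *(1)]
      C.linear_extension_single[OF *(2)] C.linear_extension_zero[OF *(1)]
      C.linear_extension_zero[OF *(2)] C.linear_extension_add[OF *(1)]
      C.linear_extension_add[OF *(2)] monoid_algebra_mult_keys[OF M]
      C.linear_extension_closed[OF *(1)] C.linear_extension_closed[OF *(2)] C.smult_r_distr
    from p show ?thesis
      by (induction p rule: poly_mapping_induct_keys)
        (use x h closed in \<open>simp_all add: simps keys_single monoid.m_closed[OF M] C.smult_smult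
          mult.commute\<close>)
  qed
  have J: "p \<in> ?J \<longleftrightarrow> p \<in> carrier ?A \<and> (\<forall>h\<in>H. linear_extension C h p = \<zero>\<^bsub>C\<^esub>)" for p
    by simp
  have carrier: "p \<in> carrier ?A \<longleftrightarrow> Poly_Mapping.keys p \<subseteq> carrier M" for p
    by (simp add: monoid_algebra_simps)
  show ?thesis
  proof (rule idealI)
    show "ring ?A"
      by (rule A.ring_axioms)
    have "additive_subgroup ?J ?A"
    proof (rule additive_subgroup.intro, rule A.add.subgroupI)
      show "?J \<noteq> {}"
        using linear_maps_zero[OF lin] by (auto intro!: exI[of _ "\<zero>\<^bsub>?A\<^esub>"])
    qed (auto simp: linear_maps_a_inv[OF lin] linear_maps_add[OF lin])
    then show "subgroup ?J (add_monoid ?A)"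
      by (simp add: additive_subgroup_def)
  next
    fix p q assume p: "p \<in> ?J" and q: "q \<in> carrier ?A"
    then have "linear_extension C h (q \<otimes>\<^bsub>?A\<^esub> p) = \<zero>\<^bsub>C\<^esub>" if "h \<in> H" for h
    proof -
      from q have "Poly_Mapping.keys q \<subseteq> carrier M"
        by (simp add: carrier)
      then show ?thesis
      proof (induction q rule: poly_mapping_induct_keys)
        case zero
        then show ?case
          using linear_maps_zero[OF lin[OF that]]
          by (simp add: monoid_algebra_mult_simps monoid_algebra_simps)
      next
        case (single x c)
        then show ?case
          using mult_left[OF that] p left[OF that] by (simp add: carrier)
      next
        case (add q r)
        then have "q \<otimes>\<^bsub>?A\<^esub> p \<in> carrier ?A" "r \<otimes>\<^bsub>?A\<^esub> p \<in> carrier ?A"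
          using p by (simp_all add: carrier[symmetric])
        with add show ?case
          using linear_maps_add[OF lin[OF that]]
          by (simp add: monoid_algebra_mult_simps monoid_algebra_simps)
      qed
    qed
    then show "q \<otimes>\<^bsub>?A\<^esub> p \<in> ?J"
      using p q by simp
  next
    fix p q assume p: "p \<in> ?J" and q: "q \<in> carrier ?A"
    then have "linear_extension C h (p \<otimes>\<^bsub>?A\<^esub> q) = \<zero>\<^bsub>C\<^esub>" if "h \<in> H" for h
    proof -
      from q have "Poly_Mapping.keys q \<subseteq> carrier M"
        by (simp add: carrier)
      then show ?thesis
      proof (induction q rule: poly_mapping_induct_keys)
        case zero
        then show ?case
          using linear_maps_zero[OF lin[OF that]]
          by (simp add: monoid_algebra_mult_simps monoid_algebra_simps)
      next
        case (single x c)
        then show ?case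
          using mult_right[OF that] p right[OF that] by (simp add: carrier)
      next
        case (add q r)
        then have "p \<otimes>\<^bsub>?A\<^esub> q \<in> carrier ?A" "p \<otimes>\<^bsub>?A\<^esub> r \<in> carrier ?A"
          using p by (simp_all add: carrier[symmetric])
        with add show ?case
          using linear_maps_add[OF lin[OF that]]
          by (simp add: monoid_algebra_mult_simps monoid_algebra_simps)
      qed
    qed
    then show "p \<otimes>\<^bsub>?A\<^esub> q \<in> ?J"
      using p q by simp
  qed
qed

section \<open>Tensor products\<close>

definition bilinear_maps ::
    "('k, 'a) module \<Rightarrow> ('k, 'b) module \<Rightarrow> ('k, 'c) module \<Rightarrow> ('a \<Rightarrow> 'b \<Rightarrow> 'c) set" where
  "bilinear_maps A B C = {h. (\<forall>a\<in>carrier A. h a \<in> linear_maps B C) \<and>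
    (\<forall>b\<in>carrier B. (\<lambda>a. h a b) \<in> linear_maps A C)}"

lemma bilinear_mapsI:
  assumes "\<And>a. a \<in> carrier A \<Longrightarrow> h a \<in> linear_maps B C"
    and "\<And>b. b \<in> carrier B \<Longrightarrow> (\<lambda>a. h a b) \<in> linear_maps A C"
  shows "h \<in> bilinear_maps A B C"
  using assms by (auto simp: bilinear_maps_def)

lemma bilinear_maps_right:
  "h \<in> bilinear_maps A B C \<Longrightarrow> a \<in> carrier A \<Longrightarrow> h a \<in> linear_maps B C"
  by (auto simp: bilinear_maps_def)

lemma bilinear_maps_left:
  "h \<in> bilinear_maps A B C \<Longrightarrow> b \<in> carrier B \<Longrightarrow> (\<lambda>a. h a b) \<in> linear_maps A C"
  by (auto simp: bilinear_maps_def)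

lemma bilinear_maps_closed:
  "h \<in> bilinear_maps A B C \<Longrightarrow> a \<in> carrier A \<Longrightarrow> b \<in> carrier B \<Longrightarrow> h a b \<in> carrier C"
  by (rule linear_maps_closed[OF bilinear_maps_right])

lemma algebra_homsI:
  assumes "h \<in> linear_maps A B"
    and "\<And>x y. x \<in> carrier A \<Longrightarrow> y \<in> carrier A \<Longrightarrow> h (x \<otimes>\<^bsub>A\<^esub> y) = h x \<otimes>\<^bsub>B\<^esub> h y"
    and "h \<one>\<^bsub>A\<^esub> = \<one>\<^bsub>B\<^esub>"
  shows "h \<in> algebra_homs A B"
  using assms
  by (simp add: algebra_homs_def ring_hom_memI linear_maps_closed linear_maps_add)

lemma algebra_homs_linear: "h \<in> algebra_homs A B \<Longrightarrow> h \<in> linear_maps A B"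
  by (simp add: algebra_homs_def)

lemma algebra_homs_mult:
  "h \<in> algebra_homs A B \<Longrightarrow> x \<in> carrier A \<Longrightarrow> y \<in> carrier A \<Longrightarrow>
    h (x \<otimes>\<^bsub>A\<^esub> y) = h x \<otimes>\<^bsub>B\<^esub> h y"
  by (simp add: algebra_homs_def ring_hom_mult)

lemma algebra_homs_one: "h \<in> algebra_homs A B \<Longrightarrow> h \<one>\<^bsub>A\<^esub> = \<one>\<^bsub>B\<^esub>"
  by (simp add: algebra_homs_def ring_hom_one)

lemma algebra_homs_comp:
  "g \<in> algebra_homs B C \<Longrightarrow> h \<in> algebra_homs A B \<Longrightarrow> (\<lambda>x. g (h x)) \<in> algebra_homs A C"
  by (rule algebra_homsI)
    (simp_all add: algebra_homs_mult algebra_homs_one linear_maps_closed[OF algebra_homs_linear]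
      linear_maps_comp[OF algebra_homs_linear algebra_homs_linear])

locale tensor_pair = A: algebra_over A + B: algebra_over B
  for A :: "('f::field, 'a) module" and B :: "('f, 'b) module"
begin

abbreviation AB where "AB \<equiv> tensor_algebra A B"
abbreviation F where "F \<equiv> monoid_algebra (A \<times>\<times> B) :: ('f, 'a \<times> 'b \<Rightarrow>\<^sub>0 'f) module"
abbreviation tens (infixr "\<boxtimes>" 72) where "a \<boxtimes> b \<equiv> pure_tensor A B a b"

lemma monoid_prod: "Group.monoid (A \<times>\<times> B)"
  by (rule DirProd_monoid) (rule A.monoid_axioms B.monoid_axioms)+

sublocale F: algebra_over F
  by unfold_locales (rule monoid_assoc_algebra[OF monoid_prod])

lemma single_carrier:
  "a \<in> carrier A \<Longrightarrow> b \<in> carrier B \<Longrightarrow> Poly_Mapping.single (a, b) c \<in> carrier F"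
  by (simp add: monoid_algebra_simps keys_single)

lemma F_minus: "p \<in> carrier F \<Longrightarrow> q \<in> carrier F \<Longrightarrow> p \<ominus>\<^bsub>F\<^esub> q = p - q"
proof -
  have "p - q = p + Poly_Mapping.map ((*) (- 1)) q" for p q :: "'a \<times> 'b \<Rightarrow>\<^sub>0 'f"
    by (rule poly_mapping_eqI) (simp add: lookup_scale lookup_add lookup_minus)
  then show "p \<in> carrier F \<Longrightarrow> q \<in> carrier F \<Longrightarrow> p \<ominus>\<^bsub>F\<^esub> q = p - q"
    by (simp add: a_minus_def F.a_inv_eq_smult) (simp add: monoid_algebra_simps)
qed

lemma F_diff_closed: "p \<in> carrier F \<Longrightarrow> q \<in> carrier F \<Longrightarrow> p - q \<in> carrier F"
  using F.minus_closed F_minus by metis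

lemma relations_carrier: "bilinear_relations A B \<subseteq> carrier F"
  unfolding bilinear_relations_def by (auto intro!: F_diff_closed single_carrier)

sublocale I: algebra_ideal "tensor_ideal A B" F
  unfolding tensor_ideal_def
  by (intro algebra_ideal.intro F.algebra_over_axioms F.genideal_ideal relations_carrier)

lemma tensor_algebra_eq: "AB = I.Q"
  by (simp add: tensor_algebra_def)

lemma tensor_assoc_algebra: "assoc_algebra AB"
  unfolding tensor_algebra_eq by (rule I.quotient_assoc_algebra)

sublocale AB: algebra_over AB
  by unfold_locales (rule tensor_assoc_algebra)

lemma relation_in_ideal: "p \<in> bilinear_relations A B \<Longrightarrow> p \<in> tensor_ideal A B"
  unfolding tensor_ideal_def using F.genideal_self[OF relations_carrier] by blast

lemma pure_closed [simp, intro]: "a \<in> carrier A \<Longrightarrow> b \<in> carrier B \<Longrightarrow> a \<boxtimes> b \<in> carrier AB"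
  unfolding tensor_algebra_eq pure_tensor_def by (intro I.coset_closed single_carrier)

lemma pure_mult:
  assumes "a \<in> carrier A" "b \<in> carrier B" "a' \<in> carrier A" "b' \<in> carrier B"
  shows "(a \<boxtimes> b) \<otimes>\<^bsub>AB\<^esub> (a' \<boxtimes> b') = (a \<otimes>\<^bsub>A\<^esub> a') \<boxtimes> (b \<otimes>\<^bsub>B\<^esub> b')"
  using assms unfolding tensor_algebra_eq pure_tensor_def
  by (simp add: I.coset_mult single_carrier monoid_algebra_mult_single)

lemma pure_one: "\<one>\<^bsub>AB\<^esub> = \<one>\<^bsub>A\<^esub> \<boxtimes> \<one>\<^bsub>B\<^esub>"
  unfolding tensor_algebra_eq pure_tensor_def by (simp add: I.coset_one monoid_algebra_simps)

text \<open>The shape \<open>p - q - r\<close> is that of the two additivity families in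
  \<open>bilinear_relations\<close>; \<open>coset_smultI\<close> has the shape of the two scaling
  families.\<close>

lemma coset_eqI:
  assumes "p \<in> carrier F" "q \<in> carrier F" "r \<in> carrier F" "p - q - r \<in> bilinear_relations A B"
  shows "tensor_ideal A B +>\<^bsub>F\<^esub> p =
    (tensor_ideal A B +>\<^bsub>F\<^esub> q) \<oplus>\<^bsub>AB\<^esub> (tensor_ideal A B +>\<^bsub>F\<^esub> r)"
proof -
  have qr: "q \<oplus>\<^bsub>F\<^esub> r = q + r"
    by (simp add: monoid_algebra_simps)
  then have "q + r \<in> carrier F"
    using F.a_closed[OF assms(2,3)] by simp
  moreover have "p \<ominus>\<^bsub>F\<^esub> (q + r) \<in> tensor_ideal A B"
    using relation_in_ideal[OF assms(4)] calculation assms(1) by (simp add: F_minus diff_diff_eq)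
  ultimately show ?thesis
    unfolding tensor_algebra_eq
    using assms I.coset_eq_iff[of p "q + r"] I.coset_add[of q r] qr by simp
qed

lemma coset_smultI:
  assumes "p \<in> carrier F" "a \<in> carrier A" "b \<in> carrier B"
    "p - Poly_Mapping.single (a, b) c \<in> bilinear_relations A B"
  shows "tensor_ideal A B +>\<^bsub>F\<^esub> p = c \<odot>\<^bsub>AB\<^esub> (a \<boxtimes> b)"
proof -
  have "p \<ominus>\<^bsub>F\<^esub> Poly_Mapping.single (a, b) c \<in> tensor_ideal A B"
    using relation_in_ideal[OF assms(4)] assms single_carrier by (simp add: F_minus)
  moreover have "c \<odot>\<^bsub>F\<^esub> Poly_Mapping.single (a, b) 1 = Poly_Mapping.single (a, b) c"
    by (simp add: monoid_algebra_simps scale_simps)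
  ultimately show ?thesis
    using assms I.coset_eq_iff[of p "Poly_Mapping.single (a, b) c"]
      I.coset_smult[of "Poly_Mapping.single (a, b) 1" c] single_carrier
    unfolding tensor_algebra_eq pure_tensor_def by simp
qed

lemma pure_bilinear: "pure_tensor A B \<in> bilinear_maps A B AB"
proof (rule bilinear_mapsI)
  fix a assume a: "a \<in> carrier A"
  show "pure_tensor A B a \<in> linear_maps B AB"
  proof (rule linear_mapsI)
    fix b b' assume b: "b \<in> carrier B" "b' \<in> carrier B"
    show "a \<boxtimes> (b \<oplus>\<^bsub>B\<^esub> b') = (a \<boxtimes> b) \<oplus>\<^bsub>AB\<^esub> (a \<boxtimes> b')"
      unfolding pure_tensor_def
      by (rule coset_eqI) (use a b in \<open>auto simp: bilinear_relations_def intro!: single_carrier\<close>)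
  next
    fix c b assume b: "b \<in> carrier B"
    show "a \<boxtimes> (c \<odot>\<^bsub>B\<^esub> b) = c \<odot>\<^bsub>AB\<^esub> (a \<boxtimes> b)"
      unfolding pure_tensor_def[of _ _ a "c \<odot>\<^bsub>B\<^esub> b"]
      by (rule coset_smultI) (use a b in \<open>auto simp: bilinear_relations_def intro!: single_carrier\<close>)
  qed (use a in simp)
next
  fix b assume b: "b \<in> carrier B"
  show "(\<lambda>a. a \<boxtimes> b) \<in> linear_maps A AB"
  proof (rule linear_mapsI)
    fix a a' assume a: "a \<in> carrier A" "a' \<in> carrier A"
    show "(a \<oplus>\<^bsub>A\<^esub> a') \<boxtimes> b = (a \<boxtimes> b) \<oplus>\<^bsub>AB\<^esub> (a' \<boxtimes> b)"
      unfolding pure_tensor_def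
      by (rule coset_eqI) (use a b in \<open>auto simp: bilinear_relations_def intro!: single_carrier\<close>)
  next
    fix c a assume a: "a \<in> carrier A"
    show "(c \<odot>\<^bsub>A\<^esub> a) \<boxtimes> b = c \<odot>\<^bsub>AB\<^esub> (a \<boxtimes> b)"
      unfolding pure_tensor_def[of _ _ "c \<odot>\<^bsub>A\<^esub> a" b]
      by (rule coset_smultI) (use a b in \<open>auto simp: bilinear_relations_def intro!: single_carrier\<close>)
  qed (use b in simp)
qed

lemma tensor_induct [consumes 1, case_names pure add smult]:
  assumes "X \<in> carrier AB"
    and pure: "\<And>a b. a \<in> carrier A \<Longrightarrow> b \<in> carrier B \<Longrightarrow> P (a \<boxtimes> b)"
    and add: "\<And>X Y. X \<in> carrier AB \<Longrightarrow> Y \<in> carrier AB \<Longrightarrow> P X \<Longrightarrow> P Y \<Longrightarrow> P (X \<oplus>\<^bsub>AB\<^esub> Y)"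
    and smult: "\<And>c X. X \<in> carrier AB \<Longrightarrow> P X \<Longrightarrow> P (c \<odot>\<^bsub>AB\<^esub> X)"
  shows "P X"
proof -
  obtain p where p: "p \<in> carrier F" and X: "X = tensor_ideal A B +>\<^bsub>F\<^esub> p"
    using assms(1) I.coset_cases unfolding tensor_algebra_eq by metis
  have scaled: "tensor_ideal A B +>\<^bsub>F\<^esub> Poly_Mapping.single (a, b) c = c \<odot>\<^bsub>AB\<^esub> (a \<boxtimes> b)"
    if "a \<in> carrier A" "b \<in> carrier B" for a b c
    unfolding tensor_algebra_eq pure_tensor_def
    using that I.coset_smult[of "Poly_Mapping.single (a, b) 1" c] single_carrier
    by (simp add: monoid_algebra_simps scale_simps)
  have "Poly_Mapping.keys p \<subseteq> carrier A \<times> carrier B"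
    using p by (simp add: monoid_algebra_simps)
  then have "P (tensor_ideal A B +>\<^bsub>F\<^esub> p)"
  proof (induction p rule: poly_mapping_induct_keys)
    case zero
    have "tensor_ideal A B +>\<^bsub>F\<^esub> 0 = 0 \<odot>\<^bsub>AB\<^esub> (\<one>\<^bsub>A\<^esub> \<boxtimes> \<one>\<^bsub>B\<^esub>)"
      using I.coset_zero unfolding tensor_algebra_eq[symmetric] by (simp add: monoid_algebra_simps)
    then show ?case
      using smult[OF pure_closed pure, of "\<one>\<^bsub>A\<^esub>" "\<one>\<^bsub>B\<^esub>" 0] by simp
  next
    case (single x c)
    then show ?case
      using scaled smult[OF pure_closed pure] by auto
  next
    case (add p q)
    have pq: "p \<in> carrier F" "q \<in> carrier F"
      using add.hyps by (simp_all add: monoid_algebra_simps)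
    then have "P ((tensor_ideal A B +>\<^bsub>F\<^esub> p) \<oplus>\<^bsub>AB\<^esub> (tensor_ideal A B +>\<^bsub>F\<^esub> q))"
      using add.IH I.coset_closed unfolding tensor_algebra_eq[symmetric] by (intro assms(3))
    then show ?case
      using I.coset_add[OF pq] unfolding tensor_algebra_eq[symmetric] by (simp add: monoid_algebra_simps)
  qed
  then show ?thesis
    by (simp add: X)
qed

lemma linear_maps_eq_on_tensors:
  assumes "algebra_over C" "f \<in> linear_maps AB C" "g \<in> linear_maps AB C"
    and "\<And>a b. a \<in> carrier A \<Longrightarrow> b \<in> carrier B \<Longrightarrow> f (a \<boxtimes> b) = g (a \<boxtimes> b)"
    and "X \<in> carrier AB"
  shows "f X = g X"
  using assms(5)
  by (induction X rule: tensor_induct)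
    (simp_all add: assms(4) linear_maps_add[OF assms(2)] linear_maps_add[OF assms(3)]
      linear_maps_smult[OF assms(2)] linear_maps_smult[OF assms(3)])

section \<open>The universal property of the tensor product\<close>

context
  fixes C :: "('f, 'c) module" and h
  assumes C: "algebra_over C" and h: "h \<in> bilinear_maps A B C"
begin

interpretation C: algebra_over C by (rule C)

lemma case_prod_closed:
  "h' \<in> bilinear_maps A B C \<Longrightarrow> case_prod h' \<in> carrier (A \<times>\<times> B) \<rightarrow> carrier C"
  by (auto intro: bilinear_maps_closed)

text \<open>The kernel belonging to a single bilinear map need not be an ideal. The common kernel of
  all bilinear maps into \<open>C\<close> is one, because composing a bilinear map with
  multiplications by fixed elements in both arguments is again bilinear. It contains the relations,
  hence the ideal they generate.\<close>

lemma linear_extension_tensor_ideal: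
  assumes "p \<in> tensor_ideal A B"
  shows "linear_extension C (case_prod h) p = \<zero>\<^bsub>C\<^esub>"
proof -
  let ?H = "case_prod ` bilinear_maps A B C"
  let ?J = "{p \<in> carrier F. \<forall>h\<in>?H. linear_extension C h p = \<zero>\<^bsub>C\<^esub>}"
  have "ideal ?J F"
  proof (rule linear_extension_kernel_ideal[OF monoid_prod C])
    show "?H \<subseteq> carrier (A \<times>\<times> B) \<rightarrow> carrier C"
      by (auto dest: bilinear_maps_closed)
  next
    fix g x assume "g \<in> ?H" "x \<in> carrier (A \<times>\<times> B)"
    then obtain g' a b where g: "g = case_prod g'" "g' \<in> bilinear_maps A B C"
        and x: "x = (a, b)" "a \<in> carrier A" "b \<in> carrier B"
      by auto
    have "(\<lambda>a'. \<lambda>b'. g' (a \<otimes>\<^bsub>A\<^esub> a') (b \<otimes>\<^bsub>B\<^esub> b')) \<in> bilinear_maps A B C"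
      using x bilinear_maps_right[OF g(2)] bilinear_maps_left[OF g(2)]
      by (intro bilinear_mapsI linear_mapsI)
        (simp_all add: bilinear_maps_closed[OF g(2)] linear_maps_add linear_maps_smult A.r_distr B.r_distr
          linear_maps_add[of "\<lambda>a. g' a _"] linear_maps_smult[of "\<lambda>a. g' a _"])
    then show "(\<lambda>y. g (x \<otimes>\<^bsub>A \<times>\<times> B\<^esub> y)) \<in> ?H"
      by (rule rev_image_eqI) (auto simp: g x fun_eq_iff)
    have "(\<lambda>a'. \<lambda>b'. g' (a' \<otimes>\<^bsub>A\<^esub> a) (b' \<otimes>\<^bsub>B\<^esub> b)) \<in> bilinear_maps A B C"
      using x bilinear_maps_right[OF g(2)] bilinear_maps_left[OF g(2)]
      by (intro bilinear_mapsI linear_mapsI)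
        (simp_all add: bilinear_maps_closed[OF g(2)] linear_maps_add linear_maps_smult A.l_distr B.l_distr
          linear_maps_add[of "\<lambda>a. g' a _"] linear_maps_smult[of "\<lambda>a. g' a _"])
    then show "(\<lambda>y. g (y \<otimes>\<^bsub>A \<times>\<times> B\<^esub> x)) \<in> ?H"
      by (rule rev_image_eqI) (auto simp: g x fun_eq_iff)
  qed
  moreover have "bilinear_relations A B \<subseteq> ?J"
  proof
    fix p assume p: "p \<in> bilinear_relations A B"
    have "linear_extension C (case_prod h') p = \<zero>\<^bsub>C\<^esub>" if h': "h' \<in> bilinear_maps A B C" for h'
    proof -
      let ?l = "linear_extension C (case_prod h')"
      interpret algebra_pair F C ..
      have lin: "?l \<in> linear_maps F C"
        by (rule linear_extension_linear_maps[OF C case_prod_closed[OF h']])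
      have diff: "?l (q - r) = ?l q \<ominus>\<^bsub>C\<^esub> ?l r" if "q \<in> carrier F" "r \<in> carrier F" for q r
        using linear_maps_diff[OF lin that] F_minus[OF that] by simp
      have single: "?l (Poly_Mapping.single (a, b) c) = c \<odot>\<^bsub>C\<^esub> h' a b"
        if "a \<in> carrier A" "b \<in> carrier B" for a b c
        using C.linear_extension_single[OF case_prod_closed[OF h'], of "(a, b)" c] that by simp
      note closed = bilinear_maps_closed[OF h']
      have cancel: "x \<oplus>\<^bsub>C\<^esub> y \<ominus>\<^bsub>C\<^esub> x \<ominus>\<^bsub>C\<^esub> y = \<zero>\<^bsub>C\<^esub>"
        if "x \<in> carrier C" "y \<in> carrier C" for x y
      proof -
        have "x \<oplus>\<^bsub>C\<^esub> y \<ominus>\<^bsub>C\<^esub> x \<ominus>\<^bsub>C\<^esub> y = (x \<oplus>\<^bsub>C\<^esub> y) \<ominus>\<^bsub>C\<^esub> (x \<oplus>\<^bsub>C\<^esub> y)"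
          using that by (simp add: C.minus_eq C.minus_add C.a_assoc)
        then show ?thesis
          using that by (simp add: C.minus_eq C.r_neg)
      qed
      show ?thesis
        using p unfolding bilinear_relations_def
        using linear_maps_add[OF bilinear_maps_right[OF h']] linear_maps_add[OF bilinear_maps_left[OF h']]
          linear_maps_smult[OF bilinear_maps_right[OF h']] linear_maps_smult[OF bilinear_maps_left[OF h']]
        by (auto simp: diff single single_carrier F_diff_closed closed cancel C.minus_eq_zero_iff)
    qed
    then show "p \<in> ?J"
      using p relations_carrier by auto
  qed
  ultimately have "tensor_ideal A B \<subseteq> ?J"
    unfolding tensor_ideal_def by (rule F.genideal_minimal)
  with assms h show ?thesis
    by auto
qed

lemma tensor_lift_coset:
  assumes p: "p \<in> carrier F"
  shows "tensor_lift C h (tensor_ideal A B +>\<^bsub>F\<^esub> p) = linear_extension C (case_prod h) p"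
proof -
  have "tensor_lift C h X = linear_extension C (case_prod h) (SOME p. p \<in> X)" for X
    unfolding tensor_lift_def linear_extension_def Let_def
    by (rule arg_cong[where f = "\<lambda>f. finsum C f _"]) (simp add: fun_eq_iff)
  then show ?thesis
    using I.quotient_lift[OF C linear_extension_linear_maps[OF C case_prod_closed[OF h]]
        linear_extension_tensor_ideal p] by simp
qed

lemma tensor_lift_linear: "tensor_lift C h \<in> linear_maps AB C"
proof -
  have lin: "linear_extension C (case_prod h) \<in> linear_maps F C"
    by (rule linear_extension_linear_maps[OF C case_prod_closed[OF h]])
  show ?thesis
    unfolding tensor_algebra_eq
    by (rule linear_mapsI; (elim I.coset_cases)?)
      (simp_all add: tensor_lift_coset I.coset_ops linear_maps_closed[OF lin]
        linear_maps_add[OF lin] linear_maps_smult[OF lin])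
qed

lemma tensor_lift_pure:
  assumes "a \<in> carrier A" "b \<in> carrier B"
  shows "tensor_lift C h (a \<boxtimes> b) = h a b"
proof -
  have "h a b \<in> carrier C"
    by (rule bilinear_maps_closed[OF h assms])
  then show ?thesis
    unfolding pure_tensor_def
    using tensor_lift_coset[OF single_carrier[OF assms]] assms
      C.linear_extension_single[OF case_prod_closed[OF h], of "(a, b)" 1] by simp
qed

lemma tensor_lift_hom:
  assumes mult: "\<And>a a' b b'. a \<in> carrier A \<Longrightarrow> a' \<in> carrier A \<Longrightarrow> b \<in> carrier B \<Longrightarrow> b' \<in> carrier B \<Longrightarrow>
      h (a \<otimes>\<^bsub>A\<^esub> a') (b \<otimes>\<^bsub>B\<^esub> b') = h a b \<otimes>\<^bsub>C\<^esub> h a' b'"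
    and one: "h \<one>\<^bsub>A\<^esub> \<one>\<^bsub>B\<^esub> = \<one>\<^bsub>C\<^esub>"
  shows "tensor_lift C h \<in> algebra_homs AB C"
proof (rule algebra_homsI[OF tensor_lift_linear])
  interpret AC: algebra_pair AB C ..
  interpret AA: algebra_pair AB AB ..
  note lin = tensor_lift_linear
  have id: "(\<lambda>X. X) \<in> linear_maps AB AB"
    by (rule linear_mapsI) simp_all
  fix X Y assume X: "X \<in> carrier AB" and Y: "Y \<in> carrier AB"
  show "tensor_lift C h (X \<otimes>\<^bsub>AB\<^esub> Y) = tensor_lift C h X \<otimes>\<^bsub>C\<^esub> tensor_lift C h Y"
  proof (rule linear_maps_eq_on_tensors[OF C _ _ _ X])
    show "(\<lambda>X. tensor_lift C h (X \<otimes>\<^bsub>AB\<^esub> Y)) \<in> linear_maps AB C"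
      by (rule linear_maps_comp[OF lin AA.linear_maps_mult_right[OF id Y]])
    show "(\<lambda>X. tensor_lift C h X \<otimes>\<^bsub>C\<^esub> tensor_lift C h Y) \<in> linear_maps AB C"
      by (rule AC.linear_maps_mult_right[OF lin linear_maps_closed[OF lin Y]])
    fix a b assume ab: "a \<in> carrier A" "b \<in> carrier B"
    show "tensor_lift C h ((a \<boxtimes> b) \<otimes>\<^bsub>AB\<^esub> Y) = tensor_lift C h (a \<boxtimes> b) \<otimes>\<^bsub>C\<^esub> tensor_lift C h Y"
    proof (rule linear_maps_eq_on_tensors[OF C _ _ _ Y])
      show "(\<lambda>Y. tensor_lift C h ((a \<boxtimes> b) \<otimes>\<^bsub>AB\<^esub> Y)) \<in> linear_maps AB C"
        by (rule linear_maps_comp[OF lin AA.linear_maps_mult_left[OF id pure_closed[OF ab]]])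
      show "(\<lambda>Y. tensor_lift C h (a \<boxtimes> b) \<otimes>\<^bsub>C\<^esub> tensor_lift C h Y) \<in> linear_maps AB C"
        by (rule AC.linear_maps_mult_left[OF lin linear_maps_closed[OF lin pure_closed[OF ab]]])
    qed (simp add: ab pure_mult tensor_lift_pure mult)
  qed
qed (simp add: pure_one tensor_lift_pure one)

end
end

section \<open>Universal enveloping algebras\<close>

text \<open>Closure under the three operations keeps \<open>uea_relations\<close> inside the free
  algebra on the carrier, where the ideal is generated.\<close>

locale lie_carrier =
  fixes L :: "('f::field, 'x) lie_algebra" (structure)
  assumes add_carrier: "x \<in> carrier L \<Longrightarrow> y \<in> carrier L \<Longrightarrow> x \<oplus> y \<in> carrier L"
    and smult_carrier: "x \<in> carrier L \<Longrightarrow> c \<odot> x \<in> carrier L"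
    and bracket_carrier: "x \<in> carrier L \<Longrightarrow> y \<in> carrier L \<Longrightarrow> lie_bracket L x y \<in> carrier L"
begin

abbreviation U where "U \<equiv> uea L"
abbreviation F where "F \<equiv> free_algebra (carrier L) :: ('f, 'x list \<Rightarrow>\<^sub>0 'f) module"
abbreviation W where "W \<equiv> \<lparr>carrier = lists (carrier L), mult = (@), one = []\<rparr>"
abbreviation \<iota> where "\<iota> \<equiv> uea_incl L"

lemma monoid_words: "Group.monoid W"
  by (rule monoidI) auto

lemma F_eq: "F = monoid_algebra W"
  by (simp add: free_algebra_def)

sublocale F: algebra_over F
  unfolding F_eq by unfold_locales (rule monoid_assoc_algebra[OF monoid_words])

lemma F_carrier: "p \<in> carrier F \<longleftrightarrow> Poly_Mapping.keys p \<subseteq> lists (carrier L)"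
  by (simp add: F_eq monoid_algebra_simps)

lemma F_ops:
  "p \<oplus>\<^bsub>F\<^esub> q = p + q" "c \<odot>\<^bsub>F\<^esub> p = Poly_Mapping.map ((*) c) p" "\<zero>\<^bsub>F\<^esub> = 0"
  "\<one>\<^bsub>F\<^esub> = Poly_Mapping.single [] 1"
  "Poly_Mapping.single v c \<otimes>\<^bsub>F\<^esub> Poly_Mapping.single w d = Poly_Mapping.single (v @ w) (c * d)"
  by (simp_all add: F_eq monoid_algebra_simps monoid_algebra_mult_single)

lemma single_carrier: "w \<in> lists (carrier L) \<Longrightarrow> Poly_Mapping.single w c \<in> carrier F"
  by (simp add: F_carrier keys_single)

lemma F_minus: "p \<in> carrier F \<Longrightarrow> q \<in> carrier F \<Longrightarrow> p \<ominus>\<^bsub>F\<^esub> q = p - q"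
proof -
  have "p - q = p + Poly_Mapping.map ((*) (- 1)) q" for p q :: "'x list \<Rightarrow>\<^sub>0 'f"
    by (rule poly_mapping_eqI) (simp add: lookup_scale lookup_add lookup_minus)
  then show "p \<in> carrier F \<Longrightarrow> q \<in> carrier F \<Longrightarrow> p \<ominus>\<^bsub>F\<^esub> q = p - q"
    by (simp add: a_minus_def F.a_inv_eq_smult) (simp add: F_ops)
qed

lemma F_diff_closed: "p \<in> carrier F \<Longrightarrow> q \<in> carrier F \<Longrightarrow> p - q \<in> carrier F"
  using F.minus_closed F_minus by metis

lemma relations_carrier: "uea_relations L \<subseteq> carrier F"
  unfolding uea_relations_def
  by (auto intro!: F_diff_closed single_carrier add_carrier smult_carrier bracket_carrier)

sublocale I: algebra_ideal "uea_ideal L" F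
  unfolding uea_ideal_def
  by (intro algebra_ideal.intro F.algebra_over_axioms F.genideal_ideal relations_carrier)

lemma uea_eq: "U = I.Q"
  by (simp add: uea_def)

lemma uea_assoc_algebra: "assoc_algebra U"
  unfolding uea_eq by (rule I.quotient_assoc_algebra)

sublocale U: algebra_over U
  by unfold_locales (rule uea_assoc_algebra)

lemma relation_in_ideal: "p \<in> uea_relations L \<Longrightarrow> p \<in> uea_ideal L"
  unfolding uea_ideal_def using F.genideal_self[OF relations_carrier] by blast

lemma incl_closed [simp, intro]: "x \<in> carrier L \<Longrightarrow> \<iota> x \<in> carrier U"
  unfolding uea_eq uea_incl_def by (intro I.coset_closed single_carrier) simp

lemma incl_add:
  assumes "x \<in> carrier L" "y \<in> carrier L"
  shows "\<iota> (x \<oplus> y) = \<iota> x \<oplus>\<^bsub>U\<^esub> \<iota> y"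
proof -
  let ?p = "Poly_Mapping.single [x] 1 + Poly_Mapping.single [y] (1 :: 'f)"
  have s: "Poly_Mapping.single [x] 1 \<in> carrier F" "Poly_Mapping.single [y] 1 \<in> carrier F"
      "Poly_Mapping.single [x \<oplus> y] 1 \<in> carrier F"
    using assms by (auto intro!: single_carrier add_carrier)
  have p: "?p \<in> carrier F"
    using F.a_closed[OF s(1,2)] by (simp add: F_ops)
  have "Poly_Mapping.single [x \<oplus> y] 1 - ?p \<in> uea_relations L"
    unfolding uea_relations_def diff_diff_eq[symmetric] using assms by blast
  then have "Poly_Mapping.single [x \<oplus> y] 1 \<ominus>\<^bsub>F\<^esub> ?p \<in> uea_ideal L"
    using relation_in_ideal s p by (simp add: F_minus)
  then show ?thesis
    unfolding uea_eq uea_incl_def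
    using I.coset_add[OF s(1,2)] I.coset_eq_iff[OF s(3) p] by (simp add: F_ops)
qed

lemma incl_smult:
  assumes "x \<in> carrier L"
  shows "\<iota> (c \<odot> x) = c \<odot>\<^bsub>U\<^esub> \<iota> x"
proof -
  have s: "Poly_Mapping.single [x] 1 \<in> carrier F" "Poly_Mapping.single [x] c \<in> carrier F"
      "Poly_Mapping.single [c \<odot> x] 1 \<in> carrier F"
    using assms by (auto intro!: single_carrier smult_carrier)
  have "Poly_Mapping.single [c \<odot> x] 1 - Poly_Mapping.single [x] c \<in> uea_relations L"
    unfolding uea_relations_def using assms by blast
  then have "Poly_Mapping.single [c \<odot> x] 1 \<ominus>\<^bsub>F\<^esub> Poly_Mapping.single [x] c \<in> uea_ideal L"
    using relation_in_ideal s by (simp add: F_minus)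
  then show ?thesis
    unfolding uea_eq uea_incl_def
    using I.coset_smult[OF s(1)] I.coset_eq_iff[OF s(3,2)] by (simp add: F_ops scale_simps)
qed

lemma incl_bracket:
  assumes "x \<in> carrier L" "y \<in> carrier L"
  shows "\<iota> x \<otimes>\<^bsub>U\<^esub> \<iota> y \<ominus>\<^bsub>U\<^esub> \<iota> y \<otimes>\<^bsub>U\<^esub> \<iota> x = \<iota> (lie_bracket L x y)"
proof -
  let ?b = "Poly_Mapping.single [lie_bracket L x y] (1 :: 'f)"
  let ?p = "Poly_Mapping.single [y, x] 1 + ?b"
  have s: "Poly_Mapping.single [x] 1 \<in> carrier F" "Poly_Mapping.single [y] 1 \<in> carrier F"
      "Poly_Mapping.single [x, y] 1 \<in> carrier F" "Poly_Mapping.single [y, x] 1 \<in> carrier F"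
      "?b \<in> carrier F"
    using assms by (auto intro!: single_carrier bracket_carrier)
  have p: "?p \<in> carrier F"
    using F.a_closed[OF s(4,5)] by (simp add: F_ops)
  have "Poly_Mapping.single [x, y] 1 - ?p \<in> uea_relations L"
    unfolding uea_relations_def diff_diff_eq[symmetric] using assms by blast
  then have "Poly_Mapping.single [x, y] 1 \<ominus>\<^bsub>F\<^esub> ?p \<in> uea_ideal L"
    using relation_in_ideal s p by (simp add: F_minus)
  then have "\<iota> x \<otimes>\<^bsub>U\<^esub> \<iota> y = \<iota> y \<otimes>\<^bsub>U\<^esub> \<iota> x \<oplus>\<^bsub>U\<^esub> \<iota> (lie_bracket L x y)"
    unfolding uea_eq uea_incl_def
    using I.coset_mult[OF s(1,2)] I.coset_mult[OF s(2,1)] I.coset_add[OF s(4,5)]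
      I.coset_eq_iff[OF s(3) p] by (simp add: F_ops)
  moreover have "\<iota> x \<in> carrier U" "\<iota> y \<in> carrier U" "\<iota> (lie_bracket L x y) \<in> carrier U"
    using assms by (simp_all add: bracket_carrier)
  ultimately show ?thesis
    by (simp add: a_minus_def U.a_ac U.r_neg1 U.r_neg)
qed

text \<open>Words are built by left multiplication with generators, and the case \<open>incl\<close>
  follows this. The rule serves identities between maps that are linear but not multiplicative, such
  as the antipode axioms, which cannot be compared on generators alone.\<close>

lemma uea_induct [consumes 1, case_names one incl add smult]:
  assumes "u \<in> carrier U"
    and one: "P \<one>\<^bsub>U\<^esub>"
    and incl: "\<And>x u. x \<in> carrier L \<Longrightarrow> u \<in> carrier U \<Longrightarrow> P u \<Longrightarrow> P (\<iota> x \<otimes>\<^bsub>U\<^esub> u)"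
    and add: "\<And>u v. u \<in> carrier U \<Longrightarrow> v \<in> carrier U \<Longrightarrow> P u \<Longrightarrow> P v \<Longrightarrow> P (u \<oplus>\<^bsub>U\<^esub> v)"
    and smult: "\<And>c u. u \<in> carrier U \<Longrightarrow> P u \<Longrightarrow> P (c \<odot>\<^bsub>U\<^esub> u)"
  shows "P u"
proof -
  let ?\<pi> = "\<lambda>p. uea_ideal L +>\<^bsub>F\<^esub> p"
  obtain p where p: "p \<in> carrier F" and u: "u = ?\<pi> p"
    using assms(1) I.coset_cases unfolding uea_eq by metis
  have word: "P (?\<pi> (Poly_Mapping.single w 1))" if "w \<in> lists (carrier L)" for w
    using that
  proof (induction w)
    case Nil
    then show ?case
      using one unfolding uea_eq by (simp add: I.coset_one F_ops)
  next
    case (Cons x w)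
    have s: "Poly_Mapping.single [x] 1 \<in> carrier F" "Poly_Mapping.single w 1 \<in> carrier F"
      using Cons.hyps by (auto intro!: single_carrier)
    then have "P (\<iota> x \<otimes>\<^bsub>U\<^esub> ?\<pi> (Poly_Mapping.single w 1))"
      using Cons I.coset_closed unfolding uea_eq[symmetric] by (intro incl)
    then show ?case
      using I.coset_mult[OF s] unfolding uea_eq[symmetric] by (simp add: uea_incl_def F_ops)
  qed
  have scaled: "P (?\<pi> (Poly_Mapping.single w c))" if w: "w \<in> lists (carrier L)" for w c
  proof -
    have s: "Poly_Mapping.single w 1 \<in> carrier F"
      using w by (rule single_carrier)
    have "P (c \<odot>\<^bsub>U\<^esub> ?\<pi> (Poly_Mapping.single w 1))"
      using word[OF w] I.coset_closed[OF s] unfolding uea_eq[symmetric] by (intro smult)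
    then show ?thesis
      using I.coset_smult[OF s] unfolding uea_eq[symmetric] by (simp add: F_ops scale_simps)
  qed
  have "Poly_Mapping.keys p \<subseteq> lists (carrier L)"
    using p by (simp add: F_carrier)
  then have "P (?\<pi> p)"
  proof (induction p rule: poly_mapping_induct_keys)
    case zero
    show ?case
      using scaled[of "[]" 0] by simp
  next
    case (add p q)
    then have pq: "p \<in> carrier F" "q \<in> carrier F"
      by (simp_all add: F_carrier)
    then have "P (?\<pi> p \<oplus>\<^bsub>U\<^esub> ?\<pi> q)"
      using add.IH I.coset_closed unfolding uea_eq[symmetric] by (intro assms(4))
    then show ?case
      using I.coset_add[OF pq] unfolding uea_eq[symmetric] by (simp add: F_ops)
  qed (rule scaled)
  then show ?thesis
    by (simp add: u)
qed

lemma algebra_homs_eq_on_incl: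
  assumes f: "f \<in> algebra_homs U B" and g: "g \<in> algebra_homs U B"
    and eq: "\<And>x. x \<in> carrier L \<Longrightarrow> f (\<iota> x) = g (\<iota> x)"
    and u: "u \<in> carrier U"
  shows "f u = g u"
  using u
  by (induction u rule: uea_induct)
    (simp_all add: eq algebra_homs_one[OF f] algebra_homs_one[OF g]
      algebra_homs_mult[OF f] algebra_homs_mult[OF g]
      linear_maps_add[OF algebra_homs_linear[OF f]] linear_maps_add[OF algebra_homs_linear[OF g]]
      linear_maps_smult[OF algebra_homs_linear[OF f]] linear_maps_smult[OF algebra_homs_linear[OF g]])

section \<open>The universal property of the enveloping algebra\<close>

context
  fixes B :: "('f, 'b) module" and \<phi>
  assumes B: "algebra_over B" and \<phi>_closed: "\<And>x. x \<in> carrier L \<Longrightarrow> \<phi> x \<in> carrier B"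
    and \<phi>_add: "\<And>x y. x \<in> carrier L \<Longrightarrow> y \<in> carrier L \<Longrightarrow> \<phi> (x \<oplus> y) = \<phi> x \<oplus>\<^bsub>B\<^esub> \<phi> y"
    and \<phi>_smult: "\<And>c x. x \<in> carrier L \<Longrightarrow> \<phi> (c \<odot> x) = c \<odot>\<^bsub>B\<^esub> \<phi> x"
    and \<phi>_bracket: "\<And>x y. x \<in> carrier L \<Longrightarrow> y \<in> carrier L \<Longrightarrow>
      \<phi> (lie_bracket L x y) = \<phi> x \<otimes>\<^bsub>B\<^esub> \<phi> y \<ominus>\<^bsub>B\<^esub> \<phi> y \<otimes>\<^bsub>B\<^esub> \<phi> x"
begin

interpretation B: algebra_over B by (rule B)

definition word_value where "word_value w = foldr (\<lambda>x u. \<phi> x \<otimes>\<^bsub>B\<^esub> u) w \<one>\<^bsub>B\<^esub>"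

lemma word_value_simps:
  "word_value [] = \<one>\<^bsub>B\<^esub>" "word_value (x # w) = \<phi> x \<otimes>\<^bsub>B\<^esub> word_value w"
  by (simp_all add: word_value_def)

lemma word_value_closed: "w \<in> lists (carrier L) \<Longrightarrow> word_value w \<in> carrier B"
  by (induction w) (auto simp: word_value_simps \<phi>_closed)

lemma word_value_append:
  "v \<in> lists (carrier L) \<Longrightarrow> w \<in> lists (carrier L) \<Longrightarrow>
    word_value (v @ w) = word_value v \<otimes>\<^bsub>B\<^esub> word_value w"
  by (induction v) (auto simp: word_value_simps word_value_closed \<phi>_closed B.m_assoc)

text \<open>The family \<open>H\<close> of maps
  \<open>w \<mapsto> a \<otimes> word_value w \<otimes> b\<close> is stable under translation on
  both sides because \<open>word_value\<close> is multiplicative, so its common kernel is a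
  two-sided ideal. The relations lie in it, and a = b = 1 gives \<open>word_value\<close>
  itself.\<close>

lemma linear_extension_uea_ideal:
  assumes "p \<in> uea_ideal L"
  shows "linear_extension B word_value p = \<zero>\<^bsub>B\<^esub>"
proof -
  define H where "H = {g. \<exists>a\<in>carrier B. \<exists>b\<in>carrier B. \<forall>w\<in>lists (carrier L).
    g w = a \<otimes>\<^bsub>B\<^esub> word_value w \<otimes>\<^bsub>B\<^esub> b}"
  let ?J = "{p \<in> carrier (monoid_algebra W). \<forall>h\<in>H. linear_extension B h p = \<zero>\<^bsub>B\<^esub>}"
  interpret algebra_pair F B ..
  have HI: "g \<in> H" if "a \<in> carrier B" "b \<in> carrier B"
    "\<And>w. w \<in> lists (carrier L) \<Longrightarrow> g w = a \<otimes>\<^bsub>B\<^esub> word_value w \<otimes>\<^bsub>B\<^esub> b" for g a b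
    using that unfolding H_def by blast
  have HE: "\<exists>a b. a \<in> carrier B \<and> b \<in> carrier B \<and>
      (\<forall>w\<in>lists (carrier L). g w = a \<otimes>\<^bsub>B\<^esub> word_value w \<otimes>\<^bsub>B\<^esub> b)" if "g \<in> H" for g
    using that unfolding H_def by blast
  have H_closed: "g \<in> lists (carrier L) \<rightarrow> carrier B" if "g \<in> H" for g
  proof
    fix w assume w: "w \<in> lists (carrier L)"
    from HE[OF that] obtain a b where "a \<in> carrier B" "b \<in> carrier B"
        "g w = a \<otimes>\<^bsub>B\<^esub> word_value w \<otimes>\<^bsub>B\<^esub> b"
      using w by blast
    with word_value_closed[OF w] show "g w \<in> carrier B"
      by simp
  qed
  have "ideal ?J (monoid_algebra W)"
  proof (rule linear_extension_kernel_ideal[OF monoid_words B])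
    show "H \<subseteq> carrier W \<rightarrow> carrier B"
      using H_closed by auto
  next
    fix g w assume "g \<in> H" and "w \<in> carrier W"
    then have w: "w \<in> lists (carrier L)"
      by simp
    obtain a b where ab: "a \<in> carrier B" "b \<in> carrier B"
        and g: "\<And>w. w \<in> lists (carrier L) \<Longrightarrow> g w = a \<otimes>\<^bsub>B\<^esub> word_value w \<otimes>\<^bsub>B\<^esub> b"
      using HE[OF \<open>g \<in> H\<close>] by blast
    note closed = word_value_closed ab w
    show "(\<lambda>v. g (w \<otimes>\<^bsub>W\<^esub> v)) \<in> H"
      by (rule HI[of "a \<otimes>\<^bsub>B\<^esub> word_value w" b]) (use closed in \<open>simp_all add: g word_value_append B.m_assoc\<close>)
    show "(\<lambda>v. g (v \<otimes>\<^bsub>W\<^esub> w)) \<in> H"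
      by (rule HI[of a "word_value w \<otimes>\<^bsub>B\<^esub> b"]) (use closed in \<open>simp_all add: g word_value_append B.m_assoc\<close>)
  qed
  moreover have "uea_relations L \<subseteq> ?J"
  proof
    fix p assume p: "p \<in> uea_relations L"
    have "linear_extension B g p = \<zero>\<^bsub>B\<^esub>" if "g \<in> H" for g
    proof -
      let ?l = "linear_extension B g"
      obtain a b where ab: "a \<in> carrier B" "b \<in> carrier B"
          and g: "\<And>w. w \<in> lists (carrier L) \<Longrightarrow> g w = a \<otimes>\<^bsub>B\<^esub> word_value w \<otimes>\<^bsub>B\<^esub> b"
        using HE[OF \<open>g \<in> H\<close>] by blast
      have lin: "?l \<in> linear_maps F B"
        unfolding F_eq by (rule linear_extension_linear_maps[OF B]) (use H_closed[OF that] in simp)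
      have diff: "?l (q - r) = ?l q \<ominus>\<^bsub>B\<^esub> ?l r" if "q \<in> carrier F" "r \<in> carrier F" for q r
        using linear_maps_diff[OF lin that] F_minus[OF that] by simp
      have single: "?l (Poly_Mapping.single w c) = c \<odot>\<^bsub>B\<^esub> (a \<otimes>\<^bsub>B\<^esub> word_value w \<otimes>\<^bsub>B\<^esub> b)"
        if "w \<in> lists (carrier L)" for w c
        using B.linear_extension_single[OF H_closed[OF \<open>g \<in> H\<close>] that, of c] g[OF that] by simp
      note closed = ab \<phi>_closed add_carrier smult_carrier bracket_carrier
      note rules = diff single single_carrier F_diff_closed closed word_value_simps B.minus_eq_zero_iff
        \<phi>_add \<phi>_smult \<phi>_bracket
      consider (add) x y where "x \<in> carrier L" "y \<in> carrier L" "p = Poly_Mapping.single [x \<oplus> y] 1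
            - Poly_Mapping.single [x] 1 - Poly_Mapping.single [y] 1"
        | (smult) c x where "x \<in> carrier L"
          "p = Poly_Mapping.single [c \<odot> x] 1 - Poly_Mapping.single [x] c"
        | (bracket) x y where "x \<in> carrier L" "y \<in> carrier L" "p = Poly_Mapping.single [x, y] 1
            - Poly_Mapping.single [y, x] 1 - Poly_Mapping.single [lie_bracket L x y] 1"
        using p unfolding uea_relations_def by blast
      then show ?thesis
      proof cases
        case add
        have "u \<oplus>\<^bsub>B\<^esub> v \<ominus>\<^bsub>B\<^esub> u = v" if "u \<in> carrier B" "v \<in> carrier B" for u v
          using that by (simp add: B.minus_eq B.a_comm[of u] B.a_assoc B.r_neg)
        with add show ?thesis
          by (simp add: rules B.l_distr B.r_distr)
      next
        case bracket
        then show ?thesis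
          by (simp add: rules B.minus_eq B.l_distr B.r_distr B.l_minus B.r_minus B.m_assoc B.r_neg)
      qed (simp add: rules)
    qed
    then show "p \<in> ?J"
      using p relations_carrier unfolding F_eq[symmetric] by auto
  qed
  ultimately have "uea_ideal L \<subseteq> ?J"
    unfolding uea_ideal_def F_eq[symmetric] by (rule F.genideal_minimal)
  moreover have "word_value \<in> H"
    by (rule HI[of "\<one>\<^bsub>B\<^esub>" "\<one>\<^bsub>B\<^esub>"]) (simp_all add: word_value_closed)
  ultimately show ?thesis
    using assms by auto
qed

lemma word_value_linear: "linear_extension B word_value \<in> linear_maps F B"
  unfolding F_eq by (rule linear_extension_linear_maps[OF B]) (use word_value_closed in auto)

lemma uea_lift_coset:
  assumes p: "p \<in> carrier F"
  shows "uea_lift B \<phi> (uea_ideal L +>\<^bsub>F\<^esub> p) = linear_extension B word_value p"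
  unfolding uea_lift_def Let_def word_value_def[symmetric] linear_extension_def[symmetric]
  by (rule I.quotient_lift[OF B word_value_linear linear_extension_uea_ideal p])

lemma uea_lift_hom: "uea_lift B \<phi> \<in> algebra_homs U B"
proof -
  note lin = word_value_linear
  have words: "word_value \<in> carrier W \<rightarrow> carrier B"
    using word_value_closed by auto
  have mult: "linear_extension B word_value (p \<otimes>\<^bsub>F\<^esub> q) =
      linear_extension B word_value p \<otimes>\<^bsub>B\<^esub> linear_extension B word_value q"
    if "p \<in> carrier F" "q \<in> carrier F" for p q
    unfolding F_eq using that
    by (intro linear_extension_mult[OF monoid_words B words])
      (simp_all add: word_value_append F_carrier)
  have one: "linear_extension B word_value \<one>\<^bsub>F\<^esub> = \<one>\<^bsub>B\<^esub>"
    using B.linear_extension_single[OF words, of "[]" 1] by (simp add: F_ops word_value_simps)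
  show ?thesis
    unfolding uea_eq
    by (rule algebra_homsI; (rule linear_mapsI)?; (elim I.coset_cases)?)
      (simp_all add: uea_lift_coset I.coset_ops linear_maps_closed[OF lin]
        linear_maps_add[OF lin] linear_maps_smult[OF lin] mult one)
qed

lemma uea_lift_incl:
  assumes "x \<in> carrier L"
  shows "uea_lift B \<phi> (\<iota> x) = \<phi> x"
proof -
  have "word_value \<in> lists (carrier L) \<rightarrow> carrier B"
    using word_value_closed by auto
  from B.linear_extension_single[OF this, of "[x]" 1] show ?thesis
    unfolding uea_incl_def using assms
    by (simp add: uea_lift_coset single_carrier word_value_simps \<phi>_closed)
qed

end
end

section \<open>Formal power series over an algebra\<close>

locale series_over = algebra_over A
  for A :: "('f::field, 'a) module" (structure)
begin

abbreviation H where "H \<equiv> series_algebra A"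
abbreviation const where "const \<equiv> series_const A"
abbreviation tsum where "tsum \<equiv> series_tsum A"

lemma carrier_iff: "x \<in> carrier H \<longleftrightarrow> (\<forall>n. x n \<in> carrier A)"
  by (auto simp: series_algebra_def)

lemma coeff_closed [simp]: "x \<in> carrier H \<Longrightarrow> x n \<in> carrier A"
  by (simp add: carrier_iff)

lemma H_simps:
  "x \<oplus>\<^bsub>H\<^esub> y = (\<lambda>n. x n \<oplus> y n)" "\<zero>\<^bsub>H\<^esub> = (\<lambda>n. \<zero>)" "\<one>\<^bsub>H\<^esub> = const \<one>"
  by (simp_all add: series_algebra_def)

lemma mult_coeff: "(x \<otimes>\<^bsub>H\<^esub> y) n = (\<Oplus>i\<in>{..n}. x i \<otimes> y (n - i))"
  by (simp add: series_algebra_def)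

lemma smult_coeff: "(c \<odot>\<^bsub>H\<^esub> x) n = (\<Oplus>i\<in>{..n}. fps_nth c i \<odot> x (n - i))"
  by (simp add: series_algebra_def)

lemma const_coeff: "const a n = (if n = 0 then a else \<zero>)"
  by (simp add: series_const_def)

lemma const_carrier [simp]: "a \<in> carrier A \<Longrightarrow> const a \<in> carrier H"
  by (simp add: carrier_iff const_coeff)

lemma shift_carrier: "x \<in> carrier H \<Longrightarrow> (\<lambda>n. x (Suc n)) \<in> carrier H"
  by (simp add: carrier_iff)

lemma mult_carrier: "x \<in> carrier H \<Longrightarrow> y \<in> carrier H \<Longrightarrow> x \<otimes>\<^bsub>H\<^esub> y \<in> carrier H"
  by (auto simp: carrier_iff mult_coeff intro!: finsum_closed)

lemma mult_0: "x \<in> carrier H \<Longrightarrow> y \<in> carrier H \<Longrightarrow> (x \<otimes>\<^bsub>H\<^esub> y) 0 = x 0 \<otimes> y 0"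
  by (simp add: mult_coeff)

text \<open>Writing the left factor as x = x 0 + t x' turns the Cauchy product into a recursion on
  the coefficient index. Associativity is then an induction and no double sum has to be
  reindexed.\<close>

lemma mult_Suc:
  assumes "x \<in> carrier H" "y \<in> carrier H"
  shows "(x \<otimes>\<^bsub>H\<^esub> y) (Suc n) = x 0 \<otimes> y (Suc n) \<oplus> ((\<lambda>n. x (Suc n)) \<otimes>\<^bsub>H\<^esub> y) n"
proof -
  have "(x \<otimes>\<^bsub>H\<^esub> y) (Suc n) = (\<Oplus>i\<in>{..n}. x (Suc i) \<otimes> y (Suc n - Suc i)) \<oplus> x 0 \<otimes> y (Suc n - 0)"
    unfolding mult_coeff by (rule finsum_Suc2) (use assms in auto)
  moreover have "(\<Oplus>i\<in>{..n}. x (Suc i) \<otimes> y (n - i)) \<in> carrier A"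
    using assms by (intro finsum_closed) auto
  ultimately show ?thesis
    using assms by (simp add: mult_coeff a_comm)
qed

lemma mult_coeff_rev:
  assumes "x \<in> carrier H" "y \<in> carrier H"
  shows "(x \<otimes>\<^bsub>H\<^esub> y) n = (\<Oplus>i\<in>{..n}. x (n - i) \<otimes> y i)"
proof -
  have inj: "inj_on (\<lambda>i. n - i) {..n}"
    by (rule inj_onI) auto
  have "i \<in> (\<lambda>i. n - i) ` {..n}" if "i \<le> n" for i
    using that by (intro image_eqI[of _ _ "n - i"]) auto
  then have im: "(\<lambda>i. n - i) ` {..n} = {..n}"
    by auto
  have "(\<Oplus>i\<in>(\<lambda>i. n - i) ` {..n}. x i \<otimes> y (n - i)) = (\<Oplus>i\<in>{..n}. x (n - i) \<otimes> y (n - (n - i)))"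
    by (rule finsum_reindex[OF _ inj]) (use assms in auto)
  also have "\<dots> = (\<Oplus>i\<in>{..n}. x (n - i) \<otimes> y i)"
    by (rule finsum_cong') (use assms in auto)
  finally show ?thesis
    by (simp add: mult_coeff im)
qed

text \<open>Coefficient n of a product sees only coefficients up to n of the factors. Both
  uniqueness and the recursive construction of solutions of differential equations depend on this
  locality.\<close>

lemma mult_cong:
  assumes "x' \<in> carrier H" "y' \<in> carrier H" "\<And>k. k \<le> n \<Longrightarrow> x k = x' k" "\<And>k. k \<le> n \<Longrightarrow> y k = y' k"
  shows "(x \<otimes>\<^bsub>H\<^esub> y) n = (x' \<otimes>\<^bsub>H\<^esub> y') n"
  unfolding mult_coeff by (rule finsum_cong') (use assms in auto)

lemma mult_zero_left: "y \<in> carrier H \<Longrightarrow> ((\<lambda>n. \<zero>) \<otimes>\<^bsub>H\<^esub> y) n = \<zero>"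
  by (simp add: mult_coeff)

lemma mult_assoc:
  "x \<in> carrier H \<Longrightarrow> y \<in> carrier H \<Longrightarrow> z \<in> carrier H \<Longrightarrow>
    ((x \<otimes>\<^bsub>H\<^esub> y) \<otimes>\<^bsub>H\<^esub> z) n = (x \<otimes>\<^bsub>H\<^esub> (y \<otimes>\<^bsub>H\<^esub> z)) n"
proof (induction n arbitrary: x y)
  case 0
  then show ?case
    by (simp add: mult_0 mult_carrier m_assoc)
next
  case (Suc n)
  have distr: "((\<lambda>n. a \<otimes> v n \<oplus> w n) \<otimes>\<^bsub>H\<^esub> z) n = a \<otimes> (v \<otimes>\<^bsub>H\<^esub> z) n \<oplus> (w \<otimes>\<^bsub>H\<^esub> z) n"
    if "a \<in> carrier A" "v \<in> carrier H" "w \<in> carrier H" for a v w n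
  proof -
    have "((\<lambda>n. a \<otimes> v n \<oplus> w n) \<otimes>\<^bsub>H\<^esub> z) n =
        (\<Oplus>i\<in>{..n}. a \<otimes> (v i \<otimes> z (n - i)) \<oplus> w i \<otimes> z (n - i))"
      unfolding mult_coeff using that Suc.prems(3)
      by (intro finsum_cong') (auto simp: l_distr m_assoc)
    also have "\<dots> = (\<Oplus>i\<in>{..n}. a \<otimes> (v i \<otimes> z (n - i))) \<oplus> (w \<otimes>\<^bsub>H\<^esub> z) n"
      unfolding mult_coeff using that Suc.prems(3) by (intro finsum_addf) auto
    also have "(\<Oplus>i\<in>{..n}. a \<otimes> (v i \<otimes> z (n - i))) = a \<otimes> (v \<otimes>\<^bsub>H\<^esub> z) n"
      unfolding mult_coeff using that Suc.prems(3) by (intro finsum_rdistr[symmetric]) auto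
    finally show ?thesis .
  qed
  have eq: "(\<lambda>n. (x \<otimes>\<^bsub>H\<^esub> y) (Suc n)) = (\<lambda>n. x 0 \<otimes> y (Suc n) \<oplus> ((\<lambda>n. x (Suc n)) \<otimes>\<^bsub>H\<^esub> y) n)"
    using Suc.prems by (simp add: mult_Suc)
  have "((x \<otimes>\<^bsub>H\<^esub> y) \<otimes>\<^bsub>H\<^esub> z) (Suc n) =
      (x 0 \<otimes> y 0) \<otimes> z (Suc n) \<oplus> (x 0 \<otimes> ((\<lambda>n. y (Suc n)) \<otimes>\<^bsub>H\<^esub> z) n
        \<oplus> (((\<lambda>n. x (Suc n)) \<otimes>\<^bsub>H\<^esub> y) \<otimes>\<^bsub>H\<^esub> z) n)"
    using Suc.prems by (simp add: mult_Suc[of "x \<otimes>\<^bsub>H\<^esub> y"] eq distr mult_0 mult_carrier shift_carrier)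
  also have "\<dots> = x 0 \<otimes> (y 0 \<otimes> z (Suc n) \<oplus> ((\<lambda>n. y (Suc n)) \<otimes>\<^bsub>H\<^esub> z) n)
        \<oplus> ((\<lambda>n. x (Suc n)) \<otimes>\<^bsub>H\<^esub> (y \<otimes>\<^bsub>H\<^esub> z)) n"
    using Suc.prems Suc.IH[of "\<lambda>n. x (Suc n)" y]
    by (simp add: shift_carrier mult_carrier r_distr m_assoc a_assoc)
  also have "\<dots> = (x \<otimes>\<^bsub>H\<^esub> (y \<otimes>\<^bsub>H\<^esub> z)) (Suc n)"
    using Suc.prems by (simp add: mult_Suc mult_carrier)
  finally show ?case .
qed

lemma mult_const_left:
  assumes "a \<in> carrier A" "x \<in> carrier H"
  shows "const a \<otimes>\<^bsub>H\<^esub> x = (\<lambda>n. a \<otimes> x n)"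
proof
  fix n
  have "(\<lambda>n. const a (Suc n)) = (\<lambda>n. \<zero>)"
    by (simp add: const_coeff)
  with assms show "(const a \<otimes>\<^bsub>H\<^esub> x) n = a \<otimes> x n"
    by (cases n) (simp_all add: mult_0 mult_Suc mult_zero_left const_coeff)
qed

lemma mult_const_right:
  assumes "a \<in> carrier A" "x \<in> carrier H"
  shows "x \<otimes>\<^bsub>H\<^esub> const a = (\<lambda>n. x n \<otimes> a)"
proof
  fix n
  from assms(2) show "(x \<otimes>\<^bsub>H\<^esub> const a) n = x n \<otimes> a"
    by (induction n arbitrary: x)
      (use assms(1) in \<open>simp_all add: mult_0 mult_Suc const_coeff shift_carrier\<close>)
qed

lemma distr_coeff:
  assumes "x \<in> carrier H" "y \<in> carrier H" "z \<in> carrier H"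
  shows "((x \<oplus>\<^bsub>H\<^esub> y) \<otimes>\<^bsub>H\<^esub> z) n = (x \<otimes>\<^bsub>H\<^esub> z) n \<oplus> (y \<otimes>\<^bsub>H\<^esub> z) n"
    and "(z \<otimes>\<^bsub>H\<^esub> (x \<oplus>\<^bsub>H\<^esub> y)) n = (z \<otimes>\<^bsub>H\<^esub> x) n \<oplus> (z \<otimes>\<^bsub>H\<^esub> y) n"
proof -
  have "((x \<oplus>\<^bsub>H\<^esub> y) \<otimes>\<^bsub>H\<^esub> z) n = (\<Oplus>i\<in>{..n}. x i \<otimes> z (n - i) \<oplus> y i \<otimes> z (n - i))"
    unfolding mult_coeff H_simps using assms by (intro finsum_cong') (auto simp: l_distr)
  then show "((x \<oplus>\<^bsub>H\<^esub> y) \<otimes>\<^bsub>H\<^esub> z) n = (x \<otimes>\<^bsub>H\<^esub> z) n \<oplus> (y \<otimes>\<^bsub>H\<^esub> z) n"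
    unfolding mult_coeff using assms by (simp only:) (intro finsum_addf; auto)
  have "(z \<otimes>\<^bsub>H\<^esub> (x \<oplus>\<^bsub>H\<^esub> y)) n = (\<Oplus>i\<in>{..n}. z i \<otimes> x (n - i) \<oplus> z i \<otimes> y (n - i))"
    unfolding mult_coeff H_simps using assms by (intro finsum_cong') (auto simp: r_distr)
  then show "(z \<otimes>\<^bsub>H\<^esub> (x \<oplus>\<^bsub>H\<^esub> y)) n = (z \<otimes>\<^bsub>H\<^esub> x) n \<oplus> (z \<otimes>\<^bsub>H\<^esub> y) n"
    unfolding mult_coeff using assms by (simp only:) (intro finsum_addf; auto)
qed

text \<open>The copy of the scalar series \<open>c\<close> inside A[[t]]. It is central, and scaling
  by \<open>c\<close> is multiplication by it from either side, so the module axioms over F[[t]]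
  follow from the ring axioms.\<close>

definition scalar_series :: "'f fps \<Rightarrow> nat \<Rightarrow> 'a" where
  "scalar_series c = (\<lambda>n. fps_nth c n \<odot> \<one>)"

lemma scalar_series_carrier: "scalar_series c \<in> carrier H"
  by (simp add: scalar_series_def carrier_iff)

lemma smult_eq_mult:
  assumes "x \<in> carrier H"
  shows "c \<odot>\<^bsub>H\<^esub> x = scalar_series c \<otimes>\<^bsub>H\<^esub> x"
  using assms by (simp add: fun_eq_iff smult_coeff mult_coeff scalar_series_def)

lemma smult_eq_mult_right:
  assumes "x \<in> carrier H"
  shows "c \<odot>\<^bsub>H\<^esub> x = x \<otimes>\<^bsub>H\<^esub> scalar_series c"
  using assms
  by (simp add: fun_eq_iff smult_coeff mult_coeff_rev scalar_series_carrier)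
    (simp add: scalar_series_def)

lemma scalar_series_simps:
  "scalar_series (c + d) = scalar_series c \<oplus>\<^bsub>H\<^esub> scalar_series d"
  "scalar_series (c * d) = scalar_series c \<otimes>\<^bsub>H\<^esub> scalar_series d"
  "scalar_series 1 = \<one>\<^bsub>H\<^esub>" "scalar_series 0 = \<zero>\<^bsub>H\<^esub>"
proof -
  show "scalar_series (c * d) = scalar_series c \<otimes>\<^bsub>H\<^esub> scalar_series d"
    by (simp add: fun_eq_iff mult_coeff scalar_series_def fps_mult_nth smult_smult
        finsum_smult_left atLeast0AtMost mult.commute)
qed (simp_all add: fun_eq_iff H_simps const_coeff scalar_series_def smult_l_distr)

lemma H_assoc_algebra: "assoc_algebra H"
proof (rule assoc_algebraI)
  fix x y z assume xyz: "x \<in> carrier H" "y \<in> carrier H" "z \<in> carrier H"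
  show "(x \<otimes>\<^bsub>H\<^esub> y) \<otimes>\<^bsub>H\<^esub> z = x \<otimes>\<^bsub>H\<^esub> (y \<otimes>\<^bsub>H\<^esub> z)"
    using xyz by (intro ext mult_assoc)
  show "(x \<oplus>\<^bsub>H\<^esub> y) \<otimes>\<^bsub>H\<^esub> z = x \<otimes>\<^bsub>H\<^esub> z \<oplus>\<^bsub>H\<^esub> y \<otimes>\<^bsub>H\<^esub> z"
    using distr_coeff(1)[OF xyz] by (simp add: fun_eq_iff H_simps)
  show "z \<otimes>\<^bsub>H\<^esub> (x \<oplus>\<^bsub>H\<^esub> y) = z \<otimes>\<^bsub>H\<^esub> x \<oplus>\<^bsub>H\<^esub> z \<otimes>\<^bsub>H\<^esub> y"
    using distr_coeff(2)[OF xyz] by (simp add: fun_eq_iff H_simps)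
  show "x \<oplus>\<^bsub>H\<^esub> y \<oplus>\<^bsub>H\<^esub> z = x \<oplus>\<^bsub>H\<^esub> (y \<oplus>\<^bsub>H\<^esub> z)"
    using xyz by (simp add: H_simps a_assoc)
next
  fix c d x assume x: "x \<in> carrier H"
  show "c \<odot>\<^bsub>H\<^esub> x \<in> carrier H"
    using x by (simp add: smult_eq_mult mult_carrier scalar_series_carrier)
  show "(c + d) \<odot>\<^bsub>H\<^esub> x = c \<odot>\<^bsub>H\<^esub> x \<oplus>\<^bsub>H\<^esub> d \<odot>\<^bsub>H\<^esub> x"
    using distr_coeff(1)[OF scalar_series_carrier scalar_series_carrier x]
    by (simp add: smult_eq_mult x scalar_series_simps fun_eq_iff H_simps(1)[of "_ \<otimes>\<^bsub>H\<^esub> _"])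
  show "(c * d) \<odot>\<^bsub>H\<^esub> x = c \<odot>\<^bsub>H\<^esub> (d \<odot>\<^bsub>H\<^esub> x)"
    using mult_assoc[OF scalar_series_carrier scalar_series_carrier x]
    by (simp add: smult_eq_mult x scalar_series_simps mult_carrier scalar_series_carrier fun_eq_iff)
  fix y assume y: "y \<in> carrier H"
  have xy: "x \<oplus>\<^bsub>H\<^esub> y \<in> carrier H"
    using x y by (simp add: H_simps carrier_iff)
  show "c \<odot>\<^bsub>H\<^esub> (x \<oplus>\<^bsub>H\<^esub> y) = c \<odot>\<^bsub>H\<^esub> x \<oplus>\<^bsub>H\<^esub> c \<odot>\<^bsub>H\<^esub> y"
    unfolding smult_eq_mult[OF xy] smult_eq_mult[OF x] smult_eq_mult[OF y]
      H_simps(1)[of "scalar_series c \<otimes>\<^bsub>H\<^esub> x"]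
    by (rule ext) (rule distr_coeff(2)[OF x y scalar_series_carrier])
  show "(c \<odot>\<^bsub>H\<^esub> x) \<otimes>\<^bsub>H\<^esub> y = c \<odot>\<^bsub>H\<^esub> (x \<otimes>\<^bsub>H\<^esub> y)"
    using mult_assoc[OF scalar_series_carrier x y]
    by (simp add: smult_eq_mult x y mult_carrier fun_eq_iff)
  show "x \<otimes>\<^bsub>H\<^esub> (c \<odot>\<^bsub>H\<^esub> y) = c \<odot>\<^bsub>H\<^esub> (x \<otimes>\<^bsub>H\<^esub> y)"
    using mult_assoc[OF x y scalar_series_carrier]
    by (simp add: smult_eq_mult_right x y mult_carrier fun_eq_iff)
qed (simp_all add: mult_carrier smult_eq_mult scalar_series_simps,
    simp_all add: H_simps carrier_iff const_coeff mult_const_left mult_const_right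
      mult_zero_left a_comm fun_eq_iff)

sublocale H: algebra_over H
  by unfold_locales (rule H_assoc_algebra)

lemma smult_const_coeff:
  assumes "x \<in> carrier H"
  shows "(fps_const c \<odot>\<^bsub>H\<^esub> x) n = c \<odot> x n"
proof -
  have "scalar_series (fps_const c) = const (c \<odot> \<one>)"
    by (simp add: fun_eq_iff scalar_series_def const_coeff)
  then show ?thesis
    using assms by (simp add: smult_eq_mult mult_const_left)
qed

lemma smult_X_0 [simp]: "x \<in> carrier H \<Longrightarrow> (fps_X \<odot>\<^bsub>H\<^esub> x) 0 = \<zero>"
  by (simp add: smult_coeff)

lemma smult_X_Suc [simp]:
  assumes "x \<in> carrier H"
  shows "(fps_X \<odot>\<^bsub>H\<^esub> x) (Suc n) = x n"
proof -
  have "(\<lambda>n. scalar_series fps_X (Suc n)) = \<one>\<^bsub>H\<^esub>"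
    by (simp add: fun_eq_iff scalar_series_def H_simps const_coeff)
  with assms show ?thesis
    by (simp add: smult_eq_mult mult_Suc scalar_series_carrier) (simp add: scalar_series_def)
qed

lemma series_decompose:
  assumes "x \<in> carrier H"
  shows "x = const (x 0) \<oplus>\<^bsub>H\<^esub> fps_X \<odot>\<^bsub>H\<^esub> (\<lambda>n. x (Suc n))"
proof
  fix n
  show "x n = (const (x 0) \<oplus>\<^bsub>H\<^esub> fps_X \<odot>\<^bsub>H\<^esub> (\<lambda>n. x (Suc n))) n"
    using assms by (cases n) (simp_all add: H_simps const_coeff shift_carrier)
qed

lemma const_simps:
  "a \<in> carrier A \<Longrightarrow> b \<in> carrier A \<Longrightarrow> const (a \<oplus> b) = const a \<oplus>\<^bsub>H\<^esub> const b"
  "a \<in> carrier A \<Longrightarrow> b \<in> carrier A \<Longrightarrow> const (a \<otimes> b) = const a \<otimes>\<^bsub>H\<^esub> const b"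
  "a \<in> carrier A \<Longrightarrow> const (c \<odot> a) = fps_const c \<odot>\<^bsub>H\<^esub> const a"
  "const \<zero> = \<zero>\<^bsub>H\<^esub>" "const \<one> = \<one>\<^bsub>H\<^esub>"
  by (simp_all add: fun_eq_iff mult_const_left smult_const_coeff) (simp_all add: H_simps const_coeff)

lemma a_inv_coeff:
  assumes "x \<in> carrier H"
  shows "(\<ominus>\<^bsub>H\<^esub> x) n = \<ominus> x n"
  using assms smult_const_coeff[OF assms, of "-1" n]
  by (simp add: a_inv_eq_smult H.a_inv_eq_smult fps_const_neg[symmetric])

lemma minus_coeff: "x \<in> carrier H \<Longrightarrow> y \<in> carrier H \<Longrightarrow> (x \<ominus>\<^bsub>H\<^esub> y) n = x n \<ominus> y n"
  by (simp add: a_minus_def H_simps a_inv_coeff)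

lemma tsum_coeff: "tsum x n = (\<Oplus>i\<in>{..n}. x i (n - i))"
  by (simp add: series_tsum_def)

lemma tsum_closed [simp, intro]: "(\<And>i. x i \<in> carrier H) \<Longrightarrow> tsum x \<in> carrier H"
  by (auto simp: carrier_iff tsum_coeff intro!: finsum_closed)

text \<open>Coefficient n of the right-hand side involves the tail only through its coefficient n -
  1. Identities between t-adic sums are therefore proved by induction on n, with the summands
  arbitrary.\<close>

lemma tsum_unfold:
  assumes "\<And>i. x i \<in> carrier H"
  shows "tsum x = x 0 \<oplus>\<^bsub>H\<^esub> fps_X \<odot>\<^bsub>H\<^esub> tsum (\<lambda>i. x (Suc i))"
proof
  fix n
  have carr: "tsum (\<lambda>i. x (Suc i)) \<in> carrier H"
    using assms by auto
  show "tsum x n = (x 0 \<oplus>\<^bsub>H\<^esub> fps_X \<odot>\<^bsub>H\<^esub> tsum (\<lambda>i. x (Suc i))) n"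
  proof (cases n)
    case 0
    then show ?thesis
      using assms carr by (simp add: H_simps tsum_coeff)
  next
    case (Suc m)
    have "tsum x (Suc m) = (\<Oplus>i\<in>{..m}. x (Suc i) (Suc m - Suc i)) \<oplus> x 0 (Suc m - 0)"
      unfolding tsum_coeff by (rule finsum_Suc2) (use assms in auto)
    moreover have "(\<Oplus>i\<in>{..m}. x (Suc i) (m - i)) \<in> carrier A"
      using assms by (intro finsum_closed) auto
    ultimately show ?thesis
      using assms carr Suc by (simp add: H_simps a_comm) (simp add: tsum_coeff)
  qed
qed

lemma tsum_add:
  assumes "\<And>i. x i \<in> carrier H" "\<And>i. y i \<in> carrier H"
  shows "tsum (\<lambda>i. x i \<oplus>\<^bsub>H\<^esub> y i) = tsum x \<oplus>\<^bsub>H\<^esub> tsum y"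
  unfolding fun_eq_iff tsum_coeff H_simps using assms by (auto intro!: finsum_addf)

lemma tsum_const: "x \<in> carrier H \<Longrightarrow> tsum (\<lambda>i. const (x i)) = x"
proof
  fix n
  assume "x \<in> carrier H"
  then show "tsum (\<lambda>i. const (x i)) n = x n"
  proof (induction n arbitrary: x)
    case 0
    then show ?case
      by (simp add: tsum_coeff const_coeff)
  next
    case (Suc n)
    have "tsum (\<lambda>i. const (x i)) (Suc n) = tsum (\<lambda>i. const (x (Suc i))) n"
      using Suc.prems by (subst tsum_unfold) (auto simp: H_simps const_coeff)
    then show ?case
      using Suc.IH[OF shift_carrier[OF Suc.prems]] by simp
  qed
qed

end

lemma fps_decompose: "(c :: 'f::field fps) = fps_const (fps_nth c 0) + fps_X * fps_shift 1 c"
  by (rule fps_ext) (simp add: fps_X_mult_nth)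

section \<open>Linear maps between algebras of formal series\<close>

locale series_pair = A: series_over A + B: series_over B
  for A :: "('f::field, 'a) module" and B :: "('f, 'b) module"
begin

abbreviation HA where "HA \<equiv> series_algebra A"
abbreviation HB where "HB \<equiv> series_algebra B"

sublocale H: algebra_pair HA HB ..

text \<open>Compatibility with t and with constants suffices: splitting a scalar as c = c_0 + t c'
  reduces coefficient n for c to coefficient n - 1 for c', so all of F[[t]] is reached by
  induction.\<close>

lemma series_linear_mapsI:
  assumes closed: "\<And>x. x \<in> carrier HA \<Longrightarrow> f x \<in> carrier HB"
    and add: "\<And>x y. x \<in> carrier HA \<Longrightarrow> y \<in> carrier HA \<Longrightarrow> f (x \<oplus>\<^bsub>HA\<^esub> y) = f x \<oplus>\<^bsub>HB\<^esub> f y"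
    and X: "\<And>x. x \<in> carrier HA \<Longrightarrow> f (fps_X \<odot>\<^bsub>HA\<^esub> x) = fps_X \<odot>\<^bsub>HB\<^esub> f x"
    and scalar: "\<And>c x. x \<in> carrier HA \<Longrightarrow> f (fps_const c \<odot>\<^bsub>HA\<^esub> x) = fps_const c \<odot>\<^bsub>HB\<^esub> f x"
  shows "f \<in> linear_maps HA HB"
proof (rule linear_mapsI)
  fix c x assume x: "x \<in> carrier HA"
  have "f (c \<odot>\<^bsub>HA\<^esub> x) n = (c \<odot>\<^bsub>HB\<^esub> f x) n" for n
  proof (induction n arbitrary: c)
    case 0
    have "f (c \<odot>\<^bsub>HA\<^esub> x) = f (fps_const (fps_nth c 0) \<odot>\<^bsub>HA\<^esub> x)
        \<oplus>\<^bsub>HB\<^esub> fps_X \<odot>\<^bsub>HB\<^esub> f (fps_shift 1 c \<odot>\<^bsub>HA\<^esub> x)"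
      by (subst fps_decompose[of c])
        (simp add: x A.H.smult_l_distr A.H.smult_smult[symmetric] add X)
    with x show ?case
      by (simp add: B.H_simps scalar B.smult_const_coeff closed) (simp add: B.smult_coeff closed)
  next
    case (Suc n)
    have "f (c \<odot>\<^bsub>HA\<^esub> x) = fps_const (fps_nth c 0) \<odot>\<^bsub>HB\<^esub> f x
        \<oplus>\<^bsub>HB\<^esub> fps_X \<odot>\<^bsub>HB\<^esub> f (fps_shift 1 c \<odot>\<^bsub>HA\<^esub> x)"
      by (subst fps_decompose[of c])
        (simp add: x A.H.smult_l_distr A.H.smult_smult[symmetric] add X scalar)
    moreover have "c \<odot>\<^bsub>HB\<^esub> f x = fps_const (fps_nth c 0) \<odot>\<^bsub>HB\<^esub> f x
        \<oplus>\<^bsub>HB\<^esub> fps_X \<odot>\<^bsub>HB\<^esub> (fps_shift 1 c \<odot>\<^bsub>HB\<^esub> f x)"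
      by (subst fps_decompose[of c])
        (simp add: x B.H.smult_l_distr B.H.smult_smult[symmetric] closed)
    ultimately show ?case
      using x Suc.IH by (simp add: B.H_simps closed)
  qed
  then show "f (c \<odot>\<^bsub>HA\<^esub> x) = c \<odot>\<^bsub>HB\<^esub> f x"
    by blast
qed (simp_all add: closed add)

text \<open>Linearity over F[[t]] forces t-adic continuity: since x = x_0 + t x', coefficient n at x
  is determined by the value at the constant x_0 and by coefficient n - 1 at x'.\<close>

lemma linear_maps_eq_on_const:
  assumes f: "f \<in> linear_maps HA HB" and g: "g \<in> linear_maps HA HB"
    and eq: "\<And>a. a \<in> carrier A \<Longrightarrow> f (series_const A a) = g (series_const A a)"
    and x: "x \<in> carrier HA"
  shows "f x = g x"
proof -
  have unfold: "h x = h (series_const A (x 0)) \<oplus>\<^bsub>HB\<^esub> fps_X \<odot>\<^bsub>HB\<^esub> h (\<lambda>n. x (Suc n))"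
    if "h \<in> linear_maps HA HB" "x \<in> carrier HA" for h x
    by (subst A.series_decompose[OF that(2)])
      (simp add: that A.shift_carrier linear_maps_add[OF that(1)] linear_maps_smult[OF that(1)])
  have "f x n = g x n" for n
    using x
  proof (induction n arbitrary: x)
    case 0
    then show ?case
      using unfold[OF f 0] unfold[OF g 0] linear_maps_closed[OF f] linear_maps_closed[OF g]
      by (simp add: eq B.H_simps A.shift_carrier)
  next
    case (Suc n)
    then show ?case
      using unfold[OF f Suc.prems] unfold[OF g Suc.prems] linear_maps_closed[OF f]
        linear_maps_closed[OF g] Suc.IH[OF A.shift_carrier[OF Suc.prems]]
      by (simp add: eq B.H_simps A.shift_carrier)
  qed
  then show ?thesis
    by blast
qed

lemma linear_maps_tsum:
  assumes f: "f \<in> linear_maps HA HB" and x: "\<And>i. x i \<in> carrier HA"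
  shows "f (series_tsum A x) = series_tsum B (\<lambda>i. f (x i))"
proof -
  have "f (series_tsum A x) n = series_tsum B (\<lambda>i. f (x i)) n" for n
    using x
  proof (induction n arbitrary: x)
    case 0
    then show ?case
      using linear_maps_closed[OF f]
      by (subst A.tsum_unfold, simp, subst B.tsum_unfold, simp)
        (simp add: linear_maps_add[OF f] linear_maps_smult[OF f] B.H_simps)
  next
    case (Suc n)
    then show ?case
      using linear_maps_closed[OF f]
      by (subst A.tsum_unfold, simp, subst B.tsum_unfold, simp)
        (simp add: linear_maps_add[OF f] linear_maps_smult[OF f] B.H_simps)
  qed
  then show ?thesis
    by blast
qed

end

text \<open>
  A linear map \<open>A \<rightarrow> C[[t]]\<close> extends uniquely to an \<open>'f[[t]]\<close>-linear map \<open>A[[t]] \<rightarrow> C[[t]]\<close>.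
\<close>

definition formal_maps :: "('f::field, 'a) module \<Rightarrow> ('f, 'c) module \<Rightarrow> ('a \<Rightarrow> nat \<Rightarrow> 'c) set" where
  "formal_maps A C = {\<phi>. \<phi> \<in> carrier A \<rightarrow> carrier (series_algebra C) \<and>
    (\<forall>a\<in>carrier A. \<forall>b\<in>carrier A. \<phi> (a \<oplus>\<^bsub>A\<^esub> b) = \<phi> a \<oplus>\<^bsub>series_algebra C\<^esub> \<phi> b) \<and>
    (\<forall>s. \<forall>a\<in>carrier A. \<phi> (s \<odot>\<^bsub>A\<^esub> a) = fps_const s \<odot>\<^bsub>series_algebra C\<^esub> \<phi> a)}"

definition series_extension ::
    "('f, 'c) module \<Rightarrow> ('a \<Rightarrow> nat \<Rightarrow> 'c) \<Rightarrow> (nat \<Rightarrow> 'a) \<Rightarrow> nat \<Rightarrow> 'c" where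
  "series_extension C \<phi> x = series_tsum C (\<lambda>k. \<phi> (x k))"

lemma formal_mapsI:
  assumes "\<And>a. a \<in> carrier A \<Longrightarrow> \<phi> a \<in> carrier (series_algebra C)"
    and "\<And>a b. a \<in> carrier A \<Longrightarrow> b \<in> carrier A \<Longrightarrow>
      \<phi> (a \<oplus>\<^bsub>A\<^esub> b) = \<phi> a \<oplus>\<^bsub>series_algebra C\<^esub> \<phi> b"
    and "\<And>s a. a \<in> carrier A \<Longrightarrow> \<phi> (s \<odot>\<^bsub>A\<^esub> a) = fps_const s \<odot>\<^bsub>series_algebra C\<^esub> \<phi> a"
  shows "\<phi> \<in> formal_maps A C"
  using assms by (auto simp: formal_maps_def)

lemma formal_maps_closed: "\<phi> \<in> formal_maps A C \<Longrightarrow> a \<in> carrier A \<Longrightarrow> \<phi> a \<in> carrier (series_algebra C)"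
  by (auto simp: formal_maps_def)

lemma formal_maps_add:
  "\<phi> \<in> formal_maps A C \<Longrightarrow> a \<in> carrier A \<Longrightarrow> b \<in> carrier A \<Longrightarrow>
    \<phi> (a \<oplus>\<^bsub>A\<^esub> b) = \<phi> a \<oplus>\<^bsub>series_algebra C\<^esub> \<phi> b"
  by (auto simp: formal_maps_def)

lemma formal_maps_smult:
  "\<phi> \<in> formal_maps A C \<Longrightarrow> a \<in> carrier A \<Longrightarrow>
    \<phi> (s \<odot>\<^bsub>A\<^esub> a) = fps_const s \<odot>\<^bsub>series_algebra C\<^esub> \<phi> a"
  by (auto simp: formal_maps_def)

context series_pair
begin

lemma formal_maps_zero: "\<phi> \<in> formal_maps A B \<Longrightarrow> \<phi> \<zero>\<^bsub>A\<^esub> = \<zero>\<^bsub>HB\<^esub>"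
  using formal_maps_smult[of \<phi> A B "\<zero>\<^bsub>A\<^esub>" 0] by (simp add: formal_maps_closed)

lemma linear_maps_restrict:
  "f \<in> linear_maps HA HB \<Longrightarrow> (\<lambda>a. f (series_const A a)) \<in> formal_maps A B"
  by (rule formal_mapsI)
    (simp_all add: linear_maps_closed A.const_simps linear_maps_add linear_maps_smult)

lemma linear_maps_coefficientwise:
  assumes "\<phi> \<in> linear_maps A B"
  shows "(\<lambda>x n. \<phi> (x n)) \<in> linear_maps HA HB"
proof (rule series_linear_mapsI)
  interpret algebra_pair A B ..
  fix x assume x: "x \<in> carrier HA"
  then show carr: "(\<lambda>n. \<phi> (x n)) \<in> carrier HB"
    using assms by (simp add: B.carrier_iff linear_maps_closed)
  show "(\<lambda>n. \<phi> ((fps_X \<odot>\<^bsub>HA\<^esub> x) n)) = fps_X \<odot>\<^bsub>HB\<^esub> (\<lambda>n. \<phi> (x n))"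
  proof
    fix n
    show "\<phi> ((fps_X \<odot>\<^bsub>HA\<^esub> x) n) = (fps_X \<odot>\<^bsub>HB\<^esub> (\<lambda>n. \<phi> (x n))) n"
      using x carr assms by (cases n) (simp_all add: linear_maps_zero)
  qed
  fix c
  show "(\<lambda>n. \<phi> ((fps_const c \<odot>\<^bsub>HA\<^esub> x) n)) = fps_const c \<odot>\<^bsub>HB\<^esub> (\<lambda>n. \<phi> (x n))"
    using x carr assms by (simp add: fun_eq_iff A.smult_const_coeff B.smult_const_coeff linear_maps_smult)
next
  fix x y assume "x \<in> carrier HA" "y \<in> carrier HA"
  then show "(\<lambda>n. \<phi> ((x \<oplus>\<^bsub>HA\<^esub> y) n)) = (\<lambda>n. \<phi> (x n)) \<oplus>\<^bsub>HB\<^esub> (\<lambda>n. \<phi> (y n))"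
    using assms by (simp add: A.H_simps B.H_simps linear_maps_add)
qed

context
  fixes \<phi> assumes \<phi>: "\<phi> \<in> formal_maps A B"
begin

lemma extension_linear: "series_extension B \<phi> \<in> linear_maps HA HB"
proof (rule series_linear_mapsI)
  fix x assume x: "x \<in> carrier HA"
  then have closed: "\<phi> (x k) \<in> carrier HB" for k
    using \<phi> by (simp add: formal_maps_closed)
  then show "series_extension B \<phi> x \<in> carrier HB"
    by (simp add: series_extension_def)
  have xX: "fps_X \<odot>\<^bsub>HA\<^esub> x \<in> carrier HA"
    using x by simp
  show "series_extension B \<phi> (fps_X \<odot>\<^bsub>HA\<^esub> x) = fps_X \<odot>\<^bsub>HB\<^esub> series_extension B \<phi> x"
    unfolding series_extension_def
    using x xX closed \<phi> by (subst B.tsum_unfold) (simp_all add: formal_maps_closed formal_maps_zero)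
  interpret BB: series_pair B B ..
  fix c
  have lin: "(\<lambda>y. fps_const c \<odot>\<^bsub>HB\<^esub> y) \<in> linear_maps HB HB"
    by (rule linear_mapsI) (simp_all add: B.H.smult_r_distr B.H.smult_smult mult.commute)
  show "series_extension B \<phi> (fps_const c \<odot>\<^bsub>HA\<^esub> x) = fps_const c \<odot>\<^bsub>HB\<^esub> series_extension B \<phi> x"
    unfolding series_extension_def
    using x closed \<phi> by (simp add: BB.linear_maps_tsum[OF lin] A.smult_const_coeff formal_maps_smult)
next
  fix x y assume "x \<in> carrier HA" "y \<in> carrier HA"
  then show "series_extension B \<phi> (x \<oplus>\<^bsub>HA\<^esub> y) = series_extension B \<phi> x \<oplus>\<^bsub>HB\<^esub> series_extension B \<phi> y"
    unfolding series_extension_def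
    using \<phi> by (simp add: A.H_simps formal_maps_add B.tsum_add formal_maps_closed)
qed

lemma extension_const:
  assumes "a \<in> carrier A"
  shows "series_extension B \<phi> (series_const A a) = \<phi> a"
proof -
  have "series_tsum B (\<lambda>k. \<zero>\<^bsub>HB\<^esub>) = \<zero>\<^bsub>HB\<^esub>"
    by (simp add: fun_eq_iff B.tsum_coeff B.H_simps)
  then show ?thesis
    unfolding series_extension_def using assms \<phi>
    by (subst B.tsum_unfold) (simp_all add: A.const_coeff formal_maps_closed formal_maps_zero)
qed

end
end

section \<open>Derivatives and linear differential equations\<close>

definition series_deriv :: "('f::field, 'a) module \<Rightarrow> (nat \<Rightarrow> 'a) \<Rightarrow> nat \<Rightarrow> 'a" where
  "series_deriv A x = (\<lambda>n. of_nat (Suc n) \<odot>\<^bsub>A\<^esub> x (Suc n))"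

context series_over
begin

abbreviation deriv where "deriv \<equiv> series_deriv A"

lemma deriv_closed [simp, intro]: "x \<in> carrier H \<Longrightarrow> deriv x \<in> carrier H"
  by (simp add: carrier_iff series_deriv_def)

lemma deriv_add:
  "x \<in> carrier H \<Longrightarrow> y \<in> carrier H \<Longrightarrow> deriv (x \<oplus>\<^bsub>H\<^esub> y) = deriv x \<oplus>\<^bsub>H\<^esub> deriv y"
  by (simp add: fun_eq_iff series_deriv_def H_simps smult_r_distr)

lemma deriv_smult_const:
  "x \<in> carrier H \<Longrightarrow> deriv (fps_const c \<odot>\<^bsub>H\<^esub> x) = fps_const c \<odot>\<^bsub>H\<^esub> deriv x"
  by (simp add: fun_eq_iff smult_const_coeff deriv_closed)
    (simp add: series_deriv_def smult_const_coeff smult_smult mult.commute)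

lemma deriv_a_inv: "x \<in> carrier H \<Longrightarrow> deriv (\<ominus>\<^bsub>H\<^esub> x) = \<ominus>\<^bsub>H\<^esub> deriv x"
  by (simp add: fun_eq_iff a_inv_coeff) (simp add: series_deriv_def a_inv_coeff smult_a_inv)

lemma deriv_const: "deriv (const a) = \<zero>\<^bsub>H\<^esub>"
  by (simp add: fun_eq_iff series_deriv_def const_coeff H_simps)

lemma deriv_one: "deriv \<one>\<^bsub>H\<^esub> = \<zero>\<^bsub>H\<^esub>"
  by (simp add: H_simps(3) deriv_const)

lemma deriv_const_mult:
  "a \<in> carrier A \<Longrightarrow> x \<in> carrier H \<Longrightarrow> deriv (const a \<otimes>\<^bsub>H\<^esub> x) = const a \<otimes>\<^bsub>H\<^esub> deriv x"
  by (simp add: mult_const_left) (simp add: series_deriv_def)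

lemma deriv_X:
  assumes "x \<in> carrier H"
  shows "deriv (fps_X \<odot>\<^bsub>H\<^esub> x) = x \<oplus>\<^bsub>H\<^esub> fps_X \<odot>\<^bsub>H\<^esub> deriv x"
proof
  fix n
  show "deriv (fps_X \<odot>\<^bsub>H\<^esub> x) n = (x \<oplus>\<^bsub>H\<^esub> fps_X \<odot>\<^bsub>H\<^esub> deriv x) n"
  proof (cases n)
    case (Suc m)
    have "of_nat (Suc (Suc m)) \<odot> x (Suc m) = (1 + of_nat (Suc m)) \<odot> x (Suc m)"
      by simp
    with assms Suc show ?thesis
      by (simp only: smult_l_distr coeff_closed smult_one H_simps smult_X_Suc deriv_closed)
        (simp add: series_deriv_def smult_l_distr)
  qed (use assms in \<open>simp add: H_simps\<close>, use assms in \<open>simp add: series_deriv_def\<close>)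
qed

lemma tsum_index:
  assumes "\<And>i. x i \<in> carrier H"
  shows "tsum (\<lambda>i. fps_const (of_nat i) \<odot>\<^bsub>H\<^esub> x i) =
    fps_X \<odot>\<^bsub>H\<^esub> tsum (\<lambda>i. fps_const (of_nat (Suc i)) \<odot>\<^bsub>H\<^esub> x (Suc i))"
  by (subst tsum_unfold) (use assms in \<open>auto simp: H.l_zero\<close>)

text \<open>The product rule for x_i t^i, summed over i: the first sum differentiates the series
  x_i, the second the powers of t after a shift of the index.\<close>

lemma deriv_tsum:
  assumes "\<And>i. x i \<in> carrier H"
  shows "deriv (tsum x) = tsum (\<lambda>i. deriv (x i)) \<oplus>\<^bsub>H\<^esub>
    tsum (\<lambda>i. fps_const (of_nat (Suc i)) \<odot>\<^bsub>H\<^esub> x (Suc i))"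
proof -
  let ?k = "\<lambda>i. fps_const (of_nat i) :: 'f fps"
  define A1 where "A1 = (\<lambda>x. tsum (\<lambda>i. deriv (x i)))"
  define A2 where "A2 = (\<lambda>x. tsum (\<lambda>i. ?k (Suc i) \<odot>\<^bsub>H\<^esub> x (Suc i)))"
  have "deriv (tsum x) n = (A1 x \<oplus>\<^bsub>H\<^esub> A2 x) n" for n
    using assms
  proof (induction n arbitrary: x rule: less_induct)
    case (less n)
    define x' where "x' = (\<lambda>i. x (Suc i))"
    have x': "x' i \<in> carrier H" for i
      using less.prems by (simp add: x'_def)
    have closed: "A1 x' \<in> carrier H" "A2 x' \<in> carrier H" "A1 x \<in> carrier H" "A2 x \<in> carrier H"
        "tsum x' \<in> carrier H"
      using less.prems x' by (auto simp: A1_def A2_def)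
    have "deriv (tsum x) = deriv (x 0) \<oplus>\<^bsub>H\<^esub> (tsum x' \<oplus>\<^bsub>H\<^esub> fps_X \<odot>\<^bsub>H\<^esub> deriv (tsum x'))"
      using less.prems closed
      by (subst tsum_unfold) (simp_all add: deriv_add deriv_X x'_def[symmetric])
    moreover have "(fps_X \<odot>\<^bsub>H\<^esub> deriv (tsum x')) n = (fps_X \<odot>\<^bsub>H\<^esub> (A1 x' \<oplus>\<^bsub>H\<^esub> A2 x')) n"
      using closed less.IH[of "n - 1" x'] x' by (cases n) simp_all
    moreover have "A1 x = deriv (x 0) \<oplus>\<^bsub>H\<^esub> fps_X \<odot>\<^bsub>H\<^esub> A1 x'"
      unfolding A1_def x'_def using less.prems by (subst tsum_unfold) auto
    \<comment> \<open>Splitting the factor i + 1 into 1 and i gives the sum of the shifted terms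
      plus a copy of the same expression for \<open>x'\<close>, multiplied by t.\<close>
    moreover have "A2 x = tsum x' \<oplus>\<^bsub>H\<^esub> fps_X \<odot>\<^bsub>H\<^esub> A2 x'"
    proof -
      have "A2 x = tsum (\<lambda>i. x' i \<oplus>\<^bsub>H\<^esub> ?k i \<odot>\<^bsub>H\<^esub> x' i)"
        unfolding A2_def x'_def using less.prems
        by (intro arg_cong[where f = tsum] ext)
          (simp add: fps_const_add[symmetric] H.smult_l_distr del: fps_const_add)
      also have "\<dots> = tsum x' \<oplus>\<^bsub>H\<^esub> fps_X \<odot>\<^bsub>H\<^esub> A2 x'"
        using x' by (simp add: tsum_add tsum_index A2_def)
      finally show ?thesis .
    qed
    moreover have "deriv (x 0) \<in> carrier H"
      using less.prems by simp
    ultimately show ?case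
      using closed by (simp add: H.smult_r_distr) (simp add: H_simps a_ac)
  qed
  then show ?thesis
    by (simp add: A1_def A2_def fun_eq_iff)
qed

lemma mult_right_linear: "y \<in> carrier H \<Longrightarrow> (\<lambda>x. x \<otimes>\<^bsub>H\<^esub> y) \<in> linear_maps H H"
  by (rule linear_mapsI) (simp_all add: H.l_distr)

lemma mult_left_linear: "y \<in> carrier H \<Longrightarrow> (\<lambda>x. y \<otimes>\<^bsub>H\<^esub> x) \<in> linear_maps H H"
  by (rule linear_mapsI) (simp_all add: H.r_distr)

lemma smult_linear: "(\<lambda>x. c \<odot>\<^bsub>H\<^esub> x) \<in> linear_maps H H"
  by (rule linear_mapsI) (simp_all add: H.smult_r_distr H.smult_smult mult.commute)

lemma tsum_linear:
  assumes "f \<in> linear_maps H H" "\<And>i. x i \<in> carrier H"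
  shows "f (tsum x) = tsum (\<lambda>i. f (x i))"
proof -
  interpret series_pair A A ..
  show ?thesis
    by (rule linear_maps_tsum[OF assms])
qed

text \<open>Expanding x as the t-adic sum of its constant coefficients leaves only products of a
  constant with y, for which differentiation passes through; \<open>deriv_tsum\<close> then yields
  both terms of the Leibniz rule.\<close>

lemma deriv_mult:
  assumes x: "x \<in> carrier H" and y: "y \<in> carrier H"
  shows "deriv (x \<otimes>\<^bsub>H\<^esub> y) = deriv x \<otimes>\<^bsub>H\<^esub> y \<oplus>\<^bsub>H\<^esub> x \<otimes>\<^bsub>H\<^esub> deriv y"
proof -
  have dx: "deriv x = tsum (\<lambda>i. fps_const (of_nat (Suc i)) \<odot>\<^bsub>H\<^esub> const (x (Suc i)))"
  proof -
    have "deriv x = tsum (\<lambda>i. const (deriv x i))"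
      using x by (simp add: tsum_const)
    also have "\<dots> = tsum (\<lambda>i. fps_const (of_nat (Suc i)) \<odot>\<^bsub>H\<^esub> const (x (Suc i)))"
      using x by (simp add: series_deriv_def const_simps)
    finally show ?thesis .
  qed
  have prod: "x \<otimes>\<^bsub>H\<^esub> z = tsum (\<lambda>i. const (x i) \<otimes>\<^bsub>H\<^esub> z)" if "z \<in> carrier H" for z
    using tsum_linear[OF mult_right_linear[OF that], of "\<lambda>i. const (x i)"] x by (simp add: tsum_const)
  have "deriv x \<otimes>\<^bsub>H\<^esub> y = tsum (\<lambda>i. fps_const (of_nat (Suc i)) \<odot>\<^bsub>H\<^esub> (const (x (Suc i)) \<otimes>\<^bsub>H\<^esub> y))"
    unfolding dx using x y by (subst tsum_linear[OF mult_right_linear[OF y]]) simp_all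
  moreover have "deriv (x \<otimes>\<^bsub>H\<^esub> y) = tsum (\<lambda>i. const (x i) \<otimes>\<^bsub>H\<^esub> deriv y) \<oplus>\<^bsub>H\<^esub>
      tsum (\<lambda>i. fps_const (of_nat (Suc i)) \<odot>\<^bsub>H\<^esub> (const (x (Suc i)) \<otimes>\<^bsub>H\<^esub> y))"
    unfolding prod[OF y] using x y by (simp add: deriv_tsum deriv_const_mult)
  ultimately show ?thesis
    using x y by (simp add: prod H.a_comm)
qed

end

lemma (in series_pair) deriv_extension:
  assumes \<phi>: "\<phi> \<in> formal_maps A B" and x: "x \<in> carrier HA"
  shows "series_deriv B (series_extension B \<phi> x) =
    series_extension B (\<lambda>a. series_deriv B (\<phi> a)) x \<oplus>\<^bsub>HB\<^esub> series_extension B \<phi> (series_deriv A x)"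
  using x formal_maps_closed[OF \<phi>]
  by (simp add: series_extension_def B.deriv_tsum)
    (simp add: series_deriv_def formal_maps_smult[OF \<phi>])

lemma (in series_pair) deriv_formal_map:
  assumes \<phi>: "\<phi> \<in> formal_maps A B"
  shows "(\<lambda>a. series_deriv B (\<phi> a)) \<in> formal_maps A B"
  by (rule formal_mapsI)
    (simp_all add: formal_maps_closed[OF \<phi>] formal_maps_add[OF \<phi>] formal_maps_smult[OF \<phi>]
      B.deriv_add B.deriv_smult_const)

text \<open>Coefficient m + 1 depends on all earlier ones, so the recursion carries a whole
  sequence. Entries beyond the computed prefix hold the dummy value \<open>z\<close>: it keeps the
  sequence in the carrier, and by \<open>mult_cong\<close> it does not influence coefficient m of
  the two products.\<close>

primrec flow_prefix :: "('f::field, 'a) module \<Rightarrow> (nat \<Rightarrow> 'a) \<Rightarrow> 'a \<Rightarrow> nat \<Rightarrow> nat \<Rightarrow> 'a" where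
  "flow_prefix A P z 0 = (\<lambda>_. z)"
| "flow_prefix A P z (Suc m) = (flow_prefix A P z m)
    (Suc m := (1 / of_nat (Suc m)) \<odot>\<^bsub>A\<^esub> (P \<otimes>\<^bsub>series_algebra A\<^esub> flow_prefix A P z m
      \<ominus>\<^bsub>series_algebra A\<^esub> flow_prefix A P z m \<otimes>\<^bsub>series_algebra A\<^esub> P) m)"

text \<open>The solution \<open>Y\<close> of \<open>Y' = P Y - Y P\<close> with \<open>Y(0) = z\<close>.\<close>

definition flow :: "('f::field, 'a) module \<Rightarrow> (nat \<Rightarrow> 'a) \<Rightarrow> 'a \<Rightarrow> nat \<Rightarrow> 'a" where
  "flow A P z n = flow_prefix A P z n n"

section \<open>Existence and uniqueness for linear differential equations in characteristic
  0\<close>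

locale series_over_char_0 = series_over A
  for A :: "('f::field_char_0, 'a) module" (structure)
begin

text \<open>Coefficient n of the derivative is (n + 1) times coefficient n + 1 of the series, and n
  + 1 is invertible. Agreement up to n thus propagates to n + 1 whenever the equation determines the
  derivative from earlier coefficients.\<close>

lemma deriv_eq_imp_eq:
  assumes Y: "Y \<in> carrier H" and Z: "Z \<in> carrier H" and "Y 0 = Z 0"
    and step: "\<And>n. (\<And>k. k \<le> n \<Longrightarrow> Y k = Z k) \<Longrightarrow> deriv Y n = deriv Z n"
  shows "Y = Z"
proof
  fix n
  show "Y n = Z n"
  proof (induction n rule: less_induct)
    case (less n)
    show ?case
    proof (cases n)
      case (Suc m)
      have "(1 / of_nat (Suc m)) \<odot> deriv Y m = (1 / of_nat (Suc m)) \<odot> deriv Z m"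
        using step[of m] less Suc by simp
      moreover have "(1 / of_nat (Suc m)) \<odot> deriv X m = X (Suc m)" if "X \<in> carrier H" for X
        using that by (simp add: series_deriv_def smult_smult del: of_nat_Suc)
      ultimately show ?thesis
        using Suc Y Z by simp
    qed (use assms in simp)
  qed
qed

text \<open>Two terms with independent left and right factors cover the commutator equation as well
  as the two equations behind the antipode axioms, which are not of commutator type.\<close>

lemma linear_ode_unique:
  assumes "Y \<in> carrier H" "Z \<in> carrier H" "P \<in> carrier H" "P' \<in> carrier H" "Q \<in> carrier H" "Q' \<in> carrier H"
    and "Y 0 = Z 0"
    and "deriv Y = P \<otimes>\<^bsub>H\<^esub> (Y \<otimes>\<^bsub>H\<^esub> P') \<oplus>\<^bsub>H\<^esub> Q \<otimes>\<^bsub>H\<^esub> (Y \<otimes>\<^bsub>H\<^esub> Q')"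
    and "deriv Z = P \<otimes>\<^bsub>H\<^esub> (Z \<otimes>\<^bsub>H\<^esub> P') \<oplus>\<^bsub>H\<^esub> Q \<otimes>\<^bsub>H\<^esub> (Z \<otimes>\<^bsub>H\<^esub> Q')"
  shows "Y = Z"
proof (rule deriv_eq_imp_eq[OF assms(1,2,7)])
  fix n assume eq: "\<And>k. k \<le> n \<Longrightarrow> Y k = Z k"
  have "(Q \<otimes>\<^bsub>H\<^esub> (Y \<otimes>\<^bsub>H\<^esub> Q')) n = (Q \<otimes>\<^bsub>H\<^esub> (Z \<otimes>\<^bsub>H\<^esub> Q')) n"
    if "Q \<in> carrier H" "Q' \<in> carrier H" for Q Q'
  proof (rule mult_cong)
    fix k assume "k \<le> n"
    then show "(Y \<otimes>\<^bsub>H\<^esub> Q') k = (Z \<otimes>\<^bsub>H\<^esub> Q') k"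
      by (intro mult_cong) (use assms eq that in simp_all)
  qed (use assms that in simp_all)
  then show "deriv Y n = deriv Z n"
    using assms(3-6) by (simp add: assms(8,9) H_simps)
qed

lemma commutator_ode_unique:
  assumes "Y \<in> carrier H" "Z \<in> carrier H" "P \<in> carrier H" "Y 0 = Z 0"
    and "deriv Y = P \<otimes>\<^bsub>H\<^esub> Y \<ominus>\<^bsub>H\<^esub> Y \<otimes>\<^bsub>H\<^esub> P" "deriv Z = P \<otimes>\<^bsub>H\<^esub> Z \<ominus>\<^bsub>H\<^esub> Z \<otimes>\<^bsub>H\<^esub> P"
  shows "Y = Z"
  by (rule linear_ode_unique[of Y Z P "\<one>\<^bsub>H\<^esub>" "\<ominus>\<^bsub>H\<^esub> \<one>\<^bsub>H\<^esub>" P])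
    (use assms in \<open>simp_all add: a_minus_def H.l_minus\<close>)

context
  fixes P assumes P: "P \<in> carrier H"
begin

lemma flow_prefix_closed: "z \<in> carrier A \<Longrightarrow> flow_prefix A P z m \<in> carrier H"
proof (induction m)
  case (Suc m)
  then have "P \<otimes>\<^bsub>H\<^esub> flow_prefix A P z m \<ominus>\<^bsub>H\<^esub> flow_prefix A P z m \<otimes>\<^bsub>H\<^esub> P \<in> carrier H"
    using P by simp
  with Suc show ?case
    by (auto simp: carrier_iff)
qed (simp add: carrier_iff)

lemma flow_prefix_stable: "k \<le> m \<Longrightarrow> flow_prefix A P z m k = flow A P z k"
  by (induction m) (auto simp: flow_def le_Suc_eq)

lemma flow_closed [simp, intro]: "z \<in> carrier A \<Longrightarrow> flow A P z \<in> carrier H"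
  using flow_prefix_closed by (simp add: flow_def carrier_iff)

lemma flow_0: "flow A P z 0 = z"
  by (simp add: flow_def)

lemma deriv_flow:
  assumes z: "z \<in> carrier A"
  shows "deriv (flow A P z) = P \<otimes>\<^bsub>H\<^esub> flow A P z \<ominus>\<^bsub>H\<^esub> flow A P z \<otimes>\<^bsub>H\<^esub> P"
proof
  fix n
  let ?p = "flow_prefix A P z n"
  have p: "?p \<in> carrier H"
    by (rule flow_prefix_closed[OF z])
  have "deriv (flow A P z) n = (P \<otimes>\<^bsub>H\<^esub> ?p \<ominus>\<^bsub>H\<^esub> ?p \<otimes>\<^bsub>H\<^esub> P) n"
    using P p by (simp add: series_deriv_def flow_def smult_smult del: of_nat_Suc)
  moreover have "(P \<otimes>\<^bsub>H\<^esub> ?p) n = (P \<otimes>\<^bsub>H\<^esub> flow A P z) n" "(?p \<otimes>\<^bsub>H\<^esub> P) n = (flow A P z \<otimes>\<^bsub>H\<^esub> P) n"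
    by (rule mult_cong; use P z flow_prefix_stable in simp)+
  ultimately show "deriv (flow A P z) n = (P \<otimes>\<^bsub>H\<^esub> flow A P z \<ominus>\<^bsub>H\<^esub> flow A P z \<otimes>\<^bsub>H\<^esub> P) n"
    using P p z by (simp add: minus_coeff)
qed

lemma flow_eqI:
  assumes "z \<in> carrier A" "Y \<in> carrier H" "Y 0 = z" "deriv Y = P \<otimes>\<^bsub>H\<^esub> Y \<ominus>\<^bsub>H\<^esub> Y \<otimes>\<^bsub>H\<^esub> P"
  shows "flow A P z = Y"
  by (rule commutator_ode_unique) (use assms P flow_0 deriv_flow in auto)

lemma flow_add:
  assumes "z \<in> carrier A" "w \<in> carrier A"
  shows "flow A P (z \<oplus> w) = flow A P z \<oplus>\<^bsub>H\<^esub> flow A P w"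
proof (rule flow_eqI)
  show "(flow A P z \<oplus>\<^bsub>H\<^esub> flow A P w) 0 = z \<oplus> w"
    by (simp add: H_simps flow_0)
  have "flow A P z \<in> carrier H" "flow A P w \<in> carrier H"
    using assms by simp_all
  then show "deriv (flow A P z \<oplus>\<^bsub>H\<^esub> flow A P w) =
      P \<otimes>\<^bsub>H\<^esub> (flow A P z \<oplus>\<^bsub>H\<^esub> flow A P w) \<ominus>\<^bsub>H\<^esub> (flow A P z \<oplus>\<^bsub>H\<^esub> flow A P w) \<otimes>\<^bsub>H\<^esub> P"
    using P assms by (simp add: deriv_add deriv_flow a_minus_def H.l_distr H.r_distr H.minus_add H.a_ac)
qed (use assms in auto)

lemma flow_smult:
  assumes "z \<in> carrier A"
  shows "flow A P (c \<odot> z) = fps_const c \<odot>\<^bsub>H\<^esub> flow A P z"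
proof (rule flow_eqI)
  show "(fps_const c \<odot>\<^bsub>H\<^esub> flow A P z) 0 = c \<odot> z"
    using assms by (simp add: smult_const_coeff flow_0)
  show "deriv (fps_const c \<odot>\<^bsub>H\<^esub> flow A P z) =
      P \<otimes>\<^bsub>H\<^esub> (fps_const c \<odot>\<^bsub>H\<^esub> flow A P z) \<ominus>\<^bsub>H\<^esub> (fps_const c \<odot>\<^bsub>H\<^esub> flow A P z) \<otimes>\<^bsub>H\<^esub> P"
    using P assms by (simp add: deriv_smult_const deriv_flow H.smult_minus)
qed (use assms in auto)

text \<open>The bracket with P is a derivation, so the product of two solutions is again a solution.
  This replaces the remark that conjugation by the twist is multiplicative.\<close>

lemma flow_mult:
  assumes z: "z \<in> carrier A" and w: "w \<in> carrier A"
  shows "flow A P (z \<otimes> w) = flow A P z \<otimes>\<^bsub>H\<^esub> flow A P w"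
proof (rule flow_eqI)
  show "(flow A P z \<otimes>\<^bsub>H\<^esub> flow A P w) 0 = z \<otimes> w"
    using assms by (simp add: mult_0 flow_0)
  have closed: "flow A P z \<in> carrier H" "flow A P w \<in> carrier H"
    using assms by simp_all
  then show "deriv (flow A P z \<otimes>\<^bsub>H\<^esub> flow A P w) =
      P \<otimes>\<^bsub>H\<^esub> (flow A P z \<otimes>\<^bsub>H\<^esub> flow A P w) \<ominus>\<^bsub>H\<^esub> (flow A P z \<otimes>\<^bsub>H\<^esub> flow A P w) \<otimes>\<^bsub>H\<^esub> P"
    using P assms
    by (simp add: deriv_mult deriv_flow a_minus_def H.l_distr H.r_distr H.l_minus H.r_minus
        H.m_assoc H.a_assoc H.r_neg1)
qed (use assms in auto)

lemma flow_one: "flow A P \<one> = \<one>\<^bsub>H\<^esub>"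
  by (rule flow_eqI) (use P in \<open>simp_all add: deriv_one a_minus_def H.r_neg\<close>, simp add: H_simps const_coeff)

end
end

lemma (in series_pair) algebra_hom_coefficientwise:
  assumes \<phi>: "\<phi> \<in> algebra_homs A B"
  shows "(\<lambda>x n. \<phi> (x n)) \<in> algebra_homs HA HB"
proof (rule algebra_homsI)
  interpret algebra_pair A B ..
  note lin = algebra_homs_linear[OF \<phi>]
  show "(\<lambda>x n. \<phi> (x n)) \<in> linear_maps HA HB"
    by (rule linear_maps_coefficientwise[OF lin])
  fix x y assume xy: "x \<in> carrier HA" "y \<in> carrier HA"
  show "(\<lambda>n. \<phi> ((x \<otimes>\<^bsub>HA\<^esub> y) n)) = (\<lambda>n. \<phi> (x n)) \<otimes>\<^bsub>HB\<^esub> (\<lambda>n. \<phi> (y n))"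
  proof
    fix n
    have "(\<lambda>i. x i \<otimes>\<^bsub>A\<^esub> y (n - i)) \<in> {..n} \<rightarrow> carrier A"
      using xy by auto
    then show "\<phi> ((x \<otimes>\<^bsub>HA\<^esub> y) n) = ((\<lambda>n. \<phi> (x n)) \<otimes>\<^bsub>HB\<^esub> (\<lambda>n. \<phi> (y n))) n"
      using xy by (simp add: A.mult_coeff B.mult_coeff linear_maps_finsum[OF lin] algebra_homs_mult[OF \<phi>])
  qed
next
  interpret algebra_pair A B ..
  show "(\<lambda>n. \<phi> (\<one>\<^bsub>HA\<^esub> n)) = \<one>\<^bsub>HB\<^esub>"
    by (simp add: fun_eq_iff A.H_simps B.H_simps A.const_coeff B.const_coeff
        algebra_homs_one[OF \<phi>] linear_maps_zero[OF algebra_homs_linear[OF \<phi>]])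
qed

lemma (in series_pair) algebra_hom_extension:
  assumes \<phi>: "\<phi> \<in> formal_maps A B"
    and mult: "\<And>a b. a \<in> carrier A \<Longrightarrow> b \<in> carrier A \<Longrightarrow> \<phi> (a \<otimes>\<^bsub>A\<^esub> b) = \<phi> a \<otimes>\<^bsub>HB\<^esub> \<phi> b"
    and one: "\<phi> \<one>\<^bsub>A\<^esub> = \<one>\<^bsub>HB\<^esub>"
  shows "series_extension B \<phi> \<in> algebra_homs HA HB"
proof (rule algebra_homsI)
  let ?f = "series_extension B \<phi>"
  note lin = extension_linear[OF \<phi>]
  note f = linear_maps_closed[OF lin] extension_const[OF \<phi>]
  show "?f \<in> linear_maps HA HB"
    by (rule lin)
  fix x y assume x: "x \<in> carrier HA" and y: "y \<in> carrier HA"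
  show "?f (x \<otimes>\<^bsub>HA\<^esub> y) = ?f x \<otimes>\<^bsub>HB\<^esub> ?f y"
  proof (rule linear_maps_eq_on_const[OF _ _ _ x])
    show "(\<lambda>x. ?f (x \<otimes>\<^bsub>HA\<^esub> y)) \<in> linear_maps HA HB"
      by (rule linear_maps_comp[OF lin A.mult_right_linear[OF y]])
    show "(\<lambda>x. ?f x \<otimes>\<^bsub>HB\<^esub> ?f y) \<in> linear_maps HA HB"
      by (rule linear_maps_comp[OF B.mult_right_linear lin]) (rule f(1)[OF y])
    fix a assume a: "a \<in> carrier A"
    show "?f (series_const A a \<otimes>\<^bsub>HA\<^esub> y) = ?f (series_const A a) \<otimes>\<^bsub>HB\<^esub> ?f y"
    proof (rule linear_maps_eq_on_const[OF _ _ _ y])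
      show "(\<lambda>y. ?f (series_const A a \<otimes>\<^bsub>HA\<^esub> y)) \<in> linear_maps HA HB"
        by (rule linear_maps_comp[OF lin A.mult_left_linear]) (use a in simp)
      show "(\<lambda>y. ?f (series_const A a) \<otimes>\<^bsub>HB\<^esub> ?f y) \<in> linear_maps HA HB"
        by (rule linear_maps_comp[OF B.mult_left_linear lin]) (use a f(2) formal_maps_closed[OF \<phi>] in simp)
    qed (use a mult in \<open>simp add: A.const_simps(2)[symmetric] f(2)\<close>)
  qed
qed (simp add: A.const_simps(5)[symmetric] extension_const[OF \<phi>] one)

lemma (in series_pair) linear_maps_coeff_0:
  assumes f: "f \<in> linear_maps HA HB" and x: "x \<in> carrier HA"
  shows "f x 0 = f (series_const A (x 0)) 0"
  using linear_maps_closed[OF f]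
  by (subst A.series_decompose[OF x])
    (simp add: x A.shift_carrier linear_maps_add[OF f] linear_maps_smult[OF f] B.H_simps)

text \<open>A chain rule for a linear map that itself depends on t: \<open>g\<close> is the
  derivative of \<open>f\<close> in t, tested on constant arguments, and the other term
  differentiates the argument.\<close>

lemma (in series_pair) deriv_linear_map:
  assumes f: "f \<in> linear_maps HA HB" and g: "g \<in> linear_maps HA HB" and x: "x \<in> carrier HA"
    and g_const: "\<And>a. a \<in> carrier A \<Longrightarrow> g (series_const A a) = series_deriv B (f (series_const A a))"
  shows "series_deriv B (f x) = f (series_deriv A x) \<oplus>\<^bsub>HB\<^esub> g x"
proof -
  let ?\<phi> = "\<lambda>a. f (series_const A a)"
  have \<phi>: "?\<phi> \<in> formal_maps A B"
    by (rule linear_maps_restrict[OF f])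
  note d\<phi> = deriv_formal_map[OF \<phi>]
  have eq: "series_extension B ?\<phi> y = f y" if "y \<in> carrier HA" for y
    by (rule linear_maps_eq_on_const[OF extension_linear[OF \<phi>] f _ that]) (rule extension_const[OF \<phi>])
  moreover have "series_extension B (\<lambda>a. series_deriv B (?\<phi> a)) x = g x"
    by (rule linear_maps_eq_on_const[OF extension_linear[OF d\<phi>] g _ x])
      (simp add: extension_const[OF d\<phi>] g_const)
  ultimately show ?thesis
    using deriv_extension[OF \<phi> x] x linear_maps_closed[OF f] linear_maps_closed[OF g]
    by (simp add: B.H.a_comm)
qed

section \<open>Tensor products of series\<close>

locale tensor_series = tensor_pair A B
  for A :: "('f::field, 'a) module" and B :: "('f, 'b) module"
begin

sublocale SA: series_over A ..
sublocale SB: series_over B ..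
sublocale S: series_over AB ..
sublocale A_AB: series_pair A AB ..
sublocale B_AB: series_pair B AB ..

abbreviation HA where "HA \<equiv> series_algebra A"
abbreviation HB where "HB \<equiv> series_algebra B"
abbreviation HAB where "HAB \<equiv> series_algebra AB"
abbreviation stens (infixr "\<box>" 72) where "x \<box> y \<equiv> series_tensor A B x y"

lemma pure_zero:
  "a \<in> carrier A \<Longrightarrow> a \<boxtimes> \<zero>\<^bsub>B\<^esub> = \<zero>\<^bsub>AB\<^esub>" "b \<in> carrier B \<Longrightarrow> \<zero>\<^bsub>A\<^esub> \<boxtimes> b = \<zero>\<^bsub>AB\<^esub>"
proof -
  interpret AA: algebra_pair A AB ..
  interpret BB: algebra_pair B AB ..
  show "a \<in> carrier A \<Longrightarrow> a \<boxtimes> \<zero>\<^bsub>B\<^esub> = \<zero>\<^bsub>AB\<^esub>"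
    by (rule BB.linear_maps_zero[OF bilinear_maps_right[OF pure_bilinear]])
  show "b \<in> carrier B \<Longrightarrow> \<zero>\<^bsub>A\<^esub> \<boxtimes> b = \<zero>\<^bsub>AB\<^esub>"
    by (rule AA.linear_maps_zero[OF bilinear_maps_left[OF pure_bilinear]])
qed

text \<open>A tensor of two series is the product of these two embeddings (\<open>stens_eq\<close>),
  whose images commute. Bilinearity, multiplication and differentiation of tensors follow from facts
  about homomorphisms instead of manipulations of convolution sums.\<close>

definition left where "left x = (\<lambda>n. x n \<boxtimes> \<one>\<^bsub>B\<^esub>)"
definition right where "right y = (\<lambda>n. \<one>\<^bsub>A\<^esub> \<boxtimes> y n)"

lemma pure_left_hom: "(\<lambda>a. a \<boxtimes> \<one>\<^bsub>B\<^esub>) \<in> algebra_homs A AB"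
  by (rule algebra_homsI) (simp_all add: bilinear_maps_left[OF pure_bilinear] pure_mult pure_one)

lemma pure_right_hom: "(\<lambda>b. \<one>\<^bsub>A\<^esub> \<boxtimes> b) \<in> algebra_homs B AB"
  by (rule algebra_homsI) (simp_all add: bilinear_maps_right[OF pure_bilinear] pure_mult pure_one)

lemma left_hom: "left \<in> algebra_homs HA HAB"
  unfolding left_def[abs_def] by (rule A_AB.algebra_hom_coefficientwise[OF pure_left_hom])

lemma right_hom: "right \<in> algebra_homs HB HAB"
  unfolding right_def[abs_def] by (rule B_AB.algebra_hom_coefficientwise[OF pure_right_hom])

lemmas left_closed [simp, intro] = linear_maps_closed[OF algebra_homs_linear[OF left_hom]]
lemmas right_closed [simp, intro] = linear_maps_closed[OF algebra_homs_linear[OF right_hom]]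

lemma stens_eq:
  assumes "x \<in> carrier HA" "y \<in> carrier HB"
  shows "x \<box> y = left x \<otimes>\<^bsub>HAB\<^esub> right y"
  unfolding fun_eq_iff S.mult_coeff series_tensor_def left_def right_def
  by (intro allI AB.finsum_cong') (use assms in \<open>simp_all add: pure_mult\<close>)

lemma left_right_commute:
  assumes "x \<in> carrier HA" "y \<in> carrier HB"
  shows "right y \<otimes>\<^bsub>HAB\<^esub> left x = left x \<otimes>\<^bsub>HAB\<^esub> right y"
proof
  fix n
  have "(right y \<otimes>\<^bsub>HAB\<^esub> left x) n = (\<Oplus>\<^bsub>AB\<^esub>i\<in>{..n}. right y (n - i) \<otimes>\<^bsub>AB\<^esub> left x i)"
    by (rule S.mult_coeff_rev) (use assms in auto)
  also have "\<dots> = (left x \<otimes>\<^bsub>HAB\<^esub> right y) n"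
    unfolding S.mult_coeff left_def right_def
    by (intro AB.finsum_cong') (use assms in \<open>simp_all add: pure_mult\<close>)
  finally show "(right y \<otimes>\<^bsub>HAB\<^esub> left x) n = (left x \<otimes>\<^bsub>HAB\<^esub> right y) n" .
qed

lemma stens_closed [simp, intro]: "x \<in> carrier HA \<Longrightarrow> y \<in> carrier HB \<Longrightarrow> x \<box> y \<in> carrier HAB"
  by (simp add: stens_eq)

lemma stens_bilinear: "series_tensor A B \<in> bilinear_maps HA HB HAB"
  by (intro bilinear_mapsI linear_mapsI)
    (simp_all add: stens_eq linear_maps_add[OF algebra_homs_linear[OF left_hom]]
      linear_maps_add[OF algebra_homs_linear[OF right_hom]]
      linear_maps_smult[OF algebra_homs_linear[OF left_hom]]
      linear_maps_smult[OF algebra_homs_linear[OF right_hom]] S.H.l_distr S.H.r_distr)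

lemmas stens_linear_left = bilinear_maps_left[OF stens_bilinear]
lemmas stens_linear_right = bilinear_maps_right[OF stens_bilinear]

lemma stens_add_left:
  "x \<in> carrier HA \<Longrightarrow> x' \<in> carrier HA \<Longrightarrow> y \<in> carrier HB \<Longrightarrow>
    (x \<oplus>\<^bsub>HA\<^esub> x') \<box> y = (x \<box> y) \<oplus>\<^bsub>HAB\<^esub> (x' \<box> y)"
  by (rule linear_maps_add[OF stens_linear_left])

lemma stens_add_right:
  "x \<in> carrier HA \<Longrightarrow> y \<in> carrier HB \<Longrightarrow> y' \<in> carrier HB \<Longrightarrow>
    x \<box> (y \<oplus>\<^bsub>HB\<^esub> y') = (x \<box> y) \<oplus>\<^bsub>HAB\<^esub> (x \<box> y')"
  by (rule linear_maps_add[OF stens_linear_right])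

lemma stens_smult_left:
  "x \<in> carrier HA \<Longrightarrow> y \<in> carrier HB \<Longrightarrow> (c \<odot>\<^bsub>HA\<^esub> x) \<box> y = c \<odot>\<^bsub>HAB\<^esub> (x \<box> y)"
  by (rule linear_maps_smult[OF stens_linear_left])

lemma stens_smult_right:
  "x \<in> carrier HA \<Longrightarrow> y \<in> carrier HB \<Longrightarrow> x \<box> (c \<odot>\<^bsub>HB\<^esub> y) = c \<odot>\<^bsub>HAB\<^esub> (x \<box> y)"
  by (rule linear_maps_smult[OF stens_linear_right])

lemma stens_a_inv_left:
  "x \<in> carrier HA \<Longrightarrow> y \<in> carrier HB \<Longrightarrow> (\<ominus>\<^bsub>HA\<^esub> x) \<box> y = \<ominus>\<^bsub>HAB\<^esub> (x \<box> y)"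
  by (rule A_AB.H.linear_maps_a_inv[OF stens_linear_left])

lemma stens_a_inv_right:
  "x \<in> carrier HA \<Longrightarrow> y \<in> carrier HB \<Longrightarrow> x \<box> (\<ominus>\<^bsub>HB\<^esub> y) = \<ominus>\<^bsub>HAB\<^esub> (x \<box> y)"
  by (rule B_AB.H.linear_maps_a_inv[OF stens_linear_right])

lemma stens_zero_left: "y \<in> carrier HB \<Longrightarrow> \<zero>\<^bsub>HA\<^esub> \<box> y = \<zero>\<^bsub>HAB\<^esub>"
  by (rule A_AB.H.linear_maps_zero[OF stens_linear_left])

lemma stens_zero_right: "x \<in> carrier HA \<Longrightarrow> x \<box> \<zero>\<^bsub>HB\<^esub> = \<zero>\<^bsub>HAB\<^esub>"
  by (rule B_AB.H.linear_maps_zero[OF stens_linear_right])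

lemmas stens_simps = stens_add_left stens_add_right stens_smult_left stens_smult_right
  stens_a_inv_left stens_a_inv_right stens_zero_left stens_zero_right

lemma stens_mult:
  assumes "x \<in> carrier HA" "x' \<in> carrier HA" "y \<in> carrier HB" "y' \<in> carrier HB"
  shows "(x \<box> y) \<otimes>\<^bsub>HAB\<^esub> (x' \<box> y') = (x \<otimes>\<^bsub>HA\<^esub> x') \<box> (y \<otimes>\<^bsub>HB\<^esub> y')"
proof -
  have "(left x \<otimes>\<^bsub>HAB\<^esub> right y) \<otimes>\<^bsub>HAB\<^esub> (left x' \<otimes>\<^bsub>HAB\<^esub> right y') =
      left x \<otimes>\<^bsub>HAB\<^esub> ((right y \<otimes>\<^bsub>HAB\<^esub> left x') \<otimes>\<^bsub>HAB\<^esub> right y')"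
    using assms by (simp add: S.H.m_assoc)
  also have "\<dots> = (left x \<otimes>\<^bsub>HAB\<^esub> left x') \<otimes>\<^bsub>HAB\<^esub> (right y \<otimes>\<^bsub>HAB\<^esub> right y')"
    using assms by (simp add: left_right_commute S.H.m_assoc)
  finally show ?thesis
    using assms by (simp add: stens_eq algebra_homs_mult[OF left_hom] algebra_homs_mult[OF right_hom])
qed

lemma stens_one: "\<one>\<^bsub>HA\<^esub> \<box> \<one>\<^bsub>HB\<^esub> = \<one>\<^bsub>HAB\<^esub>"
  by (simp add: stens_eq algebra_homs_one[OF left_hom] algebra_homs_one[OF right_hom])

lemma stens_const:
  "a \<in> carrier A \<Longrightarrow> b \<in> carrier B \<Longrightarrow>
    series_const A a \<box> series_const B b = series_const AB (a \<boxtimes> b)"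
proof -
  assume a: "a \<in> carrier A" and b: "b \<in> carrier B"
  interpret AA: algebra_pair A AB ..
  interpret BB: algebra_pair B AB ..
  have "left (series_const A a) = series_const AB (a \<boxtimes> \<one>\<^bsub>B\<^esub>)"
    by (simp add: fun_eq_iff left_def SA.const_coeff S.const_coeff
        AA.linear_maps_zero[OF algebra_homs_linear[OF pure_left_hom]])
  moreover have "right (series_const B b) = series_const AB (\<one>\<^bsub>A\<^esub> \<boxtimes> b)"
    by (simp add: fun_eq_iff right_def SB.const_coeff S.const_coeff
        BB.linear_maps_zero[OF algebra_homs_linear[OF pure_right_hom]])
  ultimately show ?thesis
    using a b by (simp add: stens_eq S.const_simps(2)[symmetric] pure_mult)
qed

lemma stens_0: "x \<in> carrier HA \<Longrightarrow> y \<in> carrier HB \<Longrightarrow> (x \<box> y) 0 = x 0 \<boxtimes> y 0"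
  by (simp add: series_tensor_def)

lemma deriv_stens:
  assumes "x \<in> carrier HA" "y \<in> carrier HB"
  shows "series_deriv AB (x \<box> y) = (series_deriv A x \<box> y) \<oplus>\<^bsub>HAB\<^esub> (x \<box> series_deriv B y)"
proof -
  have "series_deriv AB (left x) = left (series_deriv A x)"
    using assms linear_maps_smult[OF algebra_homs_linear[OF pure_left_hom]]
    by (simp add: fun_eq_iff series_deriv_def left_def)
  moreover have "series_deriv AB (right y) = right (series_deriv B y)"
    using assms linear_maps_smult[OF algebra_homs_linear[OF pure_right_hom]]
    by (simp add: fun_eq_iff series_deriv_def right_def)
  ultimately show ?thesis
    using assms by (simp add: stens_eq S.deriv_mult)
qed

lemma linear_maps_eq_on_stens:
  assumes C: "algebra_over C" and f: "f \<in> linear_maps HAB (series_algebra C)"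
    and g: "g \<in> linear_maps HAB (series_algebra C)"
    and eq: "\<And>a b. a \<in> carrier A \<Longrightarrow> b \<in> carrier B \<Longrightarrow>
      f (series_const A a \<box> series_const B b) = g (series_const A a \<box> series_const B b)"
    and x: "x \<in> carrier HAB"
  shows "f x = g x"
proof -
  interpret C: algebra_over C by (rule C)
  interpret P: series_pair AB C ..
  show ?thesis
  proof (rule P.linear_maps_eq_on_const[OF f g _ x])
    fix w assume "w \<in> carrier AB"
    then show "f (series_const AB w) = g (series_const AB w)"
      by (induction w rule: tensor_induct)
        (simp_all add: stens_const[symmetric] eq S.const_simps linear_maps_add[OF f]
          linear_maps_add[OF g] linear_maps_smult[OF f] linear_maps_smult[OF g])
  qed
qed

context
  fixes C :: "('f, 'c) module" and h
  assumes C: "algebra_over C" and h: "h \<in> bilinear_maps HA HB (series_algebra C)"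
begin

interpretation C: series_over C by (rule series_over.intro[OF C])
interpretation P: series_pair AB C ..

private definition \<phi> where
  "\<phi> w = (\<lambda>m. tensor_lift C (\<lambda>a b. h (series_const A a) (series_const B b) m) w)"

private lemma bilinear_coeff:
  "(\<lambda>a b. h (series_const A a) (series_const B b) m) \<in> bilinear_maps A B C"
  using linear_maps_closed[OF bilinear_maps_right[OF h]]
  by (intro bilinear_mapsI linear_mapsI)
    (simp_all add: SA.const_simps SB.const_simps linear_maps_add[OF bilinear_maps_left[OF h]]
      linear_maps_add[OF bilinear_maps_right[OF h]] linear_maps_smult[OF bilinear_maps_left[OF h]]
      linear_maps_smult[OF bilinear_maps_right[OF h]] C.H_simps C.smult_const_coeff)

private lemma \<phi>_formal: "\<phi> \<in> formal_maps AB C"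
proof -
  note lin = tensor_lift_linear[OF C bilinear_coeff]
  have closed: "\<phi> w \<in> carrier (series_algebra C)" if "w \<in> carrier AB" for w
    using that by (simp add: C.carrier_iff \<phi>_def linear_maps_closed[OF lin])
  show ?thesis
    by (rule formal_mapsI)
      (simp_all add: closed fun_eq_iff C.smult_const_coeff,
        simp_all add: C.H_simps \<phi>_def linear_maps_add[OF lin] linear_maps_smult[OF lin])
qed

private lemma lift_eq: "series_lift A B C h = series_extension C \<phi>"
  by (simp add: fun_eq_iff series_lift_def series_extension_def \<phi>_def)

lemma series_lift_linear: "series_lift A B C h \<in> linear_maps HAB (series_algebra C)"
  unfolding lift_eq by (rule P.extension_linear[OF \<phi>_formal])

text \<open>\<open>series_lift\<close> is built from the values of \<open>h\<close> on constant
  series only. Both sides are F[[t]]-linear in each argument, so agreement on constants extends to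
  all series, one argument at a time.\<close>

lemma series_lift_stens:
  assumes x: "x \<in> carrier HA" and y: "y \<in> carrier HB"
  shows "series_lift A B C h (x \<box> y) = h x y"
proof -
  interpret AC: series_pair A C ..
  interpret BC: series_pair B C ..
  note lin = series_lift_linear
  show ?thesis
  proof (rule AC.linear_maps_eq_on_const[OF _ bilinear_maps_left[OF h y] _ x])
    show "(\<lambda>x. series_lift A B C h (x \<box> y)) \<in> linear_maps HA (series_algebra C)"
      by (rule linear_maps_comp[OF lin stens_linear_left[OF y]])
    fix a assume a: "a \<in> carrier A"
    show "series_lift A B C h (series_const A a \<box> y) = h (series_const A a) y"
    proof (rule BC.linear_maps_eq_on_const[OF _ bilinear_maps_right[OF h] _ y])
      show "(\<lambda>y. series_lift A B C h (series_const A a \<box> y)) \<in> linear_maps HB (series_algebra C)"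
        by (rule linear_maps_comp[OF lin stens_linear_right]) (use a in simp)
      fix b assume b: "b \<in> carrier B"
      show "series_lift A B C h (series_const A a \<box> series_const B b) =
          h (series_const A a) (series_const B b)"
        using a b unfolding lift_eq
        by (simp add: stens_const P.extension_const[OF \<phi>_formal])
          (simp add: \<phi>_def tensor_lift_pure[OF C bilinear_coeff])
    qed (use a in simp)
  qed
qed

lemma series_lift_hom:
  assumes mult: "\<And>x x' y y'. x \<in> carrier HA \<Longrightarrow> x' \<in> carrier HA \<Longrightarrow> y \<in> carrier HB \<Longrightarrow> y' \<in> carrier HB \<Longrightarrow>
      h (x \<otimes>\<^bsub>HA\<^esub> x') (y \<otimes>\<^bsub>HB\<^esub> y') = h x y \<otimes>\<^bsub>series_algebra C\<^esub> h x' y'"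
    and one: "h \<one>\<^bsub>HA\<^esub> \<one>\<^bsub>HB\<^esub> = \<one>\<^bsub>series_algebra C\<^esub>"
  shows "series_lift A B C h \<in> algebra_homs HAB (series_algebra C)"
proof (rule algebra_homsI[OF series_lift_linear])
  let ?f = "series_lift A B C h"
  note lin = series_lift_linear
  fix X Y assume X: "X \<in> carrier HAB" and Y: "Y \<in> carrier HAB"
  show "?f (X \<otimes>\<^bsub>HAB\<^esub> Y) = ?f X \<otimes>\<^bsub>series_algebra C\<^esub> ?f Y"
  proof (rule linear_maps_eq_on_stens[OF C _ _ _ X])
    show "(\<lambda>X. ?f (X \<otimes>\<^bsub>HAB\<^esub> Y)) \<in> linear_maps HAB (series_algebra C)"
      by (rule linear_maps_comp[OF lin S.mult_right_linear[OF Y]])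
    show "(\<lambda>X. ?f X \<otimes>\<^bsub>series_algebra C\<^esub> ?f Y) \<in> linear_maps HAB (series_algebra C)"
      by (rule linear_maps_comp[OF C.mult_right_linear lin]) (rule linear_maps_closed[OF lin Y])
    fix a b assume ab: "a \<in> carrier A" "b \<in> carrier B"
    let ?t = "series_const A a \<box> series_const B b"
    have t: "?t \<in> carrier HAB"
      using ab by simp
    show "?f (?t \<otimes>\<^bsub>HAB\<^esub> Y) = ?f ?t \<otimes>\<^bsub>series_algebra C\<^esub> ?f Y"
    proof (rule linear_maps_eq_on_stens[OF C _ _ _ Y])
      show "(\<lambda>Y. ?f (?t \<otimes>\<^bsub>HAB\<^esub> Y)) \<in> linear_maps HAB (series_algebra C)"
        by (rule linear_maps_comp[OF lin S.mult_left_linear[OF t]])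
      show "(\<lambda>Y. ?f ?t \<otimes>\<^bsub>series_algebra C\<^esub> ?f Y) \<in> linear_maps HAB (series_algebra C)"
        by (rule linear_maps_comp[OF C.mult_left_linear lin]) (rule linear_maps_closed[OF lin t])
    qed (use ab in \<open>simp add: stens_mult series_lift_stens mult\<close>)
  qed
next
  show "series_lift A B C h \<one>\<^bsub>HAB\<^esub> = \<one>\<^bsub>series_algebra C\<^esub>"
    by (simp add: stens_one[symmetric] series_lift_stens one)
qed

end
end

section \<open>The Jordanian twist of a Hopf algebra\<close>

text \<open>When a candidate Y is checked against Y' = N Y - Y N, both products come out as
  negatives that differ by a single term; this lemma and the next one cancel the common
  part.\<close>

lemma (in ring) neg_minus_neg_add:
  "p \<in> carrier R \<Longrightarrow> k \<in> carrier R \<Longrightarrow> \<ominus> p \<ominus> \<ominus> (p \<oplus> k) = k"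
  by (simp add: a_minus_def r_neg1)

lemma (in ring) neg_add_minus_neg:
  "p \<in> carrier R \<Longrightarrow> q \<in> carrier R \<Longrightarrow> \<ominus> (p \<oplus> q) \<ominus> \<ominus> p = \<ominus> q"
  by (simp add: a_minus_def minus_add a_comm[of "\<ominus> p"] a_assoc l_neg)

section \<open>Series in L and their commutation with T\<close>

locale twist_data = series_over_char_0 U
  for U :: "('f::field_char_0, 'a) module" (structure) +
  fixes T L :: 'a
  assumes T_closed [simp, intro]: "T \<in> carrier U" and L_closed [simp, intro]: "L \<in> carrier U"
    and T_L: "T \<otimes> L = L \<otimes> T \<oplus> L"
begin

abbreviation E where "E \<equiv> binomial_series U L"

text \<open>This is L (1 - L t)^(-1), the negative of the derivative of ln (1 - L t).\<close>

definition G where "G = E (-1) \<otimes>\<^bsub>H\<^esub> const L"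

lemma E_coeff: "E c m = ((-1) ^ m * (c gchoose m)) \<odot> L [^] m"
  by (simp add: binomial_series_def)

lemma E_closed [simp, intro]: "E c \<in> carrier H"
  by (simp add: carrier_iff E_coeff)

lemma G_closed [simp, intro]: "G \<in> carrier H"
  by (simp add: G_def)

text \<open>In each power of L this is Vandermonde's convolution; the signs of the two factors
  combine to one that does not depend on the summation index.\<close>

lemma E_mult: "E c \<otimes>\<^bsub>H\<^esub> E d = E (c + d)"
proof
  fix n
  have "(E c \<otimes>\<^bsub>H\<^esub> E d) n = (\<Oplus>i\<in>{..n}. ((-1) ^ n * ((c gchoose i) * (d gchoose (n - i)))) \<odot> L [^] n)"
    unfolding mult_coeff
  proof (rule finsum_cong')
    fix i assume "i \<in> {..n}"
    then have "L [^] i \<otimes> L [^] (n - i) = L [^] n" "(-1) ^ i * (-1) ^ (n - i) = ((-1) ^ n :: 'f)"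
      by (simp_all add: nat_pow_mult flip: power_add)
    then show "E c i \<otimes> E d (n - i) = ((-1) ^ n * ((c gchoose i) * (d gchoose (n - i)))) \<odot> L [^] n"
      by (simp add: E_coeff smult_smult mult_ac)
  qed simp_all
  also have "\<dots> = E (c + d) n"
    by (simp add: finsum_smult_left E_coeff sum_distrib_left[symmetric] gbinomial_Vandermonde[symmetric]
        atLeast0AtMost)
  finally show "(E c \<otimes>\<^bsub>H\<^esub> E d) n = E (c + d) n" .
qed

lemma E_0: "E 0 = \<one>\<^bsub>H\<^esub>"
proof
  fix n
  show "E 0 n = \<one>\<^bsub>H\<^esub> n"
    by (cases n) (simp_all add: E_coeff H_simps const_coeff)
qed

lemma E_1: "E 1 = \<one>\<^bsub>H\<^esub> \<ominus>\<^bsub>H\<^esub> fps_X \<odot>\<^bsub>H\<^esub> const L"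
proof
  fix n
  have "(1 gchoose Suc (Suc k)) = (0 :: 'f)" for k
    by (simp add: gbinomial_Suc_Suc[of "0 :: 'f", simplified] gbinomial_mult_1 numeral_2_eq_2)
  then show "E 1 n = (\<one>\<^bsub>H\<^esub> \<ominus>\<^bsub>H\<^esub> fps_X \<odot>\<^bsub>H\<^esub> const L) n"
    by (cases n rule: nat.exhaust[case_names 0 Suc]; cases "n - 1")
      (auto simp: E_coeff minus_coeff H_simps(3) const_coeff, simp_all add: a_minus_def smult_uminus)
qed

lemma E_L: "const L \<otimes>\<^bsub>H\<^esub> E c = E c \<otimes>\<^bsub>H\<^esub> const L"
  by (simp add: fun_eq_iff mult_const_left mult_const_right E_coeff pow_mult_distrib nat_pow_comm[of L 1, simplified])

lemma deriv_E: "deriv (E c) = fps_const (- c) \<odot>\<^bsub>H\<^esub> (const L \<otimes>\<^bsub>H\<^esub> E (c - 1))"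
proof
  fix m
  have "of_nat (Suc m) * ((-1) ^ Suc m * (c gchoose Suc m)) = - c * ((-1) ^ m * ((c - 1) gchoose m))"
  proof -
    have "of_nat (Suc m) * ((-1) ^ Suc m * (c gchoose Suc m)) =
        (-1) ^ Suc m * (of_nat (Suc m) * (c gchoose Suc m))"
      by (simp only: mult_ac)
    then show ?thesis
      by (simp only: gbinomial_absorption) simp
  qed
  moreover have "L \<otimes> L [^] m = L [^] Suc m"
    by (rule nat_pow_Suc2[symmetric]) simp
  ultimately show "deriv (E c) m = (fps_const (- c) \<odot>\<^bsub>H\<^esub> (const L \<otimes>\<^bsub>H\<^esub> E (c - 1))) m"
    unfolding smult_const_coeff[OF H.m_closed[OF const_carrier[OF L_closed] E_closed]]
    by (simp add: series_deriv_def mult_const_left E_coeff smult_smult del: power_Suc nat_pow_Suc of_nat_Suc)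
qed

lemma E_inverse: "E 1 \<otimes>\<^bsub>H\<^esub> E (-1) = \<one>\<^bsub>H\<^esub>" "E (-1) \<otimes>\<^bsub>H\<^esub> E 1 = \<one>\<^bsub>H\<^esub>"
  by (simp_all add: E_mult E_0)

lemma G_alt: "G = const L \<otimes>\<^bsub>H\<^esub> E (-1)"
  by (simp add: G_def E_L)

lemma E_G: "E 1 \<otimes>\<^bsub>H\<^esub> G = const L" "G \<otimes>\<^bsub>H\<^esub> E 1 = const L"
proof -
  show "E 1 \<otimes>\<^bsub>H\<^esub> G = const L"
    by (simp add: G_def H.m_assoc[symmetric] E_inverse)
  show "G \<otimes>\<^bsub>H\<^esub> E 1 = const L"
    by (simp add: G_alt H.m_assoc E_inverse)
qed

lemma E_minus_1: "E (-1) = \<one>\<^bsub>H\<^esub> \<oplus>\<^bsub>H\<^esub> fps_X \<odot>\<^bsub>H\<^esub> G"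
proof -
  have "E (-1) \<ominus>\<^bsub>H\<^esub> fps_X \<odot>\<^bsub>H\<^esub> G = \<one>\<^bsub>H\<^esub>"
    using E_inverse(2) unfolding E_1
    by (simp add: a_minus_def H.r_distr H.r_minus G_def)
  moreover have "(E (-1) \<ominus>\<^bsub>H\<^esub> fps_X \<odot>\<^bsub>H\<^esub> G) \<oplus>\<^bsub>H\<^esub> fps_X \<odot>\<^bsub>H\<^esub> G = E (-1)"
    by (simp add: a_minus_def H.a_assoc H.l_neg)
  ultimately show ?thesis
    by simp
qed

lemma deriv_G: "deriv G = const L \<otimes>\<^bsub>H\<^esub> E (-2) \<otimes>\<^bsub>H\<^esub> const L"
  by (simp add: G_def deriv_mult deriv_E deriv_const)

text \<open>Both sides are the derivative of t G, that is, of (1 - L t)^(-1). The left form arises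
  when the correction term of the coproduct is differentiated, the right form when G is commuted
  past a weight element.\<close>

lemma G_plus_deriv: "G \<oplus>\<^bsub>H\<^esub> fps_X \<odot>\<^bsub>H\<^esub> deriv G = const L \<otimes>\<^bsub>H\<^esub> E (-2)"
proof -
  have "G = const L \<otimes>\<^bsub>H\<^esub> (E (-2) \<otimes>\<^bsub>H\<^esub> E 1)"
    by (simp add: G_alt E_mult)
  also have "\<dots> = const L \<otimes>\<^bsub>H\<^esub> E (-2) \<ominus>\<^bsub>H\<^esub> fps_X \<odot>\<^bsub>H\<^esub> deriv G"
    by (simp add: E_1 deriv_G a_minus_def H.r_distr H.r_minus H.m_assoc)
  finally have "G \<oplus>\<^bsub>H\<^esub> fps_X \<odot>\<^bsub>H\<^esub> deriv G =
      const L \<otimes>\<^bsub>H\<^esub> E (-2) \<ominus>\<^bsub>H\<^esub> fps_X \<odot>\<^bsub>H\<^esub> deriv G \<oplus>\<^bsub>H\<^esub> fps_X \<odot>\<^bsub>H\<^esub> deriv G"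
    by simp
  then show ?thesis
    by (simp add: a_minus_def H.a_assoc H.l_neg)
qed

lemma X_deriv_coeff: "x \<in> carrier H \<Longrightarrow> (fps_X \<odot>\<^bsub>H\<^esub> deriv x) n = of_nat n \<odot> x n"
  by (cases n) (simp_all, simp_all add: series_deriv_def)

text \<open>Elements \<open>d\<close> with \<open>[d, L] = \<kappa> L\<close> act on series in \<open>L\<close> by \<open>\<kappa> t d/dt\<close>.\<close>

context
  fixes d \<kappa>
  assumes d [simp, intro]: "d \<in> carrier U" and d_L: "d \<otimes> L = L \<otimes> d \<oplus> \<kappa> \<odot> L"
begin

lemma weight_pow: "d \<otimes> L [^] m = L [^] m \<otimes> d \<oplus> (\<kappa> * of_nat m) \<odot> L [^] (m :: nat)"
proof (induction m)
  case (Suc m)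
  have "d \<otimes> L [^] Suc m = (d \<otimes> L [^] m) \<otimes> L"
    by (simp add: m_assoc)
  also have "\<dots> = L [^] m \<otimes> (d \<otimes> L) \<oplus> (\<kappa> * of_nat m) \<odot> (L [^] m \<otimes> L)"
    by (simp add: Suc.IH l_distr m_assoc)
  also have "\<dots> = L [^] m \<otimes> L \<otimes> d \<oplus> (\<kappa> \<odot> (L [^] m \<otimes> L) \<oplus> (\<kappa> * of_nat m) \<odot> (L [^] m \<otimes> L))"
    by (simp add: d_L r_distr m_assoc a_assoc)
  also have "\<dots> = L [^] Suc m \<otimes> d \<oplus> (\<kappa> * of_nat (Suc m)) \<odot> L [^] Suc m"
    by (simp add: smult_l_distr[symmetric] distrib_left)
  finally show ?case .
qed simp

lemma weight_E:
  "const d \<otimes>\<^bsub>H\<^esub> E c = E c \<otimes>\<^bsub>H\<^esub> const d \<oplus>\<^bsub>H\<^esub> fps_const \<kappa> \<odot>\<^bsub>H\<^esub> (fps_X \<odot>\<^bsub>H\<^esub> deriv (E c))"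
proof
  fix n
  show "(const d \<otimes>\<^bsub>H\<^esub> E c) n =
      (E c \<otimes>\<^bsub>H\<^esub> const d \<oplus>\<^bsub>H\<^esub> fps_const \<kappa> \<odot>\<^bsub>H\<^esub> (fps_X \<odot>\<^bsub>H\<^esub> deriv (E c))) n"
    by (simp add: mult_const_left mult_const_right H_simps(1) smult_const_coeff X_deriv_coeff)
      (simp add: E_coeff weight_pow smult_r_distr smult_smult mult_ac)
qed

text \<open>Coefficient n of G is L^(n+1), whose weight is \<kappa> (n + 1), one unit more than its
  power of t accounts for. Hence the commutator is \<kappa> (G + t G') and not \<kappa> t
  G'.\<close>

lemma weight_G:
  "const d \<otimes>\<^bsub>H\<^esub> G = G \<otimes>\<^bsub>H\<^esub> const d \<oplus>\<^bsub>H\<^esub> fps_const \<kappa> \<odot>\<^bsub>H\<^esub> (const L \<otimes>\<^bsub>H\<^esub> E (-2))"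
proof -
  have dL: "const d \<otimes>\<^bsub>H\<^esub> const L = const L \<otimes>\<^bsub>H\<^esub> const d \<oplus>\<^bsub>H\<^esub> fps_const \<kappa> \<odot>\<^bsub>H\<^esub> const L"
    by (simp add: const_simps[symmetric] d_L)
  have "const d \<otimes>\<^bsub>H\<^esub> G = (const d \<otimes>\<^bsub>H\<^esub> E (-1)) \<otimes>\<^bsub>H\<^esub> const L"
    by (simp add: G_def H.m_assoc)
  also have "\<dots> = E (-1) \<otimes>\<^bsub>H\<^esub> (const d \<otimes>\<^bsub>H\<^esub> const L)
      \<oplus>\<^bsub>H\<^esub> fps_const \<kappa> \<odot>\<^bsub>H\<^esub> (fps_X \<odot>\<^bsub>H\<^esub> (deriv (E (-1)) \<otimes>\<^bsub>H\<^esub> const L))"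
    by (simp add: weight_E H.l_distr H.m_assoc)
  also have "deriv (E (-1)) \<otimes>\<^bsub>H\<^esub> const L = deriv G"
    by (simp add: deriv_E deriv_G)
  also have "E (-1) \<otimes>\<^bsub>H\<^esub> (const d \<otimes>\<^bsub>H\<^esub> const L) = G \<otimes>\<^bsub>H\<^esub> const d \<oplus>\<^bsub>H\<^esub> fps_const \<kappa> \<odot>\<^bsub>H\<^esub> G"
    by (simp add: dL G_def H.r_distr H.m_assoc)
  finally show ?thesis
    by (simp add: G_plus_deriv[symmetric] H.smult_r_distr H.a_assoc)
qed

end

lemma T_E: "const T \<otimes>\<^bsub>H\<^esub> E c = E c \<otimes>\<^bsub>H\<^esub> const T \<oplus>\<^bsub>H\<^esub> fps_X \<odot>\<^bsub>H\<^esub> deriv (E c)"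
  using weight_E[of T 1 c] T_L by simp

lemma const_T_L: "const T \<otimes>\<^bsub>H\<^esub> const L = const L \<otimes>\<^bsub>H\<^esub> const T \<oplus>\<^bsub>H\<^esub> const L"
  by (simp add: const_simps[symmetric] T_L)

lemma G_L: "const L \<otimes>\<^bsub>H\<^esub> G = G \<otimes>\<^bsub>H\<^esub> const L"
  by (simp add: G_def H.m_assoc[symmetric] E_L)

section \<open>The logarithmic derivative of the twist and explicit solutions for T, L and weight
  elements\<close>

sublocale t: tensor_pair U U ..
sublocale tt: series_over_char_0 "tensor_algebra U U" ..
sublocale ts: tensor_series U U ..

abbreviation UU where "UU \<equiv> tensor_algebra U U"
abbreviation HH where "HH \<equiv> series_algebra (tensor_algebra U U)"
abbreviation tensor_U (infixr "\<boxtimes>" 72) where "a \<boxtimes> b \<equiv> pure_tensor U U a b"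
abbreviation tensor_H (infixr "\<box>" 68) where "x \<box> y \<equiv> series_tensor U U x y"

text \<open>The logarithmic derivative in \<open>t\<close> of the twist \<open>exp (T \<otimes> ln (1 - L t))\<close>.\<close>

definition N where "N = \<ominus>\<^bsub>HH\<^esub> (const T \<box> G)"

text \<open>For the deformed antipode S one has S(T) G = T S(G) = - T L (\<open>S_T_G\<close>,
  \<open>T_S_G\<close>); with M = T L the terms that arise on differentiating the antipode
  identities cancel.\<close>

definition M where "M = const T \<otimes>\<^bsub>H\<^esub> const L"

lemma N_closed [simp, intro]: "N \<in> carrier HH"
  by (simp add: N_def)

lemma M_closed [simp, intro]: "M \<in> carrier H"
  by (simp add: M_def)

text \<open>T commutes with d, so only the second leg fails to commute with N. There the commutator
  of d with G is \<kappa> times the derivative of t G, by \<open>weight_G\<close> and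
  \<open>G_plus_deriv\<close>, which makes \<kappa> T \<otimes> t G the required correction; T
  \<otimes> t G itself commutes with N.\<close>

lemma flow_weight:
  assumes d [simp]: "d \<in> carrier U" and d_L: "d \<otimes> L = L \<otimes> d \<oplus> \<kappa> \<odot> L" and T_d: "T \<otimes> d = d \<otimes> T"
  shows "flow UU N ((d \<boxtimes> \<one>) \<oplus>\<^bsub>UU\<^esub> (\<one> \<boxtimes> d)) =
    (const d \<box> \<one>\<^bsub>H\<^esub>) \<oplus>\<^bsub>HH\<^esub> (\<one>\<^bsub>H\<^esub> \<box> const d)
      \<oplus>\<^bsub>HH\<^esub> fps_const \<kappa> \<odot>\<^bsub>HH\<^esub> (const T \<box> (fps_X \<odot>\<^bsub>H\<^esub> G))" (is "_ = ?Y")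
proof (rule tt.flow_eqI[OF N_closed])
  show "?Y 0 = (d \<boxtimes> \<one>) \<oplus>\<^bsub>UU\<^esub> (\<one> \<boxtimes> d)"
    by (simp add: tt.H_simps(1) tt.smult_const_coeff ts.stens_0)
      (simp add: const_coeff H_simps(3) ts.pure_zero)
  let ?k = "fps_const \<kappa> \<odot>\<^bsub>HH\<^esub> (const T \<box> (const L \<otimes>\<^bsub>H\<^esub> E (-2)))"
  let ?p = "(const d \<otimes>\<^bsub>H\<^esub> const T \<box> G) \<oplus>\<^bsub>HH\<^esub> (const T \<box> G \<otimes>\<^bsub>H\<^esub> const d) \<oplus>\<^bsub>HH\<^esub>
    fps_const \<kappa> \<odot>\<^bsub>HH\<^esub> (fps_X \<odot>\<^bsub>HH\<^esub> (const T \<otimes>\<^bsub>H\<^esub> const T \<box> G \<otimes>\<^bsub>H\<^esub> G))"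
  have comm: "const T \<otimes>\<^bsub>H\<^esub> const d = const d \<otimes>\<^bsub>H\<^esub> const T"
    by (simp add: const_simps[symmetric] T_d)
  have "N \<otimes>\<^bsub>HH\<^esub> ?Y = \<ominus>\<^bsub>HH\<^esub> ?p"
    by (simp add: N_def tt.H.r_distr tt.H.l_minus tt.H.minus_add tt.H.smult_a_inv ts.stens_mult ts.stens_simps comm)
  moreover have "?Y \<otimes>\<^bsub>HH\<^esub> N = \<ominus>\<^bsub>HH\<^esub> (?p \<oplus>\<^bsub>HH\<^esub> ?k)"
    by (simp add: N_def tt.H.l_distr tt.H.r_minus tt.H.minus_add tt.H.smult_a_inv ts.stens_mult ts.stens_simps weight_G[OF d d_L])
      (simp add: tt.H.a_ac)
  moreover have "series_deriv UU ?Y = ?k"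
    by (simp add: tt.deriv_add tt.deriv_smult_const ts.deriv_stens deriv_const deriv_one ts.stens_zero_left
        ts.stens_zero_right deriv_X G_plus_deriv)
  ultimately show "series_deriv UU ?Y = N \<otimes>\<^bsub>HH\<^esub> ?Y \<ominus>\<^bsub>HH\<^esub> ?Y \<otimes>\<^bsub>HH\<^esub> N"
    by (simp add: tt.H.neg_minus_neg_add)
qed simp_all

text \<open>The term 1 \<otimes> L commutes with N. In the other term [T, L] = L and G (1 - L t) =
  L, so the bracket is - L \<otimes> L, which is the derivative of L \<otimes> (1 - L t).\<close>

lemma flow_L: "flow UU N ((L \<boxtimes> \<one>) \<oplus>\<^bsub>UU\<^esub> (\<one> \<boxtimes> L)) =
    (const L \<box> E 1) \<oplus>\<^bsub>HH\<^esub> (\<one>\<^bsub>H\<^esub> \<box> const L)" (is "_ = ?Y")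
proof (rule tt.flow_eqI[OF N_closed])
  show "?Y 0 = (L \<boxtimes> \<one>) \<oplus>\<^bsub>UU\<^esub> (\<one> \<boxtimes> L)"
    by (simp add: tt.H_simps(1) ts.stens_0) (simp add: const_coeff H_simps(3) E_coeff)
  let ?p = "(const L \<otimes>\<^bsub>H\<^esub> const T \<box> const L) \<oplus>\<^bsub>HH\<^esub> (const T \<box> G \<otimes>\<^bsub>H\<^esub> const L)"
  have "N \<otimes>\<^bsub>HH\<^esub> ?Y = \<ominus>\<^bsub>HH\<^esub> (?p \<oplus>\<^bsub>HH\<^esub> (const L \<box> const L))"
    by (simp add: N_def tt.H.r_distr tt.H.l_minus tt.H.minus_add tt.H.smult_a_inv ts.stens_mult ts.stens_simps const_T_L E_G)
      (simp add: tt.H.a_ac)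
  moreover have "?Y \<otimes>\<^bsub>HH\<^esub> N = \<ominus>\<^bsub>HH\<^esub> ?p"
    by (simp add: N_def tt.H.l_distr tt.H.r_minus tt.H.minus_add tt.H.smult_a_inv ts.stens_mult ts.stens_simps E_G G_L)
  moreover have "series_deriv UU ?Y = \<ominus>\<^bsub>HH\<^esub> (const L \<box> const L)"
  proof -
    have "deriv (E 1) = \<ominus>\<^bsub>H\<^esub> const L"
      by (simp add: deriv_E E_0 H.a_inv_eq_smult fps_const_neg[symmetric] del: fps_const_neg)
    then show ?thesis
      by (simp add: tt.deriv_add ts.deriv_stens deriv_const deriv_one ts.stens_simps)
  qed
  ultimately show "series_deriv UU ?Y = N \<otimes>\<^bsub>HH\<^esub> ?Y \<ominus>\<^bsub>HH\<^esub> ?Y \<otimes>\<^bsub>HH\<^esub> N"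
    by (simp add: tt.H.neg_add_minus_neg)
qed simp_all

text \<open>M is constant in t and [d, M] = \<kappa> M. Bracketing M with \<kappa> t M - d therefore
  gives \<kappa> M, the derivative of that series.\<close>

lemma flow_antipode_weight:
  assumes d [simp]: "d \<in> carrier U" and d_L: "d \<otimes> L = L \<otimes> d \<oplus> \<kappa> \<odot> L" and T_d: "T \<otimes> d = d \<otimes> T"
  shows "flow U M (\<ominus> d) = fps_const \<kappa> \<odot>\<^bsub>H\<^esub> (fps_X \<odot>\<^bsub>H\<^esub> M) \<ominus>\<^bsub>H\<^esub> const d" (is "_ = ?Y")
proof (rule flow_eqI[OF M_closed])
  show "?Y 0 = \<ominus> d"
    by (simp add: minus_coeff smult_const_coeff) (simp add: const_coeff a_minus_def)
  have dM: "const d \<otimes>\<^bsub>H\<^esub> M = M \<otimes>\<^bsub>H\<^esub> const d \<oplus>\<^bsub>H\<^esub> fps_const \<kappa> \<odot>\<^bsub>H\<^esub> M"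
  proof -
    have "d \<otimes> (T \<otimes> L) = (T \<otimes> d) \<otimes> L"
      by (simp add: T_d m_assoc)
    also have "\<dots> = T \<otimes> L \<otimes> d \<oplus> \<kappa> \<odot> (T \<otimes> L)"
      by (simp add: m_assoc d_L r_distr)
    finally show ?thesis
      by (simp add: M_def const_simps[symmetric])
  qed
  have "deriv M = \<zero>\<^bsub>H\<^esub>"
    by (simp add: M_def const_simps[symmetric] deriv_const)
  then have "deriv ?Y = fps_const \<kappa> \<odot>\<^bsub>H\<^esub> M"
    by (simp add: a_minus_def deriv_add deriv_a_inv deriv_const deriv_smult_const deriv_X)
  moreover have "M \<otimes>\<^bsub>H\<^esub> ?Y \<ominus>\<^bsub>H\<^esub> ?Y \<otimes>\<^bsub>H\<^esub> M = fps_const \<kappa> \<odot>\<^bsub>H\<^esub> M"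
  proof -
    have "x \<ominus>\<^bsub>H\<^esub> y \<ominus>\<^bsub>H\<^esub> (x \<ominus>\<^bsub>H\<^esub> (y \<oplus>\<^bsub>H\<^esub> z)) = z"
      if "x \<in> carrier H" "y \<in> carrier H" "z \<in> carrier H" for x y z
    proof -
      have "x \<ominus>\<^bsub>H\<^esub> y \<ominus>\<^bsub>H\<^esub> (x \<ominus>\<^bsub>H\<^esub> (y \<oplus>\<^bsub>H\<^esub> z)) = (x \<ominus>\<^bsub>H\<^esub> y) \<ominus>\<^bsub>H\<^esub> (x \<ominus>\<^bsub>H\<^esub> y) \<oplus>\<^bsub>H\<^esub> z"
        using that by (simp add: a_minus_def H.minus_add H.a_ac)
      then show ?thesis
        using that by (simp add: a_minus_def H.r_neg)
    qed
    moreover have "?Y \<otimes>\<^bsub>H\<^esub> M = fps_const \<kappa> \<odot>\<^bsub>H\<^esub> (fps_X \<odot>\<^bsub>H\<^esub> (M \<otimes>\<^bsub>H\<^esub> M)) \<ominus>\<^bsub>H\<^esub> const d \<otimes>\<^bsub>H\<^esub> M"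
        "M \<otimes>\<^bsub>H\<^esub> ?Y = fps_const \<kappa> \<odot>\<^bsub>H\<^esub> (fps_X \<odot>\<^bsub>H\<^esub> (M \<otimes>\<^bsub>H\<^esub> M)) \<ominus>\<^bsub>H\<^esub> M \<otimes>\<^bsub>H\<^esub> const d"
      by (simp_all add: a_minus_def H.l_distr H.r_distr H.l_minus H.r_minus)
    ultimately show ?thesis
      by (simp only: dM) simp
  qed
  ultimately show "deriv ?Y = M \<otimes>\<^bsub>H\<^esub> ?Y \<ominus>\<^bsub>H\<^esub> ?Y \<otimes>\<^bsub>H\<^esub> M"
    by simp
qed simp_all

text \<open>L commutes with G, so [T L, G] = [T, G] L = L (1 - L t)^(-2) L, which is the derivative
  of G.\<close>

lemma flow_antipode_L: "flow U M (\<ominus> L) = \<ominus>\<^bsub>H\<^esub> G"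
proof (rule flow_eqI[OF M_closed])
  show "(\<ominus>\<^bsub>H\<^esub> G) 0 = \<ominus> L"
    by (simp add: a_inv_coeff G_def mult_0) (simp add: E_coeff const_coeff)
  let ?p = "G \<otimes>\<^bsub>H\<^esub> const T \<otimes>\<^bsub>H\<^esub> const L"
  have "M \<otimes>\<^bsub>H\<^esub> G = (const T \<otimes>\<^bsub>H\<^esub> G) \<otimes>\<^bsub>H\<^esub> const L"
    by (simp add: M_def H.m_assoc G_L)
  also have "\<dots> = ?p \<oplus>\<^bsub>H\<^esub> deriv G"
    using weight_G[of T 1] T_L by (simp add: deriv_G H.l_distr)
  finally have "M \<otimes>\<^bsub>H\<^esub> (\<ominus>\<^bsub>H\<^esub> G) \<ominus>\<^bsub>H\<^esub> (\<ominus>\<^bsub>H\<^esub> G) \<otimes>\<^bsub>H\<^esub> M =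
      \<ominus>\<^bsub>H\<^esub> (?p \<oplus>\<^bsub>H\<^esub> deriv G) \<ominus>\<^bsub>H\<^esub> \<ominus>\<^bsub>H\<^esub> ?p"
    by (simp add: H.r_minus H.l_minus M_def H.m_assoc)
  also have "\<dots> = \<ominus>\<^bsub>H\<^esub> deriv G"
    by (simp add: a_minus_def H.minus_add H.a_ac H.r_neg H.r_neg1 H.r_neg2)
  finally show "deriv (\<ominus>\<^bsub>H\<^esub> G) = M \<otimes>\<^bsub>H\<^esub> (\<ominus>\<^bsub>H\<^esub> G) \<ominus>\<^bsub>H\<^esub> (\<ominus>\<^bsub>H\<^esub> G) \<otimes>\<^bsub>H\<^esub> M"
    by (simp add: deriv_a_inv)
qed simp_all

end

text \<open>The associator is a lift inside a lift. The outer one is governed by its universal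
  property only once the inner lift is known to be linear in its parameter \<open>a\<close>; this
  and multiplicativity are checked by comparing linear maps on pure tensors.\<close>

lemma tensor_assoc_eq:
  assumes A: "algebra_over A"
  shows "tensor_assoc A \<in> algebra_homs (tensor_algebra A (tensor_algebra A A)) (tensor_algebra (tensor_algebra A A) A)"
    and "a \<in> carrier A \<Longrightarrow> b \<in> carrier A \<Longrightarrow> c \<in> carrier A \<Longrightarrow>
      tensor_assoc A (pure_tensor A (tensor_algebra A A) a (pure_tensor A A b c)) =
        pure_tensor (tensor_algebra A A) A (pure_tensor A A a b) c"
proof -
  interpret algebra_over A by (rule A)
  interpret t: tensor_pair A A ..
  interpret l: tensor_pair "tensor_algebra A A" A ..
  interpret r: tensor_pair A "tensor_algebra A A" ..
  let ?AA = "tensor_algebra A A"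
  let ?P = "tensor_algebra ?AA A"
  note P = l.AB.algebra_over_axioms
  define k where "k = (\<lambda>a b c. pure_tensor ?AA A (pure_tensor A A a b) c)"
  define h where "h = (\<lambda>a. tensor_lift ?P (k a))"
  note t_left = bilinear_maps_left[OF t.pure_bilinear] and t_right = bilinear_maps_right[OF t.pure_bilinear]
  note l_left = bilinear_maps_left[OF l.pure_bilinear] and l_right = bilinear_maps_right[OF l.pure_bilinear]
  have k_bilinear: "k a \<in> bilinear_maps A A ?P" if "a \<in> carrier A" for a
    unfolding k_def using that
    by (intro bilinear_mapsI l_right linear_maps_comp[OF l_left t_right]) auto
  have h_lin: "h a \<in> linear_maps ?AA ?P" if "a \<in> carrier A" for a
    unfolding h_def by (rule t.tensor_lift_linear[OF P k_bilinear[OF that]])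
  have h_closed: "h a w \<in> carrier ?P" if "a \<in> carrier A" "w \<in> carrier ?AA" for a w
    by (rule linear_maps_closed[OF h_lin]) (use that in simp_all)
  have h_pure: "h a (pure_tensor A A b c) = k a b c"
    if "a \<in> carrier A" "b \<in> carrier A" "c \<in> carrier A" for a b c
    unfolding h_def by (rule t.tensor_lift_pure[OF P k_bilinear]) (use that in auto)
  interpret AP: algebra_pair ?AA ?P ..
  have h_left: "(\<lambda>a. h a w) \<in> linear_maps A ?P" if w: "w \<in> carrier ?AA" for w
  proof (rule linear_mapsI)
    fix a a' assume a: "a \<in> carrier A" "a' \<in> carrier A"
    show "h (a \<oplus>\<^bsub>A\<^esub> a') w = h a w \<oplus>\<^bsub>?P\<^esub> h a' w"
      by (rule t.linear_maps_eq_on_tensors[OF P h_lin AP.linear_maps_sum[OF h_lin h_lin] _ w])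
        (use a in \<open>simp_all add: h_pure k_def linear_maps_add[OF t_left] linear_maps_add[OF l_left]\<close>)
  next
    fix s a assume a: "a \<in> carrier A"
    have sm: "(\<lambda>x. s \<odot>\<^bsub>?P\<^esub> x) \<in> linear_maps ?P ?P"
      by (rule linear_mapsI) (simp_all add: l.AB.smult_r_distr l.AB.smult_smult mult.commute)
    show "h (s \<odot>\<^bsub>A\<^esub> a) w = s \<odot>\<^bsub>?P\<^esub> h a w"
      by (rule t.linear_maps_eq_on_tensors[OF P h_lin linear_maps_comp[OF sm h_lin] _ w])
        (use a in \<open>simp_all add: h_pure k_def linear_maps_smult[OF t_left] linear_maps_smult[OF l_left]\<close>)
  qed (rule linear_maps_closed[OF h_lin w])
  have h: "h \<in> bilinear_maps A ?AA ?P"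
    by (intro bilinear_mapsI h_lin h_left)
  have eq: "tensor_assoc A = tensor_lift ?P h"
    unfolding tensor_assoc_def Let_def h_def k_def by (rule refl)
  have one: "h \<one>\<^bsub>A\<^esub> \<one>\<^bsub>?AA\<^esub> = \<one>\<^bsub>?P\<^esub>"
    by (simp add: t.pure_one l.pure_one h_pure k_def)
  interpret AAA: algebra_pair ?AA ?AA ..
  have id: "(\<lambda>x. x) \<in> linear_maps ?AA ?AA"
    by (rule linear_mapsI) simp_all
  have mult: "h (a \<otimes>\<^bsub>A\<^esub> a') (w \<otimes>\<^bsub>?AA\<^esub> w') = h a w \<otimes>\<^bsub>?P\<^esub> h a' w'"
    if a: "a \<in> carrier A" "a' \<in> carrier A" and w: "w \<in> carrier ?AA" and w': "w' \<in> carrier ?AA" for a a' w w'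
  proof (rule t.linear_maps_eq_on_tensors[OF P _ _ _ w])
    show "(\<lambda>w. h (a \<otimes>\<^bsub>A\<^esub> a') (w \<otimes>\<^bsub>?AA\<^esub> w')) \<in> linear_maps ?AA ?P"
      by (rule linear_maps_comp[OF h_lin AAA.linear_maps_mult_right[OF id w']]) (use a in simp)
    show "(\<lambda>w. h a w \<otimes>\<^bsub>?P\<^esub> h a' w') \<in> linear_maps ?AA ?P"
      by (rule AP.linear_maps_mult_right[OF h_lin]) (use a w' h_closed in simp_all)
    fix b c assume bc: "b \<in> carrier A" "c \<in> carrier A"
    let ?w = "pure_tensor A A b c"
    show "h (a \<otimes>\<^bsub>A\<^esub> a') (?w \<otimes>\<^bsub>?AA\<^esub> w') = h a ?w \<otimes>\<^bsub>?P\<^esub> h a' w'"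
    proof (rule t.linear_maps_eq_on_tensors[OF P _ _ _ w'])
      show "(\<lambda>w'. h (a \<otimes>\<^bsub>A\<^esub> a') (?w \<otimes>\<^bsub>?AA\<^esub> w')) \<in> linear_maps ?AA ?P"
        by (rule linear_maps_comp[OF h_lin AAA.linear_maps_mult_left[OF id]]) (use a bc in simp_all)
      show "(\<lambda>w'. h a ?w \<otimes>\<^bsub>?P\<^esub> h a' w') \<in> linear_maps ?AA ?P"
        by (rule AP.linear_maps_mult_left[OF h_lin]) (use a bc h_closed in simp_all)
    qed (use a bc in \<open>simp add: t.pure_mult l.pure_mult h_pure k_def\<close>)
  qed
  show "tensor_assoc A \<in> algebra_homs (tensor_algebra A ?AA) ?P"
    unfolding eq by (rule r.tensor_lift_hom[OF P h mult one])
  show "tensor_assoc A (pure_tensor A ?AA a (pure_tensor A A b c)) =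
      pure_tensor ?AA A (pure_tensor A A a b) c"
    if "a \<in> carrier A" "b \<in> carrier A" "c \<in> carrier A"
    unfolding eq using that by (simp add: r.tensor_lift_pure[OF P h] h_pure k_def)
qed

lemma (in tensor_series) deriv_linear_map_stens:
  assumes C: "algebra_over C" and f: "f \<in> linear_maps HAB (series_algebra C)"
    and g: "g \<in> linear_maps HAB (series_algebra C)" and x: "x \<in> carrier HAB"
    and eq: "\<And>a b. a \<in> carrier A \<Longrightarrow> b \<in> carrier B \<Longrightarrow>
      g (series_const A a \<box> series_const B b) = series_deriv C (f (series_const A a \<box> series_const B b))"
  shows "series_deriv C (f x) = f (series_deriv AB x) \<oplus>\<^bsub>series_algebra C\<^esub> g x"
proof -
  interpret C: algebra_over C by (rule C)
  interpret P: series_pair AB C ..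
  show ?thesis
  proof (rule P.deriv_linear_map[OF f g x])
    fix w assume "w \<in> carrier AB"
    then show "g (series_const AB w) = series_deriv C (f (series_const AB w))"
      by (induction w rule: tensor_induct)
        (simp_all add: stens_const[symmetric] eq S.const_simps linear_maps_closed[OF f] linear_maps_add[OF f]
          linear_maps_add[OF g] linear_maps_smult[OF f] linear_maps_smult[OF g] P.B.deriv_add P.B.deriv_smult_const)
  qed
qed

text \<open>This supplies initial values: at t = 0 a lifted map becomes the corresponding lift over
  the undeformed algebra.\<close>

lemma (in tensor_series) linear_maps_stens_0:
  assumes C: "algebra_over C" and f: "f \<in> linear_maps HAB (series_algebra C)"
    and h: "h \<in> bilinear_maps A B C" and x: "x \<in> carrier HAB"
    and eq: "\<And>a b. a \<in> carrier A \<Longrightarrow> b \<in> carrier B \<Longrightarrow>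
      f (series_const A a \<box> series_const B b) 0 = h a b"
  shows "f x 0 = tensor_lift C h (x 0)"
proof -
  interpret C: algebra_over C by (rule C)
  interpret P: series_pair AB C ..
  have "(\<lambda>w. f (series_const AB w) 0) \<in> linear_maps AB C"
    by (rule linear_mapsI)
      (simp_all add: S.const_simps linear_maps_closed[OF f] linear_maps_add[OF f] linear_maps_smult[OF f]
        P.B.H_simps P.B.smult_const_coeff)
  from linear_maps_eq_on_tensors[OF C this tensor_lift_linear[OF C h], of "x 0"]
  have "f (series_const AB (x 0)) 0 = tensor_lift C h (x 0)"
    using x by (simp add: stens_const[symmetric] eq tensor_lift_pure[OF C h])
  then show ?thesis
    using P.linear_maps_coeff_0[OF f x] by simp
qed

text \<open>The deformation is carried out for an abstract Hopf algebra with primitive T and L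
  satisfying [T, L] = L; the enveloping algebra enters afterwards as an instance.\<close>

locale twist_hopf = twist_data U T L
  for U :: "('f::field_char_0, 'a) module" (structure) and T L +
  fixes \<Delta>\<^sub>0 :: "'a \<Rightarrow> ('a \<times> 'a \<Rightarrow>\<^sub>0 'f) set" and S\<^sub>0 :: "'a \<Rightarrow> 'a" and \<epsilon>\<^sub>0 :: "'a \<Rightarrow> 'f"
  assumes \<Delta>\<^sub>0_hom: "\<Delta>\<^sub>0 \<in> algebra_homs U UU"
    and S\<^sub>0_hom: "S\<^sub>0 \<in> algebra_homs U (opposite_algebra U)"
    and \<epsilon>\<^sub>0_hom: "\<epsilon>\<^sub>0 \<in> algebra_homs U scalar_algebra"
    and \<Delta>\<^sub>0_T: "\<Delta>\<^sub>0 T = (T \<boxtimes> \<one>) \<oplus>\<^bsub>UU\<^esub> (\<one> \<boxtimes> T)" and \<Delta>\<^sub>0_L: "\<Delta>\<^sub>0 L = (L \<boxtimes> \<one>) \<oplus>\<^bsub>UU\<^esub> (\<one> \<boxtimes> L)"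
    and S\<^sub>0_T: "S\<^sub>0 T = \<ominus> T" and S\<^sub>0_L: "S\<^sub>0 L = \<ominus> L"
    and \<epsilon>\<^sub>0_T: "\<epsilon>\<^sub>0 T = 0" and \<epsilon>\<^sub>0_L: "\<epsilon>\<^sub>0 L = 0"
    and coassoc\<^sub>0: "x \<in> carrier U \<Longrightarrow>
      tensor_lift (tensor_algebra UU U) (\<lambda>a b. pure_tensor UU U (\<Delta>\<^sub>0 a) b) (\<Delta>\<^sub>0 x) =
      tensor_assoc U (tensor_lift (tensor_algebra U UU) (\<lambda>a b. pure_tensor U UU a (\<Delta>\<^sub>0 b)) (\<Delta>\<^sub>0 x))"
    and counit\<^sub>0: "x \<in> carrier U \<Longrightarrow> tensor_lift U (\<lambda>a b. \<epsilon>\<^sub>0 a \<odot> b) (\<Delta>\<^sub>0 x) = x"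
      "x \<in> carrier U \<Longrightarrow> tensor_lift U (\<lambda>a b. \<epsilon>\<^sub>0 b \<odot> a) (\<Delta>\<^sub>0 x) = x"
    and antipode\<^sub>0: "x \<in> carrier U \<Longrightarrow> tensor_lift U (\<lambda>a b. S\<^sub>0 a \<otimes> b) (\<Delta>\<^sub>0 x) = \<epsilon>\<^sub>0 x \<odot> \<one>"
      "x \<in> carrier U \<Longrightarrow> tensor_lift U (\<lambda>a b. a \<otimes> S\<^sub>0 b) (\<Delta>\<^sub>0 x) = \<epsilon>\<^sub>0 x \<odot> \<one>"
begin

definition \<delta> where "\<delta> a = flow UU N (\<Delta>\<^sub>0 a)"
definition \<Delta> where "\<Delta> = series_extension UU \<delta>"
definition \<sigma> where "\<sigma> a = flow U M (S\<^sub>0 a)"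
definition S where "S = series_extension U \<sigma>"
definition \<epsilon> where "\<epsilon> x = Abs_fps (\<lambda>n. \<epsilon>\<^sub>0 (x n))"

sublocale U_U: series_pair U U ..
sublocale UU_U: series_pair UU U ..
sublocale UU_UU: series_pair UU UU ..

lemmas \<Delta>\<^sub>0_linear = algebra_homs_linear[OF \<Delta>\<^sub>0_hom]
lemmas \<Delta>\<^sub>0_closed [simp, intro] = linear_maps_closed[OF \<Delta>\<^sub>0_linear]

lemma S\<^sub>0_linear: "S\<^sub>0 \<in> linear_maps U U"
  using algebra_homs_linear[OF S\<^sub>0_hom] by (simp add: linear_maps_def opposite_algebra_def)

lemmas S\<^sub>0_closed [simp, intro] = linear_maps_closed[OF S\<^sub>0_linear]

lemma S\<^sub>0_mult: "x \<in> carrier U \<Longrightarrow> y \<in> carrier U \<Longrightarrow> S\<^sub>0 (x \<otimes> y) = S\<^sub>0 y \<otimes> S\<^sub>0 x"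
  using algebra_homs_mult[OF S\<^sub>0_hom] by (simp add: opposite_algebra_def)

lemma S\<^sub>0_one: "S\<^sub>0 \<one> = \<one>"
  using algebra_homs_one[OF S\<^sub>0_hom] by (simp add: opposite_algebra_def)

lemma \<epsilon>\<^sub>0_simps:
  "x \<in> carrier U \<Longrightarrow> y \<in> carrier U \<Longrightarrow> \<epsilon>\<^sub>0 (x \<oplus> y) = \<epsilon>\<^sub>0 x + \<epsilon>\<^sub>0 y"
  "x \<in> carrier U \<Longrightarrow> y \<in> carrier U \<Longrightarrow> \<epsilon>\<^sub>0 (x \<otimes> y) = \<epsilon>\<^sub>0 x * \<epsilon>\<^sub>0 y"
  "x \<in> carrier U \<Longrightarrow> \<epsilon>\<^sub>0 (c \<odot> x) = c * \<epsilon>\<^sub>0 x"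
  "\<epsilon>\<^sub>0 \<one> = 1"
  using algebra_homs_linear[OF \<epsilon>\<^sub>0_hom] algebra_homs_mult[OF \<epsilon>\<^sub>0_hom] algebra_homs_one[OF \<epsilon>\<^sub>0_hom]
  by (simp_all add: linear_maps_def scalar_algebra_def)

lemma \<epsilon>\<^sub>0_zero: "\<epsilon>\<^sub>0 \<zero> = 0"
  using \<epsilon>\<^sub>0_simps(3)[of "\<zero>" 0] by simp

lemma \<delta>_formal: "\<delta> \<in> formal_maps U UU"
  unfolding \<delta>_def
  by (rule formal_mapsI)
    (simp_all add: tt.flow_closed[OF N_closed] tt.flow_add[OF N_closed] tt.flow_smult[OF N_closed]
      linear_maps_add[OF \<Delta>\<^sub>0_linear] linear_maps_smult[OF \<Delta>\<^sub>0_linear])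

lemmas \<delta>_closed [simp, intro] = formal_maps_closed[OF \<delta>_formal]

lemma \<Delta>_hom: "\<Delta> \<in> algebra_homs H HH"
  unfolding \<Delta>_def
  by (rule ts.A_AB.algebra_hom_extension[OF \<delta>_formal])
    (simp_all add: \<delta>_def algebra_homs_mult[OF \<Delta>\<^sub>0_hom] algebra_homs_one[OF \<Delta>\<^sub>0_hom]
      tt.flow_mult[OF N_closed] tt.flow_one[OF N_closed])

lemmas \<Delta>_linear = algebra_homs_linear[OF \<Delta>_hom]
lemmas \<Delta>_closed [simp, intro] = linear_maps_closed[OF \<Delta>_linear]
lemmas \<Delta>_mult = algebra_homs_mult[OF \<Delta>_hom]
lemmas \<Delta>_one = algebra_homs_one[OF \<Delta>_hom]

lemma \<Delta>_const: "a \<in> carrier U \<Longrightarrow> \<Delta> (const a) = \<delta> a"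
  unfolding \<Delta>_def by (rule ts.A_AB.extension_const[OF \<delta>_formal])

lemma \<delta>_0: "\<delta> a 0 = \<Delta>\<^sub>0 a"
  by (simp add: \<delta>_def tt.flow_0[OF N_closed])

lemma deriv_\<delta>: "a \<in> carrier U \<Longrightarrow>
    series_deriv UU (\<delta> a) = N \<otimes>\<^bsub>HH\<^esub> \<delta> a \<ominus>\<^bsub>HH\<^esub> \<delta> a \<otimes>\<^bsub>HH\<^esub> N"
  by (simp add: \<delta>_def tt.deriv_flow[OF N_closed])

lemma \<sigma>_formal: "\<sigma> \<in> formal_maps U U"
  unfolding \<sigma>_def
  by (rule formal_mapsI)
    (simp_all add: flow_closed[OF M_closed] flow_add[OF M_closed] flow_smult[OF M_closed]
      linear_maps_add[OF S\<^sub>0_linear] linear_maps_smult[OF S\<^sub>0_linear])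

lemmas \<sigma>_closed [simp, intro] = formal_maps_closed[OF \<sigma>_formal]

lemma S_linear: "S \<in> linear_maps H H"
  unfolding S_def by (rule U_U.extension_linear[OF \<sigma>_formal])

lemmas S_closed [simp, intro] = linear_maps_closed[OF S_linear]

lemma S_const: "a \<in> carrier U \<Longrightarrow> S (const a) = \<sigma> a"
  unfolding S_def by (rule U_U.extension_const[OF \<sigma>_formal])

lemma \<sigma>_0: "\<sigma> a 0 = S\<^sub>0 a"
  by (simp add: \<sigma>_def flow_0[OF M_closed])

lemma deriv_\<sigma>: "a \<in> carrier U \<Longrightarrow> deriv (\<sigma> a) = M \<otimes>\<^bsub>H\<^esub> \<sigma> a \<ominus>\<^bsub>H\<^esub> \<sigma> a \<otimes>\<^bsub>H\<^esub> M"
  by (simp add: \<sigma>_def deriv_flow[OF M_closed])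

lemma S_mult:
  assumes x: "x \<in> carrier H" and y: "y \<in> carrier H"
  shows "S (x \<otimes>\<^bsub>H\<^esub> y) = S y \<otimes>\<^bsub>H\<^esub> S x"
proof (rule U_U.linear_maps_eq_on_const[OF _ _ _ x])
  show "(\<lambda>x. S (x \<otimes>\<^bsub>H\<^esub> y)) \<in> linear_maps H H"
    by (rule linear_maps_comp[OF S_linear mult_right_linear[OF y]])
  show "(\<lambda>x. S y \<otimes>\<^bsub>H\<^esub> S x) \<in> linear_maps H H"
    by (rule linear_maps_comp[OF mult_left_linear S_linear]) (use y in simp)
  fix a assume a: "a \<in> carrier U"
  show "S (const a \<otimes>\<^bsub>H\<^esub> y) = S y \<otimes>\<^bsub>H\<^esub> S (const a)"
  proof (rule U_U.linear_maps_eq_on_const[OF _ _ _ y])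
    show "(\<lambda>y. S (const a \<otimes>\<^bsub>H\<^esub> y)) \<in> linear_maps H H"
      by (rule linear_maps_comp[OF S_linear mult_left_linear]) (use a in simp)
    show "(\<lambda>y. S y \<otimes>\<^bsub>H\<^esub> S (const a)) \<in> linear_maps H H"
      by (rule linear_maps_comp[OF mult_right_linear S_linear]) (use a in simp)
    fix b assume "b \<in> carrier U"
    with a show "S (const a \<otimes>\<^bsub>H\<^esub> const b) = S (const b) \<otimes>\<^bsub>H\<^esub> S (const a)"
      by (simp add: const_simps(2)[symmetric] S_const)
        (simp add: \<sigma>_def S\<^sub>0_mult flow_mult[OF M_closed])
  qed
qed

lemma S_one: "S \<one>\<^bsub>H\<^esub> = \<one>\<^bsub>H\<^esub>"
  by (simp add: const_simps(5)[symmetric] S_const)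
    (simp add: \<sigma>_def S\<^sub>0_one flow_one[OF M_closed] const_simps)

lemma \<epsilon>_hom: "\<epsilon> \<in> algebra_homs H scalar_algebra"
proof (rule algebra_homsI, rule linear_mapsI)
  interpret K: algebra_over "scalar_algebra :: ('f, 'f) module"
    by unfold_locales (rule scalar_assoc_algebra)
  interpret P: algebra_pair U "scalar_algebra :: ('f, 'f) module" ..
  note sums = P.linear_maps_finsum[OF algebra_homs_linear[OF \<epsilon>\<^sub>0_hom]] finsum_scalar_algebra
  fix x y c assume x: "x \<in> carrier H"
  show "\<epsilon> x \<in> carrier scalar_algebra"
    by (simp add: scalar_algebra_def)
  have "\<epsilon>\<^sub>0 ((c \<odot>\<^bsub>H\<^esub> x) n) = (\<Sum>i\<le>n. fps_nth c i * \<epsilon>\<^sub>0 (x (n - i)))" for n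
    unfolding smult_coeff using x by (subst sums) (auto simp: sums \<epsilon>\<^sub>0_simps)
  then show "\<epsilon> (c \<odot>\<^bsub>H\<^esub> x) = c \<odot>\<^bsub>scalar_algebra\<^esub> \<epsilon> x"
    by (simp add: \<epsilon>_def scalar_algebra_def fps_eq_iff fps_mult_nth atLeast0AtMost)
  assume y: "y \<in> carrier H"
  show "\<epsilon> (x \<oplus>\<^bsub>H\<^esub> y) = \<epsilon> x \<oplus>\<^bsub>scalar_algebra\<^esub> \<epsilon> y"
    using x y by (simp add: \<epsilon>_def scalar_algebra_def fps_eq_iff H_simps \<epsilon>\<^sub>0_simps)
  have "\<epsilon>\<^sub>0 ((x \<otimes>\<^bsub>H\<^esub> y) n) = (\<Sum>i\<le>n. \<epsilon>\<^sub>0 (x i) * \<epsilon>\<^sub>0 (y (n - i)))" for n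
    unfolding mult_coeff using x y by (subst sums) (auto simp: sums \<epsilon>\<^sub>0_simps)
  then show "\<epsilon> (x \<otimes>\<^bsub>H\<^esub> y) = \<epsilon> x \<otimes>\<^bsub>scalar_algebra\<^esub> \<epsilon> y"
    by (simp add: \<epsilon>_def scalar_algebra_def fps_eq_iff fps_mult_nth atLeast0AtMost)
next
  show "\<epsilon> \<one>\<^bsub>H\<^esub> = \<one>\<^bsub>scalar_algebra\<^esub>"
    by (simp add: \<epsilon>_def scalar_algebra_def fps_eq_iff H_simps const_coeff \<epsilon>\<^sub>0_simps \<epsilon>\<^sub>0_zero)
qed

lemma \<epsilon>_simps:
  "x \<in> carrier H \<Longrightarrow> y \<in> carrier H \<Longrightarrow> \<epsilon> (x \<oplus>\<^bsub>H\<^esub> y) = \<epsilon> x + \<epsilon> y"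
  "x \<in> carrier H \<Longrightarrow> y \<in> carrier H \<Longrightarrow> \<epsilon> (x \<otimes>\<^bsub>H\<^esub> y) = \<epsilon> x * \<epsilon> y"
  "x \<in> carrier H \<Longrightarrow> \<epsilon> (c \<odot>\<^bsub>H\<^esub> x) = c * \<epsilon> x"
  using algebra_homs_linear[OF \<epsilon>_hom] algebra_homs_mult[OF \<epsilon>_hom]
  by (simp_all add: linear_maps_def scalar_algebra_def)

lemma \<epsilon>_const: "\<epsilon> (const a) = fps_const (\<epsilon>\<^sub>0 a)"
  by (simp add: \<epsilon>_def fps_eq_iff const_coeff \<epsilon>\<^sub>0_zero)

subsection \<open>The structure maps on \<open>T\<close> and on series in \<open>L\<close>\<close>

lemma \<Delta>_T: "\<Delta> (const T) = (const T \<box> E (-1)) \<oplus>\<^bsub>HH\<^esub> (\<one>\<^bsub>H\<^esub> \<box> const T)"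
proof -
  have "\<Delta> (const T) = (const T \<box> \<one>\<^bsub>H\<^esub>) \<oplus>\<^bsub>HH\<^esub> (\<one>\<^bsub>H\<^esub> \<box> const T) \<oplus>\<^bsub>HH\<^esub> (const T \<box> (fps_X \<odot>\<^bsub>H\<^esub> G))"
    using flow_weight[of T 1] T_L by (simp add: \<Delta>_const \<delta>_def \<Delta>\<^sub>0_T)
  then show ?thesis
    by (simp add: E_minus_1 ts.stens_add_right) (simp add: tt.H.a_ac)
qed

lemma \<Delta>_L: "\<Delta> (const L) = (const L \<box> E 1) \<oplus>\<^bsub>HH\<^esub> (\<one>\<^bsub>H\<^esub> \<box> const L)"
  by (simp add: \<Delta>_const \<delta>_def \<Delta>\<^sub>0_L flow_L)

lemma \<Delta>_E1: "\<Delta> (E 1) = E 1 \<box> E 1"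
proof -
  have "\<Delta> (E 1) = (\<one>\<^bsub>H\<^esub> \<box> \<one>\<^bsub>H\<^esub>) \<ominus>\<^bsub>HH\<^esub> fps_X \<odot>\<^bsub>HH\<^esub> ((const L \<box> E 1) \<oplus>\<^bsub>HH\<^esub> (\<one>\<^bsub>H\<^esub> \<box> const L))"
    by (simp add: E_1 ts.A_AB.H.linear_maps_diff[OF \<Delta>_linear] linear_maps_smult[OF \<Delta>_linear] \<Delta>_one
        \<Delta>_L[unfolded E_1] ts.stens_one)
  moreover have "E 1 \<box> E 1 = (\<one>\<^bsub>H\<^esub> \<box> E 1) \<ominus>\<^bsub>HH\<^esub> fps_X \<odot>\<^bsub>HH\<^esub> (const L \<box> E 1)"
    by (subst (1) E_1) (simp add: a_minus_def ts.stens_simps)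
  moreover have "\<one>\<^bsub>H\<^esub> \<box> E 1 = (\<one>\<^bsub>H\<^esub> \<box> \<one>\<^bsub>H\<^esub>) \<ominus>\<^bsub>HH\<^esub> fps_X \<odot>\<^bsub>HH\<^esub> (\<one>\<^bsub>H\<^esub> \<box> const L)"
    by (subst E_1) (simp add: a_minus_def ts.stens_simps)
  ultimately show ?thesis
    by (simp add: a_minus_def tt.H.smult_r_distr tt.H.minus_add tt.H.a_ac)
qed

text \<open>Since 1 - L t is grouplike, \<open>\<Delta> G\<close> times E(1) \<otimes> E(1) is the
  coproduct of G (1 - L t) = L. Multiplying by the inverse recovers \<open>\<Delta> G\<close>, and
  the infinite series G is never expanded.\<close>

lemma \<Delta>_G: "\<Delta> G = (G \<box> \<one>\<^bsub>H\<^esub>) \<oplus>\<^bsub>HH\<^esub> (E (-1) \<box> G)"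
proof -
  have "\<Delta> G = \<Delta> G \<otimes>\<^bsub>HH\<^esub> ((E 1 \<box> E 1) \<otimes>\<^bsub>HH\<^esub> (E (-1) \<box> E (-1)))"
    by (simp add: ts.stens_mult E_inverse ts.stens_one)
  also have "\<dots> = \<Delta> (G \<otimes>\<^bsub>H\<^esub> E 1) \<otimes>\<^bsub>HH\<^esub> (E (-1) \<box> E (-1))"
    by (simp add: \<Delta>_mult \<Delta>_E1 tt.H.m_assoc)
  also have "\<dots> = (G \<box> \<one>\<^bsub>H\<^esub>) \<oplus>\<^bsub>HH\<^esub> (E (-1) \<box> G)"
    by (simp add: E_G \<Delta>_L tt.H.l_distr ts.stens_mult E_inverse G_alt[symmetric])
  finally show ?thesis .
qed

lemma S_T: "S (const T) = \<ominus>\<^bsub>H\<^esub> (const T \<otimes>\<^bsub>H\<^esub> E 1)"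
proof -
  have "S (const T) = fps_X \<odot>\<^bsub>H\<^esub> M \<ominus>\<^bsub>H\<^esub> const T"
    using flow_antipode_weight[of T 1] T_L by (simp add: S_const \<sigma>_def S\<^sub>0_T)
  then show ?thesis
    by (simp add: E_1 M_def a_minus_def H.r_distr H.r_minus H.minus_add H.a_comm)
qed

lemma S_L: "S (const L) = \<ominus>\<^bsub>H\<^esub> G"
  by (simp add: S_const \<sigma>_def S\<^sub>0_L flow_antipode_L)

text \<open>S reverses products and sends 1 - L t to its inverse. Applying it to G (1 - L t) = L
  gives (1 - L t)^(-1) S(G) = - G, which is solved for S(G).\<close>

lemma S_G: "S G = \<ominus>\<^bsub>H\<^esub> const L"
proof -
  have "S (E 1) = \<one>\<^bsub>H\<^esub> \<ominus>\<^bsub>H\<^esub> fps_X \<odot>\<^bsub>H\<^esub> S (const L)"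
    by (simp add: E_1 U_U.H.linear_maps_diff[OF S_linear] linear_maps_smult[OF S_linear] S_one)
  also have "\<dots> = E (-1)"
    by (simp add: S_L a_minus_def H.smult_a_inv E_minus_1)
  finally have "S (G \<otimes>\<^bsub>H\<^esub> E 1) = E (-1) \<otimes>\<^bsub>H\<^esub> S G"
    by (simp add: S_mult)
  then have "E 1 \<otimes>\<^bsub>H\<^esub> (E (-1) \<otimes>\<^bsub>H\<^esub> S G) = E 1 \<otimes>\<^bsub>H\<^esub> (\<ominus>\<^bsub>H\<^esub> G)"
    by (simp add: E_G S_L)
  then show ?thesis
    by (simp add: H.m_assoc[symmetric] E_inverse H.r_minus E_G)
qed

lemma S_T_G: "S (const T) \<otimes>\<^bsub>H\<^esub> G = \<ominus>\<^bsub>H\<^esub> M"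
  by (simp add: S_T H.l_minus H.m_assoc E_G M_def)

lemma T_S_G: "const T \<otimes>\<^bsub>H\<^esub> S G = \<ominus>\<^bsub>H\<^esub> M"
  by (simp add: S_G H.r_minus M_def)

subsection \<open>Coassociativity\<close>

sublocale l: tensor_pair UU U ..
sublocale ll: series_over_char_0 "tensor_algebra UU U" ..
sublocale ls: tensor_series UU U ..
sublocale r: tensor_pair U UU ..
sublocale rs: tensor_series U UU ..

abbreviation P3 where "P3 \<equiv> tensor_algebra UU U"
abbreviation Q3 where "Q3 \<equiv> tensor_algebra U UU"
abbreviation HP where "HP \<equiv> series_algebra P3"
abbreviation HQ where "HQ \<equiv> series_algebra Q3"
abbreviation tensor_l (infixr "\<box>\<^sub>l" 68) where "X \<box>\<^sub>l y \<equiv> series_tensor UU U X y"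
abbreviation tensor_r (infixr "\<box>\<^sub>r" 68) where "x \<box>\<^sub>r Y \<equiv> series_tensor U UU x Y"

sublocale Q_P: series_pair Q3 P3 ..

definition \<Psi> where "\<Psi> X = (\<lambda>n. tensor_assoc U (X n))"

lemma \<Psi>_hom: "\<Psi> \<in> algebra_homs HQ HP"
  unfolding \<Psi>_def[abs_def]
  by (rule Q_P.algebra_hom_coefficientwise[OF tensor_assoc_eq(1)]) (rule algebra_over_axioms)

lemmas \<Psi>_linear = algebra_homs_linear[OF \<Psi>_hom]

lemma deriv_\<Psi>: "X \<in> carrier HQ \<Longrightarrow> series_deriv P3 (\<Psi> X) = \<Psi> (series_deriv Q3 X)"
  using linear_maps_smult[OF algebra_homs_linear[OF tensor_assoc_eq(1)[OF algebra_over_axioms]]]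
  by (simp add: fun_eq_iff \<Psi>_def series_deriv_def)

lemma \<Psi>_tensor:
  assumes x: "x \<in> carrier H" and y: "y \<in> carrier H" and z: "z \<in> carrier H"
  shows "\<Psi> (x \<box>\<^sub>r (y \<box> z)) = (x \<box> y) \<box>\<^sub>l z"
proof (rule ls.B_AB.linear_maps_eq_on_const[OF _ _ _ x])
  show "(\<lambda>x. \<Psi> (x \<box>\<^sub>r (y \<box> z))) \<in> linear_maps H HP"
    by (rule linear_maps_comp[OF \<Psi>_linear rs.stens_linear_left]) (use y z in simp)
  show "(\<lambda>x. (x \<box> y) \<box>\<^sub>l z) \<in> linear_maps H HP"
    by (rule linear_maps_comp[OF ls.stens_linear_left ts.stens_linear_left]) (use y z in simp_all)
  fix a assume a: "a \<in> carrier U"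
  show "\<Psi> (const a \<box>\<^sub>r (y \<box> z)) = (const a \<box> y) \<box>\<^sub>l z"
  proof (rule ls.B_AB.linear_maps_eq_on_const[OF _ _ _ y])
    show "(\<lambda>y. \<Psi> (const a \<box>\<^sub>r (y \<box> z))) \<in> linear_maps H HP"
      by (rule linear_maps_comp[OF \<Psi>_linear linear_maps_comp[OF rs.stens_linear_right ts.stens_linear_left]])
        (use a z in simp_all)
    show "(\<lambda>y. (const a \<box> y) \<box>\<^sub>l z) \<in> linear_maps H HP"
      by (rule linear_maps_comp[OF ls.stens_linear_left ts.stens_linear_right]) (use a z in simp_all)
    fix b assume b: "b \<in> carrier U"
    show "\<Psi> (const a \<box>\<^sub>r (const b \<box> z)) = (const a \<box> const b) \<box>\<^sub>l z"
    proof (rule ls.B_AB.linear_maps_eq_on_const[OF _ _ _ z])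
      show "(\<lambda>z. \<Psi> (const a \<box>\<^sub>r (const b \<box> z))) \<in> linear_maps H HP"
        by (rule linear_maps_comp[OF \<Psi>_linear linear_maps_comp[OF rs.stens_linear_right ts.stens_linear_right]])
          (use a b in simp_all)
      show "(\<lambda>z. (const a \<box> const b) \<box>\<^sub>l z) \<in> linear_maps H HP"
        by (rule ls.stens_linear_right) (use a b in simp)
      fix c assume c: "c \<in> carrier U"
      interpret QP: algebra_pair Q3 P3 ..
      have "\<Psi> (series_const Q3 (pure_tensor U UU a (b \<boxtimes> c))) = series_const P3 (pure_tensor UU U (a \<boxtimes> b) c)"
        using a b c tensor_assoc_eq(2)[OF algebra_over_axioms]
          QP.linear_maps_zero[OF algebra_homs_linear[OF tensor_assoc_eq(1)[OF algebra_over_axioms]]]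
        by (simp add: fun_eq_iff \<Psi>_def rs.S.const_coeff ll.const_coeff)
      with a b c show "\<Psi> (const a \<box>\<^sub>r (const b \<box> const c)) = (const a \<box> const b) \<box>\<^sub>l const c"
        by (simp add: ts.stens_const rs.stens_const ls.stens_const)
    qed
  qed
qed

text \<open>\<open>\<Lambda>\<^sub>1\<close> is \<Delta> \<otimes> id and
  \<open>\<Lambda>\<^sub>q\<close> is id \<otimes> \<Delta>. \<open>\<Lambda>\<^sub>2\<close>
  carries the latter to the left-bracketed triple product, so that both sides of coassociativity
  live in the same algebra.\<close>

definition \<Lambda>\<^sub>1 where "\<Lambda>\<^sub>1 = series_lift U U P3 (\<lambda>x y. \<Delta> x \<box>\<^sub>l y)"
definition \<Lambda>\<^sub>q where "\<Lambda>\<^sub>q = series_lift U U Q3 (\<lambda>x y. x \<box>\<^sub>r \<Delta> y)"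
definition \<Lambda>\<^sub>2 where "\<Lambda>\<^sub>2 W = \<Psi> (\<Lambda>\<^sub>q W)"

lemma \<Lambda>\<^sub>1_bilinear: "(\<lambda>x y. \<Delta> x \<box>\<^sub>l y) \<in> bilinear_maps H H HP"
  by (intro bilinear_mapsI ls.stens_linear_right linear_maps_comp[OF ls.stens_linear_left \<Delta>_linear]) simp_all

lemma \<Lambda>\<^sub>q_bilinear: "(\<lambda>x y. x \<box>\<^sub>r \<Delta> y) \<in> bilinear_maps H H HQ"
  by (intro bilinear_mapsI rs.stens_linear_left linear_maps_comp[OF rs.stens_linear_right \<Delta>_linear]) simp_all

lemma \<Lambda>\<^sub>1_hom: "\<Lambda>\<^sub>1 \<in> algebra_homs HH HP"
  unfolding \<Lambda>\<^sub>1_def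
  by (rule ts.series_lift_hom[OF l.AB.algebra_over_axioms \<Lambda>\<^sub>1_bilinear])
    (simp_all add: \<Delta>_mult \<Delta>_one ls.stens_mult ls.stens_one)

lemma \<Lambda>\<^sub>q_hom: "\<Lambda>\<^sub>q \<in> algebra_homs HH HQ"
  unfolding \<Lambda>\<^sub>q_def
  by (rule ts.series_lift_hom[OF r.AB.algebra_over_axioms \<Lambda>\<^sub>q_bilinear])
    (simp_all add: \<Delta>_mult \<Delta>_one rs.stens_mult rs.stens_one)

lemma \<Lambda>\<^sub>2_hom: "\<Lambda>\<^sub>2 \<in> algebra_homs HH HP"
  unfolding \<Lambda>\<^sub>2_def[abs_def] by (rule algebra_homs_comp[OF \<Psi>_hom \<Lambda>\<^sub>q_hom])

lemma \<Lambda>\<^sub>1_tensor: "x \<in> carrier H \<Longrightarrow> y \<in> carrier H \<Longrightarrow> \<Lambda>\<^sub>1 (x \<box> y) = \<Delta> x \<box>\<^sub>l y"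
  unfolding \<Lambda>\<^sub>1_def by (rule ts.series_lift_stens[OF l.AB.algebra_over_axioms \<Lambda>\<^sub>1_bilinear])

lemma \<Lambda>\<^sub>q_tensor: "x \<in> carrier H \<Longrightarrow> y \<in> carrier H \<Longrightarrow> \<Lambda>\<^sub>q (x \<box> y) = x \<box>\<^sub>r \<Delta> y"
  unfolding \<Lambda>\<^sub>q_def by (rule ts.series_lift_stens[OF r.AB.algebra_over_axioms \<Lambda>\<^sub>q_bilinear])

text \<open>Two sources of dependence on t add up: \<delta> x evolves by N, which \<open>f\<close>
  turns into f(N), and \<open>f\<close> itself evolves by P on constant tensors.\<close>

lemma deriv_hom_\<delta>:
  assumes f: "f \<in> algebra_homs HH HP" and P: "P \<in> carrier HP" and x: "x \<in> carrier U"
    and eq: "\<And>a b. a \<in> carrier U \<Longrightarrow> b \<in> carrier U \<Longrightarrow> series_deriv P3 (f (const a \<box> const b)) =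
      P \<otimes>\<^bsub>HP\<^esub> f (const a \<box> const b) \<ominus>\<^bsub>HP\<^esub> f (const a \<box> const b) \<otimes>\<^bsub>HP\<^esub> P"
  shows "series_deriv P3 (f (\<delta> x)) =
    (f N \<oplus>\<^bsub>HP\<^esub> P) \<otimes>\<^bsub>HP\<^esub> f (\<delta> x) \<ominus>\<^bsub>HP\<^esub> f (\<delta> x) \<otimes>\<^bsub>HP\<^esub> (f N \<oplus>\<^bsub>HP\<^esub> P)"
proof -
  note lin = algebra_homs_linear[OF f]
  note closed = linear_maps_closed[OF lin]
  let ?g = "\<lambda>W. P \<otimes>\<^bsub>HP\<^esub> f W \<ominus>\<^bsub>HP\<^esub> f W \<otimes>\<^bsub>HP\<^esub> P"
  have g: "?g \<in> linear_maps HH HP"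
    unfolding a_minus_def
    by (intro ls.A_AB.H.linear_maps_sum ls.A_AB.H.linear_maps_uminus ls.A_AB.H.linear_maps_mult_left
        ls.A_AB.H.linear_maps_mult_right lin P)
  have "series_deriv P3 (f (\<delta> x)) = f (series_deriv UU (\<delta> x)) \<oplus>\<^bsub>HP\<^esub> ?g (\<delta> x)"
    by (rule ts.deriv_linear_map_stens[OF l.AB.algebra_over_axioms lin g]) (use x eq in simp_all)
  also have "f (series_deriv UU (\<delta> x)) = f N \<otimes>\<^bsub>HP\<^esub> f (\<delta> x) \<ominus>\<^bsub>HP\<^esub> f (\<delta> x) \<otimes>\<^bsub>HP\<^esub> f N"
    using x by (simp add: deriv_\<delta> ls.A_AB.H.linear_maps_diff[OF lin] algebra_homs_mult[OF f])
  finally show ?thesis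
    using x P closed[of "\<delta> x"] closed[of N]
    by (simp add: a_minus_def ll.H.l_distr ll.H.r_distr ll.H.minus_add ll.H.a_ac)
qed

lemma pure_assoc_bilinear:
  "(\<lambda>a b. pure_tensor UU U (\<Delta>\<^sub>0 a) b) \<in> bilinear_maps U U P3"
  "(\<lambda>a b. pure_tensor U UU a (\<Delta>\<^sub>0 b)) \<in> bilinear_maps U U Q3"
  by (intro bilinear_mapsI bilinear_maps_right[OF l.pure_bilinear]
      linear_maps_comp[OF bilinear_maps_left[OF l.pure_bilinear] \<Delta>\<^sub>0_linear]; simp)
    (intro bilinear_mapsI bilinear_maps_left[OF r.pure_bilinear]
      linear_maps_comp[OF bilinear_maps_right[OF r.pure_bilinear] \<Delta>\<^sub>0_linear]; simp)

text \<open>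
  Both sides of coassociativity solve \<open>Y' = [P, Y]\<close>; the two values of \<open>P\<close> agree because
  \<open>N = - T \<otimes> G\<close> with \<open>\<Delta> T = T \<otimes> E (-1) + 1 \<otimes> T\<close> and \<open>\<Delta> G = G \<otimes> 1 + E (-1) \<otimes> G\<close>.
\<close>

lemma twist_cocycle: "\<Lambda>\<^sub>1 N \<oplus>\<^bsub>HP\<^esub> (N \<box>\<^sub>l \<one>\<^bsub>H\<^esub>) = \<Lambda>\<^sub>2 N \<oplus>\<^bsub>HP\<^esub> \<Psi> (\<one>\<^bsub>H\<^esub> \<box>\<^sub>r N)"
proof -
  have "\<Lambda>\<^sub>1 N = \<ominus>\<^bsub>HP\<^esub> (((const T \<box> E (-1)) \<box>\<^sub>l G) \<oplus>\<^bsub>HP\<^esub> ((\<one>\<^bsub>H\<^esub> \<box> const T) \<box>\<^sub>l G))"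
    by (simp add: N_def ls.A_AB.H.linear_maps_a_inv[OF algebra_homs_linear[OF \<Lambda>\<^sub>1_hom]] \<Lambda>\<^sub>1_tensor
        \<Delta>_T ls.stens_add_left)
  moreover have "N \<box>\<^sub>l \<one>\<^bsub>H\<^esub> = \<ominus>\<^bsub>HP\<^esub> ((const T \<box> G) \<box>\<^sub>l \<one>\<^bsub>H\<^esub>)"
    by (simp add: N_def ls.stens_simps)
  moreover have "\<Lambda>\<^sub>2 N = \<ominus>\<^bsub>HP\<^esub> (((const T \<box> G) \<box>\<^sub>l \<one>\<^bsub>H\<^esub>) \<oplus>\<^bsub>HP\<^esub> ((const T \<box> E (-1)) \<box>\<^sub>l G))"
    by (simp add: N_def ls.A_AB.H.linear_maps_a_inv[OF algebra_homs_linear[OF \<Lambda>\<^sub>2_hom]])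
      (simp add: \<Lambda>\<^sub>2_def \<Lambda>\<^sub>q_tensor \<Delta>_G rs.stens_add_right linear_maps_add[OF \<Psi>_linear] \<Psi>_tensor)
  moreover have "\<Psi> (\<one>\<^bsub>H\<^esub> \<box>\<^sub>r N) = \<ominus>\<^bsub>HP\<^esub> ((\<one>\<^bsub>H\<^esub> \<box> const T) \<box>\<^sub>l G)"
    by (simp add: N_def rs.stens_simps Q_P.H.linear_maps_a_inv[OF \<Psi>_linear] \<Psi>_tensor)
  ultimately show ?thesis
    by (simp add: ll.H.minus_add ll.H.a_ac)
qed

lemma coassoc_\<delta>:
  assumes x: "x \<in> carrier U"
  shows "\<Lambda>\<^sub>1 (\<delta> x) = \<Lambda>\<^sub>2 (\<delta> x)"
proof (rule ll.commutator_ode_unique)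
  note closed = linear_maps_closed[OF algebra_homs_linear[OF \<Lambda>\<^sub>1_hom]]
    linear_maps_closed[OF algebra_homs_linear[OF \<Lambda>\<^sub>2_hom]] linear_maps_closed[OF \<Psi>_linear]
  let ?P = "\<Lambda>\<^sub>1 N \<oplus>\<^bsub>HP\<^esub> (N \<box>\<^sub>l \<one>\<^bsub>H\<^esub>)"
  show "\<Lambda>\<^sub>1 (\<delta> x) \<in> carrier HP" "\<Lambda>\<^sub>2 (\<delta> x) \<in> carrier HP" "?P \<in> carrier HP"
    using x by (simp_all add: closed)
  show "series_deriv P3 (\<Lambda>\<^sub>1 (\<delta> x)) = ?P \<otimes>\<^bsub>HP\<^esub> \<Lambda>\<^sub>1 (\<delta> x) \<ominus>\<^bsub>HP\<^esub> \<Lambda>\<^sub>1 (\<delta> x) \<otimes>\<^bsub>HP\<^esub> ?P"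
  proof (rule deriv_hom_\<delta>[OF \<Lambda>\<^sub>1_hom _ x])
    fix a b assume "a \<in> carrier U" "b \<in> carrier U"
    then show "series_deriv P3 (\<Lambda>\<^sub>1 (const a \<box> const b)) =
        (N \<box>\<^sub>l \<one>\<^bsub>H\<^esub>) \<otimes>\<^bsub>HP\<^esub> \<Lambda>\<^sub>1 (const a \<box> const b) \<ominus>\<^bsub>HP\<^esub>
        \<Lambda>\<^sub>1 (const a \<box> const b) \<otimes>\<^bsub>HP\<^esub> (N \<box>\<^sub>l \<one>\<^bsub>H\<^esub>)"
      by (simp add: \<Lambda>\<^sub>1_tensor \<Delta>_const ls.deriv_stens deriv_\<delta> deriv_const ls.stens_mult a_minus_def
          ls.stens_simps)
  qed simp
  show "series_deriv P3 (\<Lambda>\<^sub>2 (\<delta> x)) = ?P \<otimes>\<^bsub>HP\<^esub> \<Lambda>\<^sub>2 (\<delta> x) \<ominus>\<^bsub>HP\<^esub> \<Lambda>\<^sub>2 (\<delta> x) \<otimes>\<^bsub>HP\<^esub> ?P"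
    \<comment> \<open>The common coefficient is rewritten into the form that
      \<open>\<Lambda>\<^sub>2\<close> produces; this is the only place where the two sides of
      coassociativity meet.\<close>
    unfolding twist_cocycle
  proof (rule deriv_hom_\<delta>[OF \<Lambda>\<^sub>2_hom _ x])
    fix a b assume "a \<in> carrier U" "b \<in> carrier U"
    then show "series_deriv P3 (\<Lambda>\<^sub>2 (const a \<box> const b)) =
        \<Psi> (\<one>\<^bsub>H\<^esub> \<box>\<^sub>r N) \<otimes>\<^bsub>HP\<^esub> \<Lambda>\<^sub>2 (const a \<box> const b) \<ominus>\<^bsub>HP\<^esub>
        \<Lambda>\<^sub>2 (const a \<box> const b) \<otimes>\<^bsub>HP\<^esub> \<Psi> (\<one>\<^bsub>H\<^esub> \<box>\<^sub>r N)"
      by (simp add: \<Lambda>\<^sub>2_def \<Lambda>\<^sub>q_tensor \<Delta>_const deriv_\<Psi> rs.deriv_stens deriv_\<delta> deriv_const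
          algebra_homs_mult[OF \<Psi>_hom, symmetric] rs.stens_mult a_minus_def rs.stens_simps
          linear_maps_add[OF \<Psi>_linear] Q_P.H.linear_maps_a_inv[OF \<Psi>_linear])
  qed (simp add: closed)
  have "\<Lambda>\<^sub>1 (\<delta> x) 0 = tensor_lift P3 (\<lambda>a b. pure_tensor UU U (\<Delta>\<^sub>0 a) b) (\<delta> x 0)"
    by (rule ts.linear_maps_stens_0[OF l.AB.algebra_over_axioms algebra_homs_linear[OF \<Lambda>\<^sub>1_hom]
          pure_assoc_bilinear(1)])
      (use x in \<open>simp_all add: \<Lambda>\<^sub>1_tensor ls.stens_0 \<Delta>_const \<delta>_0 const_coeff\<close>)
  moreover have "\<Lambda>\<^sub>q (\<delta> x) 0 = tensor_lift Q3 (\<lambda>a b. pure_tensor U UU a (\<Delta>\<^sub>0 b)) (\<delta> x 0)"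
    by (rule ts.linear_maps_stens_0[OF r.AB.algebra_over_axioms algebra_homs_linear[OF \<Lambda>\<^sub>q_hom]
          pure_assoc_bilinear(2)])
      (use x in \<open>simp_all add: \<Lambda>\<^sub>q_tensor rs.stens_0 \<Delta>_const \<delta>_0 const_coeff\<close>)
  ultimately show "\<Lambda>\<^sub>1 (\<delta> x) 0 = \<Lambda>\<^sub>2 (\<delta> x) 0"
    using coassoc\<^sub>0[OF x] by (simp add: \<Lambda>\<^sub>2_def \<Psi>_def \<delta>_0)
qed

lemma coassoc:
  assumes "z \<in> carrier H"
  shows "series_lift U U P3 (\<lambda>x y. \<Delta> x \<box>\<^sub>l y) (\<Delta> z) =
    tensor_assoc U \<circ> series_lift U U Q3 (\<lambda>x y. x \<box>\<^sub>r \<Delta> y) (\<Delta> z)"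
proof -
  have "\<Lambda>\<^sub>1 (\<Delta> z) = \<Lambda>\<^sub>2 (\<Delta> z)"
  proof (rule ls.B_AB.linear_maps_eq_on_const[OF _ _ _ assms])
    show "(\<lambda>z. \<Lambda>\<^sub>1 (\<Delta> z)) \<in> linear_maps H HP" "(\<lambda>z. \<Lambda>\<^sub>2 (\<Delta> z)) \<in> linear_maps H HP"
      by (rule linear_maps_comp[OF algebra_homs_linear[OF \<Lambda>\<^sub>1_hom] \<Delta>_linear]
          linear_maps_comp[OF algebra_homs_linear[OF \<Lambda>\<^sub>2_hom] \<Delta>_linear])+
  qed (simp add: \<Delta>_const coassoc_\<delta>)
  then show ?thesis
    by (simp add: \<Lambda>\<^sub>1_def \<Lambda>\<^sub>2_def \<Lambda>\<^sub>q_def \<Psi>_def comp_def)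
qed

subsection \<open>Counit\<close>

text \<open>Both counit laws are instances, \<open>h\<close> being contraction by the counit in one
  of the legs. \<open>left\<close> and \<open>right\<close> hold because the counit vanishes on T
  and on G. The contraction then kills N W and W N, so its value at \<delta> x has derivative zero
  and keeps its initial value x.\<close>

lemma counit_aux:
  assumes h: "h \<in> bilinear_maps H H H" and h\<^sub>0: "h\<^sub>0 \<in> bilinear_maps U U U"
    and const: "\<And>a b. a \<in> carrier U \<Longrightarrow> b \<in> carrier U \<Longrightarrow> h (const a) (const b) = const (h\<^sub>0 a b)"
    and left: "\<And>x y. x \<in> carrier H \<Longrightarrow> y \<in> carrier H \<Longrightarrow> h (const T \<otimes>\<^bsub>H\<^esub> x) (G \<otimes>\<^bsub>H\<^esub> y) = \<zero>\<^bsub>H\<^esub>"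
    and right: "\<And>x y. x \<in> carrier H \<Longrightarrow> y \<in> carrier H \<Longrightarrow> h (x \<otimes>\<^bsub>H\<^esub> const T) (y \<otimes>\<^bsub>H\<^esub> G) = \<zero>\<^bsub>H\<^esub>"
    and init: "\<And>x. x \<in> carrier U \<Longrightarrow> tensor_lift U h\<^sub>0 (\<Delta>\<^sub>0 x) = x"
    and z: "z \<in> carrier H"
  shows "series_lift U U U h (\<Delta> z) = z"
proof -
  let ?f = "series_lift U U U h"
  have lin: "?f \<in> linear_maps HH H"
    by (rule ts.series_lift_linear[OF algebra_over_axioms h])
  have f: "?f (x \<box> y) = h x y" if "x \<in> carrier H" "y \<in> carrier H" for x y
    using that by (rule ts.series_lift_stens[OF algebra_over_axioms h])
  have zero: "(\<lambda>W. \<zero>\<^bsub>H\<^esub>) \<in> linear_maps HH H"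
    by (rule linear_mapsI) simp_all
  note closed = linear_maps_closed[OF lin]
  have N_left: "?f (N \<otimes>\<^bsub>HH\<^esub> W) = \<zero>\<^bsub>H\<^esub>" if "W \<in> carrier HH" for W
  proof (rule ts.linear_maps_eq_on_stens[OF algebra_over_axioms _ zero _ that])
    show "(\<lambda>W. ?f (N \<otimes>\<^bsub>HH\<^esub> W)) \<in> linear_maps HH H"
      by (rule linear_maps_comp[OF lin tt.mult_left_linear]) simp
  qed (simp add: N_def tt.H.l_minus ts.stens_mult UU_U.H.linear_maps_a_inv[OF lin] f left)
  have N_right: "?f (W \<otimes>\<^bsub>HH\<^esub> N) = \<zero>\<^bsub>H\<^esub>" if "W \<in> carrier HH" for W
  proof (rule ts.linear_maps_eq_on_stens[OF algebra_over_axioms _ zero _ that])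
    show "(\<lambda>W. ?f (W \<otimes>\<^bsub>HH\<^esub> N)) \<in> linear_maps HH H"
      by (rule linear_maps_comp[OF lin tt.mult_right_linear]) simp
  qed (simp add: N_def tt.H.r_minus ts.stens_mult UU_U.H.linear_maps_a_inv[OF lin] f right)
  have \<delta>: "?f (\<delta> x) = const x" if x: "x \<in> carrier U" for x
  proof (rule deriv_eq_imp_eq)
    have "deriv (?f (\<delta> x)) = ?f (series_deriv UU (\<delta> x)) \<oplus>\<^bsub>H\<^esub> \<zero>\<^bsub>H\<^esub>"
      by (rule ts.deriv_linear_map_stens[OF algebra_over_axioms lin zero])
        (use x in \<open>simp_all add: f const deriv_const\<close>)
    then show "deriv (?f (\<delta> x)) n = deriv (const x) n" for n
      using x by (simp add: deriv_\<delta> UU_U.H.linear_maps_diff[OF lin] N_left N_right deriv_const)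
        (simp add: a_minus_def)
    have "?f (\<delta> x) 0 = tensor_lift U h\<^sub>0 (\<delta> x 0)"
      by (rule ts.linear_maps_stens_0[OF algebra_over_axioms lin h\<^sub>0])
        (use x in \<open>simp_all add: f const const_coeff\<close>)
    then show "?f (\<delta> x) 0 = const x 0"
      using x by (simp add: \<delta>_0 init const_coeff)
  qed (use x closed in simp_all)
  show ?thesis
  proof (rule U_U.linear_maps_eq_on_const[OF _ _ _ z])
    show "(\<lambda>z. ?f (\<Delta> z)) \<in> linear_maps H H"
      by (rule linear_maps_comp[OF lin \<Delta>_linear])
    show "(\<lambda>z. z) \<in> linear_maps H H"
      by (rule linear_mapsI) simp_all
  qed (simp add: \<Delta>_const \<delta>)
qed

lemma \<epsilon>_G: "\<epsilon> G = 0"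
  by (simp add: G_def \<epsilon>_simps \<epsilon>_const \<epsilon>\<^sub>0_L)

lemma counit:
  assumes z: "z \<in> carrier H"
  shows "series_lift U U U (\<lambda>x y. \<epsilon> x \<odot>\<^bsub>H\<^esub> y) (\<Delta> z) = z"
    and "series_lift U U U (\<lambda>x y. \<epsilon> y \<odot>\<^bsub>H\<^esub> x) (\<Delta> z) = z"
proof -
  have bil: "(\<lambda>x y. \<epsilon> x \<odot>\<^bsub>H\<^esub> y) \<in> bilinear_maps H H H" "(\<lambda>x y. \<epsilon> y \<odot>\<^bsub>H\<^esub> x) \<in> bilinear_maps H H H"
    "(\<lambda>a b. \<epsilon>\<^sub>0 a \<odot> b) \<in> bilinear_maps U U U" "(\<lambda>a b. \<epsilon>\<^sub>0 b \<odot> a) \<in> bilinear_maps U U U"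
    by (intro bilinear_mapsI linear_mapsI; simp add: \<epsilon>_simps \<epsilon>\<^sub>0_simps H.smult_l_distr H.smult_r_distr
        H.smult_smult smult_l_distr smult_r_distr smult_smult mult.commute)+
  show "series_lift U U U (\<lambda>x y. \<epsilon> x \<odot>\<^bsub>H\<^esub> y) (\<Delta> z) = z"
    by (rule counit_aux[OF bil(1,3) _ _ _ counit\<^sub>0(1) z])
      (simp_all add: \<epsilon>_const const_simps \<epsilon>_simps \<epsilon>\<^sub>0_T)
  show "series_lift U U U (\<lambda>x y. \<epsilon> y \<odot>\<^bsub>H\<^esub> x) (\<Delta> z) = z"
    by (rule counit_aux[OF bil(2,4) _ _ _ counit\<^sub>0(2) z])
      (simp_all add: \<epsilon>_const \<epsilon>\<^sub>0_T const_simps \<epsilon>_simps \<epsilon>_G)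
qed

subsection \<open>Antipode\<close>

lemma counit_unit_linear: "(\<lambda>z. \<epsilon> z \<odot>\<^bsub>H\<^esub> \<one>\<^bsub>H\<^esub>) \<in> linear_maps H H"
  by (rule linear_mapsI) (simp_all add: \<epsilon>_simps H.smult_l_distr H.smult_smult)

lemma deriv_scalar: "deriv (fps_const c \<odot>\<^bsub>H\<^esub> \<one>\<^bsub>H\<^esub>) = \<zero>\<^bsub>H\<^esub>"
  by (simp add: deriv_smult_const deriv_one)

text \<open>Let Y be the image of \<delta> x. Differentiating S(a) b contributes M S(a) b - S(a) M
  b, and N on the left contributes S(a) M b, so the terms \<open>?\<Theta>\<close> cancel. What
  remains is Y' = M Y + S(T) Y G, which the constant counit value also solves because S(T) G = -
  M.\<close>

lemma antipode_left:
  assumes z: "z \<in> carrier H"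
  shows "series_lift U U U (\<lambda>x y. S x \<otimes>\<^bsub>H\<^esub> y) (\<Delta> z) = \<epsilon> z \<odot>\<^bsub>H\<^esub> \<one>\<^bsub>H\<^esub>"
proof -
  let ?f = "series_lift U U U (\<lambda>x y. S x \<otimes>\<^bsub>H\<^esub> y)"
  let ?\<Theta> = "series_lift U U U (\<lambda>x y. S x \<otimes>\<^bsub>H\<^esub> (M \<otimes>\<^bsub>H\<^esub> y))"
  have bil: "(\<lambda>x y. S x \<otimes>\<^bsub>H\<^esub> y) \<in> bilinear_maps H H H"
    "(\<lambda>x y. S x \<otimes>\<^bsub>H\<^esub> (M \<otimes>\<^bsub>H\<^esub> y)) \<in> bilinear_maps H H H"
    "(\<lambda>a b. S\<^sub>0 a \<otimes> b) \<in> bilinear_maps U U U"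
    by (intro bilinear_mapsI linear_mapsI; simp add: linear_maps_add[OF S_linear] linear_maps_smult[OF S_linear]
        linear_maps_add[OF S\<^sub>0_linear] linear_maps_smult[OF S\<^sub>0_linear] H.l_distr H.r_distr l_distr r_distr)+
  note lin = ts.series_lift_linear[OF algebra_over_axioms bil(1)]
    ts.series_lift_linear[OF algebra_over_axioms bil(2)]
  note f = ts.series_lift_stens[OF algebra_over_axioms bil(1)]
    ts.series_lift_stens[OF algebra_over_axioms bil(2)]
  note closed [simp] = linear_maps_closed[OF lin(1)] linear_maps_closed[OF lin(2)]
  have N_left: "?f (N \<otimes>\<^bsub>HH\<^esub> W) = ?\<Theta> W" if "W \<in> carrier HH" for W
  proof (rule ts.linear_maps_eq_on_stens[OF algebra_over_axioms _ lin(2) _ that])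
    show "(\<lambda>W. ?f (N \<otimes>\<^bsub>HH\<^esub> W)) \<in> linear_maps HH H"
      by (rule linear_maps_comp[OF lin(1) tt.mult_left_linear]) simp
    fix a b assume ab: "a \<in> carrier U" "b \<in> carrier U"
    then have "?f (N \<otimes>\<^bsub>HH\<^esub> (const a \<box> const b)) =
        \<ominus>\<^bsub>H\<^esub> (S (const a) \<otimes>\<^bsub>H\<^esub> ((S (const T) \<otimes>\<^bsub>H\<^esub> G) \<otimes>\<^bsub>H\<^esub> const b))"
      by (simp add: N_def tt.H.l_minus ts.stens_mult UU_U.H.linear_maps_a_inv[OF lin(1)] f S_mult H.m_assoc)
    with ab show "?f (N \<otimes>\<^bsub>HH\<^esub> (const a \<box> const b)) = ?\<Theta> (const a \<box> const b)"
      by (simp add: f S_T_G H.l_minus H.r_minus)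
  qed
  have N_right: "?f (W \<otimes>\<^bsub>HH\<^esub> N) = \<ominus>\<^bsub>H\<^esub> (S (const T) \<otimes>\<^bsub>H\<^esub> (?f W \<otimes>\<^bsub>H\<^esub> G))" if "W \<in> carrier HH" for W
  proof (rule ts.linear_maps_eq_on_stens[OF algebra_over_axioms _ _ _ that])
    show "(\<lambda>W. ?f (W \<otimes>\<^bsub>HH\<^esub> N)) \<in> linear_maps HH H"
      by (rule linear_maps_comp[OF lin(1) tt.mult_right_linear]) simp
    show "(\<lambda>W. \<ominus>\<^bsub>H\<^esub> (S (const T) \<otimes>\<^bsub>H\<^esub> (?f W \<otimes>\<^bsub>H\<^esub> G))) \<in> linear_maps HH H"
      by (intro UU_U.H.linear_maps_uminus UU_U.H.linear_maps_mult_left UU_U.H.linear_maps_mult_right lin) simp_all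
  qed (simp add: N_def tt.H.r_minus ts.stens_mult UU_U.H.linear_maps_a_inv[OF lin(1)] f S_mult H.m_assoc)
  have \<delta>: "?f (\<delta> x) = fps_const (\<epsilon>\<^sub>0 x) \<odot>\<^bsub>H\<^esub> \<one>\<^bsub>H\<^esub>" if x: "x \<in> carrier U" for x
  proof (rule linear_ode_unique[where P = M and P' = "\<one>\<^bsub>H\<^esub>" and Q = "S (const T)" and Q' = G])
    let ?g = "\<lambda>W. M \<otimes>\<^bsub>H\<^esub> ?f W \<ominus>\<^bsub>H\<^esub> ?\<Theta> W"
    have g: "?g \<in> linear_maps HH H"
      unfolding a_minus_def
      by (intro UU_U.H.linear_maps_sum UU_U.H.linear_maps_uminus UU_U.H.linear_maps_mult_left lin) simp
    have "deriv (?f (\<delta> x)) = ?f (series_deriv UU (\<delta> x)) \<oplus>\<^bsub>H\<^esub> ?g (\<delta> x)"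
    proof (rule ts.deriv_linear_map_stens[OF algebra_over_axioms lin(1) g])
      fix a b assume "a \<in> carrier U" "b \<in> carrier U"
      then show "?g (const a \<box> const b) = deriv (?f (const a \<box> const b))"
        by (simp add: f S_const deriv_mult deriv_const deriv_\<sigma> a_minus_def H.l_distr H.l_minus H.m_assoc)
    qed (use x in simp)
    also have "?f (series_deriv UU (\<delta> x)) = ?\<Theta> (\<delta> x) \<oplus>\<^bsub>H\<^esub> S (const T) \<otimes>\<^bsub>H\<^esub> (?f (\<delta> x) \<otimes>\<^bsub>H\<^esub> G)"
      using x by (simp add: deriv_\<delta> UU_U.H.linear_maps_diff[OF lin(1)] N_left N_right)
        (simp add: a_minus_def)
    also have "\<dots> \<oplus>\<^bsub>H\<^esub> ?g (\<delta> x) =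
        M \<otimes>\<^bsub>H\<^esub> (?f (\<delta> x) \<otimes>\<^bsub>H\<^esub> \<one>\<^bsub>H\<^esub>) \<oplus>\<^bsub>H\<^esub> S (const T) \<otimes>\<^bsub>H\<^esub> (?f (\<delta> x) \<otimes>\<^bsub>H\<^esub> G)"
    proof -
      have "u \<oplus>\<^bsub>H\<^esub> v \<oplus>\<^bsub>H\<^esub> (w \<ominus>\<^bsub>H\<^esub> u) = w \<oplus>\<^bsub>H\<^esub> v"
        if "u \<in> carrier H" "v \<in> carrier H" "w \<in> carrier H" for u v w
      proof -
        have "u \<oplus>\<^bsub>H\<^esub> v \<oplus>\<^bsub>H\<^esub> (w \<ominus>\<^bsub>H\<^esub> u) = (u \<ominus>\<^bsub>H\<^esub> u) \<oplus>\<^bsub>H\<^esub> (w \<oplus>\<^bsub>H\<^esub> v)"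
          using that by (simp add: a_minus_def H.a_ac)
        then show ?thesis
          using that by (simp add: a_minus_def H.r_neg)
      qed
      then show ?thesis
        using x by simp
    qed
    finally show "deriv (?f (\<delta> x)) =
      M \<otimes>\<^bsub>H\<^esub> (?f (\<delta> x) \<otimes>\<^bsub>H\<^esub> \<one>\<^bsub>H\<^esub>) \<oplus>\<^bsub>H\<^esub> S (const T) \<otimes>\<^bsub>H\<^esub> (?f (\<delta> x) \<otimes>\<^bsub>H\<^esub> G)" .
    show "deriv (fps_const (\<epsilon>\<^sub>0 x) \<odot>\<^bsub>H\<^esub> \<one>\<^bsub>H\<^esub>) =
        M \<otimes>\<^bsub>H\<^esub> (fps_const (\<epsilon>\<^sub>0 x) \<odot>\<^bsub>H\<^esub> \<one>\<^bsub>H\<^esub> \<otimes>\<^bsub>H\<^esub> \<one>\<^bsub>H\<^esub>) \<oplus>\<^bsub>H\<^esub>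
        S (const T) \<otimes>\<^bsub>H\<^esub> (fps_const (\<epsilon>\<^sub>0 x) \<odot>\<^bsub>H\<^esub> \<one>\<^bsub>H\<^esub> \<otimes>\<^bsub>H\<^esub> G)"
      by (simp add: deriv_scalar S_T_G H.smult_a_inv H.r_neg)
    have "?f (\<delta> x) 0 = tensor_lift U (\<lambda>a b. S\<^sub>0 a \<otimes> b) (\<delta> x 0)"
      by (rule ts.linear_maps_stens_0[OF algebra_over_axioms lin(1) bil(3)])
        (use x in \<open>simp_all add: f mult_0 S_const \<sigma>_0 const_coeff\<close>)
    then show "?f (\<delta> x) 0 = (fps_const (\<epsilon>\<^sub>0 x) \<odot>\<^bsub>H\<^esub> \<one>\<^bsub>H\<^esub>) 0"
      using x by (simp add: \<delta>_0 antipode\<^sub>0 smult_const_coeff) (simp add: H_simps const_coeff)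
  qed (use x in simp_all)
  show ?thesis
    by (rule U_U.linear_maps_eq_on_const[OF linear_maps_comp[OF lin(1) \<Delta>_linear] counit_unit_linear _ z])
      (simp add: \<Delta>_const \<delta> \<epsilon>_const)
qed

text \<open>As on the left, with the roles of the sides exchanged: here the terms a M S(b) cancel
  and Y' = T Y L - Y M remains. A scalar constant solves it because M = T L.\<close>

lemma antipode_right:
  assumes z: "z \<in> carrier H"
  shows "series_lift U U U (\<lambda>x y. x \<otimes>\<^bsub>H\<^esub> S y) (\<Delta> z) = \<epsilon> z \<odot>\<^bsub>H\<^esub> \<one>\<^bsub>H\<^esub>"
proof -
  let ?f = "series_lift U U U (\<lambda>x y. x \<otimes>\<^bsub>H\<^esub> S y)"
  let ?\<Theta> = "series_lift U U U (\<lambda>x y. x \<otimes>\<^bsub>H\<^esub> (M \<otimes>\<^bsub>H\<^esub> S y))"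
  have bil: "(\<lambda>x y. x \<otimes>\<^bsub>H\<^esub> S y) \<in> bilinear_maps H H H"
    "(\<lambda>x y. x \<otimes>\<^bsub>H\<^esub> (M \<otimes>\<^bsub>H\<^esub> S y)) \<in> bilinear_maps H H H"
    "(\<lambda>a b. a \<otimes> S\<^sub>0 b) \<in> bilinear_maps U U U"
    by (intro bilinear_mapsI linear_mapsI; simp add: linear_maps_add[OF S_linear] linear_maps_smult[OF S_linear]
        linear_maps_add[OF S\<^sub>0_linear] linear_maps_smult[OF S\<^sub>0_linear] H.l_distr H.r_distr l_distr r_distr)+
  note lin = ts.series_lift_linear[OF algebra_over_axioms bil(1)]
    ts.series_lift_linear[OF algebra_over_axioms bil(2)]
  note f = ts.series_lift_stens[OF algebra_over_axioms bil(1)]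
    ts.series_lift_stens[OF algebra_over_axioms bil(2)]
  note closed [simp] = linear_maps_closed[OF lin(1)] linear_maps_closed[OF lin(2)]
  have N_left: "?f (N \<otimes>\<^bsub>HH\<^esub> W) = const T \<otimes>\<^bsub>H\<^esub> (?f W \<otimes>\<^bsub>H\<^esub> const L)" if "W \<in> carrier HH" for W
  proof (rule ts.linear_maps_eq_on_stens[OF algebra_over_axioms _ _ _ that])
    show "(\<lambda>W. ?f (N \<otimes>\<^bsub>HH\<^esub> W)) \<in> linear_maps HH H"
      by (rule linear_maps_comp[OF lin(1) tt.mult_left_linear]) simp
    show "(\<lambda>W. const T \<otimes>\<^bsub>H\<^esub> (?f W \<otimes>\<^bsub>H\<^esub> const L)) \<in> linear_maps HH H"
      by (intro UU_U.H.linear_maps_mult_left UU_U.H.linear_maps_mult_right lin) simp_all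
  qed (simp add: N_def tt.H.l_minus ts.stens_mult UU_U.H.linear_maps_a_inv[OF lin(1)] f S_mult S_G
      H.m_assoc H.r_minus)
  have N_right: "?f (W \<otimes>\<^bsub>HH\<^esub> N) = ?\<Theta> W" if "W \<in> carrier HH" for W
  proof (rule ts.linear_maps_eq_on_stens[OF algebra_over_axioms _ lin(2) _ that])
    show "(\<lambda>W. ?f (W \<otimes>\<^bsub>HH\<^esub> N)) \<in> linear_maps HH H"
      by (rule linear_maps_comp[OF lin(1) tt.mult_right_linear]) simp
    fix a b assume ab: "a \<in> carrier U" "b \<in> carrier U"
    then have "?f ((const a \<box> const b) \<otimes>\<^bsub>HH\<^esub> N) =
        \<ominus>\<^bsub>H\<^esub> (const a \<otimes>\<^bsub>H\<^esub> ((const T \<otimes>\<^bsub>H\<^esub> S G) \<otimes>\<^bsub>H\<^esub> S (const b)))"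
      by (simp add: N_def tt.H.r_minus ts.stens_mult UU_U.H.linear_maps_a_inv[OF lin(1)] f S_mult H.m_assoc)
    with ab show "?f ((const a \<box> const b) \<otimes>\<^bsub>HH\<^esub> N) = ?\<Theta> (const a \<box> const b)"
      by (simp add: f T_S_G H.l_minus H.r_minus)
  qed
  have \<delta>: "?f (\<delta> x) = fps_const (\<epsilon>\<^sub>0 x) \<odot>\<^bsub>H\<^esub> \<one>\<^bsub>H\<^esub>" if x: "x \<in> carrier U" for x
  proof (rule linear_ode_unique[where P = "const T" and P' = "const L" and Q = "\<ominus>\<^bsub>H\<^esub> \<one>\<^bsub>H\<^esub>" and Q' = M])
    let ?g = "\<lambda>W. ?\<Theta> W \<ominus>\<^bsub>H\<^esub> ?f W \<otimes>\<^bsub>H\<^esub> M"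
    have g: "?g \<in> linear_maps HH H"
      unfolding a_minus_def
      by (intro UU_U.H.linear_maps_sum UU_U.H.linear_maps_uminus UU_U.H.linear_maps_mult_right lin) simp
    have "deriv (?f (\<delta> x)) = ?f (series_deriv UU (\<delta> x)) \<oplus>\<^bsub>H\<^esub> ?g (\<delta> x)"
    proof (rule ts.deriv_linear_map_stens[OF algebra_over_axioms lin(1) g])
      fix a b assume "a \<in> carrier U" "b \<in> carrier U"
      then show "?g (const a \<box> const b) = deriv (?f (const a \<box> const b))"
        by (simp add: f S_const deriv_mult deriv_const deriv_\<sigma> a_minus_def H.r_distr H.r_minus H.m_assoc)
    qed (use x in simp)
    also have "?f (series_deriv UU (\<delta> x)) = const T \<otimes>\<^bsub>H\<^esub> (?f (\<delta> x) \<otimes>\<^bsub>H\<^esub> const L) \<ominus>\<^bsub>H\<^esub> ?\<Theta> (\<delta> x)"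
      using x by (simp add: deriv_\<delta> UU_U.H.linear_maps_diff[OF lin(1)] N_left N_right)
    also have "\<dots> \<oplus>\<^bsub>H\<^esub> ?g (\<delta> x) = const T \<otimes>\<^bsub>H\<^esub> (?f (\<delta> x) \<otimes>\<^bsub>H\<^esub> const L)
        \<oplus>\<^bsub>H\<^esub> \<ominus>\<^bsub>H\<^esub> \<one>\<^bsub>H\<^esub> \<otimes>\<^bsub>H\<^esub> (?f (\<delta> x) \<otimes>\<^bsub>H\<^esub> M)"
      using x by (simp add: a_minus_def H.a_assoc H.r_neg1 H.l_minus)
    finally show "deriv (?f (\<delta> x)) = const T \<otimes>\<^bsub>H\<^esub> (?f (\<delta> x) \<otimes>\<^bsub>H\<^esub> const L)
        \<oplus>\<^bsub>H\<^esub> \<ominus>\<^bsub>H\<^esub> \<one>\<^bsub>H\<^esub> \<otimes>\<^bsub>H\<^esub> (?f (\<delta> x) \<otimes>\<^bsub>H\<^esub> M)" .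
    show "deriv (fps_const (\<epsilon>\<^sub>0 x) \<odot>\<^bsub>H\<^esub> \<one>\<^bsub>H\<^esub>) =
        const T \<otimes>\<^bsub>H\<^esub> (fps_const (\<epsilon>\<^sub>0 x) \<odot>\<^bsub>H\<^esub> \<one>\<^bsub>H\<^esub> \<otimes>\<^bsub>H\<^esub> const L) \<oplus>\<^bsub>H\<^esub>
        \<ominus>\<^bsub>H\<^esub> \<one>\<^bsub>H\<^esub> \<otimes>\<^bsub>H\<^esub> (fps_const (\<epsilon>\<^sub>0 x) \<odot>\<^bsub>H\<^esub> \<one>\<^bsub>H\<^esub> \<otimes>\<^bsub>H\<^esub> M)"
      by (simp add: deriv_scalar M_def H.smult_a_inv H.l_minus H.r_neg)
    have "?f (\<delta> x) 0 = tensor_lift U (\<lambda>a b. a \<otimes> S\<^sub>0 b) (\<delta> x 0)"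
      by (rule ts.linear_maps_stens_0[OF algebra_over_axioms lin(1) bil(3)])
        (use x in \<open>simp_all add: f mult_0 S_const \<sigma>_0 const_coeff\<close>)
    then show "?f (\<delta> x) 0 = (fps_const (\<epsilon>\<^sub>0 x) \<odot>\<^bsub>H\<^esub> \<one>\<^bsub>H\<^esub>) 0"
      using x by (simp add: \<delta>_0 antipode\<^sub>0 smult_const_coeff) (simp add: H_simps const_coeff)
  qed (use x in simp_all)
  show ?thesis
    by (rule U_U.linear_maps_eq_on_const[OF linear_maps_comp[OF lin(1) \<Delta>_linear] counit_unit_linear _ z])
      (simp add: \<Delta>_const \<delta> \<epsilon>_const)
qed

lemma formal_hopf_algebra_twist: "formal_hopf_algebra U \<Delta> S \<epsilon>"
  unfolding formal_hopf_algebra_def Let_def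
  using H_assoc_algebra \<Delta>_hom \<epsilon>_hom S_linear coassoc counit antipode_left antipode_right by blast

end

subsection \<open>The coproduct and antipode of a string of root vectors\<close>

context twist_data
begin

lemma rising_closed [simp, intro]: "rising U a T n \<in> carrier U"
  by (induction n) auto

lemma T_rising_comm: "T \<otimes> rising U a T n = rising U a T n \<otimes> T"
proof (induction n)
  case (Suc n)
  have "T \<otimes> rising U a T (Suc n) = (T \<otimes> rising U a T n) \<otimes> (T \<oplus> (a + of_nat n) \<odot> \<one>)"
    by (simp add: m_assoc)
  also have "\<dots> = rising U a T n \<otimes> (T \<otimes> (T \<oplus> (a + of_nat n) \<odot> \<one>))"
    by (simp only: Suc.IH) (simp add: m_assoc)
  also have "T \<otimes> (T \<oplus> (a + of_nat n) \<odot> \<one>) = (T \<oplus> (a + of_nat n) \<odot> \<one>) \<otimes> T"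
    by (simp add: l_distr r_distr)
  finally show ?case
    by (simp add: m_assoc)
qed simp

text \<open>From T L = L T + L one gets L T = (T - 1) L, so passing L through each factor lowers its
  shift by one.\<close>

lemma L_rising: "L \<otimes> rising U a T n = rising U (a - 1) T n \<otimes> L"
proof (induction n)
  case (Suc n)
  have "L \<otimes> (T \<oplus> (a + of_nat n) \<odot> \<one>) = (T \<oplus> (a - 1 + of_nat n) \<odot> \<one>) \<otimes> L"
  proof -
    have "(T \<oplus> (a - 1 + of_nat n) \<odot> \<one>) \<otimes> L = L \<otimes> T \<oplus> (1 \<odot> L \<oplus> (a - 1 + of_nat n) \<odot> L)"
      by (simp add: l_distr T_L a_assoc)
    also have "1 \<odot> L \<oplus> (a - 1 + of_nat n) \<odot> L = (a + of_nat n) \<odot> L"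
      by (simp only: smult_l_distr[symmetric] L_closed) simp
    finally show ?thesis
      by (simp add: r_distr)
  qed
  then have "rising U (a - 1) T n \<otimes> (L \<otimes> (T \<oplus> (a + of_nat n) \<odot> \<one>)) = rising U (a - 1) T (Suc n) \<otimes> L"
    by (simp add: m_assoc)
  moreover have "L \<otimes> rising U a T (Suc n) = rising U (a - 1) T n \<otimes> (L \<otimes> (T \<oplus> (a + of_nat n) \<odot> \<one>))"
    by (simp add: m_assoc[symmetric] Suc.IH)
  ultimately show ?case
    by (simp only:)
qed simp

lemma T_rising_1: "T \<otimes> rising U 1 T n = rising U 0 T (Suc n)"
proof (induction n)
  case (Suc n)
  have "T \<otimes> rising U 1 T (Suc n) = (T \<otimes> rising U 1 T n) \<otimes> (T \<oplus> (1 + of_nat n) \<odot> \<one>)"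
    by (simp add: m_assoc)
  also have "\<dots> = rising U 0 T (Suc (Suc n))"
    by (simp only: Suc.IH rising.simps(2)[of U 0 T "Suc n"]) simp
  finally show ?case .
qed simp

text \<open>\<open>l i\<close> models the root vector of \<beta> + i \<alpha>. The constant D = det2
  \<alpha> (\<beta> + i \<alpha>) is the same for every i, as det2 \<alpha> \<alpha> = 0, while the
  weight under T grows by one per step.\<close>

context
  fixes l :: "nat \<Rightarrow> 'a" and b D :: 'f
  assumes l_closed [simp, intro]: "l i \<in> carrier U"
    and L_l: "L \<otimes> l i = l i \<otimes> L \<oplus> D \<odot> l (Suc i)"
    and T_l: "T \<otimes> l i = l i \<otimes> T \<oplus> (b + of_nat i) \<odot> l i"
begin

text \<open>Only [T, l 0] = b l 0 contributes to the bracket with N, namely - b times l 0 \<otimes>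
  G (1 - L t)^b, and this is l 0 tensored with the derivative of (1 - L t)^b.\<close>

lemma flow_root_left: "flow UU N (l 0 \<boxtimes> \<one>) = const (l 0) \<box> E b"
proof (rule tt.flow_eqI[OF N_closed])
  show "(const (l 0) \<box> E b) 0 = l 0 \<boxtimes> \<one>"
    by (simp add: ts.stens_0) (simp add: const_coeff E_coeff)
  have T_l0: "const T \<otimes>\<^bsub>H\<^esub> const (l 0) = const (l 0) \<otimes>\<^bsub>H\<^esub> const T \<oplus>\<^bsub>H\<^esub> fps_const b \<odot>\<^bsub>H\<^esub> const (l 0)"
    using T_l[of 0] by (simp add: const_simps[symmetric])
  have G_E: "G \<otimes>\<^bsub>H\<^esub> E b = const L \<otimes>\<^bsub>H\<^esub> E (b - 1)" "E b \<otimes>\<^bsub>H\<^esub> G = const L \<otimes>\<^bsub>H\<^esub> E (b - 1)"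
  proof -
    show "G \<otimes>\<^bsub>H\<^esub> E b = const L \<otimes>\<^bsub>H\<^esub> E (b - 1)"
      by (simp add: G_alt H.m_assoc E_mult)
    show "E b \<otimes>\<^bsub>H\<^esub> G = const L \<otimes>\<^bsub>H\<^esub> E (b - 1)"
      by (simp add: G_def H.m_assoc[symmetric] E_mult E_L)
  qed
  let ?p = "(const (l 0) \<otimes>\<^bsub>H\<^esub> const T) \<box> (const L \<otimes>\<^bsub>H\<^esub> E (b - 1))"
  let ?q = "fps_const b \<odot>\<^bsub>HH\<^esub> (const (l 0) \<box> (const L \<otimes>\<^bsub>H\<^esub> E (b - 1)))"
  have "N \<otimes>\<^bsub>HH\<^esub> (const (l 0) \<box> E b) = \<ominus>\<^bsub>HH\<^esub> (?p \<oplus>\<^bsub>HH\<^esub> ?q)"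
    by (simp add: N_def tt.H.l_minus ts.stens_mult T_l0 G_E ts.stens_simps)
  moreover have "(const (l 0) \<box> E b) \<otimes>\<^bsub>HH\<^esub> N = \<ominus>\<^bsub>HH\<^esub> ?p"
    by (simp add: N_def tt.H.r_minus ts.stens_mult G_E)
  moreover have "series_deriv UU (const (l 0) \<box> E b) = \<ominus>\<^bsub>HH\<^esub> ?q"
    by (simp add: ts.deriv_stens deriv_const ts.stens_simps deriv_E tt.H.smult_uminus fps_const_neg[symmetric]
        del: fps_const_neg)
  ultimately show "series_deriv UU (const (l 0) \<box> E b) =
      N \<otimes>\<^bsub>HH\<^esub> (const (l 0) \<box> E b) \<ominus>\<^bsub>HH\<^esub> (const (l 0) \<box> E b) \<otimes>\<^bsub>HH\<^esub> N"
    by (simp add: tt.H.neg_add_minus_neg)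
qed simp_all

definition R where "R i = const (rising U 0 T i)"

lemma R_closed [simp, intro]: "R i \<in> carrier H"
  by (simp add: R_def)

lemma R_Suc: "R (Suc i) = const T \<otimes>\<^bsub>H\<^esub> R i \<oplus>\<^bsub>H\<^esub> fps_const (of_nat i) \<odot>\<^bsub>H\<^esub> R i"
  by (simp add: R_def const_simps[symmetric] T_rising_comm r_distr)

lemma T_R: "const T \<otimes>\<^bsub>H\<^esub> R i = R i \<otimes>\<^bsub>H\<^esub> const T"
  by (simp add: R_def const_simps[symmetric] T_rising_comm)

text \<open>The coefficient (-1)^i c_i of the i-th term of the coproduct. Its recursion
  \<open>s_Suc\<close> is what allows the sums to be shifted by one index.\<close>

definition s where "s i = (-1) ^ i * (D ^ i / fact i)"

lemma s_Suc: "of_nat (Suc i) * s (Suc i) = - (D * s i)"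
  by (simp add: s_def fact_Suc field_simps del: of_nat_Suc)

definition u where "u i = R i \<box> (E (- of_nat i) \<otimes>\<^bsub>H\<^esub> const (l i))"

lemma u_closed [simp, intro]: "u i \<in> carrier HH"
  by (simp add: u_def)

lemma const_L_l: "const L \<otimes>\<^bsub>H\<^esub> const (l i) =
    const (l i) \<otimes>\<^bsub>H\<^esub> const L \<oplus>\<^bsub>H\<^esub> fps_const D \<odot>\<^bsub>H\<^esub> const (l (Suc i))"
  by (simp add: const_simps[symmetric] L_l)

lemma l_E1: "const (l i) \<otimes>\<^bsub>H\<^esub> E 1 =
    E 1 \<otimes>\<^bsub>H\<^esub> const (l i) \<oplus>\<^bsub>H\<^esub> fps_X \<odot>\<^bsub>H\<^esub> (fps_const D \<odot>\<^bsub>H\<^esub> const (l (Suc i)))"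
proof -
  have "p \<oplus>\<^bsub>H\<^esub> \<ominus>\<^bsub>H\<^esub> q = p \<oplus>\<^bsub>H\<^esub> \<ominus>\<^bsub>H\<^esub> (q \<oplus>\<^bsub>H\<^esub> r) \<oplus>\<^bsub>H\<^esub> r"
    if "p \<in> carrier H" "q \<in> carrier H" "r \<in> carrier H" for p q r
    using that by (simp add: H.minus_add H.a_assoc H.l_neg)
  then show ?thesis
    by (simp add: E_1 a_minus_def H.l_distr H.r_distr H.l_minus H.r_minus const_L_l H.smult_r_distr)
qed

text \<open>Sandwiching between two copies of 1 \<otimes> (1 - L t) turns the G inside N into L,
  using the left copy for N u and the right copy for u N. All that survives of the difference is
  [L, l i] = D l (i + 1).\<close>

lemma twisted_bracket_u:
  "(\<one>\<^bsub>H\<^esub> \<box> E 1) \<otimes>\<^bsub>HH\<^esub> (N \<otimes>\<^bsub>HH\<^esub> u i \<ominus>\<^bsub>HH\<^esub> u i \<otimes>\<^bsub>HH\<^esub> N) \<otimes>\<^bsub>HH\<^esub> (\<one>\<^bsub>H\<^esub> \<box> E 1) =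
    fps_const (- D) \<odot>\<^bsub>HH\<^esub> ((const T \<otimes>\<^bsub>H\<^esub> R i) \<box> (E (- of_nat i) \<otimes>\<^bsub>H\<^esub> const (l (Suc i))))"
proof -
  let ?E = "E (- of_nat i)" and ?l = "const (l i)" and ?TR = "const T \<otimes>\<^bsub>H\<^esub> R i"
  have L_E: "const L \<otimes>\<^bsub>H\<^esub> (?E \<otimes>\<^bsub>H\<^esub> x) = ?E \<otimes>\<^bsub>H\<^esub> (const L \<otimes>\<^bsub>H\<^esub> x)" if "x \<in> carrier H" for x
    using that by (simp add: H.m_assoc[symmetric] E_L)
  have E_E: "E 1 \<otimes>\<^bsub>H\<^esub> (?E \<otimes>\<^bsub>H\<^esub> x) = ?E \<otimes>\<^bsub>H\<^esub> (E 1 \<otimes>\<^bsub>H\<^esub> x)" if "x \<in> carrier H" for x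
    using that by (simp add: H.m_assoc[symmetric] E_mult add.commute)
  have leg: "const L \<otimes>\<^bsub>H\<^esub> (?l \<otimes>\<^bsub>H\<^esub> E 1) = E 1 \<otimes>\<^bsub>H\<^esub> (?l \<otimes>\<^bsub>H\<^esub> const L) \<oplus>\<^bsub>H\<^esub> fps_const D \<odot>\<^bsub>H\<^esub> const (l (Suc i))"
  proof -
    have "const L \<otimes>\<^bsub>H\<^esub> (?l \<otimes>\<^bsub>H\<^esub> E 1) = (const L \<otimes>\<^bsub>H\<^esub> ?l) \<ominus>\<^bsub>H\<^esub> fps_X \<odot>\<^bsub>H\<^esub> (const L \<otimes>\<^bsub>H\<^esub> (?l \<otimes>\<^bsub>H\<^esub> const L))"
      by (simp add: E_1 a_minus_def H.r_distr H.r_minus)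
    also have "\<dots> = (?l \<otimes>\<^bsub>H\<^esub> const L \<ominus>\<^bsub>H\<^esub> fps_X \<odot>\<^bsub>H\<^esub> (const L \<otimes>\<^bsub>H\<^esub> (?l \<otimes>\<^bsub>H\<^esub> const L)))
        \<oplus>\<^bsub>H\<^esub> fps_const D \<odot>\<^bsub>H\<^esub> const (l (Suc i))"
      by (simp only: const_L_l) (simp add: a_minus_def H.a_ac)
    also have "?l \<otimes>\<^bsub>H\<^esub> const L \<ominus>\<^bsub>H\<^esub> fps_X \<odot>\<^bsub>H\<^esub> (const L \<otimes>\<^bsub>H\<^esub> (?l \<otimes>\<^bsub>H\<^esub> const L)) = E 1 \<otimes>\<^bsub>H\<^esub> (?l \<otimes>\<^bsub>H\<^esub> const L)"
      by (simp add: E_1 a_minus_def H.l_distr H.l_minus)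
    finally show ?thesis .
  qed
  let ?e = "\<one>\<^bsub>H\<^esub> \<box> E 1"
  let ?p = "?TR \<box> (?E \<otimes>\<^bsub>H\<^esub> (E 1 \<otimes>\<^bsub>H\<^esub> (?l \<otimes>\<^bsub>H\<^esub> const L)))"
  let ?q = "fps_const D \<odot>\<^bsub>HH\<^esub> (?TR \<box> (?E \<otimes>\<^bsub>H\<^esub> const (l (Suc i))))"
  have left: "?e \<otimes>\<^bsub>HH\<^esub> (N \<otimes>\<^bsub>HH\<^esub> u i) \<otimes>\<^bsub>HH\<^esub> ?e = \<ominus>\<^bsub>HH\<^esub> (?p \<oplus>\<^bsub>HH\<^esub> ?q)"
  proof -
    have "?e \<otimes>\<^bsub>HH\<^esub> (N \<otimes>\<^bsub>HH\<^esub> u i) \<otimes>\<^bsub>HH\<^esub> ?e =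
        \<ominus>\<^bsub>HH\<^esub> (?TR \<box> (E 1 \<otimes>\<^bsub>H\<^esub> G \<otimes>\<^bsub>H\<^esub> (?E \<otimes>\<^bsub>H\<^esub> (?l \<otimes>\<^bsub>H\<^esub> E 1))))"
      by (simp add: N_def u_def tt.H.l_minus tt.H.r_minus ts.stens_mult H.m_assoc)
    then show ?thesis
      by (simp add: E_G L_E leg H.r_distr ts.stens_simps)
  qed
  have right: "?e \<otimes>\<^bsub>HH\<^esub> (u i \<otimes>\<^bsub>HH\<^esub> N) \<otimes>\<^bsub>HH\<^esub> ?e = \<ominus>\<^bsub>HH\<^esub> ?p"
    by (simp add: N_def u_def tt.H.l_minus tt.H.r_minus ts.stens_mult H.m_assoc E_E E_G T_R)
  have "?e \<otimes>\<^bsub>HH\<^esub> (N \<otimes>\<^bsub>HH\<^esub> u i) \<otimes>\<^bsub>HH\<^esub> ?e \<ominus>\<^bsub>HH\<^esub> ?e \<otimes>\<^bsub>HH\<^esub> (u i \<otimes>\<^bsub>HH\<^esub> N) \<otimes>\<^bsub>HH\<^esub> ?e = \<ominus>\<^bsub>HH\<^esub> ?q"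
    unfolding left right by (simp add: tt.H.neg_add_minus_neg)
  then show ?thesis
    by (simp add: a_minus_def tt.H.l_distr tt.H.r_distr tt.H.l_minus tt.H.r_minus
        fps_const_neg[symmetric] tt.H.smult_uminus del: fps_const_neg)
qed

text \<open>The two sides of the equation are compared after multiplication by e = 1 \<otimes> (1 -
  L t) from both sides. This removes the inverse powers brought in by N and by differentiation;
  index shifts of t-adic sums then make the sides equal.\<close>

lemma flow_root_right: "flow UU N (\<one> \<boxtimes> l 0) = tt.tsum (\<lambda>i. fps_const (s i) \<odot>\<^bsub>HH\<^esub> u i)" (is "_ = ?Y")
proof (rule tt.flow_eqI[OF N_closed])
  let ?e = "\<one>\<^bsub>H\<^esub> \<box> E 1" and ?e' = "\<one>\<^bsub>H\<^esub> \<box> E (-1)" and ?L = "\<one>\<^bsub>H\<^esub> \<box> const L"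
  let ?k = "\<lambda>i. fps_const (of_nat i) :: 'f fps"
  have Y: "?Y \<in> carrier HH"
    by auto
  show "?Y 0 = \<one> \<boxtimes> l 0"
    by (simp add: tt.tsum_coeff tt.smult_const_coeff u_def ts.stens_0 mult_0)
      (simp add: s_def R_def const_coeff E_coeff)
  have e_inv: "?e' \<otimes>\<^bsub>HH\<^esub> ?e = \<one>\<^bsub>HH\<^esub>" "?e \<otimes>\<^bsub>HH\<^esub> ?e' = \<one>\<^bsub>HH\<^esub>"
    by (simp_all add: ts.stens_mult E_inverse ts.stens_one)
  have e_eq: "?e = \<one>\<^bsub>HH\<^esub> \<ominus>\<^bsub>HH\<^esub> fps_X \<odot>\<^bsub>HH\<^esub> ?L"
    by (subst E_1) (simp add: a_minus_def ts.stens_simps ts.stens_one)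
  \<comment> \<open>The part of the derivative that comes from the powers t^i; \<open>s_Suc\<close>
    has absorbed the factor i + 1.\<close>
  define Q where "Q = tt.tsum (\<lambda>i. fps_const (- (D * s i)) \<odot>\<^bsub>HH\<^esub> u (Suc i))"
  have Q: "Q \<in> carrier HH"
    by (auto simp: Q_def)
  \<comment> \<open>Differentiating (1 - L t)^(-i) in the i-th term yields i times this
    series.\<close>
  define x where "x = (\<lambda>i. fps_const (s i) \<odot>\<^bsub>HH\<^esub> (R i \<box> (const L \<otimes>\<^bsub>H\<^esub> E (- of_nat i - 1) \<otimes>\<^bsub>H\<^esub> const (l i))))"
  have x: "x i \<in> carrier HH" for i
    by (simp add: x_def)
  have deriv_Y: "series_deriv UU ?Y = tt.tsum (\<lambda>i. ?k i \<odot>\<^bsub>HH\<^esub> x i) \<oplus>\<^bsub>HH\<^esub> Q"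
  proof -
    have "series_deriv UU (fps_const (s i) \<odot>\<^bsub>HH\<^esub> u i) = ?k i \<odot>\<^bsub>HH\<^esub> x i" for i
      by (simp add: u_def x_def tt.deriv_smult_const ts.deriv_stens deriv_mult deriv_E deriv_const R_def
          ts.stens_simps tt.H.smult_smult mult.commute)
    moreover have "?k (Suc i) \<odot>\<^bsub>HH\<^esub> (fps_const (s (Suc i)) \<odot>\<^bsub>HH\<^esub> u (Suc i)) =
        fps_const (- (D * s i)) \<odot>\<^bsub>HH\<^esub> u (Suc i)" for i
      by (simp add: tt.H.smult_smult s_Suc del: of_nat_Suc)
    ultimately show ?thesis
      by (simp add: tt.deriv_tsum Q_def del: of_nat_Suc)
  qed
  \<comment> \<open>Multiplication by 1 - L t restores the exponent -i of \<open>u i\<close>; the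
    factor i makes the term of index 0 vanish, and the shift produces t and
    \<open>Q\<close>.\<close>
  have e_x: "?e \<otimes>\<^bsub>HH\<^esub> tt.tsum (\<lambda>i. ?k i \<odot>\<^bsub>HH\<^esub> x i) = fps_X \<odot>\<^bsub>HH\<^esub> (?L \<otimes>\<^bsub>HH\<^esub> Q)"
  proof -
    have ex: "?e \<otimes>\<^bsub>HH\<^esub> x i = fps_const (s i) \<odot>\<^bsub>HH\<^esub> (?L \<otimes>\<^bsub>HH\<^esub> u i)" for i
    proof -
      have "E 1 \<otimes>\<^bsub>H\<^esub> (const L \<otimes>\<^bsub>H\<^esub> (E (- of_nat i - 1) \<otimes>\<^bsub>H\<^esub> const (l i))) =
          (E 1 \<otimes>\<^bsub>H\<^esub> const L) \<otimes>\<^bsub>H\<^esub> (E (- of_nat i - 1) \<otimes>\<^bsub>H\<^esub> const (l i))"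
        by (simp add: H.m_assoc)
      also have "\<dots> = const L \<otimes>\<^bsub>H\<^esub> ((E 1 \<otimes>\<^bsub>H\<^esub> E (- of_nat i - 1)) \<otimes>\<^bsub>H\<^esub> const (l i))"
        by (simp only: E_L[symmetric]) (simp add: H.m_assoc)
      finally have "E 1 \<otimes>\<^bsub>H\<^esub> (const L \<otimes>\<^bsub>H\<^esub> (E (- of_nat i - 1) \<otimes>\<^bsub>H\<^esub> const (l i))) =
          const L \<otimes>\<^bsub>H\<^esub> ((E 1 \<otimes>\<^bsub>H\<^esub> E (- of_nat i - 1)) \<otimes>\<^bsub>H\<^esub> const (l i))" .
      then show ?thesis
        by (simp add: x_def u_def ts.stens_mult E_mult H.m_assoc)
    qed
    have "?e \<otimes>\<^bsub>HH\<^esub> tt.tsum (\<lambda>i. ?k i \<odot>\<^bsub>HH\<^esub> x i) =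
        tt.tsum (\<lambda>i. ?k i \<odot>\<^bsub>HH\<^esub> (fps_const (s i) \<odot>\<^bsub>HH\<^esub> (?L \<otimes>\<^bsub>HH\<^esub> u i)))"
      by (subst tt.tsum_linear[OF tt.mult_left_linear]) (simp_all add: x ex)
    also have "\<dots> = fps_X \<odot>\<^bsub>HH\<^esub> tt.tsum (\<lambda>i. fps_const (- (D * s i)) \<odot>\<^bsub>HH\<^esub> (?L \<otimes>\<^bsub>HH\<^esub> u (Suc i)))"
      by (subst tt.tsum_index) (simp_all add: tt.H.smult_smult s_Suc del: of_nat_Suc)
    also have "tt.tsum (\<lambda>i. fps_const (- (D * s i)) \<odot>\<^bsub>HH\<^esub> (?L \<otimes>\<^bsub>HH\<^esub> u (Suc i))) = ?L \<otimes>\<^bsub>HH\<^esub> Q"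
      unfolding Q_def by (subst tt.tsum_linear[OF tt.mult_left_linear]) simp_all
    finally show ?thesis .
  qed
  \<comment> \<open>Since e = 1 - t (1 \<otimes> L), the product e Q falls short of Q by t (1
    \<otimes> L) Q, and \<open>e_x\<close> restores this amount.\<close>
  have e_deriv: "?e \<otimes>\<^bsub>HH\<^esub> series_deriv UU ?Y = Q"
  proof -
    have "?e \<otimes>\<^bsub>HH\<^esub> Q = Q \<ominus>\<^bsub>HH\<^esub> fps_X \<odot>\<^bsub>HH\<^esub> (?L \<otimes>\<^bsub>HH\<^esub> Q)"
      using Q by (simp add: e_eq a_minus_def tt.H.l_distr tt.H.l_minus)
    moreover have "p \<oplus>\<^bsub>HH\<^esub> (q \<ominus>\<^bsub>HH\<^esub> p) = q" if "p \<in> carrier HH" "q \<in> carrier HH" for p q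
      using that by (simp add: a_minus_def tt.H.a_lcomm[of p q] tt.H.r_neg)
    ultimately show ?thesis
      using Q x by (simp add: deriv_Y tt.H.r_distr e_x)
  qed
  define w where "w = (\<lambda>i. R i \<box> (E (- of_nat i) \<otimes>\<^bsub>H\<^esub> const (l (Suc i))))"
  have w: "w i \<in> carrier HH" for i
    by (simp add: w_def)
  let ?T = "const T \<box> \<one>\<^bsub>H\<^esub>"
  \<comment> \<open>The rising factorial of length i + 1 is T + i times the one of length i, which
    gives the first two terms; moving 1 - L t to the left past the root vector leaves the
    third.\<close>
  have u_e: "u (Suc i) \<otimes>\<^bsub>HH\<^esub> ?e = ?T \<otimes>\<^bsub>HH\<^esub> w i \<oplus>\<^bsub>HH\<^esub> ?k i \<odot>\<^bsub>HH\<^esub> w i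
      \<oplus>\<^bsub>HH\<^esub> fps_X \<odot>\<^bsub>HH\<^esub> (fps_const D \<odot>\<^bsub>HH\<^esub> w (Suc i))" for i
  proof -
    have "E (- of_nat (Suc i)) \<otimes>\<^bsub>H\<^esub> (E 1 \<otimes>\<^bsub>H\<^esub> const (l (Suc i))) = E (- of_nat i) \<otimes>\<^bsub>H\<^esub> const (l (Suc i))"
      by (simp add: H.m_assoc[symmetric] E_mult)
    then have "u (Suc i) \<otimes>\<^bsub>HH\<^esub> ?e = (R (Suc i) \<box> (E (- of_nat i) \<otimes>\<^bsub>H\<^esub> const (l (Suc i))))
        \<oplus>\<^bsub>HH\<^esub> fps_X \<odot>\<^bsub>HH\<^esub> (fps_const D \<odot>\<^bsub>HH\<^esub> w (Suc i))"
      by (simp add: u_def w_def ts.stens_mult H.m_assoc l_E1 H.r_distr ts.stens_simps del: of_nat_Suc)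
    then show ?thesis
      by (simp add: R_Suc w_def ts.stens_simps ts.stens_mult)
  qed
  \<comment> \<open>The sum with factor i, shifted by one index, is the negative of the sum with
    factor t, so only the terms with T survive.\<close>
  have "Q \<otimes>\<^bsub>HH\<^esub> ?e = tt.tsum (\<lambda>i. fps_const (- (D * s i)) \<odot>\<^bsub>HH\<^esub> (?T \<otimes>\<^bsub>HH\<^esub> w i))"
  proof -
    let ?z = "\<lambda>i. fps_const (- (D * s i)) \<odot>\<^bsub>HH\<^esub> w i"
    have 1: "Q \<otimes>\<^bsub>HH\<^esub> ?e = tt.tsum (\<lambda>i. fps_const (- (D * s i)) \<odot>\<^bsub>HH\<^esub> (?T \<otimes>\<^bsub>HH\<^esub> w i) \<oplus>\<^bsub>HH\<^esub> (?k i \<odot>\<^bsub>HH\<^esub> ?z i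
        \<oplus>\<^bsub>HH\<^esub> fps_X \<odot>\<^bsub>HH\<^esub> (fps_const (- (D * (D * s i))) \<odot>\<^bsub>HH\<^esub> w (Suc i))))"
      unfolding Q_def
      by (subst tt.tsum_linear[OF tt.mult_right_linear])
        (simp_all add: u_e w tt.H.smult_r_distr tt.H.smult_smult tt.H.a_assoc mult_ac)
    have 2: "tt.tsum (\<lambda>i. ?k i \<odot>\<^bsub>HH\<^esub> ?z i) =
        \<ominus>\<^bsub>HH\<^esub> (fps_X \<odot>\<^bsub>HH\<^esub> tt.tsum (\<lambda>i. fps_const (- (D * (D * s i))) \<odot>\<^bsub>HH\<^esub> w (Suc i)))"
    proof -
      have eq: "?k (Suc i) \<odot>\<^bsub>HH\<^esub> ?z (Suc i) = \<ominus>\<^bsub>HH\<^esub> (fps_const (- (D * (D * s i))) \<odot>\<^bsub>HH\<^esub> w (Suc i))" for i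
      proof -
        have "of_nat (Suc i) * (- (D * s (Suc i))) = - (- (D * (D * s i)))"
        proof -
          have "of_nat (Suc i) * (- (D * s (Suc i))) = - (D * (of_nat (Suc i) * s (Suc i)))"
            by (simp add: mult.left_commute del: of_nat_Suc)
          then show ?thesis
            by (simp only: s_Suc) simp
        qed
        then show ?thesis
          using w by (simp add: tt.H.smult_smult tt.H.smult_uminus[symmetric] del: of_nat_Suc)
      qed
      have neg: "(\<lambda>x. \<ominus>\<^bsub>HH\<^esub> x) \<in> linear_maps HH HH"
        by (rule linear_mapsI) (simp_all add: tt.H.minus_add tt.H.smult_a_inv)
      have "tt.tsum (\<lambda>i. ?k i \<odot>\<^bsub>HH\<^esub> ?z i) = fps_X \<odot>\<^bsub>HH\<^esub> tt.tsum (\<lambda>i. ?k (Suc i) \<odot>\<^bsub>HH\<^esub> ?z (Suc i))"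
        by (rule tt.tsum_index) (simp add: w)
      also have "tt.tsum (\<lambda>i. ?k (Suc i) \<odot>\<^bsub>HH\<^esub> ?z (Suc i)) =
          \<ominus>\<^bsub>HH\<^esub> tt.tsum (\<lambda>i. fps_const (- (D * (D * s i))) \<odot>\<^bsub>HH\<^esub> w (Suc i))"
        unfolding eq by (rule tt.tsum_linear[OF neg, symmetric]) (simp add: w)
      finally show ?thesis
        by (simp add: tt.H.smult_a_inv tt.tsum_closed w)
    qed
    have 3: "tt.tsum (\<lambda>i. fps_X \<odot>\<^bsub>HH\<^esub> (fps_const (- (D * (D * s i))) \<odot>\<^bsub>HH\<^esub> w (Suc i))) =
        fps_X \<odot>\<^bsub>HH\<^esub> tt.tsum (\<lambda>i. fps_const (- (D * (D * s i))) \<odot>\<^bsub>HH\<^esub> w (Suc i))"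
      by (rule tt.tsum_linear[OF tt.smult_linear, symmetric]) (simp add: w)
    show ?thesis
      unfolding 1 by (subst tt.tsum_add, simp add: w, simp add: w, subst tt.tsum_add, simp add: w, simp add: w)
        (simp add: 2 3 tt.H.l_neg w tt.tsum_closed)
  qed
  moreover have "?e \<otimes>\<^bsub>HH\<^esub> (N \<otimes>\<^bsub>HH\<^esub> ?Y \<ominus>\<^bsub>HH\<^esub> ?Y \<otimes>\<^bsub>HH\<^esub> N) \<otimes>\<^bsub>HH\<^esub> ?e =
      tt.tsum (\<lambda>i. fps_const (- (D * s i)) \<odot>\<^bsub>HH\<^esub> (?T \<otimes>\<^bsub>HH\<^esub> w i))"
  proof -
    let ?f = "\<lambda>W. ?e \<otimes>\<^bsub>HH\<^esub> (N \<otimes>\<^bsub>HH\<^esub> W \<ominus>\<^bsub>HH\<^esub> W \<otimes>\<^bsub>HH\<^esub> N) \<otimes>\<^bsub>HH\<^esub> ?e"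
    have f: "?f \<in> linear_maps HH HH"
    proof -
      interpret HHHH: algebra_pair HH HH ..
      show ?thesis
        unfolding a_minus_def
        by (intro HHHH.linear_maps_mult_left HHHH.linear_maps_mult_right HHHH.linear_maps_sum
            HHHH.linear_maps_uminus tt.mult_left_linear tt.mult_right_linear) simp_all
    qed
    have "?f (fps_const (s i) \<odot>\<^bsub>HH\<^esub> u i) = fps_const (- (D * s i)) \<odot>\<^bsub>HH\<^esub> (?T \<otimes>\<^bsub>HH\<^esub> w i)" for i
    proof -
      have "?f (fps_const (s i) \<odot>\<^bsub>HH\<^esub> u i) = fps_const (s i) \<odot>\<^bsub>HH\<^esub> ?f (u i)"
        by (rule linear_maps_smult[OF f]) simp
      then show ?thesis
        by (simp add: twisted_bracket_u w_def ts.stens_mult tt.H.smult_smult mult.commute)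
    qed
    then show ?thesis
      using tt.tsum_linear[OF f, of "\<lambda>i. fps_const (s i) \<odot>\<^bsub>HH\<^esub> u i"] by simp
  qed
  ultimately have "?e \<otimes>\<^bsub>HH\<^esub> series_deriv UU ?Y \<otimes>\<^bsub>HH\<^esub> ?e =
      ?e \<otimes>\<^bsub>HH\<^esub> (N \<otimes>\<^bsub>HH\<^esub> ?Y \<ominus>\<^bsub>HH\<^esub> ?Y \<otimes>\<^bsub>HH\<^esub> N) \<otimes>\<^bsub>HH\<^esub> ?e"
    by (simp add: e_deriv)
  \<comment> \<open>The factor e is invertible, so the sandwiched equation gives back the original
    one.\<close>
  then have "?e' \<otimes>\<^bsub>HH\<^esub> (?e \<otimes>\<^bsub>HH\<^esub> series_deriv UU ?Y \<otimes>\<^bsub>HH\<^esub> ?e) \<otimes>\<^bsub>HH\<^esub> ?e' =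
      ?e' \<otimes>\<^bsub>HH\<^esub> (?e \<otimes>\<^bsub>HH\<^esub> (N \<otimes>\<^bsub>HH\<^esub> ?Y \<ominus>\<^bsub>HH\<^esub> ?Y \<otimes>\<^bsub>HH\<^esub> N) \<otimes>\<^bsub>HH\<^esub> ?e) \<otimes>\<^bsub>HH\<^esub> ?e'"
    by simp
  moreover have "?e' \<otimes>\<^bsub>HH\<^esub> (?e \<otimes>\<^bsub>HH\<^esub> W \<otimes>\<^bsub>HH\<^esub> ?e) \<otimes>\<^bsub>HH\<^esub> ?e' = W" if W: "W \<in> carrier HH" for W
  proof -
    have "?e' \<otimes>\<^bsub>HH\<^esub> (?e \<otimes>\<^bsub>HH\<^esub> W \<otimes>\<^bsub>HH\<^esub> ?e) \<otimes>\<^bsub>HH\<^esub> ?e' = (?e' \<otimes>\<^bsub>HH\<^esub> ?e) \<otimes>\<^bsub>HH\<^esub> W \<otimes>\<^bsub>HH\<^esub> (?e \<otimes>\<^bsub>HH\<^esub> ?e')"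
      using W by (simp add: tt.H.m_assoc)
    then show ?thesis
      using W by (simp only: e_inv) simp
  qed
  ultimately show "series_deriv UU ?Y = N \<otimes>\<^bsub>HH\<^esub> ?Y \<ominus>\<^bsub>HH\<^esub> ?Y \<otimes>\<^bsub>HH\<^esub> N"
    using Y by simp
qed auto

definition p where "p i = l i \<otimes> rising U 1 T i"

lemma p_closed [simp, intro]: "p i \<in> carrier U"
  by (simp add: p_def)

text \<open>Termwise, \<open>[T L, p i] = D p (i + 1) + b L p i\<close>.\<close>

lemma T_L_p: "T \<otimes> L \<otimes> p i = p i \<otimes> (T \<otimes> L) \<oplus> (D \<odot> p (Suc i) \<oplus> b \<odot> (L \<otimes> p i))"
proof -
  let ?f = "rising U 1 T i" and ?g = "rising U 0 T i"
  have Lf: "L \<otimes> ?f = ?g \<otimes> L"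
    using L_rising[of 1 i] by simp
  \<comment> \<open>Both sides are the rising factorial of T of length i + 1, once extended at its
    upper end and once at its lower end.\<close>
  have Tg: "T \<otimes> ?g \<oplus> of_nat i \<odot> ?g = ?f \<otimes> T"
    using T_rising_1[of i] by (simp add: T_rising_comm r_distr)
  have "T \<otimes> L \<otimes> p i = T \<otimes> (L \<otimes> l i) \<otimes> ?f"
    by (simp add: p_def m_assoc)
  also have "\<dots> = T \<otimes> l i \<otimes> (L \<otimes> ?f) \<oplus> D \<odot> (T \<otimes> l (Suc i) \<otimes> ?f)"
    by (simp add: L_l r_distr l_distr m_assoc)
  also have "T \<otimes> l i \<otimes> (L \<otimes> ?f) = p i \<otimes> (T \<otimes> L) \<oplus> b \<odot> (l i \<otimes> (L \<otimes> ?f))"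
  proof -
    have "T \<otimes> l i \<otimes> (L \<otimes> ?f) = l i \<otimes> (T \<otimes> ?g \<oplus> of_nat i \<odot> ?g) \<otimes> L \<oplus> b \<odot> (l i \<otimes> (?g \<otimes> L))"
      by (simp add: Lf T_l l_distr r_distr smult_l_distr m_assoc a_ac)
    then show ?thesis
      by (simp add: Tg p_def m_assoc Lf)
  qed
  also have "T \<otimes> l (Suc i) \<otimes> ?f = p (Suc i) \<oplus> b \<odot> (l (Suc i) \<otimes> ?f)"
  proof -
    have "T \<otimes> l (Suc i) \<otimes> ?f = l (Suc i) \<otimes> (T \<otimes> ?f) \<oplus> (b + (1 + of_nat i)) \<odot> (l (Suc i) \<otimes> ?f)"
      by (simp add: T_l l_distr m_assoc)
    also have "\<dots> = l (Suc i) \<otimes> (?f \<otimes> T \<oplus> (1 + of_nat i) \<odot> ?f) \<oplus> b \<odot> (l (Suc i) \<otimes> ?f)"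
      by (simp only: smult_l_distr[of _ b] m_closed l_closed rising_closed T_rising_comm)
        (simp add: r_distr a_ac)
    finally show ?thesis
      by (simp add: p_def r_distr)
  qed
  also have "p i \<otimes> (T \<otimes> L) \<oplus> b \<odot> (l i \<otimes> (L \<otimes> ?f)) \<oplus> D \<odot> (p (Suc i) \<oplus> b \<odot> (l (Suc i) \<otimes> ?f)) =
      p i \<otimes> (T \<otimes> L) \<oplus> (D \<odot> p (Suc i) \<oplus> b \<odot> ((l i \<otimes> L \<oplus> D \<odot> l (Suc i)) \<otimes> ?f))"
    by (simp add: l_distr smult_r_distr smult_smult mult.commute m_assoc a_ac)
  also have "(l i \<otimes> L \<oplus> D \<odot> l (Suc i)) \<otimes> ?f = L \<otimes> p i"
    by (simp add: L_l[symmetric] p_def m_assoc)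
  finally show ?thesis .
qed

text \<open>Let P be the sum and E = (1 - L t)^(-b). Then [M, P] = P' + b L P by
  \<open>T_L_p\<close>, and [M, E] = t E' L with E' = b E G. The terms with b combine to b E (t G L
  + L) P = b E G P = E' P, so [M, E P] is the derivative of E P.\<close>

lemma flow_antipode_root:
  "flow U M (\<ominus> l 0) = \<ominus>\<^bsub>H\<^esub> (E (- b) \<otimes>\<^bsub>H\<^esub> tsum (\<lambda>i. fps_const (D ^ i / fact i) \<odot>\<^bsub>H\<^esub> const (p i)))"
  (is "_ = \<ominus>\<^bsub>H\<^esub> (_ \<otimes>\<^bsub>H\<^esub> ?P)")
proof (rule flow_eqI[OF M_closed])
  let ?c = "\<lambda>i. D ^ i / fact i"
  have P [simp]: "?P \<in> carrier H"
    by auto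
  show "(\<ominus>\<^bsub>H\<^esub> (E (- b) \<otimes>\<^bsub>H\<^esub> ?P)) 0 = \<ominus> l 0"
    by (simp add: a_inv_coeff mult_0 tsum_coeff smult_const_coeff) (simp add: E_coeff const_coeff p_def)
  have c_Suc: "of_nat (Suc i) * ?c (Suc i) = ?c i * D" for i
    by (simp add: fact_Suc field_simps del: of_nat_Suc)
  define K where "K = tsum (\<lambda>i. fps_const (?c i) \<odot>\<^bsub>H\<^esub> (fps_const D \<odot>\<^bsub>H\<^esub> const (p (Suc i))))"
  have K [simp]: "K \<in> carrier H"
    by (auto simp: K_def)
  have deriv_P: "deriv ?P = K"
  proof -
    have "tsum (\<lambda>i. \<zero>\<^bsub>H\<^esub>) = \<zero>\<^bsub>H\<^esub>"
      by (simp add: fun_eq_iff tsum_coeff H_simps)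
    then show ?thesis
      by (simp add: deriv_tsum deriv_smult_const deriv_const K_def H.smult_smult c_Suc mult.commute del: of_nat_Suc)
  qed
  have M_P: "M \<otimes>\<^bsub>H\<^esub> ?P = ?P \<otimes>\<^bsub>H\<^esub> M \<oplus>\<^bsub>H\<^esub> (K \<oplus>\<^bsub>H\<^esub> fps_const b \<odot>\<^bsub>H\<^esub> (const L \<otimes>\<^bsub>H\<^esub> ?P))"
  proof -
    have M_p: "M \<otimes>\<^bsub>H\<^esub> const (p i) = const (p i) \<otimes>\<^bsub>H\<^esub> M \<oplus>\<^bsub>H\<^esub>
        (fps_const D \<odot>\<^bsub>H\<^esub> const (p (Suc i)) \<oplus>\<^bsub>H\<^esub> fps_const b \<odot>\<^bsub>H\<^esub> (const L \<otimes>\<^bsub>H\<^esub> const (p i)))" for i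
      by (simp add: M_def const_simps[symmetric] T_L_p)
    have sm: "(\<lambda>x. fps_const b \<odot>\<^bsub>H\<^esub> (const L \<otimes>\<^bsub>H\<^esub> x)) \<in> linear_maps H H"
      by (rule linear_maps_comp[OF smult_linear mult_left_linear]) simp
    have "M \<otimes>\<^bsub>H\<^esub> ?P = tsum (\<lambda>i. fps_const (?c i) \<odot>\<^bsub>H\<^esub> (M \<otimes>\<^bsub>H\<^esub> const (p i)))"
      by (subst tsum_linear[OF mult_left_linear]) simp_all
    also have "\<dots> = tsum (\<lambda>i. fps_const (?c i) \<odot>\<^bsub>H\<^esub> const (p i) \<otimes>\<^bsub>H\<^esub> M \<oplus>\<^bsub>H\<^esub>
        (fps_const (?c i) \<odot>\<^bsub>H\<^esub> (fps_const D \<odot>\<^bsub>H\<^esub> const (p (Suc i))) \<oplus>\<^bsub>H\<^esub>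
          fps_const b \<odot>\<^bsub>H\<^esub> (const L \<otimes>\<^bsub>H\<^esub> (fps_const (?c i) \<odot>\<^bsub>H\<^esub> const (p i)))))"
      by (simp add: M_p H.smult_r_distr H.smult_smult mult.commute)
    also have "\<dots> = ?P \<otimes>\<^bsub>H\<^esub> M \<oplus>\<^bsub>H\<^esub> (K \<oplus>\<^bsub>H\<^esub> fps_const b \<odot>\<^bsub>H\<^esub> (const L \<otimes>\<^bsub>H\<^esub> ?P))"
      unfolding K_def
      by (subst tsum_add, simp, simp, subst tsum_add, simp, simp)
        (simp only: tsum_linear[OF mult_right_linear[OF M_closed]] tsum_linear[OF sm] H.smult_closed
          const_carrier p_closed)
    finally show ?thesis .
  qed
  let ?E = "E (- b)"
  let ?dE = "fps_const b \<odot>\<^bsub>H\<^esub> (?E \<otimes>\<^bsub>H\<^esub> G)"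
  have dE: "deriv ?E = ?dE"
    by (simp add: deriv_E G_def H.m_assoc[symmetric] E_mult E_L)
  have M_E: "M \<otimes>\<^bsub>H\<^esub> ?E = ?E \<otimes>\<^bsub>H\<^esub> M \<oplus>\<^bsub>H\<^esub> fps_X \<odot>\<^bsub>H\<^esub> (?dE \<otimes>\<^bsub>H\<^esub> const L)"
  proof -
    have "M \<otimes>\<^bsub>H\<^esub> ?E = (const T \<otimes>\<^bsub>H\<^esub> ?E) \<otimes>\<^bsub>H\<^esub> const L"
      by (simp add: M_def H.m_assoc E_L)
    then show ?thesis
      by (simp add: T_E dE M_def H.l_distr H.m_assoc)
  qed
  \<comment> \<open>G (1 - L t) = L rearranged; it merges the two terms with factor b, one from each
    bracket.\<close>
  have GL: "fps_X \<odot>\<^bsub>H\<^esub> (G \<otimes>\<^bsub>H\<^esub> const L) \<oplus>\<^bsub>H\<^esub> const L = G"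
  proof -
    have "const L = G \<ominus>\<^bsub>H\<^esub> fps_X \<odot>\<^bsub>H\<^esub> (G \<otimes>\<^bsub>H\<^esub> const L)"
      using E_G(2) by (simp add: E_1 a_minus_def H.r_distr H.r_minus)
    then have "fps_X \<odot>\<^bsub>H\<^esub> (G \<otimes>\<^bsub>H\<^esub> const L) \<oplus>\<^bsub>H\<^esub> const L =
        fps_X \<odot>\<^bsub>H\<^esub> (G \<otimes>\<^bsub>H\<^esub> const L) \<oplus>\<^bsub>H\<^esub> (G \<ominus>\<^bsub>H\<^esub> fps_X \<odot>\<^bsub>H\<^esub> (G \<otimes>\<^bsub>H\<^esub> const L))"
      by simp
    then show ?thesis
      by (simp add: a_minus_def H.a_lcomm H.r_neg)
  qed
  have bracket: "M \<otimes>\<^bsub>H\<^esub> (?E \<otimes>\<^bsub>H\<^esub> ?P) =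
      (?E \<otimes>\<^bsub>H\<^esub> ?P) \<otimes>\<^bsub>H\<^esub> M \<oplus>\<^bsub>H\<^esub> (?dE \<otimes>\<^bsub>H\<^esub> ?P \<oplus>\<^bsub>H\<^esub> ?E \<otimes>\<^bsub>H\<^esub> K)"
  proof -
    have "M \<otimes>\<^bsub>H\<^esub> (?E \<otimes>\<^bsub>H\<^esub> ?P) = ?E \<otimes>\<^bsub>H\<^esub> (M \<otimes>\<^bsub>H\<^esub> ?P) \<oplus>\<^bsub>H\<^esub> fps_X \<odot>\<^bsub>H\<^esub> (?dE \<otimes>\<^bsub>H\<^esub> const L) \<otimes>\<^bsub>H\<^esub> ?P"
      by (simp only: H.m_assoc[symmetric] M_closed E_closed P M_E) (simp add: H.l_distr H.m_assoc)
    also have "\<dots> = ?E \<otimes>\<^bsub>H\<^esub> ?P \<otimes>\<^bsub>H\<^esub> M \<oplus>\<^bsub>H\<^esub> (fps_const b \<odot>\<^bsub>H\<^esub>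
        (?E \<otimes>\<^bsub>H\<^esub> (fps_X \<odot>\<^bsub>H\<^esub> (G \<otimes>\<^bsub>H\<^esub> const L) \<oplus>\<^bsub>H\<^esub> const L) \<otimes>\<^bsub>H\<^esub> ?P) \<oplus>\<^bsub>H\<^esub> ?E \<otimes>\<^bsub>H\<^esub> K)"
      by (simp only: M_P)
        (simp add: H.l_distr H.r_distr H.m_assoc H.smult_r_distr H.smult_smult mult.commute H.a_ac)
    finally show ?thesis
      by (simp add: GL)
  qed
  let ?q = "?dE \<otimes>\<^bsub>H\<^esub> ?P \<oplus>\<^bsub>H\<^esub> ?E \<otimes>\<^bsub>H\<^esub> K"
  have "deriv (\<ominus>\<^bsub>H\<^esub> (?E \<otimes>\<^bsub>H\<^esub> ?P)) = \<ominus>\<^bsub>H\<^esub> ?q"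
    by (simp add: deriv_a_inv deriv_mult dE deriv_P)
  moreover have "M \<otimes>\<^bsub>H\<^esub> \<ominus>\<^bsub>H\<^esub> (?E \<otimes>\<^bsub>H\<^esub> ?P) = \<ominus>\<^bsub>H\<^esub> (?E \<otimes>\<^bsub>H\<^esub> ?P \<otimes>\<^bsub>H\<^esub> M \<oplus>\<^bsub>H\<^esub> ?q)"
    by (simp only: bracket[symmetric]) (simp add: H.r_minus)
  moreover have "\<ominus>\<^bsub>H\<^esub> (?E \<otimes>\<^bsub>H\<^esub> ?P) \<otimes>\<^bsub>H\<^esub> M = \<ominus>\<^bsub>H\<^esub> (?E \<otimes>\<^bsub>H\<^esub> ?P \<otimes>\<^bsub>H\<^esub> M)"
    by (simp add: H.l_minus)
  ultimately show "deriv (\<ominus>\<^bsub>H\<^esub> (?E \<otimes>\<^bsub>H\<^esub> ?P)) =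
      M \<otimes>\<^bsub>H\<^esub> \<ominus>\<^bsub>H\<^esub> (?E \<otimes>\<^bsub>H\<^esub> ?P) \<ominus>\<^bsub>H\<^esub> \<ominus>\<^bsub>H\<^esub> (?E \<otimes>\<^bsub>H\<^esub> ?P) \<otimes>\<^bsub>H\<^esub> M"
    by (simp add: H.neg_add_minus_neg)
qed simp_all

end
end

section \<open>The explicit formulas for the deformed coproduct and antipode\<close>

context twist_hopf
begin

lemma \<Delta>_weight:
  assumes "d \<in> carrier U" "d \<otimes> L = L \<otimes> d \<oplus> \<kappa> \<odot> L" "T \<otimes> d = d \<otimes> T"
    and "\<Delta>\<^sub>0 d = (d \<boxtimes> \<one>) \<oplus>\<^bsub>UU\<^esub> (\<one> \<boxtimes> d)"
  shows "\<Delta> (const d) = (const d \<box> \<one>\<^bsub>H\<^esub>) \<oplus>\<^bsub>HH\<^esub> (\<one>\<^bsub>H\<^esub> \<box> const d) \<oplus>\<^bsub>HH\<^esub>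
    fps_const \<kappa> \<odot>\<^bsub>HH\<^esub> (const (rising U 0 T 1) \<box> (E (- 1) \<otimes>\<^bsub>H\<^esub> (fps_X \<odot>\<^bsub>H\<^esub> const L)))"
  using assms flow_weight[OF assms(1-3)] by (simp add: \<Delta>_const \<delta>_def G_def)

text \<open>L t - L^2 t^2 = (1 - L t) L t, whose first factor cancels (1 - L t)^(-1). The displayed
  value is thus \<kappa> T L t - d, the solution found in
  \<open>flow_antipode_weight\<close>.\<close>

lemma S_weight:
  assumes "d \<in> carrier U" "d \<otimes> L = L \<otimes> d \<oplus> \<kappa> \<odot> L" "T \<otimes> d = d \<otimes> T" and "S\<^sub>0 d = \<ominus> d"
  shows "S (const d) = fps_const \<kappa> \<odot>\<^bsub>H\<^esub> (const T \<otimes>\<^bsub>H\<^esub> E (- 1) \<otimes>\<^bsub>H\<^esub>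
      (fps_X \<odot>\<^bsub>H\<^esub> const L \<ominus>\<^bsub>H\<^esub> fps_X ^ 2 \<odot>\<^bsub>H\<^esub> (const L \<otimes>\<^bsub>H\<^esub> const L))) \<ominus>\<^bsub>H\<^esub> const d"
proof -
  have "fps_X \<odot>\<^bsub>H\<^esub> const L \<ominus>\<^bsub>H\<^esub> fps_X ^ 2 \<odot>\<^bsub>H\<^esub> (const L \<otimes>\<^bsub>H\<^esub> const L) = E 1 \<otimes>\<^bsub>H\<^esub> (fps_X \<odot>\<^bsub>H\<^esub> const L)"
    by (simp add: E_1 a_minus_def H.l_distr H.l_minus H.smult_r_distr H.smult_a_inv H.smult_smult power2_eq_square)
  moreover have "const T \<otimes>\<^bsub>H\<^esub> E (- 1) \<otimes>\<^bsub>H\<^esub> (E 1 \<otimes>\<^bsub>H\<^esub> (fps_X \<odot>\<^bsub>H\<^esub> const L)) =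
      const T \<otimes>\<^bsub>H\<^esub> (E (- 1) \<otimes>\<^bsub>H\<^esub> E 1) \<otimes>\<^bsub>H\<^esub> (fps_X \<odot>\<^bsub>H\<^esub> const L)"
    by (simp add: H.m_assoc)
  ultimately show ?thesis
    using assms flow_antipode_weight[OF assms(1-3)] by (simp add: S_const \<sigma>_def E_inverse M_def)
qed

context
  fixes l :: "nat \<Rightarrow> 'a" and b D :: 'f
  assumes l_closed: "l i \<in> carrier U"
    and L_l: "L \<otimes> l i = l i \<otimes> L \<oplus> D \<odot> l (Suc i)"
    and T_l: "T \<otimes> l i = l i \<otimes> T \<oplus> (b + of_nat i) \<odot> l i"
begin

lemma \<Delta>_root:
  assumes "\<Delta>\<^sub>0 (l 0) = (l 0 \<boxtimes> \<one>) \<oplus>\<^bsub>UU\<^esub> (\<one> \<boxtimes> l 0)"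
  shows "\<Delta> (const (l 0)) = (const (l 0) \<box> E b) \<oplus>\<^bsub>HH\<^esub>
    tt.tsum (\<lambda>i. fps_const ((-1) ^ i * (D ^ i / fact i)) \<odot>\<^bsub>HH\<^esub>
      (const (rising U 0 T i) \<box> (E (- of_nat i) \<otimes>\<^bsub>H\<^esub> const (l i))))"
  using assms flow_root_left[of l D b, OF l_closed L_l T_l] flow_root_right[of l D b, OF l_closed L_l T_l]
    l_closed[of 0]
  by (simp add: \<Delta>_const \<delta>_def tt.flow_add[OF N_closed] R_def[OF l_closed L_l T_l]
      s_def[OF l_closed L_l T_l] u_def[OF l_closed L_l T_l])

lemma S_root:
  assumes "S\<^sub>0 (l 0) = \<ominus> l 0"
  shows "S (const (l 0)) = \<ominus>\<^bsub>H\<^esub> (E (- b) \<otimes>\<^bsub>H\<^esub>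
    tsum (\<lambda>i. fps_const (D ^ i / fact i) \<odot>\<^bsub>H\<^esub> (const (l i) \<otimes>\<^bsub>H\<^esub> const (rising U 1 T i))))"
  using assms flow_antipode_root[of l D b, OF l_closed L_l T_l] l_closed
  by (simp add: S_const \<sigma>_def p_def[OF l_closed L_l T_l] const_simps)

end
end

section \<open>Reduction modulo t\<close>

context series_over
begin

definition tH where "tH = (\<lambda>x. fps_X \<odot>\<^bsub>H\<^esub> x) ` carrier H"

lemma tH_iff: "x \<in> tH \<longleftrightarrow> x \<in> carrier H \<and> x 0 = \<zero>"
proof
  assume x: "x \<in> carrier H \<and> x 0 = \<zero>"
  then have "x = fps_X \<odot>\<^bsub>H\<^esub> (\<lambda>n. x (Suc n))"
    using series_decompose[of x] by (simp add: const_simps shift_carrier)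
  then show "x \<in> tH"
    using x unfolding tH_def by (intro rev_image_eqI[of "\<lambda>n. x (Suc n)"]) (simp_all add: shift_carrier)
qed (auto simp: tH_def)

lemma add_coeff: "(x \<oplus>\<^bsub>H\<^esub> y) n = x n \<oplus> y n"
  by (simp add: H_simps)

lemma tH_ideal: "ideal tH H"
proof (rule idealI)
  show "ring H"
    by (rule H.ring_axioms)
  show "subgroup tH (add_monoid H)"
  proof (rule H.add.subgroupI)
    show "tH \<subseteq> carrier H"
      using tH_iff by blast
    show "tH \<noteq> {}"
      unfolding tH_def using H.zero_closed by blast
    show "\<ominus>\<^bsub>H\<^esub> x \<in> tH" if "x \<in> tH" for x
      using that a_inv_coeff[of x 0] unfolding tH_iff by simp
    show "x \<oplus>\<^bsub>H\<^esub> y \<in> tH" if "x \<in> tH" "y \<in> tH" for x y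
      using that add_coeff[of x y 0] unfolding tH_iff by simp
  qed
  show "y \<otimes>\<^bsub>H\<^esub> x \<in> tH" "x \<otimes>\<^bsub>H\<^esub> y \<in> tH" if "x \<in> tH" "y \<in> carrier H" for x y
    using that mult_0[of x y] mult_0[of y x] unfolding tH_iff by simp_all
qed

sublocale tH: algebra_ideal tH H
  by (intro algebra_ideal.intro H.algebra_over_axioms tH_ideal)

abbreviation \<theta> where "\<theta> X \<equiv> the_elem ((\<lambda>x. x 0) ` X)"

text \<open>All members of a coset of \<open>tH\<close> share their constant coefficient, so the
  image is a singleton and \<open>the_elem\<close> returns its element.\<close>

lemma \<theta>_coset:
  assumes x: "x \<in> carrier H"
  shows "\<theta> (tH +>\<^bsub>H\<^esub> x) = x 0"
proof -
  have "y 0 = x 0" if y: "y \<in> tH +>\<^bsub>H\<^esub> x" for y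
  proof -
    have "y \<in> carrier H" "y \<ominus>\<^bsub>H\<^esub> x \<in> tH"
      using tH.coset_memD[OF y x] tH.coset_eq_iff[of y x] x by blast+
    then have "y 0 \<ominus> x 0 = \<zero>"
      using x minus_coeff[of y x 0] unfolding tH_iff by simp
    then show ?thesis
      using \<open>y \<in> carrier H\<close> x by (simp add: minus_eq_zero_iff)
  qed
  then have "(\<lambda>x. x 0) ` (tH +>\<^bsub>H\<^esub> x) = (\<lambda>_. x 0) ` (tH +>\<^bsub>H\<^esub> x)"
    by (rule image_cong[OF refl])
  moreover have "tH +>\<^bsub>H\<^esub> x \<noteq> {}"
    using tH.a_rcos_self[OF x] by (metis empty_iff)
  ultimately show ?thesis
    by (simp add: image_constant_conv)
qed

lemma \<theta>_iso: "\<theta> \<in> ring_iso (quotient_algebra H tH) A"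
proof (rule ring_iso_memI)
  show "bij_betw \<theta> (carrier (quotient_algebra H tH)) (carrier A)"
  proof (rule bij_betwI')
    fix X Y assume "X \<in> carrier (quotient_algebra H tH)" "Y \<in> carrier (quotient_algebra H tH)"
    then obtain x y where xy: "x \<in> carrier H" "X = tH +>\<^bsub>H\<^esub> x" "y \<in> carrier H" "Y = tH +>\<^bsub>H\<^esub> y"
      by (elim tH.coset_cases)
    then have "X = Y \<longleftrightarrow> x \<ominus>\<^bsub>H\<^esub> y \<in> tH"
      using tH.coset_eq_iff[of x y] by blast
    then have "X = Y \<longleftrightarrow> x 0 \<ominus> y 0 = \<zero>"
      using xy minus_coeff[of x y 0] unfolding tH_iff by simp
    then show "\<theta> X = \<theta> Y \<longleftrightarrow> X = Y"
      using xy by (simp add: \<theta>_coset minus_eq_zero_iff)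
  next
    fix a assume a: "a \<in> carrier A"
    then show "\<exists>X\<in>carrier (quotient_algebra H tH). a = \<theta> X"
      by (intro bexI[of _ "tH +>\<^bsub>H\<^esub> const a"])
        (simp_all add: \<theta>_coset tH.coset_closed, simp add: const_coeff)
  next
    fix X assume "X \<in> carrier (quotient_algebra H tH)"
    then obtain x where "x \<in> carrier H" "X = tH +>\<^bsub>H\<^esub> x"
      by (elim tH.coset_cases)
    then show "\<theta> X \<in> carrier A"
      by (simp add: \<theta>_coset)
  qed
next
  fix X assume "X \<in> carrier (quotient_algebra H tH)"
  then obtain x where x: "x \<in> carrier H" "X = tH +>\<^bsub>H\<^esub> x"
    by (elim tH.coset_cases)
  then show "\<theta> X \<in> carrier A"
    by (simp add: \<theta>_coset)
  fix Y assume "Y \<in> carrier (quotient_algebra H tH)"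
  then obtain y where y: "y \<in> carrier H" "Y = tH +>\<^bsub>H\<^esub> y"
    by (elim tH.coset_cases)
  show "\<theta> (X \<otimes>\<^bsub>quotient_algebra H tH\<^esub> Y) = \<theta> X \<otimes> \<theta> Y"
    "\<theta> (X \<oplus>\<^bsub>quotient_algebra H tH\<^esub> Y) = \<theta> X \<oplus> \<theta> Y"
    using x y by (simp_all add: \<theta>_coset tH.coset_mult tH.coset_add mult_0 add_coeff)
next
  show "\<theta> \<one>\<^bsub>quotient_algebra H tH\<^esub> = \<one>"
    by (simp add: \<theta>_coset tH.coset_one) (simp add: H_simps const_coeff)
qed

lemma reduces_mod_tI:
  assumes "\<And>x. x \<in> carrier H \<Longrightarrow> \<Delta> x 0 = \<Delta>\<^sub>0 (x 0)"
    and "\<And>x. x \<in> carrier H \<Longrightarrow> S x \<in> carrier H" "\<And>x. x \<in> carrier H \<Longrightarrow> S x 0 = S\<^sub>0 (x 0)"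
    and "\<And>x. x \<in> carrier H \<Longrightarrow> fps_nth (\<epsilon> x) 0 = \<epsilon>\<^sub>0 (x 0)"
  shows "reduces_mod_t A \<Delta> S \<epsilon> \<Delta>\<^sub>0 S\<^sub>0 \<epsilon>\<^sub>0"
proof -
  have "\<theta> (c \<odot>\<^bsub>quotient_algebra H tH\<^esub> X) = fps_nth c 0 \<odot> \<theta> X"
    if "X \<in> carrier (quotient_algebra H tH)" for c X
  proof -
    from that obtain x where "x \<in> carrier H" "X = tH +>\<^bsub>H\<^esub> x"
      by (elim tH.coset_cases)
    then show ?thesis
      by (simp add: \<theta>_coset tH.coset_smult) (simp add: smult_coeff)
  qed
  then show ?thesis
    unfolding reduces_mod_t_def Let_def tH_def[symmetric] using tH_ideal \<theta>_iso assms by (simp add: \<theta>_coset)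
qed

end

context twist_hopf
begin

lemma twist_reduces_mod_t: "reduces_mod_t U \<Delta> S \<epsilon> \<Delta>\<^sub>0 S\<^sub>0 \<epsilon>\<^sub>0"
proof (rule reduces_mod_tI)
  fix x assume x: "x \<in> carrier H"
  show "\<Delta> x 0 = \<Delta>\<^sub>0 (x 0)" "S x 0 = S\<^sub>0 (x 0)"
    using x by (simp_all add: \<Delta>_def S_def series_extension_def tt.tsum_coeff tsum_coeff \<delta>_0 \<sigma>_0)
qed (simp_all add: \<epsilon>_def)

lemma twist_noncommutative:
  assumes "L \<noteq> \<zero>"
  shows "series_noncommutative U"
proof -
  have "const T \<otimes>\<^bsub>H\<^esub> const L \<noteq> const L \<otimes>\<^bsub>H\<^esub> const T"
  proof
    assume "const T \<otimes>\<^bsub>H\<^esub> const L = const L \<otimes>\<^bsub>H\<^esub> const T"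
    then have "(const T \<otimes>\<^bsub>H\<^esub> const L) 0 = (const L \<otimes>\<^bsub>H\<^esub> const T) 0"
      by simp
    then have "L \<otimes> T \<oplus> L = L \<otimes> T"
      by (simp add: mult_0) (simp add: const_coeff T_L)
    then show False
      using assms add.l_cancel_one'[of "L \<otimes> T" L] by simp
  qed
  then show ?thesis
    unfolding series_noncommutative_def by (meson T_closed L_closed const_carrier)
qed

text \<open>The first-order term in t decides: the coefficient of t in the coproduct of T, which is
  T \<otimes> (1 - L t)^(-1) + 1 \<otimes> T, equals T \<otimes> L.\<close>

lemma twist_noncocommutative:
  assumes "T \<boxtimes> L \<noteq> L \<boxtimes> T"
  shows "series_noncocommutative U \<Delta>"
proof -
  have flip: "(\<lambda>a b. b \<boxtimes> a) \<in> bilinear_maps U U UU"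
    using bilinear_maps_left[OF t.pure_bilinear] bilinear_maps_right[OF t.pure_bilinear]
    by (intro bilinear_mapsI) auto
  have "\<Delta> (const T) 1 = T \<boxtimes> L"
    by (simp add: \<Delta>_T tt.H_simps series_tensor_def const_coeff E_coeff)
      (simp add: H_simps const_coeff ts.pure_zero)
  moreover have "tensor_flip U (T \<boxtimes> L) = L \<boxtimes> T"
    unfolding tensor_flip_def by (rule t.tensor_lift_pure[OF t.AB.algebra_over_axioms flip]) auto
  ultimately have "(tensor_flip U \<circ> \<Delta> (const T)) 1 \<noteq> \<Delta> (const T) 1"
    using assms by simp
  then have "tensor_flip U \<circ> \<Delta> (const T) \<noteq> \<Delta> (const T)"
    by metis
  then show ?thesis
    unfolding series_noncocommutative_def by (meson T_closed const_carrier)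
qed

end

section \<open>The Hopf algebra structure of the enveloping algebra\<close>

context lie_carrier
begin

sublocale t: tensor_pair U U ..

abbreviation UU where "UU \<equiv> tensor_algebra U U"
abbreviation tensor_U (infixr "\<boxtimes>" 72) where "a \<boxtimes> b \<equiv> pure_tensor U U a b"
abbreviation \<Delta>\<^sub>0 where "\<Delta>\<^sub>0 \<equiv> uea_comult L"
abbreviation S\<^sub>0 where "S\<^sub>0 \<equiv> uea_antipode L"
abbreviation \<epsilon>\<^sub>0 where "\<epsilon>\<^sub>0 \<equiv> uea_counit L"

lemma incl_bracket_eq:
  assumes "x \<in> carrier L" "y \<in> carrier L"
  shows "\<iota> x \<otimes>\<^bsub>U\<^esub> \<iota> y = \<iota> y \<otimes>\<^bsub>U\<^esub> \<iota> x \<oplus>\<^bsub>U\<^esub> \<iota> (lie_bracket L x y)"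
proof -
  have "\<iota> y \<otimes>\<^bsub>U\<^esub> \<iota> x \<oplus>\<^bsub>U\<^esub> (\<iota> x \<otimes>\<^bsub>U\<^esub> \<iota> y \<ominus>\<^bsub>U\<^esub> \<iota> y \<otimes>\<^bsub>U\<^esub> \<iota> x) = \<iota> x \<otimes>\<^bsub>U\<^esub> \<iota> y"
    using assms by (simp add: a_minus_def U.a_lcomm[of "\<iota> y \<otimes>\<^bsub>U\<^esub> \<iota> x" "\<iota> x \<otimes>\<^bsub>U\<^esub> \<iota> y"] U.r_neg)
  then show ?thesis
    using incl_bracket[OF assms] by simp
qed

lemmas pure_linear_left = bilinear_maps_left[OF t.pure_bilinear]
lemmas pure_linear_right = bilinear_maps_right[OF t.pure_bilinear]

lemma comult_hom: "\<Delta>\<^sub>0 \<in> algebra_homs U UU"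
  and comult_incl: "x \<in> carrier L \<Longrightarrow> \<Delta>\<^sub>0 (\<iota> x) = (\<iota> x \<boxtimes> \<one>\<^bsub>U\<^esub>) \<oplus>\<^bsub>UU\<^esub> (\<one>\<^bsub>U\<^esub> \<boxtimes> \<iota> x)"
proof -
  let ?\<phi> = "\<lambda>x. (\<iota> x \<boxtimes> \<one>\<^bsub>U\<^esub>) \<oplus>\<^bsub>UU\<^esub> (\<one>\<^bsub>U\<^esub> \<boxtimes> \<iota> x)"
  note UU = t.AB.algebra_over_axioms
  have closed: "?\<phi> x \<in> carrier UU" if "x \<in> carrier L" for x
    using that by simp
  have add: "?\<phi> (x \<oplus>\<^bsub>L\<^esub> y) = ?\<phi> x \<oplus>\<^bsub>UU\<^esub> ?\<phi> y" if "x \<in> carrier L" "y \<in> carrier L" for x y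
    using that by (simp add: incl_add linear_maps_add[OF pure_linear_left]
        linear_maps_add[OF pure_linear_right] t.AB.a_ac)
  have smult: "?\<phi> (c \<odot>\<^bsub>L\<^esub> x) = c \<odot>\<^bsub>UU\<^esub> ?\<phi> x" if "x \<in> carrier L" for c x
    using that by (simp add: incl_smult linear_maps_smult[OF pure_linear_left]
        linear_maps_smult[OF pure_linear_right] t.AB.smult_r_distr)
  have bracket: "?\<phi> (lie_bracket L x y) = ?\<phi> x \<otimes>\<^bsub>UU\<^esub> ?\<phi> y \<ominus>\<^bsub>UU\<^esub> ?\<phi> y \<otimes>\<^bsub>UU\<^esub> ?\<phi> x"
    if x: "x \<in> carrier L" and y: "y \<in> carrier L" for x y
  proof -
    \<comment> \<open>The product in the order y, x. The mixed terms x \<otimes> y and y \<otimes> x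
      occur in both orders, so the other order differs only by commutators inside a single
      leg.\<close>
    let ?q = "((\<iota> y \<otimes>\<^bsub>U\<^esub> \<iota> x) \<boxtimes> \<one>\<^bsub>U\<^esub>) \<oplus>\<^bsub>UU\<^esub> (\<iota> x \<boxtimes> \<iota> y) \<oplus>\<^bsub>UU\<^esub> ((\<iota> y \<boxtimes> \<iota> x) \<oplus>\<^bsub>UU\<^esub> (\<one>\<^bsub>U\<^esub> \<boxtimes> (\<iota> y \<otimes>\<^bsub>U\<^esub> \<iota> x)))"
    have "?\<phi> y \<otimes>\<^bsub>UU\<^esub> ?\<phi> x = ?q"
      using x y by (simp add: t.AB.l_distr t.AB.r_distr t.pure_mult t.AB.a_ac)
    moreover have "?\<phi> x \<otimes>\<^bsub>UU\<^esub> ?\<phi> y = ?q \<oplus>\<^bsub>UU\<^esub> ?\<phi> (lie_bracket L x y)"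
      using x y bracket_carrier[OF x y]
      by (simp add: t.AB.l_distr t.AB.r_distr t.pure_mult incl_bracket_eq[OF x y]
          linear_maps_add[OF pure_linear_left] linear_maps_add[OF pure_linear_right])
        (simp add: t.AB.a_ac)
    moreover have "?q \<in> carrier UU" "?\<phi> (lie_bracket L x y) \<in> carrier UU"
      using x y bracket_carrier[OF x y] by simp_all
    moreover have "q \<oplus>\<^bsub>UU\<^esub> r \<ominus>\<^bsub>UU\<^esub> q = r" if "q \<in> carrier UU" "r \<in> carrier UU" for q r
      using that by (simp add: a_minus_def t.AB.a_comm[of q] t.AB.a_assoc t.AB.r_neg)
    ultimately show ?thesis
      by simp
  qed
  have eq: "\<Delta>\<^sub>0 = uea_lift UU ?\<phi>"
    by (simp add: uea_comult_def Let_def)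
  show "\<Delta>\<^sub>0 \<in> algebra_homs U UU"
    unfolding eq by (rule uea_lift_hom[OF UU closed add smult bracket])
  show "\<Delta>\<^sub>0 (\<iota> x) = ?\<phi> x" if "x \<in> carrier L"
    unfolding eq by (rule uea_lift_incl[OF UU closed add smult bracket that])
qed

lemma antipode_hom: "S\<^sub>0 \<in> algebra_homs U (opposite_algebra U)"
  and antipode_incl: "x \<in> carrier L \<Longrightarrow> S\<^sub>0 (\<iota> x) = \<ominus>\<^bsub>U\<^esub> \<iota> x"
proof -
  let ?O = "opposite_algebra U"
  have O: "algebra_over ?O"
    by unfold_locales (rule U.opposite_assoc_algebra)
  then interpret O: algebra_over ?O .
  have O_simps: "carrier ?O = carrier U" "x \<oplus>\<^bsub>?O\<^esub> y = x \<oplus>\<^bsub>U\<^esub> y" "x \<otimes>\<^bsub>?O\<^esub> y = y \<otimes>\<^bsub>U\<^esub> x"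
      "c \<odot>\<^bsub>?O\<^esub> x = c \<odot>\<^bsub>U\<^esub> x" for x y c
    by (simp_all add: opposite_algebra_def)
  have neg: "\<ominus>\<^bsub>?O\<^esub> x = \<ominus>\<^bsub>U\<^esub> x" if "x \<in> carrier U" for x
    using that by (simp add: O.a_inv_eq_smult U.a_inv_eq_smult O_simps)
  have closed: "\<ominus>\<^bsub>U\<^esub> \<iota> x \<in> carrier ?O" if "x \<in> carrier L" for x
    using that by (simp add: O_simps)
  have add: "\<ominus>\<^bsub>U\<^esub> \<iota> (x \<oplus>\<^bsub>L\<^esub> y) = \<ominus>\<^bsub>U\<^esub> \<iota> x \<oplus>\<^bsub>?O\<^esub> \<ominus>\<^bsub>U\<^esub> \<iota> y"
    if "x \<in> carrier L" "y \<in> carrier L" for x y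
    using that by (simp add: O_simps incl_add U.minus_add)
  have smult: "\<ominus>\<^bsub>U\<^esub> \<iota> (c \<odot>\<^bsub>L\<^esub> x) = c \<odot>\<^bsub>?O\<^esub> \<ominus>\<^bsub>U\<^esub> \<iota> x" if "x \<in> carrier L" for c x
    using that by (simp add: O_simps incl_smult U.smult_a_inv)
  \<comment> \<open>In the opposite algebra the commutator of - x and - y is y x - x y, so negation
    respects brackets there.\<close>
  have bracket: "\<ominus>\<^bsub>U\<^esub> \<iota> (lie_bracket L x y) = \<ominus>\<^bsub>U\<^esub> \<iota> x \<otimes>\<^bsub>?O\<^esub> \<ominus>\<^bsub>U\<^esub> \<iota> y \<ominus>\<^bsub>?O\<^esub> \<ominus>\<^bsub>U\<^esub> \<iota> y \<otimes>\<^bsub>?O\<^esub> \<ominus>\<^bsub>U\<^esub> \<iota> x"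
    if "x \<in> carrier L" "y \<in> carrier L" for x y
    using that
    by (simp add: a_minus_def O_simps neg U.l_minus U.r_minus incl_bracket[symmetric] U.minus_add U.a_comm)
  have eq: "S\<^sub>0 = uea_lift ?O (\<lambda>x. \<ominus>\<^bsub>U\<^esub> \<iota> x)"
    by (simp add: uea_antipode_def)
  show "S\<^sub>0 \<in> algebra_homs U ?O"
    unfolding eq by (rule uea_lift_hom[OF O closed add smult bracket])
  show "S\<^sub>0 (\<iota> x) = \<ominus>\<^bsub>U\<^esub> \<iota> x" if "x \<in> carrier L"
    unfolding eq by (rule uea_lift_incl[OF O closed add smult bracket that])
qed

lemma counit_hom: "\<epsilon>\<^sub>0 \<in> algebra_homs U scalar_algebra"
  and counit_incl: "x \<in> carrier L \<Longrightarrow> \<epsilon>\<^sub>0 (\<iota> x) = 0"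
proof -
  let ?K = "scalar_algebra :: ('f, 'f) module"
  have K: "algebra_over ?K"
    by unfold_locales (rule scalar_assoc_algebra)
  then interpret K: algebra_over ?K .
  have zero: "(0 :: 'f) = \<zero>\<^bsub>?K\<^esub>"
    by (simp add: scalar_algebra_def)
  have cond: "0 \<in> carrier ?K" "0 = 0 \<oplus>\<^bsub>?K\<^esub> 0" "0 = c \<odot>\<^bsub>?K\<^esub> 0" "0 = 0 \<otimes>\<^bsub>?K\<^esub> 0 \<ominus>\<^bsub>?K\<^esub> 0 \<otimes>\<^bsub>?K\<^esub> 0" for c
    unfolding zero by (simp_all add: a_minus_def)
  show "\<epsilon>\<^sub>0 \<in> algebra_homs U ?K"
    unfolding uea_counit_def by (rule uea_lift_hom[OF K cond])
  show "\<epsilon>\<^sub>0 (\<iota> x) = 0" if "x \<in> carrier L"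
    unfolding uea_counit_def by (rule uea_lift_incl[OF K cond that])
qed

lemmas comult_linear = algebra_homs_linear[OF comult_hom]
lemmas comult_closed [simp, intro] = linear_maps_closed[OF comult_linear]

lemma antipode_linear: "S\<^sub>0 \<in> linear_maps U U"
  using algebra_homs_linear[OF antipode_hom] by (simp add: linear_maps_def opposite_algebra_def)

lemmas antipode_closed [simp, intro] = linear_maps_closed[OF antipode_linear]

lemma antipode_simps:
  "x \<in> carrier U \<Longrightarrow> y \<in> carrier U \<Longrightarrow> S\<^sub>0 (x \<otimes>\<^bsub>U\<^esub> y) = S\<^sub>0 y \<otimes>\<^bsub>U\<^esub> S\<^sub>0 x"
  "S\<^sub>0 \<one>\<^bsub>U\<^esub> = \<one>\<^bsub>U\<^esub>"
  using algebra_homs_mult[OF antipode_hom] algebra_homs_one[OF antipode_hom]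
  by (simp_all add: opposite_algebra_def)

lemma counit_simps:
  "x \<in> carrier U \<Longrightarrow> y \<in> carrier U \<Longrightarrow> \<epsilon>\<^sub>0 (x \<oplus>\<^bsub>U\<^esub> y) = \<epsilon>\<^sub>0 x + \<epsilon>\<^sub>0 y"
  "x \<in> carrier U \<Longrightarrow> y \<in> carrier U \<Longrightarrow> \<epsilon>\<^sub>0 (x \<otimes>\<^bsub>U\<^esub> y) = \<epsilon>\<^sub>0 x * \<epsilon>\<^sub>0 y"
  "x \<in> carrier U \<Longrightarrow> \<epsilon>\<^sub>0 (c \<odot>\<^bsub>U\<^esub> x) = c * \<epsilon>\<^sub>0 x"
  "\<epsilon>\<^sub>0 \<one>\<^bsub>U\<^esub> = 1"
  using algebra_homs_linear[OF counit_hom] algebra_homs_mult[OF counit_hom] algebra_homs_one[OF counit_hom]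
  by (simp_all add: linear_maps_def scalar_algebra_def)

text \<open>Both sides are algebra homomorphisms in x, so generators suffice; there each side is the
  sum of the generator placed in the three legs.\<close>

lemma comult_coassoc:
  assumes x: "x \<in> carrier U"
  shows "tensor_lift (tensor_algebra UU U) (\<lambda>a b. pure_tensor UU U (\<Delta>\<^sub>0 a) b) (\<Delta>\<^sub>0 x) =
    tensor_assoc U (tensor_lift (tensor_algebra U UU) (\<lambda>a b. pure_tensor U UU a (\<Delta>\<^sub>0 b)) (\<Delta>\<^sub>0 x))"
proof -
  interpret l: tensor_pair UU U ..
  interpret r: tensor_pair U UU ..
  let ?P = "tensor_algebra UU U" and ?Q = "tensor_algebra U UU"
  note l_left = bilinear_maps_left[OF l.pure_bilinear] and l_right = bilinear_maps_right[OF l.pure_bilinear]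
  note r_left = bilinear_maps_left[OF r.pure_bilinear] and r_right = bilinear_maps_right[OF r.pure_bilinear]
  note P = l.AB.algebra_over_axioms and Q = r.AB.algebra_over_axioms
  have bil: "(\<lambda>a b. pure_tensor UU U (\<Delta>\<^sub>0 a) b) \<in> bilinear_maps U U ?P"
      "(\<lambda>a b. pure_tensor U UU a (\<Delta>\<^sub>0 b)) \<in> bilinear_maps U U ?Q"
    by (intro bilinear_mapsI l_right linear_maps_comp[OF l_left comult_linear]; simp)
      (intro bilinear_mapsI r_left linear_maps_comp[OF r_right comult_linear]; simp)
  have f: "tensor_lift ?P (\<lambda>a b. pure_tensor UU U (\<Delta>\<^sub>0 a) b) \<in> algebra_homs UU ?P"
    by (rule t.tensor_lift_hom[OF P bil(1)])
      (simp_all add: algebra_homs_mult[OF comult_hom] algebra_homs_one[OF comult_hom] l.pure_mult l.pure_one)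
  have g: "tensor_lift ?Q (\<lambda>a b. pure_tensor U UU a (\<Delta>\<^sub>0 b)) \<in> algebra_homs UU ?Q"
    by (rule t.tensor_lift_hom[OF Q bil(2)])
      (simp_all add: algebra_homs_mult[OF comult_hom] algebra_homs_one[OF comult_hom] r.pure_mult r.pure_one)
  note assoc = tensor_assoc_eq[OF U.algebra_over_axioms]
  show ?thesis
  proof (rule algebra_homs_eq_on_incl[OF algebra_homs_comp[OF f comult_hom]
        algebra_homs_comp[OF assoc(1) algebra_homs_comp[OF g comult_hom]] _ x])
    fix x assume x: "x \<in> carrier L"
    have "tensor_lift ?P (\<lambda>a b. pure_tensor UU U (\<Delta>\<^sub>0 a) b) (\<Delta>\<^sub>0 (\<iota> x)) =
        pure_tensor UU U (\<iota> x \<boxtimes> \<one>\<^bsub>U\<^esub>) \<one>\<^bsub>U\<^esub> \<oplus>\<^bsub>?P\<^esub> pure_tensor UU U (\<one>\<^bsub>U\<^esub> \<boxtimes> \<iota> x) \<one>\<^bsub>U\<^esub> \<oplus>\<^bsub>?P\<^esub>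
          pure_tensor UU U (\<one>\<^bsub>U\<^esub> \<boxtimes> \<one>\<^bsub>U\<^esub>) (\<iota> x)"
      using x by (simp add: comult_incl linear_maps_add[OF algebra_homs_linear[OF f]]
          t.tensor_lift_pure[OF P bil(1)] linear_maps_add[OF l_left] algebra_homs_one[OF comult_hom]
          t.pure_one)
    moreover have "tensor_assoc U (tensor_lift ?Q (\<lambda>a b. pure_tensor U UU a (\<Delta>\<^sub>0 b)) (\<Delta>\<^sub>0 (\<iota> x))) =
        pure_tensor UU U (\<iota> x \<boxtimes> \<one>\<^bsub>U\<^esub>) \<one>\<^bsub>U\<^esub> \<oplus>\<^bsub>?P\<^esub> (pure_tensor UU U (\<one>\<^bsub>U\<^esub> \<boxtimes> \<iota> x) \<one>\<^bsub>U\<^esub> \<oplus>\<^bsub>?P\<^esub>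
          pure_tensor UU U (\<one>\<^bsub>U\<^esub> \<boxtimes> \<one>\<^bsub>U\<^esub>) (\<iota> x))"
      using x by (simp add: comult_incl linear_maps_add[OF algebra_homs_linear[OF g]]
          t.tensor_lift_pure[OF Q bil(2)] linear_maps_add[OF r_right] algebra_homs_one[OF comult_hom]
          t.pure_one linear_maps_add[OF algebra_homs_linear[OF assoc(1)]] assoc(2))
    ultimately show "tensor_lift ?P (\<lambda>a b. pure_tensor UU U (\<Delta>\<^sub>0 a) b) (\<Delta>\<^sub>0 (\<iota> x)) =
        tensor_assoc U (tensor_lift ?Q (\<lambda>a b. pure_tensor U UU a (\<Delta>\<^sub>0 b)) (\<Delta>\<^sub>0 (\<iota> x)))"
      using x by (simp add: l.AB.a_assoc)
  qed
qed

lemma comult_counit: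
  assumes x: "x \<in> carrier U"
  shows "tensor_lift U (\<lambda>a b. \<epsilon>\<^sub>0 a \<odot>\<^bsub>U\<^esub> b) (\<Delta>\<^sub>0 x) = x"
    and "tensor_lift U (\<lambda>a b. \<epsilon>\<^sub>0 b \<odot>\<^bsub>U\<^esub> a) (\<Delta>\<^sub>0 x) = x"
proof -
  note U = U.algebra_over_axioms
  have bil: "(\<lambda>a b. \<epsilon>\<^sub>0 a \<odot>\<^bsub>U\<^esub> b) \<in> bilinear_maps U U U" "(\<lambda>a b. \<epsilon>\<^sub>0 b \<odot>\<^bsub>U\<^esub> a) \<in> bilinear_maps U U U"
    by (intro bilinear_mapsI linear_mapsI; simp add: counit_simps U.smult_l_distr U.smult_r_distr
        U.smult_smult mult.commute)+
  have hom: "tensor_lift U (\<lambda>a b. \<epsilon>\<^sub>0 a \<odot>\<^bsub>U\<^esub> b) \<in> algebra_homs UU U"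
      "tensor_lift U (\<lambda>a b. \<epsilon>\<^sub>0 b \<odot>\<^bsub>U\<^esub> a) \<in> algebra_homs UU U"
    by (rule t.tensor_lift_hom[OF U bil(1)] t.tensor_lift_hom[OF U bil(2)];
        simp add: counit_simps U.smult_smult mult.commute)+
  have id: "(\<lambda>x. x) \<in> algebra_homs U U"
    by (intro algebra_homsI linear_mapsI) simp_all
  show "tensor_lift U (\<lambda>a b. \<epsilon>\<^sub>0 a \<odot>\<^bsub>U\<^esub> b) (\<Delta>\<^sub>0 x) = x"
    by (rule algebra_homs_eq_on_incl[OF algebra_homs_comp[OF hom(1) comult_hom] id _ x])
      (simp add: comult_incl linear_maps_add[OF algebra_homs_linear[OF hom(1)]]
        t.tensor_lift_pure[OF U bil(1)] counit_incl counit_simps)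
  show "tensor_lift U (\<lambda>a b. \<epsilon>\<^sub>0 b \<odot>\<^bsub>U\<^esub> a) (\<Delta>\<^sub>0 x) = x"
    by (rule algebra_homs_eq_on_incl[OF algebra_homs_comp[OF hom(2) comult_hom] id _ x])
      (simp add: comult_incl linear_maps_add[OF algebra_homs_linear[OF hom(2)]]
        t.tensor_lift_pure[OF U bil(2)] counit_incl counit_simps)
qed

text \<open>The convolutions are not homomorphisms, so words are consumed one generator at a time.
  Left multiplication by the coproduct of a generator gives zero under \<open>?f\<close> and a
  commutator under \<open>?g\<close>; the commutator vanishes because by induction \<open>?g\<close>
  yields a scalar.\<close>

lemma comult_antipode:
  assumes x: "x \<in> carrier U"
  shows "tensor_lift U (\<lambda>a b. S\<^sub>0 a \<otimes>\<^bsub>U\<^esub> b) (\<Delta>\<^sub>0 x) = \<epsilon>\<^sub>0 x \<odot>\<^bsub>U\<^esub> \<one>\<^bsub>U\<^esub>"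
    and "tensor_lift U (\<lambda>a b. a \<otimes>\<^bsub>U\<^esub> S\<^sub>0 b) (\<Delta>\<^sub>0 x) = \<epsilon>\<^sub>0 x \<odot>\<^bsub>U\<^esub> \<one>\<^bsub>U\<^esub>"
proof -
  note U = U.algebra_over_axioms
  interpret UUU: algebra_pair UU U ..
  interpret UU2: algebra_pair UU UU ..
  let ?f = "tensor_lift U (\<lambda>a b. S\<^sub>0 a \<otimes>\<^bsub>U\<^esub> b)" and ?g = "tensor_lift U (\<lambda>a b. a \<otimes>\<^bsub>U\<^esub> S\<^sub>0 b)"
  have bil: "(\<lambda>a b. S\<^sub>0 a \<otimes>\<^bsub>U\<^esub> b) \<in> bilinear_maps U U U" "(\<lambda>a b. a \<otimes>\<^bsub>U\<^esub> S\<^sub>0 b) \<in> bilinear_maps U U U"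
    by (intro bilinear_mapsI linear_mapsI; simp add: linear_maps_add[OF antipode_linear]
        linear_maps_smult[OF antipode_linear] U.l_distr U.r_distr)+
  note lin = t.tensor_lift_linear[OF U bil(1)] t.tensor_lift_linear[OF U bil(2)]
  note pure = t.tensor_lift_pure[OF U bil(1)] t.tensor_lift_pure[OF U bil(2)]
  note closed = linear_maps_closed[OF lin(1)] linear_maps_closed[OF lin(2)]
  have id: "(\<lambda>W. W) \<in> linear_maps UU UU"
    by (rule linear_mapsI) simp_all
  have step_f: "?f (\<Delta>\<^sub>0 (\<iota> x) \<otimes>\<^bsub>UU\<^esub> W) = \<zero>\<^bsub>U\<^esub>" if x: "x \<in> carrier L" and W: "W \<in> carrier UU" for x W
  proof (rule t.linear_maps_eq_on_tensors[OF U _ _ _ W])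
    show "(\<lambda>W. ?f (\<Delta>\<^sub>0 (\<iota> x) \<otimes>\<^bsub>UU\<^esub> W)) \<in> linear_maps UU U"
      by (rule linear_maps_comp[OF lin(1) UU2.linear_maps_mult_left[OF id]]) (use x in simp)
    show "(\<lambda>W. \<zero>\<^bsub>U\<^esub>) \<in> linear_maps UU U"
      by (rule linear_mapsI) simp_all
  qed (use x in \<open>simp add: comult_incl t.AB.l_distr t.pure_mult linear_maps_add[OF lin(1)] pure
      antipode_simps antipode_incl U.r_minus U.l_minus U.m_assoc U.l_neg\<close>)
  have step_g: "?g (\<Delta>\<^sub>0 (\<iota> x) \<otimes>\<^bsub>UU\<^esub> W) = \<iota> x \<otimes>\<^bsub>U\<^esub> ?g W \<ominus>\<^bsub>U\<^esub> ?g W \<otimes>\<^bsub>U\<^esub> \<iota> x"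
    if x: "x \<in> carrier L" and W: "W \<in> carrier UU" for x W
  proof (rule t.linear_maps_eq_on_tensors[OF U _ _ _ W])
    show "(\<lambda>W. ?g (\<Delta>\<^sub>0 (\<iota> x) \<otimes>\<^bsub>UU\<^esub> W)) \<in> linear_maps UU U"
      by (rule linear_maps_comp[OF lin(2) UU2.linear_maps_mult_left[OF id]]) (use x in simp)
    show "(\<lambda>W. \<iota> x \<otimes>\<^bsub>U\<^esub> ?g W \<ominus>\<^bsub>U\<^esub> ?g W \<otimes>\<^bsub>U\<^esub> \<iota> x) \<in> linear_maps UU U"
      unfolding a_minus_def
      by (intro UUU.linear_maps_sum UUU.linear_maps_uminus UUU.linear_maps_mult_left
          UUU.linear_maps_mult_right lin incl_closed x)
  qed (use x in \<open>simp add: comult_incl t.AB.l_distr t.pure_mult linear_maps_add[OF lin(2)] pure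
      antipode_simps antipode_incl U.r_minus U.m_assoc a_minus_def\<close>)
  show "?f (\<Delta>\<^sub>0 x) = \<epsilon>\<^sub>0 x \<odot>\<^bsub>U\<^esub> \<one>\<^bsub>U\<^esub>"
    using x
  proof (induction x rule: uea_induct)
    case one
    show ?case
      by (simp add: algebra_homs_one[OF comult_hom] t.pure_one pure antipode_simps counit_simps)
  next
    case (incl x u)
    then show ?case
      by (simp add: algebra_homs_mult[OF comult_hom] step_f counit_simps counit_incl)
  qed (simp_all add: linear_maps_add[OF comult_linear] linear_maps_smult[OF comult_linear]
      linear_maps_add[OF lin(1)] linear_maps_smult[OF lin(1)] counit_simps U.smult_l_distr U.smult_smult)
  show "?g (\<Delta>\<^sub>0 x) = \<epsilon>\<^sub>0 x \<odot>\<^bsub>U\<^esub> \<one>\<^bsub>U\<^esub>"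
    using x
  proof (induction x rule: uea_induct)
    case one
    show ?case
      by (simp add: algebra_homs_one[OF comult_hom] t.pure_one pure antipode_simps counit_simps)
  next
    case (incl x u)
    then show ?case
      by (simp add: algebra_homs_mult[OF comult_hom] step_g counit_simps counit_incl U.r_neg a_minus_def)
  qed (simp_all add: linear_maps_add[OF comult_linear] linear_maps_smult[OF comult_linear]
      linear_maps_add[OF lin(2)] linear_maps_smult[OF lin(2)] counit_simps U.smult_l_distr U.smult_smult)
qed

end

section \<open>Operators on functions\<close>

text \<open>Linear endomorphisms of the function space \<open>'g \<Rightarrow> 'f\<close> under
  composition; the enveloping algebra is represented here so that its elements can be told
  apart.\<close>

definition function_operators :: "('f::comm_ring_1, ('g \<Rightarrow> 'f) \<Rightarrow> 'g \<Rightarrow> 'f) module" where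
  "function_operators =
    \<lparr>carrier = {h. (\<forall>f g. h (\<lambda>x. f x + g x) = (\<lambda>x. h f x + h g x)) \<and>
        (\<forall>c f. h (\<lambda>x. c * f x) = (\<lambda>x. c * h f x))},
     mult = (\<circ>), one = id, zero = (\<lambda>f x. 0), add = (\<lambda>h k f x. h f x + k f x),
     smult = (\<lambda>c h f x. c * h f x)\<rparr>"

lemma function_operators_algebra:
  "assoc_algebra (function_operators :: ('f::comm_ring_1, ('g \<Rightarrow> 'f) \<Rightarrow> 'g \<Rightarrow> 'f) module)"
  by (rule assoc_algebraI) (simp_all add: function_operators_def, simp_all add: fun_eq_iff algebra_simps)

section \<open>The generalized Virasoro-like algebra\<close>

lemma virasoro_like_simps:
  "carrier (virasoro_like \<Gamma>) = {p. Poly_Mapping.keys p \<subseteq> Root ` (\<Gamma> - {0}) \<union> range Deriv}"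
  "p \<oplus>\<^bsub>virasoro_like \<Gamma>\<^esub> q = p + q"
  "c \<odot>\<^bsub>virasoro_like \<Gamma>\<^esub> p = Poly_Mapping.map ((*) c) p"
  by (simp_all add: virasoro_like_def)

lemma lie_bracket_superset:
  fixes p q :: "'a::field vir_index \<Rightarrow>\<^sub>0 'a"
  assumes "finite F" "finite G" "Poly_Mapping.keys p \<subseteq> F" "Poly_Mapping.keys q \<subseteq> G"
  shows "lie_bracket (virasoro_like \<Gamma>) p q = (\<Sum>x\<in>F. \<Sum>y\<in>G.
    Poly_Mapping.map ((*) (Poly_Mapping.lookup p x * Poly_Mapping.lookup q y)) (basis_bracket x y))"
proof -
  let ?t = "\<lambda>x y. Poly_Mapping.map ((*) (Poly_Mapping.lookup p x * Poly_Mapping.lookup q y))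
    (basis_bracket x y)"
  have "(\<Sum>y\<in>Poly_Mapping.keys q. ?t x y) = (\<Sum>y\<in>G. ?t x y)" for x
    by (rule sum.mono_neutral_left) (use assms in \<open>auto simp: in_keys_iff scale_simps(4)\<close>)
  moreover have "(\<Sum>x\<in>Poly_Mapping.keys p. \<Sum>y\<in>G. ?t x y) = (\<Sum>x\<in>F. \<Sum>y\<in>G. ?t x y)"
    by (rule sum.mono_neutral_left) (use assms in \<open>auto simp: in_keys_iff scale_simps(4)\<close>)
  ultimately show ?thesis
    by (simp add: virasoro_like_def)
qed

lemma lookup_L_vec: "Poly_Mapping.lookup (L_vec \<beta>) x = (if \<beta> \<noteq> 0 \<and> x = Root \<beta> then 1 else 0)"
  by (auto simp: L_vec_def lookup_single when_def)

lemma lookup_d_vec: "Poly_Mapping.lookup (d_vec j) x = (if x = Deriv j then 1 else 0)"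
  by (auto simp: d_vec_def lookup_single when_def)

text \<open>Zero indices are included, unlike in \<open>lie_bracket_basis\<close>: then the
  convention L_0 = 0 makes the left side vanish, and so does the determinant on the right. This
  matters because a string \<beta> + i \<alpha> may pass through 0.\<close>

lemma bracket_L_L:
  "lie_bracket (virasoro_like \<Gamma>) (L_vec \<alpha>) (L_vec \<beta>) = Poly_Mapping.map ((*) (det2 \<alpha> \<beta>)) (L_vec (\<alpha> + \<beta>))"
proof -
  have "lie_bracket (virasoro_like \<Gamma>) (L_vec \<alpha>) (L_vec \<beta>) =
      Poly_Mapping.map ((*) (Poly_Mapping.lookup (L_vec \<alpha>) (Root \<alpha>) * Poly_Mapping.lookup (L_vec \<beta>) (Root \<beta>)))
        (basis_bracket (Root \<alpha>) (Root \<beta>))"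
    by (subst lie_bracket_superset[of "{Root \<alpha>}" "{Root \<beta>}"]) (auto simp: L_vec_def)
  then show ?thesis
    by (cases "\<alpha> = 0 \<or> \<beta> = 0")
      (auto simp: lookup_L_vec det2_def lookup_scale intro!: poly_mapping_eqI)
qed

text \<open>T and both derivations belong to this one family (\<open>d_vec_eq_cartan\<close>), so
  each bracket formula is proved once.\<close>

definition cartan :: "'f::field ^ 2 \<Rightarrow> 'f vir_index \<Rightarrow>\<^sub>0 'f" where
  "cartan a = Poly_Mapping.map ((*) (a $ 1)) (d_vec 1) + Poly_Mapping.map ((*) (a $ 2)) (d_vec 2)"

lemma lookup_cartan: "Poly_Mapping.lookup (cartan a) x = (case x of Root \<beta> \<Rightarrow> 0 | Deriv j \<Rightarrow> a $ j)"
  by (auto simp: cartan_def lookup_add lookup_scale lookup_d_vec split: vir_index.split)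
    (metis exhaust_2)+

lemma d_vec_eq_cartan: "d_vec j = cartan (\<chi> i. if i = j then 1 else 0)"
  by (rule poly_mapping_eqI) (simp add: lookup_d_vec lookup_cartan split: vir_index.split)

lemma keys_cartan: "Poly_Mapping.keys (cartan a) \<subseteq> range Deriv"
  by (auto simp: in_keys_iff lookup_cartan split: vir_index.splits)

lemma bracket_cartan_L:
  "lie_bracket (virasoro_like \<Gamma>) (cartan a) (L_vec \<beta>) =
    Poly_Mapping.map ((*) (a $ 1 * \<beta> $ 1 + a $ 2 * \<beta> $ 2)) (L_vec \<beta>)"
proof -
  have "lie_bracket (virasoro_like \<Gamma>) (cartan a) (L_vec \<beta>) =
      (\<Sum>x\<in>range Deriv. \<Sum>y\<in>{Root \<beta>}. Poly_Mapping.map ((*) (Poly_Mapping.lookup (cartan a) x *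
        Poly_Mapping.lookup (L_vec \<beta>) y)) (basis_bracket x y))"
    by (rule lie_bracket_superset) (use keys_cartan in \<open>auto simp: L_vec_def\<close>)
  also have "\<dots> = (\<Sum>j\<in>UNIV. Poly_Mapping.map ((*) (a $ j * Poly_Mapping.lookup (L_vec \<beta>) (Root \<beta>)))
      (Poly_Mapping.map ((*) (\<beta> $ j)) (L_vec \<beta>)))"
    by (subst sum.reindex) (simp_all add: inj_on_def lookup_cartan)
  also have "\<dots> = Poly_Mapping.map ((*) (a $ 1 * \<beta> $ 1 + a $ 2 * \<beta> $ 2)) (L_vec \<beta>)"
    by (rule poly_mapping_eqI) (auto simp: lookup_scale lookup_add lookup_L_vec sum_2 algebra_simps)
  finally show ?thesis .
qed

lemma bracket_cartan_cartan: "lie_bracket (virasoro_like \<Gamma>) (cartan a) (cartan a') = 0"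
proof -
  have "lie_bracket (virasoro_like \<Gamma>) (cartan a) (cartan a') =
      (\<Sum>x\<in>range Deriv. \<Sum>y\<in>range Deriv. Poly_Mapping.map ((*) (Poly_Mapping.lookup (cartan a) x *
        Poly_Mapping.lookup (cartan a') y)) (basis_bracket x y))"
    by (rule lie_bracket_superset) (use keys_cartan in auto)
  also have "\<dots> = 0"
    by (intro sum.neutral ballI) (auto simp: scale_simps)
  finally show ?thesis .
qed

lemma virasoro_like_carrier_add:
  "p \<in> carrier (virasoro_like \<Gamma>) \<Longrightarrow> q \<in> carrier (virasoro_like \<Gamma>) \<Longrightarrow> p + q \<in> carrier (virasoro_like \<Gamma>)"
  using Poly_Mapping.keys_add[of p q] by (auto simp: virasoro_like_simps)

lemma virasoro_like_carrier_scale: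
  "p \<in> carrier (virasoro_like \<Gamma>) \<Longrightarrow> Poly_Mapping.map ((*) c) p \<in> carrier (virasoro_like \<Gamma>)"
  by (force simp: virasoro_like_simps subset_iff in_keys_iff lookup_scale)

lemma virasoro_like_carrier_sum:
  "(\<And>i. i \<in> I \<Longrightarrow> p i \<in> carrier (virasoro_like \<Gamma>)) \<Longrightarrow> sum p I \<in> carrier (virasoro_like \<Gamma>)"
  by (induction I rule: infinite_finite_induct)
    (auto intro!: virasoro_like_carrier_add, auto simp: virasoro_like_simps)

lemma L_vec_carrier: "\<beta> \<in> \<Gamma> \<Longrightarrow> L_vec \<beta> \<in> carrier (virasoro_like \<Gamma>)"
  by (simp add: virasoro_like_simps L_vec_def)

lemma cartan_carrier: "cartan a \<in> carrier (virasoro_like \<Gamma>)"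
  using keys_cartan by (auto simp: virasoro_like_simps)

lemma lie_carrier_virasoro_like:
  assumes "nondegenerate_subgroup \<Gamma>"
  shows "lie_carrier (virasoro_like \<Gamma>)"
proof
  fix p q assume p: "p \<in> carrier (virasoro_like \<Gamma>)" and q: "q \<in> carrier (virasoro_like \<Gamma>)"
  show "p \<oplus>\<^bsub>virasoro_like \<Gamma>\<^esub> q \<in> carrier (virasoro_like \<Gamma>)"
    using virasoro_like_carrier_add[OF p q] by (simp add: virasoro_like_simps(2))
  show "c \<odot>\<^bsub>virasoro_like \<Gamma>\<^esub> p \<in> carrier (virasoro_like \<Gamma>)" for c
    using virasoro_like_carrier_scale[OF p] by (simp add: virasoro_like_simps(3))
  have zero: "0 \<in> carrier (virasoro_like \<Gamma>)"
    by (simp add: virasoro_like_simps)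
  have "basis_bracket x y \<in> carrier (virasoro_like \<Gamma>)"
    if "x \<in> Poly_Mapping.keys p" "y \<in> Poly_Mapping.keys q" for x y
  proof -
    have "x \<in> Root ` \<Gamma> \<union> range Deriv" "y \<in> Root ` \<Gamma> \<union> range Deriv"
      using p q that by (auto simp: virasoro_like_simps)
    then show ?thesis
      using assms
      by (cases x; cases y)
        (auto simp: nondegenerate_subgroup_def zero intro!: virasoro_like_carrier_scale L_vec_carrier)
  qed
  then have "(\<Sum>x\<in>Poly_Mapping.keys p. \<Sum>y\<in>Poly_Mapping.keys q.
      Poly_Mapping.map ((*) (Poly_Mapping.lookup p x * Poly_Mapping.lookup q y)) (basis_bracket x y))
    \<in> carrier (virasoro_like \<Gamma>)"
    by (intro virasoro_like_carrier_sum virasoro_like_carrier_scale)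
  then show "lie_bracket (virasoro_like \<Gamma>) p q \<in> carrier (virasoro_like \<Gamma>)"
    by (subst lie_bracket_superset[OF finite_keys finite_keys order.refl order.refl])
qed

text \<open>
  The action \<open>L_\<beta> x^\<gamma> = det2 \<beta> \<gamma> x^(\<beta> + \<gamma>)\<close>, \<open>\<partial>_j x^\<gamma> = \<gamma>_j x^\<gamma>\<close> on formal sums
  \<open>\<Sum>\<gamma>. f \<gamma> x^\<gamma>\<close>, written on coefficient functions.  It makes \<open>L_\<alpha>\<close> and \<open>T\<close> visibly independent
  in the enveloping algebra, so that no Poincare-Birkhoff-Witt theorem is needed.
\<close>

primrec basis_operator :: "'f::field vir_index \<Rightarrow> ('f ^ 2 \<Rightarrow> 'f) \<Rightarrow> 'f ^ 2 \<Rightarrow> 'f" where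
  "basis_operator (Root \<beta>) f \<gamma> = det2 \<beta> \<gamma> * f (\<gamma> - \<beta>)"
| "basis_operator (Deriv j) f \<gamma> = \<gamma> $ j * f \<gamma>"

definition vir_operator :: "('f::field vir_index \<Rightarrow>\<^sub>0 'f) \<Rightarrow> ('f ^ 2 \<Rightarrow> 'f) \<Rightarrow> 'f ^ 2 \<Rightarrow> 'f" where
  "vir_operator p f \<gamma> = (\<Sum>x\<in>Poly_Mapping.keys p. Poly_Mapping.lookup p x * basis_operator x f \<gamma>)"

lemma vir_operator_superset:
  assumes "finite F" "Poly_Mapping.keys p \<subseteq> F"
  shows "vir_operator p f \<gamma> = (\<Sum>x\<in>F. Poly_Mapping.lookup p x * basis_operator x f \<gamma>)"
  unfolding vir_operator_def
  by (rule sum.mono_neutral_left) (use assms in \<open>auto simp: in_keys_iff\<close>)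

lemma vir_operator_add: "vir_operator (p + q) f \<gamma> = vir_operator p f \<gamma> + vir_operator q f \<gamma>"
proof -
  let ?F = "Poly_Mapping.keys p \<union> Poly_Mapping.keys q"
  have F: "finite ?F" "Poly_Mapping.keys p \<subseteq> ?F" "Poly_Mapping.keys q \<subseteq> ?F"
      "Poly_Mapping.keys (p + q) \<subseteq> ?F"
    using Poly_Mapping.keys_add[of p q] by auto
  show ?thesis
    unfolding vir_operator_superset[OF F(1,2)] vir_operator_superset[OF F(1,3)]
      vir_operator_superset[OF F(1,4)]
    by (simp add: lookup_add distrib_right sum.distrib)
qed

lemma vir_operator_scale:
  "vir_operator (Poly_Mapping.map ((*) c) p) f \<gamma> = c * vir_operator p f \<gamma>"
  by (simp add: vir_operator_superset[OF finite_keys keys_scale_subset] vir_operator_def[of p] lookup_scale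
      sum_distrib_left mult.assoc)

lemma vir_operator_sum: "vir_operator (sum p I) f \<gamma> = (\<Sum>i\<in>I. vir_operator (p i) f \<gamma>)"
proof -
  have "vir_operator 0 f \<gamma> = 0"
    by (simp add: vir_operator_def)
  then show ?thesis
    by (induction I rule: infinite_finite_induct) (simp_all add: vir_operator_add)
qed

lemma vir_operator_L_vec: "vir_operator (L_vec \<beta>) f \<gamma> = det2 \<beta> \<gamma> * f (\<gamma> - \<beta>)"
  by (simp add: L_vec_def vir_operator_def det2_def)

lemma vir_operator_cartan: "vir_operator (cartan a) f \<gamma> = (a $ 1 * \<gamma> $ 1 + a $ 2 * \<gamma> $ 2) * f \<gamma>"
proof -
  have "vir_operator (cartan a) f \<gamma> = (\<Sum>x\<in>range Deriv. Poly_Mapping.lookup (cartan a) x * basis_operator x f \<gamma>)"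
    by (rule vir_operator_superset[OF _ keys_cartan]) simp
  also have "\<dots> = (a $ 1 * \<gamma> $ 1 + a $ 2 * \<gamma> $ 2) * f \<gamma>"
    by (subst sum.reindex) (simp_all add: inj_on_def lookup_cartan sum_2 algebra_simps)
  finally show ?thesis .
qed

lemma basis_operator_linear:
  "basis_operator x (\<lambda>\<delta>. f \<delta> + g \<delta>) \<gamma> = basis_operator x f \<gamma> + basis_operator x g \<gamma>"
  "basis_operator x (\<lambda>\<delta>. c * f \<delta>) \<gamma> = c * basis_operator x f \<gamma>"
  by (cases x; simp add: algebra_simps)+

lemma basis_operator_sum:
  "basis_operator x (\<lambda>\<delta>. \<Sum>i\<in>I. f i \<delta>) \<gamma> = (\<Sum>i\<in>I. basis_operator x (f i) \<gamma>)"
  by (cases x) (simp_all add: sum_distrib_left)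

lemma vir_operator_carrier: "vir_operator p \<in> carrier function_operators"
  by (simp add: function_operators_def fun_eq_iff vir_operator_def basis_operator_linear
      distrib_left sum.distrib sum_distrib_left mult.left_commute)

text \<open>For two roots this is det2 \<alpha> \<gamma> det2 \<beta> (\<gamma> - \<alpha>) - det2
  \<beta> \<gamma> det2 \<alpha> (\<gamma> - \<beta>) = det2 \<alpha> \<beta> det2 (\<alpha> +
  \<beta>) \<gamma>. The factor det2 \<beta> \<gamma> in the operator equals det2 \<beta> (\<gamma>
  - \<beta>), since det2 \<beta> \<beta> = 0.\<close>

lemma vir_operator_basis_bracket:
  "vir_operator (basis_bracket x y) f \<gamma> =
    basis_operator x (basis_operator y f) \<gamma> - basis_operator y (basis_operator x f) \<gamma>"
proof (cases x; cases y)
  fix \<alpha> \<beta> assume xy: "x = Root \<alpha>" "y = Root \<beta>"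
  have "f (\<gamma> - \<alpha> - \<beta>) = f (\<gamma> - (\<alpha> + \<beta>))" "f (\<gamma> - \<beta> - \<alpha>) = f (\<gamma> - (\<alpha> + \<beta>))"
    by (simp_all add: diff_diff_eq add.commute)
  then show ?thesis
    by (simp add: xy vir_operator_scale vir_operator_L_vec) (simp add: det2_def algebra_simps)
qed (simp_all add: vir_operator_scale vir_operator_L_vec, simp_all add: algebra_simps vir_operator_def)

lemma vir_operator_comp:
  "vir_operator p (vir_operator q f) \<gamma> =
    (\<Sum>x\<in>Poly_Mapping.keys p. \<Sum>y\<in>Poly_Mapping.keys q. Poly_Mapping.lookup p x * Poly_Mapping.lookup q y *
      basis_operator x (basis_operator y f) \<gamma>)"
  by (simp add: vir_operator_def[of p] vir_operator_def[of q, abs_def] basis_operator_sum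
      basis_operator_linear sum_distrib_left mult.assoc)

lemma vir_operator_bracket:
  "vir_operator (lie_bracket (virasoro_like \<Gamma>) p q) f \<gamma> =
    vir_operator p (vir_operator q f) \<gamma> - vir_operator q (vir_operator p f) \<gamma>"
proof -
  have "vir_operator q (vir_operator p f) \<gamma> =
      (\<Sum>x\<in>Poly_Mapping.keys p. \<Sum>y\<in>Poly_Mapping.keys q. Poly_Mapping.lookup p x * Poly_Mapping.lookup q y *
        basis_operator y (basis_operator x f) \<gamma>)"
    unfolding vir_operator_comp by (subst sum.swap) (simp add: mult.commute)
  then show ?thesis
    by (simp add: virasoro_like_def vir_operator_comp vir_operator_sum vir_operator_scale
        vir_operator_basis_bracket right_diff_distrib sum_subtractf)
qed

section \<open>The generalized Virasoro-like algebra as an instance of the twist\<close>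

locale virasoro =
  fixes \<Gamma> :: "('f::field_char_0 ^ 2) set" and \<alpha> a :: "'f ^ 2"
  assumes \<Gamma>: "nondegenerate_subgroup \<Gamma>" and \<alpha>_mem: "\<alpha> \<in> \<Gamma> - {0}"
    and bracket_\<alpha>: "lie_bracket (virasoro_like \<Gamma>) (cartan a) (L_vec \<alpha>) = L_vec \<alpha>"
begin

sublocale lie_carrier "virasoro_like \<Gamma>"
  by (rule lie_carrier_virasoro_like[OF \<Gamma>])

abbreviation T\<^sub>U where "T\<^sub>U \<equiv> \<iota> (cartan a)"
abbreviation L\<^sub>U where "L\<^sub>U \<equiv> \<iota> (L_vec \<alpha>)"

lemma weight_\<alpha>: "a $ 1 * \<alpha> $ 1 + a $ 2 * \<alpha> $ 2 = 1"
proof -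
  have "Poly_Mapping.lookup (Poly_Mapping.map ((*) (a $ 1 * \<alpha> $ 1 + a $ 2 * \<alpha> $ 2)) (L_vec \<alpha>)) (Root \<alpha>) =
      Poly_Mapping.lookup (L_vec \<alpha>) (Root \<alpha>)"
    using bracket_\<alpha> by (simp add: bracket_cartan_L)
  then show ?thesis
    using \<alpha>_mem by (simp add: lookup_scale lookup_L_vec)
qed

lemma \<Gamma>_add: "\<beta> \<in> \<Gamma> \<Longrightarrow> \<gamma> \<in> \<Gamma> \<Longrightarrow> \<beta> + \<gamma> \<in> \<Gamma>"
  using \<Gamma> by (simp add: nondegenerate_subgroup_def)

lemma string_mem: "\<beta> \<in> \<Gamma> \<Longrightarrow> \<beta> + of_nat i *s \<alpha> \<in> \<Gamma>"
proof (induction i)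
  case (Suc i)
  have "\<beta> + of_nat (Suc i) *s \<alpha> = (\<beta> + of_nat i *s \<alpha>) + \<alpha>"
    by (simp add: vec_eq_iff algebra_simps)
  then show ?case
    using Suc \<alpha>_mem \<Gamma>_add[of "\<beta> + of_nat i *s \<alpha>" \<alpha>] by (simp only: Diff_iff)
qed simp

lemmas carriers = L_vec_carrier[of _ \<Gamma>] cartan_carrier[of _ \<Gamma>]

lemma T_commutes_L: "\<beta> \<in> \<Gamma> \<Longrightarrow> \<iota> (cartan a') \<otimes>\<^bsub>U\<^esub> \<iota> (L_vec \<beta>) =
    \<iota> (L_vec \<beta>) \<otimes>\<^bsub>U\<^esub> \<iota> (cartan a') \<oplus>\<^bsub>U\<^esub> (a' $ 1 * \<beta> $ 1 + a' $ 2 * \<beta> $ 2) \<odot>\<^bsub>U\<^esub> \<iota> (L_vec \<beta>)"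
  using incl_smult[of "L_vec \<beta>"] incl_bracket_eq[of "cartan a'" "L_vec \<beta>"]
  by (simp add: carriers bracket_cartan_L virasoro_like_simps(3))

lemma cartan_commute: "\<iota> (cartan a') \<otimes>\<^bsub>U\<^esub> \<iota> (cartan a'') = \<iota> (cartan a'') \<otimes>\<^bsub>U\<^esub> \<iota> (cartan a')"
proof -
  have "(0 :: 'f vir_index \<Rightarrow>\<^sub>0 'f) = 0 \<odot>\<^bsub>virasoro_like \<Gamma>\<^esub> cartan a"
    by (rule poly_mapping_eqI) (simp add: virasoro_like_simps(3) lookup_scale)
  then have "\<iota> 0 = \<zero>\<^bsub>U\<^esub>"
    using incl_smult[of "cartan a" 0] by (simp add: carriers)
  then show ?thesis
    using incl_bracket_eq[of "cartan a'" "cartan a''"] by (simp add: carriers bracket_cartan_cartan)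
qed

lemma L_commutes_L: "\<beta> \<in> \<Gamma> \<Longrightarrow> L\<^sub>U \<otimes>\<^bsub>U\<^esub> \<iota> (L_vec \<beta>) =
    \<iota> (L_vec \<beta>) \<otimes>\<^bsub>U\<^esub> L\<^sub>U \<oplus>\<^bsub>U\<^esub> det2 \<alpha> \<beta> \<odot>\<^bsub>U\<^esub> \<iota> (L_vec (\<alpha> + \<beta>))"
  using incl_smult[of "L_vec (\<alpha> + \<beta>)"] incl_bracket_eq[of "L_vec \<alpha>" "L_vec \<beta>"] \<alpha>_mem
  by (simp add: carriers bracket_L_L virasoro_like_simps(3) \<Gamma>_add)

definition \<rho> where "\<rho> = uea_lift function_operators vir_operator"
text \<open>A linear functional on the enveloping algebra: let u act on the constant function 1 and
  read off the value at \<gamma>. Shifts of the argument are invisible on a constant function, so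
  root vectors give plain determinants.\<close>

definition \<phi> where "\<phi> \<gamma> u = \<rho> u (\<lambda>_. 1) \<gamma>"

lemma \<rho>_hom: "\<rho> \<in> algebra_homs U function_operators"
  and \<rho>_incl: "p \<in> carrier (virasoro_like \<Gamma>) \<Longrightarrow> \<rho> (\<iota> p) = vir_operator p"
proof -
  let ?B = "function_operators :: ('f, ('f ^ 2 \<Rightarrow> 'f) \<Rightarrow> 'f ^ 2 \<Rightarrow> 'f) module"
  have B: "algebra_over ?B"
    by unfold_locales (rule function_operators_algebra)
  then interpret B: algebra_over ?B .
  have B_simps: "h \<oplus>\<^bsub>?B\<^esub> k = (\<lambda>f x. h f x + k f x)" "c \<odot>\<^bsub>?B\<^esub> h = (\<lambda>f x. c * h f x)"
      "h \<otimes>\<^bsub>?B\<^esub> k = h \<circ> k" for h k c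
    by (simp_all add: function_operators_def)
  have minus: "h \<ominus>\<^bsub>?B\<^esub> k = (\<lambda>f x. h f x - k f x)" if "h \<in> carrier ?B" "k \<in> carrier ?B" for h k
    using that by (simp add: a_minus_def B.a_inv_eq_smult B_simps)
  have add: "vir_operator (p \<oplus>\<^bsub>virasoro_like \<Gamma>\<^esub> q) = vir_operator p \<oplus>\<^bsub>?B\<^esub> vir_operator q" for p q
    by (simp add: B_simps fun_eq_iff virasoro_like_simps(2) vir_operator_add)
  have smult: "vir_operator (c \<odot>\<^bsub>virasoro_like \<Gamma>\<^esub> p) = c \<odot>\<^bsub>?B\<^esub> vir_operator p" for c p
    by (simp add: B_simps fun_eq_iff virasoro_like_simps(3) vir_operator_scale)
  have bracket: "vir_operator (lie_bracket (virasoro_like \<Gamma>) p q) =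
      vir_operator p \<otimes>\<^bsub>?B\<^esub> vir_operator q \<ominus>\<^bsub>?B\<^esub> vir_operator q \<otimes>\<^bsub>?B\<^esub> vir_operator p" for p q
    by (subst minus) (simp_all add: vir_operator_carrier, simp add: B_simps fun_eq_iff vir_operator_bracket)
  show "\<rho> \<in> algebra_homs U ?B"
    unfolding \<rho>_def by (rule uea_lift_hom[OF B vir_operator_carrier add smult bracket])
  show "\<rho> (\<iota> p) = vir_operator p" if "p \<in> carrier (virasoro_like \<Gamma>)"
    unfolding \<rho>_def by (rule uea_lift_incl[OF B vir_operator_carrier add smult bracket that])
qed

lemma \<phi>_linear: "\<phi> \<gamma> \<in> linear_maps U scalar_algebra"
  using linear_maps_add[OF algebra_homs_linear[OF \<rho>_hom]] linear_maps_smult[OF algebra_homs_linear[OF \<rho>_hom]]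
  by (intro linear_mapsI) (simp_all add: \<phi>_def scalar_algebra_def, simp_all add: function_operators_def)

lemma \<phi>_incl:
  "\<phi> \<gamma> T\<^sub>U = a $ 1 * \<gamma> $ 1 + a $ 2 * \<gamma> $ 2" "\<phi> \<gamma> L\<^sub>U = det2 \<alpha> \<gamma>"
  using \<alpha>_mem by (simp_all add: \<phi>_def \<rho>_incl carriers vir_operator_cartan vir_operator_L_vec)

lemma det2_nondegenerate: obtains \<gamma> where "det2 \<alpha> \<gamma> \<noteq> 0"
proof -
  have "det2 \<alpha> (axis 2 1) = \<alpha> $ 1" "det2 \<alpha> (axis 1 1) = - \<alpha> $ 2"
    by (simp_all add: det2_def axis_def)
  moreover have "\<alpha> $ 1 \<noteq> 0 \<or> \<alpha> $ 2 \<noteq> 0"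
    using \<alpha>_mem by (auto simp: vec_eq_iff forall_2)
  ultimately show thesis
    using that by (metis neg_equal_0_iff_equal)
qed

lemma L\<^sub>U_nonzero: "L\<^sub>U \<noteq> \<zero>\<^bsub>U\<^esub>"
proof -
  obtain \<gamma> where "det2 \<alpha> \<gamma> \<noteq> 0"
    by (rule det2_nondegenerate)
  moreover have "\<phi> \<gamma> \<zero>\<^bsub>U\<^esub> = 0"
    using linear_maps_smult[OF \<phi>_linear, of "\<zero>\<^bsub>U\<^esub>" \<gamma> 0] by (simp add: scalar_algebra_def)
  ultimately show ?thesis
    using \<phi>_incl(2)[of \<gamma>] by auto
qed

text \<open>The functional \<open>\<phi> \<alpha>\<close> in the first leg and
  \<open>\<phi> \<gamma>\<close> in the second separate the two tensors: the former is 1 on T and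
  det2 \<alpha> \<alpha> = 0 on L, so the values are det2 \<alpha> \<gamma> and 0, and \<gamma> is
  chosen to make the determinant nonzero.\<close>

lemma pure_T_L_neq: "pure_tensor U U T\<^sub>U L\<^sub>U \<noteq> pure_tensor U U L\<^sub>U T\<^sub>U"
proof -
  obtain \<gamma> where \<gamma>: "det2 \<alpha> \<gamma> \<noteq> 0"
    by (rule det2_nondegenerate)
  let ?K = "scalar_algebra :: ('f, 'f) module"
  let ?h = "\<lambda>u v. \<phi> \<alpha> u * \<phi> \<gamma> v"
  have K: "algebra_over ?K"
    by unfold_locales (rule scalar_assoc_algebra)
  have \<phi>: "\<phi> \<delta> (u \<oplus>\<^bsub>U\<^esub> v) = \<phi> \<delta> u + \<phi> \<delta> v" "\<phi> \<delta> (c \<odot>\<^bsub>U\<^esub> u) = c * \<phi> \<delta> u"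
    if "u \<in> carrier U" "v \<in> carrier U" for \<delta> u v c
    using that linear_maps_add[OF \<phi>_linear] linear_maps_smult[OF \<phi>_linear]
    by (simp_all add: scalar_algebra_def)
  have h: "?h \<in> bilinear_maps U U ?K"
    by (intro bilinear_mapsI linear_mapsI) (simp_all add: \<phi>, simp_all add: scalar_algebra_def algebra_simps)
  have "tensor_lift ?K ?h (pure_tensor U U u v) = ?h u v" if "u \<in> carrier U" "v \<in> carrier U" for u v
    by (rule t.tensor_lift_pure[OF K h that])
  moreover have "L\<^sub>U \<in> carrier U" "T\<^sub>U \<in> carrier U"
    using \<alpha>_mem by (simp_all add: carriers)
  moreover have "?h T\<^sub>U L\<^sub>U \<noteq> ?h L\<^sub>U T\<^sub>U"
    using \<gamma> by (simp add: \<phi>_incl weight_\<alpha>) (simp add: det2_def)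
  ultimately show ?thesis
    by metis
qed

end

context virasoro
begin

sublocale twist: twist_hopf "uea (virasoro_like \<Gamma>)" "uea_incl (virasoro_like \<Gamma>) (cartan a)"
    "uea_incl (virasoro_like \<Gamma>) (L_vec \<alpha>)" "uea_comult (virasoro_like \<Gamma>)"
    "uea_antipode (virasoro_like \<Gamma>)" "uea_counit (virasoro_like \<Gamma>)"
proof unfold_locales
  show "T\<^sub>U \<in> carrier U" "L\<^sub>U \<in> carrier U"
    using \<alpha>_mem by (simp_all add: carriers)
  show "T\<^sub>U \<otimes>\<^bsub>U\<^esub> L\<^sub>U = L\<^sub>U \<otimes>\<^bsub>U\<^esub> T\<^sub>U \<oplus>\<^bsub>U\<^esub> L\<^sub>U"
    using T_commutes_L[of \<alpha> a] \<alpha>_mem by (simp add: weight_\<alpha> carriers)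
qed (use \<alpha>_mem in \<open>simp_all add: carriers comult_hom antipode_hom counit_hom comult_incl antipode_incl
    counit_incl comult_coassoc comult_counit comult_antipode\<close>)

lemma counit_eq: "uea_series_counit (virasoro_like \<Gamma>) = twist.\<epsilon>"
  by (simp add: fun_eq_iff uea_series_counit_def twist.\<epsilon>_def)

lemma string_relations:
  assumes "\<beta> \<in> \<Gamma>"
  defines "l \<equiv> \<lambda>i. \<iota> (L_vec (\<beta> + of_nat i *s \<alpha>))"
  shows "l i \<in> carrier U"
    and "L\<^sub>U \<otimes>\<^bsub>U\<^esub> l i = l i \<otimes>\<^bsub>U\<^esub> L\<^sub>U \<oplus>\<^bsub>U\<^esub> det2 \<alpha> \<beta> \<odot>\<^bsub>U\<^esub> l (Suc i)"
    and "T\<^sub>U \<otimes>\<^bsub>U\<^esub> l i = l i \<otimes>\<^bsub>U\<^esub> T\<^sub>U \<oplus>\<^bsub>U\<^esub> (a $ 1 * \<beta> $ 1 + a $ 2 * \<beta> $ 2 + of_nat i) \<odot>\<^bsub>U\<^esub> l i"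
proof -
  let ?\<beta> = "\<beta> + of_nat i *s \<alpha>"
  have mem: "?\<beta> \<in> \<Gamma>"
    by (rule string_mem[OF assms(1)])
  show "l i \<in> carrier U"
    using mem by (simp add: l_def carriers)
  have "\<alpha> + ?\<beta> = \<beta> + of_nat (Suc i) *s \<alpha>" "det2 \<alpha> ?\<beta> = det2 \<alpha> \<beta>"
    by (simp_all add: vec_eq_iff det2_def algebra_simps)
  then show "L\<^sub>U \<otimes>\<^bsub>U\<^esub> l i = l i \<otimes>\<^bsub>U\<^esub> L\<^sub>U \<oplus>\<^bsub>U\<^esub> det2 \<alpha> \<beta> \<odot>\<^bsub>U\<^esub> l (Suc i)"
    using L_commutes_L[OF mem] by (simp only: l_def)
  have "a $ 1 * ?\<beta> $ 1 + a $ 2 * ?\<beta> $ 2 =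
      a $ 1 * \<beta> $ 1 + a $ 2 * \<beta> $ 2 + of_nat i * (a $ 1 * \<alpha> $ 1 + a $ 2 * \<alpha> $ 2)"
    by (simp add: algebra_simps)
  then show "T\<^sub>U \<otimes>\<^bsub>U\<^esub> l i = l i \<otimes>\<^bsub>U\<^esub> T\<^sub>U \<oplus>\<^bsub>U\<^esub> (a $ 1 * \<beta> $ 1 + a $ 2 * \<beta> $ 2 + of_nat i) \<odot>\<^bsub>U\<^esub> l i"
    using T_commutes_L[OF mem, of a] by (simp only: l_def weight_\<alpha> mult_1_right)
qed

lemma derivation_relations:
  "\<iota> (d_vec j) \<in> carrier U"
  "\<iota> (d_vec j) \<otimes>\<^bsub>U\<^esub> L\<^sub>U = L\<^sub>U \<otimes>\<^bsub>U\<^esub> \<iota> (d_vec j) \<oplus>\<^bsub>U\<^esub> \<alpha> $ j \<odot>\<^bsub>U\<^esub> L\<^sub>U"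
  "T\<^sub>U \<otimes>\<^bsub>U\<^esub> \<iota> (d_vec j) = \<iota> (d_vec j) \<otimes>\<^bsub>U\<^esub> T\<^sub>U"
proof -
  let ?e = "(\<chi> i. if i = j then 1 else 0) :: 'f ^ 2"
  have "?e $ 1 * \<alpha> $ 1 + ?e $ 2 * \<alpha> $ 2 = \<alpha> $ j"
    using exhaust_2[of j] by auto
  then show "\<iota> (d_vec j) \<otimes>\<^bsub>U\<^esub> L\<^sub>U = L\<^sub>U \<otimes>\<^bsub>U\<^esub> \<iota> (d_vec j) \<oplus>\<^bsub>U\<^esub> \<alpha> $ j \<odot>\<^bsub>U\<^esub> L\<^sub>U"
    using T_commutes_L[of \<alpha> ?e] \<alpha>_mem by (simp only: d_vec_eq_cartan Diff_iff)
  show "T\<^sub>U \<otimes>\<^bsub>U\<^esub> \<iota> (d_vec j) = \<iota> (d_vec j) \<otimes>\<^bsub>U\<^esub> T\<^sub>U"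
    unfolding d_vec_eq_cartan by (rule cartan_commute)
  show "\<iota> (d_vec j) \<in> carrier U"
    by (simp add: d_vec_eq_cartan carriers)
qed

end

theorem theorem2p6:
  fixes \<Gamma> :: "('f::field_char_0 ^ 2) set" and \<alpha> a :: "'f ^ 2"
  assumes "nondegenerate_subgroup \<Gamma>"
    and "\<alpha> \<in> \<Gamma> - {0}"
    and "lie_bracket (virasoro_like \<Gamma>)
           (a $ 1 \<odot>\<^bsub>virasoro_like \<Gamma>\<^esub> d_vec 1 \<oplus>\<^bsub>virasoro_like \<Gamma>\<^esub> a $ 2 \<odot>\<^bsub>virasoro_like \<Gamma>\<^esub> d_vec 2)
           (L_vec \<alpha>) = L_vec \<alpha>"
  shows
    "let V = virasoro_like \<Gamma>; U = uea V; UU = tensor_algebra U U;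
         H = series_algebra U; HH = series_algebra UU;
         tens = series_tensor U U;
         L = (\<lambda>\<beta>. series_const U (uea_incl V (L_vec \<beta>)));
         d = (\<lambda>j. series_const U (uea_incl V (d_vec j)));
         T\<^sub>U = uea_incl V (a $ 1 \<odot>\<^bsub>V\<^esub> d_vec 1 \<oplus>\<^bsub>V\<^esub> a $ 2 \<odot>\<^bsub>V\<^esub> d_vec 2);
         T = series_const U T\<^sub>U;
         T_rise = (\<lambda>c n. series_const U (rising U c T\<^sub>U n));
         E = binomial_series U (uea_incl V (L_vec \<alpha>));
         b = (\<lambda>\<beta>. a $ 1 * \<beta> $ 1 + a $ 2 * \<beta> $ 2);
         c = (\<lambda>\<beta> i. det2 \<alpha> \<beta> ^ i / fact i)
     in \<exists>\<Delta> S.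
       formal_hopf_algebra U \<Delta> S (uea_series_counit V) \<and>
       series_noncommutative U \<and> series_noncocommutative U \<Delta> \<and>
       reduces_mod_t U \<Delta> S (uea_series_counit V) (uea_comult V) (uea_antipode V) (uea_counit V) \<and>
       (\<forall>\<beta>\<in>\<Gamma> - {0}.
          \<Delta> (L \<beta>) =
            tens (L \<beta>) (E (b \<beta>)) \<oplus>\<^bsub>HH\<^esub>
            series_tsum UU (\<lambda>i. fps_const ((-1) ^ i * c \<beta> i) \<odot>\<^bsub>HH\<^esub>
              tens (T_rise 0 i) (E (- of_nat i) \<otimes>\<^bsub>H\<^esub> L (\<beta> + of_nat i *s \<alpha>)))) \<and>
       (\<forall>j. \<Delta> (d j) =
            tens (d j) \<one>\<^bsub>H\<^esub> \<oplus>\<^bsub>HH\<^esub> tens \<one>\<^bsub>H\<^esub> (d j) \<oplus>\<^bsub>HH\<^esub>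
            fps_const (\<alpha> $ j) \<odot>\<^bsub>HH\<^esub> tens (T_rise 0 1) (E (- 1) \<otimes>\<^bsub>H\<^esub> (fps_X \<odot>\<^bsub>H\<^esub> L \<alpha>))) \<and>
       (\<forall>\<beta>\<in>\<Gamma> - {0}.
          S (L \<beta>) =
            \<ominus>\<^bsub>H\<^esub> (E (- b \<beta>) \<otimes>\<^bsub>H\<^esub>
              series_tsum U (\<lambda>i. fps_const (c \<beta> i) \<odot>\<^bsub>H\<^esub> (L (\<beta> + of_nat i *s \<alpha>) \<otimes>\<^bsub>H\<^esub> T_rise 1 i)))) \<and>
       (\<forall>j. S (d j) =
            fps_const (\<alpha> $ j) \<odot>\<^bsub>H\<^esub>
              (T \<otimes>\<^bsub>H\<^esub> E (- 1) \<otimes>\<^bsub>H\<^esub>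
                (fps_X \<odot>\<^bsub>H\<^esub> L \<alpha> \<ominus>\<^bsub>H\<^esub> fps_X ^ 2 \<odot>\<^bsub>H\<^esub> (L \<alpha> \<otimes>\<^bsub>H\<^esub> L \<alpha>)))
            \<ominus>\<^bsub>H\<^esub> d j)"
proof -
  have cartan: "a $ 1 \<odot>\<^bsub>virasoro_like \<Gamma>\<^esub> d_vec 1 \<oplus>\<^bsub>virasoro_like \<Gamma>\<^esub> a $ 2 \<odot>\<^bsub>virasoro_like \<Gamma>\<^esub> d_vec 2 = cartan a"
    by (simp add: virasoro_like_simps(2,3) cartan_def)
  interpret virasoro \<Gamma> \<alpha> a
    by unfold_locales (use assms in \<open>simp_all add: cartan\<close>)
  have d_carrier: "d_vec j \<in> carrier (virasoro_like \<Gamma>)" for j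
    by (simp add: d_vec_eq_cartan cartan_carrier)
  \<comment> \<open>The string lemmas speak about the vector of index 0; the second fact identifies
    its root with \<beta>.\<close>
  have root: "L_vec \<beta> \<in> carrier (virasoro_like \<Gamma>)" "\<beta> + of_nat 0 *s \<alpha> = \<beta>" if "\<beta> \<in> \<Gamma>" for \<beta>
    using that by (simp_all add: L_vec_carrier)
  show ?thesis
    unfolding Let_def cartan counit_eq
  proof (intro exI[of _ twist.\<Delta>] exI[of _ twist.S] conjI ballI allI, goal_cases)
    case 1
    show ?case
      by (rule twist.formal_hopf_algebra_twist)
  next
    case 2
    show ?case
      by (rule twist.twist_noncommutative[OF L\<^sub>U_nonzero])
  next
    case 3
    show ?case
      by (rule twist.twist_noncocommutative[OF pure_T_L_neq])
  next
    case 4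
    show ?case
      by (rule twist.twist_reduces_mod_t)
  next
    case (5 \<beta>)
    then have \<beta>: "\<beta> \<in> \<Gamma>"
      by simp
    show ?case
      by (rule twist.\<Delta>_root[OF string_relations[OF \<beta>], unfolded root(2)[OF \<beta>], OF comult_incl[OF root(1)[OF \<beta>]]])
  next
    case (6 j)
    show ?case
      by (rule twist.\<Delta>_weight[OF derivation_relations comult_incl[OF d_carrier]])
  next
    case (7 \<beta>)
    then have \<beta>: "\<beta> \<in> \<Gamma>"
      by simp
    show ?case
      by (rule twist.S_root[OF string_relations[OF \<beta>], unfolded root(2)[OF \<beta>], OF antipode_incl[OF root(1)[OF \<beta>]]])
  next
    case (8 j)
    show ?case
      by (rule twist.S_weight[OF derivation_relations antipode_incl[OF d_carrier]])
  qed
qed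

end
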